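(* Let $n\geq 4$ and $1\leq k\leq n$. Let $P=x^n+a_1x^{n-1}+\cdots+a_n$, $R=\mathrm{Res}(P,P',x)$, and $\tilde{D}_k=\mathrm{Res}(R,\partial R/\partial a_k,a_k)$. Then $$\tilde{D}_k=c_k\,(a_n)^{d(n,k)}\,M_k^2\,T_k^3,$$ where $c_k\in\mathbb{Q}^*$, $d(n,k)=\min(1,n-k)+\max(0,n-k-2)$, and $M_k,T_k\in\mathbb{C}[a^k]$ are irreducible polynomials with integer coefficients. The zero sets $\{M_k=0\}$ and $\{T_k=0\}$ are the closures of the projections, in the space of the variables $a^k$, of the sets $\tilde{M}$ and $\Sigma$ respectively.
   Context: The coefficients $a=(a_1,\ldots,a_n)$ are complex variables, and $a^k=(a_1,\ldots,a_{k-1},a_{k+1},\ldots,a_n)$. For polynomials $G_1,G_2$ in several variables, one of which is $y$, $\mathrm{Res}(G_1,G_2,y)$ denotes the determinant of the Sylvester matrix of $G_1$ and $G_2$ viewed as polynomials in $y$. $P'$ is the derivative of $P$ with respect to $x$. The polynomial $R\in\mathbb{C}[a]$ has degree $n$ in each $a_j$ with $1\leq j\leq n-1$ and degree $n-1$ in $a_n$; in the definition of $\tilde{D}_k$, $R$ is regarded as a polynomial in $a_k$ with coefficients in $\mathbb{C}[a^k]$. $\Sigma\subset\{R=0\}\subset\mathbb{C}^n$ is the set of values of $a$ for which $P$ has a root of multiplicity $3$; $\tilde{M}\subset\{R=0\}\subset\mathbb{C}^n$ (the Maxwell stratum) is the set of values of $a$ for which $P$ has two different double roots. The projection in the space of the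 variables $a^k$ is the map $\mathbb{C}^n\to\mathbb{C}^{n-1}$, $a\mapsto a^k$, forgetting the coordinate $a_k$. *)

theory Defs
  imports
    "HOL-Analysis.Analysis"
    "HOL-Library.Poly_Mapping"
    "Subresultants.Resultant_Prelim"
begin

text \<open>
  Polynomials over the complex numbers in the variables \<open>a\<^sub>0, a\<^sub>1, \<dots>\<close>: a monomial is a finitely
  supported exponent function. The polynomial ring in the variables with indices in \<open>V\<close> is
  the subring of all \<open>p\<close> with \<open>indets p \<subseteq> V\<close>. It contains every factor of each of its nonzero
  elements and has the same units as the full ring, so that irreducibility in the subring and
  in the full ring agree.
\<close>

type_synonym mpoly = "(nat \<Rightarrow>\<^sub>0 nat) \<Rightarrow>\<^sub>0 complex"

definition Const :: "complex \<Rightarrow> mpoly" where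
  "Const c = Poly_Mapping.single 0 c"

definition Var :: "nat \<Rightarrow> mpoly" where
  "Var j = Poly_Mapping.single (Poly_Mapping.single j 1) 1"

definition indets :: "mpoly \<Rightarrow> nat set" where
  "indets p = (\<Union>m \<in> Poly_Mapping.keys p. Poly_Mapping.keys m)"

definition int_coeffs :: "mpoly \<Rightarrow> bool" where
  "int_coeffs p \<longleftrightarrow> (\<forall>m. Poly_Mapping.lookup p m \<in> \<int>)"

definition eval_mpoly :: "(nat \<Rightarrow> complex) \<Rightarrow> mpoly \<Rightarrow> complex" where
  "eval_mpoly a p =
     (\<Sum>m \<in> Poly_Mapping.keys p. Poly_Mapping.lookup p m *
        (\<Prod>j \<in> Poly_Mapping.keys m. a j ^ Poly_Mapping.lookup m j))"

definition partial_deriv :: "nat \<Rightarrow> mpoly \<Rightarrow> mpoly" where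
  "partial_deriv k p =
     (\<Sum>m \<in> Poly_Mapping.keys p.
        Poly_Mapping.single (m - Poly_Mapping.single k 1)
          (of_nat (Poly_Mapping.lookup m k) * Poly_Mapping.lookup p m))"

text \<open>
  \<open>as_univariate k p\<close> is \<open>p\<close> regarded as a polynomial in \<open>a\<^sub>k\<close>; the variable \<open>a\<^sub>k\<close> no longer
  occurs in its coefficients.
\<close>

definition as_univariate :: "nat \<Rightarrow> mpoly \<Rightarrow> mpoly poly" where
  "as_univariate k p =
     (\<Sum>m \<in> Poly_Mapping.keys p.
        monom (Poly_Mapping.single (Poly_Mapping.update k 0 m) (Poly_Mapping.lookup p m))
          (Poly_Mapping.lookup m k))"

text \<open>The general monic polynomial \<open>x\<^sup>n + a\<^sub>1 x\<^sup>n\<^sup>-\<^sup>1 + \<dots> + a\<^sub>n\<close>, as a polynomial in \<open>x\<close>.\<close>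

definition P :: "nat \<Rightarrow> mpoly poly" where
  "P n = monom 1 n + (\<Sum>j = 1..n. monom (Var j) (n - j))"

definition R :: "nat \<Rightarrow> mpoly" where
  "R n = resultant (P n) (pderiv (P n))"

definition D_tilde :: "nat \<Rightarrow> nat \<Rightarrow> mpoly" where
  "D_tilde n k = resultant (as_univariate k (R n)) (as_univariate k (partial_deriv k (R n)))"

definition d :: "nat \<Rightarrow> nat \<Rightarrow> nat" where
  "d n k = nat (min 1 (int n - int k) + max 0 (int n - int k - 2))"

text \<open>
  The affine space with coordinates indexed by a finite set \<open>I\<close>: functions on \<open>I\<close> (extended by
  \<^term>\<open>undefined\<close> outside \<open>I\<close>) with the product of the usual topologies of the complex plane.
\<close>

definition coord_space :: "nat set \<Rightarrow> (nat \<Rightarrow> complex) topology" where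
  "coord_space I = product_topology (\<lambda>_. euclidean) I"

definition P_at :: "nat \<Rightarrow> (nat \<Rightarrow> complex) \<Rightarrow> complex poly" where
  "P_at n a = map_poly (eval_mpoly a) (P n)"

definition Sigma_set :: "nat \<Rightarrow> (nat \<Rightarrow> complex) set" where
  "Sigma_set n = {a \<in> topspace (coord_space {1..n}). \<exists>x. order x (P_at n a) = 3}"

definition Maxwell_set :: "nat \<Rightarrow> (nat \<Rightarrow> complex) set" where
  "Maxwell_set n = {a \<in> topspace (coord_space {1..n}).
     \<exists>x y. x \<noteq> y \<and> order x (P_at n a) = 2 \<and> order y (P_at n a) = 2}"

definition coord_proj :: "nat \<Rightarrow> nat \<Rightarrow> (nat \<Rightarrow> complex) \<Rightarrow> nat \<Rightarrow> complex" where
  "coord_proj n k a = restrict a ({1..n} - {k})"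

definition zero_set :: "nat set \<Rightarrow> mpoly \<Rightarrow> (nat \<Rightarrow> complex) set" where
  "zero_set I p = {b \<in> topspace (coord_space I). eval_mpoly b p = 0}"

end

theory Submission
  imports Defs "Subresultants.Subresultant" "HOL-Computational_Algebra.Computational_Algebra"
    "HOL-Computational_Algebra.Field_as_Ring" "Jordan_Normal_Form.Char_Poly"
begin

text \<open>Put \<open>e = n - k\<close>. As a polynomial in \<open>a\<^sub>k\<close>, \<open>R\<close> has the roots \<open>a\<^sub>k - c\<^sub>i\<close>, where the \<open>c\<^sub>i\<close> are the
  critical values of \<open>P / x\<^sup>e\<close>. Hence the double discriminant is, up to a power of \<open>a\<^sub>n\<close>, the product of
  all differences \<open>c\<^sub>i - c\<^sub>j\<close>, \<open>i \<noteq> j\<close>. For \<open>a\<^sub>n \<noteq> 0\<close> it vanishes only if two critical values agree. After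
  a change of \<open>a\<^sub>k\<close>, \<open>P\<close> then has two double roots, or a triple root if the critical points coincide.
  Each of these two strata is parametrised, so that its ideal is prime, and the ideal is principal
  because near a generic point of the stratum the double discriminant has no other zeros.

  The multiplicity of each generator is the order of vanishing along a generic line through
  a generic point of the stratum. With \<open>s\<close> the parameter on the line, the two equal critical values
  separate at different speeds at a point with two double roots, which gives
  \<open>(c\<^sub>i - c\<^sub>j)\<^sup>2 \<sim> s\<^sup>2\<close>. At a point with a triple root the two critical points have distance \<open>\<delta>\<close> with
  \<open>\<delta>\<^sup>2 \<sim> s\<close> and \<open>c\<^sub>i - c\<^sub>j \<sim> \<delta>\<^sup>3\<close>, which gives \<open>(c\<^sub>i - c\<^sub>j)\<^sup>2 \<sim> s\<^sup>3\<close>.\<close>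

text \<open>Principality of the ideal of a stratum comes from division along a generic direction
  \<open>w\<close>: the double discriminant is an element monic along \<open>w\<close>, and no
  nonzero element is constant along \<open>w\<close>. The latter says that the stratum is a
  hypersurface; it holds because zeros of the double discriminant near a generic point lie on the
  stratum and can be moved off any hypersurface ruled by lines with direction \<open>w\<close>.

  Critical points have no analytic numbering where they merge, so they are followed along sequences,
  and subsequences make numbered roots converge. One sequence suffices, because the order at 0 of a
  polynomial is visible on it.

  The power of \<open>a n\<close> in the product formula is not the exponent \<open>d\<close>: as
  \<open>a n\<close> tends to 0, critical values merge or become infinite. Comparing P with P / x in
  this limit yields both the exponent and, by induction on \<open>n\<close>, that the double
  discriminant is not zero.

  For integrality, the ideals are kernels of substitutions with integer coefficients, and a Q-linear
  projection of the complex numbers onto Q, applied to coefficients, preserves such kernels.\<close>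

abbreviation (input) "lookup \<equiv> Poly_Mapping.lookup"
abbreviation (input) "keys \<equiv> Poly_Mapping.keys"
abbreviation (input) "single \<equiv> Poly_Mapping.single"

section \<open>Ring homomorphisms and constants\<close>

lemma comm_ring_hom_comp:
  assumes "comm_ring_hom f" "comm_ring_hom g"
  shows "comm_ring_hom (\<lambda>x. f (g x))"
proof -
  interpret f: comm_ring_hom f by fact
  interpret g: comm_ring_hom g by fact
  show ?thesis by unfold_locales (simp_all add: f.hom_add f.hom_mult g.hom_add g.hom_mult)
qed

lemma comm_ring_hom_prod:
  assumes "comm_ring_hom h" shows "h (prod f A) = (\<Prod>x\<in>A. h (f x))"
proof -
  interpret comm_ring_hom h by fact
  show ?thesis by (induction A rule: infinite_finite_induct) (simp_all add: hom_mult)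
qed

lemma comm_ring_hom_ident: "comm_ring_hom (\<lambda>x. x)"
  by unfold_locales auto

lemma comm_ring_hom_map_poly:
  assumes "comm_ring_hom h" shows "comm_ring_hom (map_poly h)"
proof -
  interpret comm_ring_hom h by fact
  interpret m: map_poly_comm_ring_hom h ..
  show ?thesis by unfold_locales
qed

lemma comm_ring_hom_poly: "comm_ring_hom (\<lambda>p. poly p x)"
  by unfold_locales auto

lemma comm_ring_hom_const_poly: 
  assumes "comm_ring_hom h" shows "comm_ring_hom (\<lambda>c. [:h c:])"
proof -
  interpret comm_ring_hom h by fact
  show ?thesis by unfold_locales (simp_all add: hom_add hom_mult pCons_one)
qed

lemma comm_ring_hom_Const: "comm_ring_hom Const"
  by unfold_locales (auto simp: Const_def single_add mult_single)

lemma Const_0 [simp]: "Const 0 = 0" by (simp add: Const_def)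
lemma Const_1 [simp]: "Const 1 = 1" by (simp add: Const_def)
lemma Const_mult: "Const (a * b) = Const a * Const b"
  by (simp add: Const_def mult_single)
lemma Const_power: "Const (a ^ i) = Const a ^ i"
  by (induction i) (simp_all add: Const_mult)
lemma Const_eq_iff [simp]: "Const a = Const b \<longleftrightarrow> a = b"
  unfolding Const_def by (metis lookup_single_eq)
lemma Const_eq_0_iff [simp]: "Const a = 0 \<longleftrightarrow> a = 0"
  using Const_eq_iff[of a 0] by (simp del: Const_eq_iff)

subsection \<open>Evaluation homomorphisms\<close>

definition monomial_value :: "(nat \<Rightarrow> 'b::comm_ring_1) \<Rightarrow> (nat \<Rightarrow>\<^sub>0 nat) \<Rightarrow> 'b" where
  "monomial_value x m = (\<Prod>j\<in>keys m. x j ^ lookup m j)"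

lemma monomial_value_superset:
  assumes "finite A" "keys m \<subseteq> A"
  shows "monomial_value x m = (\<Prod>j\<in>A. x j ^ lookup m j)"
  unfolding monomial_value_def
  by (rule prod.mono_neutral_left) (use assms in \<open>auto simp: in_keys_iff\<close>)

lemma monomial_value_add: "monomial_value x (m + m') = monomial_value x m * monomial_value x m'"
proof -
  let ?A = "keys m \<union> keys m'"
  have "monomial_value x (m + m') = (\<Prod>j\<in>?A. x j ^ lookup (m + m') j)"
    by (rule monomial_value_superset) (use Poly_Mapping.keys_add[of m m'] in auto)
  also have "\<dots> = (\<Prod>j\<in>?A. x j ^ lookup m j) * (\<Prod>j\<in>?A. x j ^ lookup m' j)"
    by (simp add: lookup_add power_add prod.distrib)
  also have "\<dots> = monomial_value x m * monomial_value x m'"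
    by (subst (1 2) monomial_value_superset[of ?A]) auto
  finally show ?thesis .
qed

lemma monomial_value_0 [simp]: "monomial_value x 0 = 1"
  by (simp add: monomial_value_def)

lemma monomial_value_single [simp]: "monomial_value x (single j i) = x j ^ i"
  by (cases "i = 0") (simp_all add: monomial_value_def)

text \<open>For a ring homomorphism \<open>h\<close>, this is the homomorphism given by the
  universal property of the polynomial ring. The target is an arbitrary commutative ring, so that
  evaluation, substitution, restriction to lines and the passage to univariate polynomials are all
  instances.\<close>

definition heval :: "(complex \<Rightarrow> 'b::comm_ring_1) \<Rightarrow> (nat \<Rightarrow> 'b) \<Rightarrow> mpoly \<Rightarrow> 'b" where
  "heval h x p = (\<Sum>m\<in>keys p. h (lookup p m) * monomial_value x m)"

lemma heval_superset:
  assumes "comm_ring_hom h" "finite A" "keys p \<subseteq> A"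
  shows "heval h x p = (\<Sum>m\<in>A. h (lookup p m) * monomial_value x m)"
proof -
  interpret comm_ring_hom h by fact
  show ?thesis unfolding heval_def
    by (rule sum.mono_neutral_left) (use assms in \<open>auto simp: in_keys_iff\<close>)
qed

lemma heval_single:
  assumes "comm_ring_hom h" shows "heval h x (single m c) = h c * monomial_value x m"
proof -
  interpret comm_ring_hom h by fact
  show ?thesis by (subst heval_superset[OF assms, of "{m}"]) auto
qed

lemma heval_add:
  assumes "comm_ring_hom h" shows "heval h x (p + q) = heval h x p + heval h x q"
proof -
  interpret comm_ring_hom h by fact
  let ?A = "keys p \<union> keys q"
  have "heval h x (p + q) = (\<Sum>m\<in>?A. h (lookup (p + q) m) * monomial_value x m)"
    by (rule heval_superset[OF assms]) (use Poly_Mapping.keys_add[of p q] in auto)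
  also have "\<dots> = (\<Sum>m\<in>?A. h (lookup p m) * monomial_value x m) + (\<Sum>m\<in>?A. h (lookup q m) * monomial_value x m)"
    by (simp add: lookup_add hom_add distrib_right sum.distrib)
  also have "\<dots> = heval h x p + heval h x q"
    by (subst (1 2) heval_superset[OF assms, of ?A]) auto
  finally show ?thesis .
qed

lemma mpoly_sum_singles: "(p :: mpoly) = (\<Sum>m\<in>keys p. single m (lookup p m))"
proof (rule poly_mapping_eqI)
  fix m
  show "lookup p m = lookup (\<Sum>m\<in>keys p. single m (lookup p m)) m"
    by (cases "m \<in> keys p") (simp_all add: lookup_sum lookup_single when_def sum.delta in_keys_iff)
qed

lemma mpoly_add_single_induct [case_names single add]:
  assumes "\<And>m c. Q (single m c)" "\<And>p q. Q p \<Longrightarrow> Q q \<Longrightarrow> Q (p + q)"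
  shows "Q (p :: mpoly)"
proof -
  have "Q (\<Sum>m\<in>A. single m (lookup p m))" if "finite A" for A
    using that
  proof induction
    case empty
    then show ?case using assms(1)[of 0 0] by simp
  qed (simp add: assms)
  from this[of "keys p"] show ?thesis using mpoly_sum_singles[of p] by simp
qed

lemma heval_hom:
  assumes "comm_ring_hom h" shows "comm_ring_hom (heval h x)"
proof -
  interpret comm_ring_hom h by fact
  have m1: "heval h x (single m c * q) = heval h x (single m c) * heval h x q" for m c q
    by (induction q rule: mpoly_add_single_induct)
       (simp_all add: heval_single[OF assms] heval_add[OF assms] mult_single hom_mult
          monomial_value_add algebra_simps)
  have "heval h x (p * q) = heval h x p * heval h x q" for p q
    by (induction p rule: mpoly_add_single_induct)
       (simp_all add: m1 heval_add[OF assms] distrib_right)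
  moreover have "heval h x 1 = 1"
    using heval_single[OF assms, of x 0 1] by simp
  moreover have "heval h x 0 = 0" by (simp add: heval_def)
  ultimately show ?thesis
    by unfold_locales (simp_all add: heval_add[OF assms])
qed

lemma heval_Const [simp]: 
  assumes "comm_ring_hom h" shows "heval h x (Const c) = h c"
  unfolding Const_def by (subst heval_single[OF assms]) simp

lemma heval_Var [simp]: 
  assumes "comm_ring_hom h" shows "heval h x (Var j) = x j"
proof -
  interpret comm_ring_hom h by fact
  show ?thesis unfolding Var_def by (subst heval_single[OF assms]) simp
qed

lemma single_eq_monomial: "single m c = Const c * monomial_value Var m"
proof -
  have "single m (1::complex) = monomial_value Var m"
  proof (induction m rule: Poly_Mapping.update_induct)
    case const
    then show ?case by simp
  next
    case (update f a b)
    have eq: "Poly_Mapping.update a b f = f + single a b"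
      by (rule poly_mapping_eqI) (use update in \<open>auto simp: lookup_update lookup_add lookup_single when_def in_keys_iff\<close>)
    have "single (single a b) (1::complex) = Var a ^ b"
    proof (induction b)
      case (Suc b)
      have "single (single a (Suc b)) (1::complex) = Var a * single (single a b) 1"
        by (simp add: Var_def mult_single flip: single_add)
      then show ?case using Suc by simp
    qed simp
    then show ?case
      using update mult_single[of f "1::complex" "single a b" 1] by (simp add: eq monomial_value_add)
  qed
  then show ?thesis using mult_single[of 0 c m 1] by (simp add: Const_def)
qed

lemma mpoly_induct [case_names Const add mult_Var]:
  assumes C: "\<And>c. Q (Const c)" and A: "\<And>p q. Q p \<Longrightarrow> Q q \<Longrightarrow> Q (p + q)"
    and V: "\<And>p j. Q p \<Longrightarrow> Q (p * Var j)"
  shows "Q (p :: mpoly)"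
proof (induction p rule: mpoly_add_single_induct)
  case (single m c)
  have *: "Q (q * Var j ^ i)" if "Q q" for q j i
    using that by (induction i arbitrary: q) (use V in \<open>auto simp: mult.assoc[symmetric]\<close>)
  have "Q (Const c * (\<Prod>j\<in>B. Var j ^ lookup m j))" if "finite B" for B
    using that
  proof induction
    case empty
    then show ?case using C by simp
  next
    case (insert x F)
    then show ?case using *[of "Const c * (\<Prod>j\<in>F. Var j ^ lookup m j)" x "lookup m x"]
      by (simp add: mult_ac)
  qed
  then show ?case by (simp add: single_eq_monomial monomial_value_def)
qed (rule A)

text \<open>Uniqueness in the universal property. Identities between composed substitutions are
  later checked only on constants and variables.\<close>

lemma mpoly_hom_eqI:
  assumes "comm_ring_hom f" "comm_ring_hom g"
    and "\<And>c. f (Const c) = g (Const c)" "\<And>j. f (Var j) = g (Var j)"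
  shows "f p = g p"
proof -
  interpret f: comm_ring_hom f by fact
  interpret g: comm_ring_hom g by fact
  show ?thesis
    by (induction p rule: mpoly_induct)
       (simp_all add: assms f.hom_add g.hom_add f.hom_mult g.hom_mult)
qed

lemma eval_mpoly_heval: "eval_mpoly a = heval (\<lambda>c. c) a"
  by (rule ext) (simp add: eval_mpoly_def heval_def monomial_value_def)

lemma eval_hom: "comm_ring_hom (eval_mpoly a)"
  unfolding eval_mpoly_heval by (rule heval_hom[OF comm_ring_hom_ident])

interpretation ev: comm_ring_hom "eval_mpoly a" for a by (rule eval_hom)

lemma eval_Const [simp]: "eval_mpoly a (Const c) = c"
  by (simp add: eval_mpoly_heval comm_ring_hom_ident)

lemma eval_Var [simp]: "eval_mpoly a (Var j) = a j"
  by (simp add: eval_mpoly_heval comm_ring_hom_ident)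

subsection \<open>One distinguished variable\<close>

lemma lookup_coeff_as_univariate:
  "lookup (coeff (as_univariate k p) i) m =
     (if lookup m k = 0 then lookup p (m + single k i) else 0)"
proof -
  have "lookup (coeff (as_univariate k p) i) m =
     (\<Sum>m'\<in>keys p. if lookup m' k = i \<and> Poly_Mapping.update k 0 m' = m then lookup p m' else 0)"
    by (auto simp: as_univariate_def coeff_sum lookup_sum lookup_single when_def intro!: sum.cong)
  also have "\<dots> = (\<Sum>m'\<in>keys p. if m' = m + single k i then (if lookup m k = 0 then lookup p m' else 0) else 0)"
  proof (rule sum.cong[OF refl])
    fix m' assume "m' \<in> keys p"
    have "lookup m' k = i \<and> Poly_Mapping.update k 0 m' = m \<longleftrightarrow> m' = m + single k i \<and> lookup m k = 0"
      by (auto simp: poly_mapping_eq_iff fun_eq_iff lookup_update lookup_add lookup_single when_def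
          split: if_splits)
    then show "(if lookup m' k = i \<and> Poly_Mapping.update k 0 m' = m then lookup p m' else 0) = 
      (if m' = m + single k i then (if lookup m k = 0 then lookup p m' else 0) else 0)" by auto
  qed
  also have "\<dots> = (if lookup m k = 0 then lookup p (m + single k i) else 0)"
    by (subst sum.delta) (auto simp: in_keys_iff)
  finally show ?thesis .
qed

lemma as_univariate_add: "as_univariate k (p + q) = as_univariate k p + as_univariate k q"
  by (intro poly_eqI poly_mapping_eqI) (simp add: lookup_coeff_as_univariate lookup_add)

lemma as_univariate_single:
  "as_univariate k (single m c) = monom (single (Poly_Mapping.update k 0 m) c) (lookup m k)"
  by (cases "c = 0") (simp_all add: as_univariate_def)

text \<open>Makes \<open>as_univariate k\<close> a ring homomorphism: its definition by monomials is
  a substitution.\<close>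

lemma as_univariate_heval:
  "as_univariate k = heval (\<lambda>c. [:Const c:]) (\<lambda>j. if j = k then [:0, 1:] else [:Var j:])"
proof
  fix p
  let ?h = "\<lambda>c. [:Const c:]"
  note h = comm_ring_hom_const_poly[OF comm_ring_hom_Const]
  let ?x = "\<lambda>j. if j = k then [:0, 1:] else [:Var j:]"
  have cp: "[:\<Prod>j\<in>B. f j:] = (\<Prod>j\<in>B. [:f j:])" for B and f :: "nat \<Rightarrow> mpoly"
    by (rule comm_ring_hom_prod[OF comm_ring_hom_const_poly[OF comm_ring_hom_ident]])
  show "as_univariate k p = heval ?h ?x p"
  proof (induction p rule: mpoly_add_single_induct)
    case (single m c)
    let ?A = "keys m - {k}"
    have "monomial_value ?x m = (\<Prod>j\<in>insert k (keys m). ?x j ^ lookup m j)"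
      by (rule monomial_value_superset) auto
    also have "\<dots> = ?x k ^ lookup m k * (\<Prod>j\<in>?A. ?x j ^ lookup m j)"
      by (simp add: prod.insert_remove)
    also have "(\<Prod>j\<in>?A. ?x j ^ lookup m j) = [:monomial_value Var (Poly_Mapping.update k 0 m):]"
      by (subst monomial_value_superset[of ?A], simp)
         (auto simp: keys_update lookup_update cp poly_const_pow intro!: prod.cong)
    finally have "heval ?h ?x (single m c) =
        [:Const c:] * ([:monomial_value Var (Poly_Mapping.update k 0 m):] * [:0,1:] ^ lookup m k)"
      by (simp add: heval_single[OF h] mult.commute)
    also have "\<dots> = monom (Const c * monomial_value Var (Poly_Mapping.update k 0 m)) (lookup m k)"
      by (simp add: monom_altdef mult.commute[of "Const c"])
    also have "\<dots> = as_univariate k (single m c)"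
      by (simp add: as_univariate_single single_eq_monomial[of "Poly_Mapping.update k 0 m"])
    finally show ?case ..
  qed (simp add: as_univariate_add heval_add[OF h])
qed

lemma as_univariate_hom: "comm_ring_hom (as_univariate k)"
  unfolding as_univariate_heval
  by (rule heval_hom[OF comm_ring_hom_const_poly[OF comm_ring_hom_Const]])

interpretation au: comm_ring_hom "as_univariate k" for k by (rule as_univariate_hom)

lemma as_univariate_Const [simp]: "as_univariate k (Const c) = [:Const c:]"
  by (simp add: as_univariate_heval comm_ring_hom_const_poly[OF comm_ring_hom_Const])

lemma as_univariate_Var: "as_univariate k (Var j) = (if j = k then [:0, 1:] else [:Var j:])"
  by (simp add: as_univariate_heval comm_ring_hom_const_poly[OF comm_ring_hom_Const])

lemma as_univariate_eq_0_iff [simp]: "as_univariate k p = 0 \<longleftrightarrow> p = 0"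
proof
  assume "as_univariate k p = 0"
  show "p = 0"
  proof (rule poly_mapping_eqI)
    fix m :: "nat \<Rightarrow>\<^sub>0 nat"
    let ?m = "Poly_Mapping.update k 0 m"
    have "?m + single k (lookup m k) = m"
      by (rule poly_mapping_eqI) (auto simp: lookup_update lookup_add lookup_single when_def)
    then have "lookup p m = lookup (coeff (as_univariate k p) (lookup m k)) ?m"
      by (simp add: lookup_coeff_as_univariate lookup_update)
    then show "lookup p m = lookup 0 m" using \<open>as_univariate k p = 0\<close> by simp
  qed
qed simp

lemma poly_as_univariate:
  "poly (map_poly (eval_mpoly a) (as_univariate k p)) z = eval_mpoly (a(k := z)) p"
  by (rule mpoly_hom_eqI[where f = "\<lambda>p. poly (map_poly (eval_mpoly a) (as_univariate k p)) z"])
     (auto intro!: comm_ring_hom_comp[OF comm_ring_hom_poly] comm_ring_hom_comp[OF comm_ring_hom_map_poly[OF eval_hom]]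
        as_univariate_hom eval_hom simp: as_univariate_Var ev.map_poly_pCons_hom)

text \<open>Makes \<open>D_tilde n k\<close> the resultant of a univariate polynomial and its own
  derivative, so that it can be computed from differences of roots.\<close>

lemma as_univariate_partial_deriv: "as_univariate k (partial_deriv k p) = pderiv (as_univariate k p)"
proof -
  have "as_univariate k (single (m - single k 1) (of_nat (lookup m k) * c)) =
        pderiv (monom (single (Poly_Mapping.update k 0 m) c) (lookup m k))" for m and c :: complex
  proof -
    have "Poly_Mapping.update k 0 (m - single k 1) = Poly_Mapping.update k 0 m"
      by (rule poly_mapping_eqI) (auto simp: lookup_update lookup_minus lookup_single when_def)
    moreover have "of_nat i * single m' c = single m' (of_nat i * c)" for i and m' :: "nat \<Rightarrow>\<^sub>0 nat"
      by (metis (no_types) add.left_neutral mult_single single_of_nat)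
    ultimately show ?thesis
      by (simp add: as_univariate_single pderiv_monom lookup_minus)
  qed
  then show ?thesis
    unfolding partial_deriv_def
    by (simp add: au.hom_sum pderiv_sum as_univariate_def[of k p])
qed

subsection \<open>Variables and coefficients\<close>

text \<open>Serves for the polynomials in given variables and for those with integer coefficients
  alike; a resultant is a determinant in the coefficients and inherits both properties.\<close>

definition subring :: "'a::comm_ring_1 set \<Rightarrow> bool" where
  "subring S \<longleftrightarrow> 1 \<in> S \<and> (\<forall>x\<in>S. \<forall>y\<in>S. x - y \<in> S \<and> x * y \<in> S)"

lemma subringD:
  assumes "subring S"
  shows "1 \<in> S" "0 \<in> S" "\<And>x y. x \<in> S \<Longrightarrow> y \<in> S \<Longrightarrow> x - y \<in> S" "\<And>x y. x \<in> S \<Longrightarrow> y \<in> S \<Longrightarrow> x * y \<in> S"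
    "\<And>x. x \<in> S \<Longrightarrow> - x \<in> S" "\<And>x y. x \<in> S \<Longrightarrow> y \<in> S \<Longrightarrow> x + y \<in> S"
proof -
  show 1: "1 \<in> S" "\<And>x y. x \<in> S \<Longrightarrow> y \<in> S \<Longrightarrow> x - y \<in> S" "\<And>x y. x \<in> S \<Longrightarrow> y \<in> S \<Longrightarrow> x * y \<in> S"
    using assms by (auto simp: subring_def)
  show 0: "0 \<in> S" using 1(1) 1(2)[of 1 1] by simp
  show 2: "\<And>x. x \<in> S \<Longrightarrow> - x \<in> S" using 1(2)[of 0] 0 by simp
  show "\<And>x y. x \<in> S \<Longrightarrow> y \<in> S \<Longrightarrow> x + y \<in> S" using 1(2)[of _ "- _"] 2 by (metis diff_minus_eq_add)
qed

lemma subring_sum: "subring S \<Longrightarrow> (\<And>x. x \<in> A \<Longrightarrow> f x \<in> S) \<Longrightarrow> sum f A \<in> S"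
  by (induction A rule: infinite_finite_induct) (auto simp: subringD)

lemma subring_prod: "subring S \<Longrightarrow> (\<And>x. x \<in> A \<Longrightarrow> f x \<in> S) \<Longrightarrow> prod f A \<in> S"
  by (induction A rule: infinite_finite_induct) (auto simp: subringD)

lemma subring_power: "subring S \<Longrightarrow> x \<in> S \<Longrightarrow> x ^ i \<in> S"
  by (induction i) (auto simp: subringD)

lemma subring_of_nat: "subring S \<Longrightarrow> of_nat i \<in> S"
  by (induction i) (auto simp: subringD)

lemma subring_det:
  assumes "subring S" "A \<in> carrier_mat m m" "\<And>i j. i < m \<Longrightarrow> j < m \<Longrightarrow> A $$ (i, j) \<in> S"
  shows "det A \<in> S"
proof -
  have "A $$ (i, q i) \<in> S" if "q permutes {0..<m}" "i < m" for q i
    using assms(3)[OF that(2), of "q i"] permutes_in_image[OF that(1), of i] that(2) by auto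
  moreover have "signof q \<in> S" for q
    using subringD[OF assms(1)] by (simp add: sign_def)
  ultimately show ?thesis
    unfolding det_def'[OF assms(2)]
    by (intro subring_sum[OF assms(1)] subringD(4)[OF assms(1)] subring_prod[OF assms(1)]) auto
qed

lemma subring_resultant:
  assumes "subring S" "\<And>i. coeff p i \<in> S" "\<And>i. coeff q i \<in> S"
  shows "resultant p q \<in> S"
  unfolding resultant_def
  by (rule subring_det[OF assms(1), of _ "degree p + degree q"])
     (auto simp: sylvester_mat_def sylvester_mat_sub_def assms subringD(2)[OF assms(1)])

definition mpolys :: "nat set \<Rightarrow> mpoly set" where
  "mpolys J = {p. indets p \<subseteq> J}"

lemma subring_mpolys: "subring (mpolys J)"
proof -
  have "indets (p - q) \<subseteq> indets p \<union> indets q" for p q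
    by (fastforce simp: indets_def in_keys_iff lookup_minus)
  moreover have "indets (p * q) \<subseteq> indets p \<union> indets q" for p q
  proof
    fix j assume "j \<in> indets (p * q)"
    then obtain m where "m \<in> keys (p * q)" "j \<in> keys m" by (auto simp: indets_def)
    moreover from this obtain m1 m2 where "m = m1 + m2" "m1 \<in> keys p" "m2 \<in> keys q"
      using keys_mult[of p q] by blast
    ultimately show "j \<in> indets p \<union> indets q"
      using Poly_Mapping.keys_add[of m1 m2] by (auto simp: indets_def)
  qed
  moreover have "indets 1 = {}" by (simp add: indets_def)
  ultimately show ?thesis unfolding subring_def mpolys_def by blast
qed

lemma Const_in_mpolys: "Const c \<in> mpolys J"
  by (simp add: mpolys_def indets_def Const_def)

lemma Var_in_mpolys: "Var j \<in> mpolys J \<longleftrightarrow> j \<in> J"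
  by (simp add: mpolys_def indets_def Var_def)

lemma subring_int_coeffs: "subring {p. int_coeffs p}"
proof -
  have "int_coeffs (p * q)" if "int_coeffs p" "int_coeffs q" for p q
  proof -
    have eq: "p * q = (\<Sum>m\<in>keys p. \<Sum>m'\<in>keys q. single (m + m') (lookup p m * lookup q m'))"
      using arg_cong2[OF mpoly_sum_singles[of p] mpoly_sum_singles[of q], of "(*)"]
      by (simp add: sum_product mult_single)
    show ?thesis
      unfolding int_coeffs_def eq lookup_sum lookup_single
      using that by (auto simp: int_coeffs_def when_def intro!: Ints_sum)
  qed
  then show ?thesis
    by (auto simp: subring_def int_coeffs_def lookup_minus lookup_one when_def)
qed

lemma int_coeffs_Var: "int_coeffs (Var j)"
  by (auto simp: int_coeffs_def Var_def lookup_single when_def)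

lemma subring_Int: "subring S \<Longrightarrow> subring T \<Longrightarrow> subring (S \<inter> T)"
  by (auto simp: subring_def)

lemma coeff_as_univariate_mpolys:
  assumes "p \<in> mpolys J" shows "coeff (as_univariate k p) i \<in> mpolys (J - {k})"
proof -
  have "keys m \<subseteq> J - {k}" if "m \<in> keys (coeff (as_univariate k p) i)" for m
  proof -
    from that have *: "lookup m k = 0" "m + single k i \<in> keys p"
      by (auto simp: in_keys_iff lookup_coeff_as_univariate split: if_splits)
    then have "keys (m + single k i) \<subseteq> J" using assms by (auto simp: mpolys_def indets_def)
    moreover have "keys m \<subseteq> keys (m + single k i)"
      by (auto simp: in_keys_iff lookup_add)
    ultimately show ?thesis using *(1) by (auto simp: in_keys_iff)
  qed
  then show ?thesis by (auto simp: mpolys_def indets_def)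
qed

lemma coeff_as_univariate_int: "int_coeffs p \<Longrightarrow> int_coeffs (coeff (as_univariate k p) i)"
  by (simp add: int_coeffs_def lookup_coeff_as_univariate)

text \<open>Translates the occurrence of a variable into a degree, which is additive in products. It
  follows that factors involve no new variables and that divisors of nonzero constants are
  constant.\<close>

lemma in_indets_iff: "j \<in> indets p \<longleftrightarrow> degree (as_univariate j p) > 0"
proof
  assume "j \<in> indets p"
  then obtain m where m: "m \<in> keys p" "j \<in> keys m" by (auto simp: indets_def)
  have "Poly_Mapping.update j 0 m + single j (lookup m j) = m"
    by (rule poly_mapping_eqI) (auto simp: lookup_update lookup_add lookup_single when_def)
  then have "lookup (coeff (as_univariate j p) (lookup m j)) (Poly_Mapping.update j 0 m) = lookup p m"
    by (simp add: lookup_coeff_as_univariate lookup_update)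
  also have "\<dots> \<noteq> 0" using m by (simp add: in_keys_iff)
  finally have "coeff (as_univariate j p) (lookup m j) \<noteq> 0" by auto
  then have "lookup m j \<le> degree (as_univariate j p)" by (rule le_degree)
  with m show "degree (as_univariate j p) > 0" by (simp add: in_keys_iff)
next
  assume "degree (as_univariate j p) > 0"
  define i where "i = degree (as_univariate j p)"
  have "coeff (as_univariate j p) i \<noteq> 0"
    using \<open>degree _ > 0\<close> unfolding i_def by (metis degree_0 leading_coeff_0_iff less_numeral_extra(3))
  then obtain m where "lookup (coeff (as_univariate j p) i) m \<noteq> 0"
    using poly_mapping_eqI[of "coeff (as_univariate j p) i" 0] by auto
  then have "m + single j i \<in> keys p"
    by (auto simp: lookup_coeff_as_univariate in_keys_iff split: if_splits)
  moreover have "j \<in> keys (m + single j i)"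
    using \<open>degree _ > 0\<close> by (simp add: in_keys_iff lookup_add i_def)
  ultimately show "j \<in> indets p" by (auto simp: indets_def)
qed

lemma degree_as_univariate_mult:
  assumes "p \<noteq> 0" "q \<noteq> 0"
  shows "degree (as_univariate j (p * q)) = degree (as_univariate j p) + degree (as_univariate j q)"
  using assms by (simp add: au.hom_mult degree_mult_eq)

lemma indets_factor:
  assumes "p * q \<noteq> 0" shows "indets p \<subseteq> indets (p * q)"
  using assms degree_as_univariate_mult[of p q] by (auto simp: in_indets_iff)

lemma indets_empty: assumes "indets p = {}" obtains c where "p = Const c"
proof -
  have "keys p \<subseteq> {0}" using assms by (auto simp: indets_def)
  then have "p = Const (lookup p 0)"
    by (intro poly_mapping_eqI) (auto simp: Const_def lookup_single when_def in_keys_iff)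
  then show ?thesis by (rule that)
qed

lemma mult_eq_ConstD:
  assumes "p * q = Const c" "c \<noteq> 0" obtains c' where "p = Const c'" "c' \<noteq> 0"
proof -
  have "indets p \<subseteq> indets (Const c)" using indets_factor[of p q] assms by auto
  moreover have "indets (Const c) = {}" by (simp add: indets_def Const_def)
  ultimately have "indets p = {}" by simp
  then obtain c' where c': "p = Const c'" by (rule indets_empty)
  moreover have "c' \<noteq> 0" using assms c' by (cases "c' = 0") (auto simp: eq_commute[of 0])
  ultimately show ?thesis by (rule that)
qed

lemma eval_cong: assumes "\<And>j. j \<in> indets p \<Longrightarrow> a j = b j" shows "eval_mpoly a p = eval_mpoly b p"
  unfolding eval_mpoly_def using assms
  by (intro sum.cong refl arg_cong2[where f = "(*)"] prod.cong arg_cong2[where f = "(^)"])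
     (auto simp: indets_def)

lemma finite_indets: "finite (indets p)"
  by (simp add: indets_def)

text \<open>Induction on the number of variables: where the leading coefficient with respect to one
  variable is nonzero, a nonzero polynomial in that variable remains, and it has a nonzero
  value.\<close>

lemma eval_nonzero: assumes "p \<noteq> 0" obtains a where "eval_mpoly a p \<noteq> 0"
proof -
  have "\<exists>a. eval_mpoly a p \<noteq> 0" using assms
  proof (induction "card (indets p)" arbitrary: p rule: less_induct)
    case less
    show ?case
    proof (cases "indets p = {}")
      case True
      with less.prems show ?thesis by (metis indets_empty eval_Const Const_0)
    next
      case False
      then obtain j where j: "j \<in> indets p" by auto
      define q where "q = lead_coeff (as_univariate j p)"
      have "q \<in> mpolys (indets p - {j})"
        unfolding q_def by (rule coeff_as_univariate_mpolys) (simp add: mpolys_def)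
      then have "indets q \<subset> indets p" using j by (auto simp: mpolys_def)
      moreover have "q \<noteq> 0" using less.prems by (simp add: q_def)
      ultimately obtain a where a: "eval_mpoly a q \<noteq> 0"
        using less.hyps[of q] psubset_card_mono[OF finite_indets] by blast
      then have "map_poly (eval_mpoly a) (as_univariate j p) \<noteq> 0"
        unfolding q_def by (metis coeff_0 ev.coeff_map_poly_hom)
      then obtain z where "poly (map_poly (eval_mpoly a) (as_univariate j p)) z \<noteq> 0"
        using poly_all_0_iff_0 by blast
      then show ?thesis by (auto simp: poly_as_univariate)
    qed
  qed
  then show ?thesis using that by blast
qed

lemma mpoly_eqI: assumes "\<And>a. eval_mpoly a p = eval_mpoly a q" shows "p = q"
  using eval_nonzero[of "p - q"] assms by (auto simp: ev.hom_minus)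

lemma comm_ring_hom_sum:
  assumes "comm_ring_hom h" shows "h (sum f A) = (\<Sum>x\<in>A. h (f x))"
proof -
  interpret comm_ring_hom h by fact
  show ?thesis by (rule hom_sum)
qed

subsection \<open>Polynomials along a direction\<close>

text \<open>The variable with index \<open>0\<close> does not occur in the polynomials of the theorem. It serves as the
  parameter of lines with direction \<open>w\<close>, where \<open>w 0 = 1\<close>.\<close>

definition dirU :: "(nat \<Rightarrow> complex) \<Rightarrow> mpoly \<Rightarrow> mpoly poly" where
  "dirU w = heval (\<lambda>c. [:Const c:]) (\<lambda>i. if i = 0 then [:0, 1:] else [:Var i, Const (w i):])"

text \<open>In the coordinates (t, b) with a = b + t w, where t is the value of \<open>Var 0\<close>
  and b lies in the hyperplane \<open>Var 0 = 0\<close>, \<open>dirU w\<close> writes a polynomial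
  as one in t. \<open>dirPsi w\<close> expresses b by a, and \<open>dirV w\<close> inverts
  \<open>dirU w\<close>.\<close>

definition dirPsi :: "(nat \<Rightarrow> complex) \<Rightarrow> mpoly \<Rightarrow> mpoly" where
  "dirPsi w = heval Const (\<lambda>i. if i = 0 then 0 else Var i - Const (w i) * Var 0)"

definition dirV :: "(nat \<Rightarrow> complex) \<Rightarrow> mpoly poly \<Rightarrow> mpoly" where
  "dirV w q = poly (map_poly (dirPsi w) q) (Var 0)"

definition drop0 :: "mpoly \<Rightarrow> mpoly" where
  "drop0 = heval Const (\<lambda>i. if i = 0 then 0 else Var i)"

text \<open>The restriction to the line through \<open>p\<close> with direction \<open>w\<close>, as
  a polynomial in the parameter of the line.\<close>

definition lp :: "(nat \<Rightarrow> complex) \<Rightarrow> (nat \<Rightarrow> complex) \<Rightarrow> mpoly \<Rightarrow> complex poly" where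
  "lp p w = heval (\<lambda>c. [:c:]) (\<lambda>i. [:p i, w i:])"

lemmas Const_poly_hom = comm_ring_hom_const_poly[OF comm_ring_hom_Const]
lemmas ident_poly_hom = comm_ring_hom_const_poly[OF comm_ring_hom_ident]

interpretation dirU: comm_ring_hom "dirU w" for w
  unfolding dirU_def by (rule heval_hom[OF Const_poly_hom])
interpretation dirPsi: comm_ring_hom "dirPsi w" for w
  unfolding dirPsi_def by (rule heval_hom[OF comm_ring_hom_Const])
interpretation drop0: comm_ring_hom drop0
  unfolding drop0_def by (rule heval_hom[OF comm_ring_hom_Const])
interpretation lp: comm_ring_hom "lp p w" for p w
  unfolding lp_def by (rule heval_hom[OF ident_poly_hom])
interpretation dirV: comm_ring_hom "dirV w" for w
proof -
  have "comm_ring_hom (\<lambda>q. poly (map_poly (dirPsi w) q) (Var 0))"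
    by (rule comm_ring_hom_comp[OF comm_ring_hom_poly comm_ring_hom_map_poly]) unfold_locales
  then show "comm_ring_hom (dirV w)" by (simp add: dirV_def[abs_def])
qed

lemma dirU_simps [simp]: "dirU w (Const c) = [:Const c:]"
  "dirU w (Var i) = (if i = 0 then [:0, 1:] else [:Var i, Const (w i):])"
  by (simp_all add: dirU_def Const_poly_hom)
lemma dirPsi_simps [simp]: "dirPsi w (Const c) = Const c"
  "dirPsi w (Var i) = (if i = 0 then 0 else Var i - Const (w i) * Var 0)"
  by (simp_all add: dirPsi_def comm_ring_hom_Const)
lemma drop0_simps [simp]: "drop0 (Const c) = Const c" "drop0 (Var i) = (if i = 0 then 0 else Var i)"
  by (simp_all add: drop0_def comm_ring_hom_Const)
lemma lp_simps [simp]: "lp p w (Const c) = [:c:]" "lp p w (Var i) = [:p i, w i:]"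
  by (simp_all add: lp_def ident_poly_hom)

lemma dirV_pCons: "dirV w (pCons c q) = dirPsi w c + Var 0 * dirV w q"
  by (simp add: dirV_def dirPsi.map_poly_pCons_hom)

lemma dirV_0 [simp]: "dirV w 0 = 0" by (rule dirV.hom_zero)

lemma dirV_const: "dirV w [:c:] = dirPsi w c"
  by (simp add: dirV_pCons)

lemma dirV_dirU [simp]: "dirV w (dirU w p) = p"
  by (rule mpoly_hom_eqI[where f = "\<lambda>p. dirV w (dirU w p)" and g = "\<lambda>p. p"])
     (auto intro: comm_ring_hom_comp comm_ring_hom_ident dirV.comm_ring_hom_axioms dirU.comm_ring_hom_axioms
       simp: dirV_pCons dirPsi.hom_one)

lemma dirU_dirPsi: "dirU w (dirPsi w p) = [:drop0 p:]"
  by (rule mpoly_hom_eqI[where f = "\<lambda>p. dirU w (dirPsi w p)" and g = "\<lambda>p. [:drop0 p:]"])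
     (auto intro: comm_ring_hom_comp comm_ring_hom_const_poly drop0.comm_ring_hom_axioms
        dirPsi.comm_ring_hom_axioms dirU.comm_ring_hom_axioms simp: dirU.hom_minus dirU.hom_mult)

lemma dirU_dirV: "dirU w (dirV w q) = map_poly drop0 q"
  by (induction q)
     (simp_all add: dirV_pCons dirU.hom_add dirU.hom_mult dirU_dirPsi drop0.map_poly_pCons_hom)

lemma drop0_coeff_dirU: "drop0 (coeff (dirU w p) i) = coeff (dirU w p) i"
  using arg_cong[OF dirU_dirV[of w "dirU w p"], of "\<lambda>q. coeff q i"] by (simp add: drop0.coeff_map_poly_hom)

lemma dirU_eq_0_iff [simp]: "dirU w p = 0 \<longleftrightarrow> p = 0"
  using dirV_dirU[of w p] by (auto simp del: dirV_dirU)

lemma drop0_indets: "0 \<notin> indets (drop0 p)"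
proof -
  have "drop0 p \<in> mpolys (-{0})"
    by (induction p rule: mpoly_induct)
       (auto simp: drop0.hom_add drop0.hom_mult subringD[OF subring_mpolys] Const_in_mpolys Var_in_mpolys)
  then show ?thesis by (auto simp: mpolys_def)
qed

lemma indets_coeff_dirU: "0 \<notin> indets (coeff (dirU w p) i)"
  using drop0_indets[of "coeff (dirU w p) i"] by (simp add: drop0_coeff_dirU)

abbreviation dg where "dg w p \<equiv> degree (dirU w p)"

text \<open>Monic along \<open>w\<close> up to a nonzero constant. On every line with this direction
  the restriction then has the same degree and the same leading coefficient, so that zeros do not
  escape to infinity.\<close>

definition wmonic :: "(nat \<Rightarrow> complex) \<Rightarrow> mpoly \<Rightarrow> bool" where
  "wmonic w p \<longleftrightarrow> (\<exists>c. c \<noteq> 0 \<and> lead_coeff (dirU w p) = Const c)"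

lemma dg_mult: "p \<noteq> 0 \<Longrightarrow> q \<noteq> 0 \<Longrightarrow> dg w (p * q) = dg w p + dg w q"
  by (simp add: dirU.hom_mult degree_mult_eq)

lemma dg_dirV_le: "dg w (dirV w q) \<le> degree q"
  by (simp add: dirU_dirV degree_map_poly_le)

lemma wmonic_factor: assumes "wmonic w (p * q)" shows "wmonic w p"
proof -
  from assms obtain c where c: "c \<noteq> 0" "lead_coeff (dirU w p) * lead_coeff (dirU w q) = Const c"
    by (auto simp: wmonic_def dirU.hom_mult lead_coeff_mult)
  show ?thesis using mult_eq_ConstD[OF c(2,1)] by (auto simp: wmonic_def)
qed

lemma wmonic_nonzero: "wmonic w p \<Longrightarrow> p \<noteq> 0"
  by (auto simp: wmonic_def)

lemma dg_0_const: assumes "wmonic w p" "dg w p = 0" obtains c where "c \<noteq> 0" "p = Const c"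
proof -
  from assms obtain c where "c \<noteq> 0" "dirU w p = [:Const c:]"
    by (metis degree_0_id wmonic_def)
  then have "c \<noteq> 0" "p = Const c"
    using dirV_dirU[of w p] by (auto simp: dirV_const)
  then show ?thesis by (rule that)
qed

lemma Const_dvd_1: "c \<noteq> 0 \<Longrightarrow> Const c dvd 1"
  by (rule dvdI[of _ _ "Const (1 / c)"]) (simp flip: Const_mult)

lemma wmonic_prime_dg: "wmonic w p \<Longrightarrow> prime_elem p \<Longrightarrow> dg w p > 0"
  by (metis Const_dvd_1 dg_0_const gr0I prime_elem_not_unit)

lemma poly_lp: "poly (lp p w A) s = eval_mpoly (\<lambda>i. p i + s * w i) A"
  by (rule mpoly_hom_eqI[where f = "\<lambda>A. poly (lp p w A) s"])
     (auto intro!: comm_ring_hom_comp[OF comm_ring_hom_poly] lp.comm_ring_hom_axioms eval_hom)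

text \<open>The line meets the hyperplane \<open>Var 0 = 0\<close> in the point
  \<open>p i - p 0 * w i\<close>, where the coefficients of \<open>dirU w A\<close> are to be
  evaluated; the parameter is shifted by \<open>p 0\<close>.\<close>

lemma lp_dirU:
  assumes "w 0 = 1"
  shows "lp p w A = pcompose (map_poly (eval_mpoly (\<lambda>i. p i - p 0 * w i)) (dirU w A)) [:p 0, 1:]"
proof -
  have pc: "comm_ring_hom (\<lambda>f. pcompose f [:p 0, 1:] :: complex poly)"
    by unfold_locales (simp_all add: pcompose_add pcompose_mult)
  have "comm_ring_hom (\<lambda>A. map_poly (eval_mpoly b) (dirU w A))" for b
    by (rule comm_ring_hom_comp[OF comm_ring_hom_map_poly[OF eval_hom] dirU.comm_ring_hom_axioms])
  note comm_ring_hom_comp[OF pc this]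
  from mpoly_hom_eqI[OF lp.comm_ring_hom_axioms this] show ?thesis
    by (simp add: ev.map_poly_pCons_hom pcompose_pCons assms)
qed

lemma degree_lp: 
  assumes "w 0 = 1" "wmonic w A"
  obtains c where "c \<noteq> 0" "\<And>p. degree (lp p w A) = dg w A" "\<And>p. lead_coeff (lp p w A) = c"
proof -
  obtain c where c: "c \<noteq> 0" "lead_coeff (dirU w A) = Const c" using assms(2) by (auto simp: wmonic_def)
  have "degree (map_poly (eval_mpoly b) (dirU w A)) = dg w A" for b
    by (rule degree_map_poly) (use c in auto)
  then have 1: "degree (lp p w A) = dg w A" for p
    by (simp add: lp_dirU[of w, OF assms(1)] degree_pcompose)
  moreover have "lead_coeff (lp p w A) = c" for p
    unfolding lp_dirU[of w, OF assms(1)]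
    by (subst lead_coeff_comp) (use c 1 in \<open>simp_all add: lp_dirU[of w, OF assms(1)] degree_pcompose ev.coeff_map_poly_hom\<close>)
  ultimately show ?thesis using c(1) that by blast
qed

lemma eval_line_const:
  assumes "w 0 = 1" "dg w r = 0"
  shows "eval_mpoly (\<lambda>i. p i + s * w i) r = eval_mpoly p r"
proof -
  obtain x where x: "dirU w r = [:x:]" using assms(2) by (metis degree_0_id)
  have "lp p w r = [:eval_mpoly (\<lambda>i. p i - p 0 * w i) x:]"
    by (simp add: lp_dirU[of w, OF assms(1)] x ev.map_poly_pCons_hom)
  then have "poly (lp p w r) s = poly (lp p w r) 0" by simp
  then show ?thesis by (simp add: poly_lp)
qed

subsection \<open>Generic directions\<close>

definition tdeg :: "(nat \<Rightarrow>\<^sub>0 nat) \<Rightarrow> nat" where "tdeg m = (\<Sum>j\<in>keys m. lookup m j)"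

lemma coeff_prod_bound:
  fixes f :: "'a \<Rightarrow> 'b::comm_ring_1 poly"
  assumes "finite A" "\<And>x. x \<in> A \<Longrightarrow> degree (f x) \<le> g x"
  shows "degree (prod f A) \<le> sum g A" "coeff (prod f A) (sum g A) = (\<Prod>x\<in>A. coeff (f x) (g x))"
proof -
  have "degree (prod f A) \<le> sum g A \<and> coeff (prod f A) (sum g A) = (\<Prod>x\<in>A. coeff (f x) (g x))"
    using assms
  proof (induction A)
    case (insert x A)
    then have IH: "degree (prod f A) \<le> sum g A" "coeff (prod f A) (sum g A) = (\<Prod>x\<in>A. coeff (f x) (g x))"
      and x: "degree (f x) \<le> g x" by auto
    have "coeff (f x * prod f A) (g x + sum g A) = (\<Sum>i\<le>g x + sum g A. coeff (f x) i * coeff (prod f A) (g x + sum g A - i))"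
      by (rule coeff_mult)
    also have "\<dots> = (\<Sum>i\<in>{g x}. coeff (f x) i * coeff (prod f A) (g x + sum g A - i))"
    proof (rule sum.mono_neutral_right)
      show "\<forall>i\<in>{..g x + sum g A} - {g x}. coeff (f x) i * coeff (prod f A) (g x + sum g A - i) = 0"
      proof
        fix i assume i: "i \<in> {..g x + sum g A} - {g x}"
        show "coeff (f x) i * coeff (prod f A) (g x + sum g A - i) = 0"
          using i x IH(1) coeff_eq_0[of "f x" i] coeff_eq_0[of "prod f A" "g x + sum g A - i"]
          by (cases "i > g x") auto
      qed
    qed auto
    finally show ?case
      using insert.hyps IH x degree_mult_le[of "f x" "prod f A"] by simp
  qed simp
  then show "degree (prod f A) \<le> sum g A" "coeff (prod f A) (sum g A) = (\<Prod>x\<in>A. coeff (f x) (g x))" by auto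
qed

lemma coeff_power_bound:
  fixes f :: "'b::comm_ring_1 poly"
  assumes "degree f \<le> 1" shows "degree (f ^ i) \<le> i" "coeff (f ^ i) i = coeff f 1 ^ i"
  using coeff_prod_bound[of "{..<i}" "\<lambda>_. f" "\<lambda>_. 1"] assms by auto

lemma dirU_single:
  assumes "w 0 = 1"
  shows "dg w (single m c) \<le> tdeg m" "coeff (dirU w (single m c)) (tdeg m) = Const (c * monomial_value w m)"
proof -
  let ?x = "\<lambda>i. if i = 0 then [:0, 1:] else [:Var i, Const (w i):]"
  have d1: "degree (?x i) \<le> 1" for i by auto
  have eq: "dirU w (single m c) = Polynomial.smult (Const c) (\<Prod>j\<in>keys m. ?x j ^ lookup m j)"
    unfolding dirU_def by (subst heval_single[OF Const_poly_hom]) (simp add: monomial_value_def)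
  note b = coeff_prod_bound[of "keys m" "\<lambda>j. ?x j ^ lookup m j" "lookup m",
    OF finite_keys coeff_power_bound(1)[OF d1]]
  have "degree (\<Prod>j\<in>keys m. ?x j ^ lookup m j) \<le> tdeg m"
    using b(1) by (simp add: tdeg_def)
  then show "dg w (single m c) \<le> tdeg m"
    unfolding eq using degree_smult_le order_trans by blast
  have "coeff (?x j) 1 = Const (w j)" for j using assms by auto
  then have "(\<Prod>j\<in>keys m. coeff (?x j ^ lookup m j) (lookup m j)) = Const (monomial_value w m)"
    unfolding monomial_value_def coeff_power_bound(2)[OF d1] comm_ring_hom_prod[OF comm_ring_hom_Const]
    by (simp add: Const_power)
  then show "coeff (dirU w (single m c)) (tdeg m) = Const (c * monomial_value w m)"
    unfolding eq using b(2) by (simp add: tdeg_def Const_mult)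
qed

text \<open>The leading coefficient of \<open>A\<close> along \<open>w\<close> is the value at
  \<open>w\<close> of the homogeneous part of highest degree, provided this value is nonzero. It
  suffices to avoid the zeros of this part and of \<open>B\<close>; since \<open>Var 0\<close>
  occurs in neither, the coordinate at 0 can be set to 1.\<close>

lemma exists_direction:
  assumes "A \<noteq> 0" "B \<noteq> 0" "0 \<notin> indets A" "0 \<notin> indets B"
  obtains w where "w 0 = 1" "wmonic w A" "eval_mpoly w B \<noteq> 0"
proof -
  define D where "D = Max (tdeg ` keys A)"
  define T where "T = (\<Sum>m\<in>{m\<in>keys A. tdeg m = D}. single m (lookup A m))"
  have ne: "keys A \<noteq> {}" using assms(1) mpoly_sum_singles[of A] by auto
  have "D \<in> tdeg ` keys A" unfolding D_def by (rule Max_in) (use ne in auto)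
  then obtain m0 where m0: "m0 \<in> keys A" "tdeg m0 = D" by auto
  have leD: "tdeg m \<le> D" if "m \<in> keys A" for m unfolding D_def using that by simp
  have lT: "lookup T m = (if m \<in> keys A \<and> tdeg m = D then lookup A m else 0)" for m
    by (simp add: T_def lookup_sum lookup_single when_def sum.delta')
  have "T \<noteq> 0" using lT[of m0] m0 by (auto simp: in_keys_iff)
  moreover have "indets T \<subseteq> indets A"
    unfolding indets_def by (auto simp: in_keys_iff lT split: if_splits)
  ultimately obtain w0 where "eval_mpoly w0 (T * B) \<noteq> 0" using assms(2) eval_nonzero[of "T * B"] by auto
  define w where "w = w0(0 := 1)"
  have "eval_mpoly w T = eval_mpoly w0 T" "eval_mpoly w B = eval_mpoly w0 B"
    by (rule eval_cong, use assms(3,4) \<open>indets T \<subseteq> indets A\<close> in \<open>auto simp: w_def\<close>)+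
  then have wT: "eval_mpoly w T \<noteq> 0" and wB: "eval_mpoly w B \<noteq> 0"
    using \<open>eval_mpoly w0 (T * B) \<noteq> 0\<close> by (auto simp: ev.hom_mult)
  have w0: "w 0 = 1" by (simp add: w_def)
  have A: "dirU w A = (\<Sum>m\<in>keys A. dirU w (single m (lookup A m)))"
    by (subst mpoly_sum_singles[of A]) (rule dirU.hom_sum)
  have "dg w A \<le> D" unfolding A
    by (rule degree_sum_le) (use leD dirU_single(1)[of w, OF w0] in \<open>auto intro: order_trans\<close>)
  have "coeff (dirU w A) D = (\<Sum>m\<in>keys A. if tdeg m = D then Const (lookup A m * monomial_value w m) else 0)"
    unfolding A coeff_sum
  proof (rule sum.cong[OF refl])
    fix m assume "m \<in> keys A"
    then show "coeff (dirU w (single m (lookup A m))) D = (if tdeg m = D then Const (lookup A m * monomial_value w m) else 0)"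
      using dirU_single[of w m "lookup A m", OF w0] leD[of m] by (auto intro!: coeff_eq_0)
  qed
  also have "\<dots> = (\<Sum>m | m \<in> keys A \<and> tdeg m = D. Const (lookup A m * monomial_value w m))"
    by (simp add: sum.inter_filter)
  also have "\<dots> = Const (eval_mpoly w T)"
    unfolding T_def ev.hom_sum comm_ring_hom_sum[OF comm_ring_hom_Const]
    by (simp add: eval_mpoly_heval heval_single[OF comm_ring_hom_ident])
  finally have "coeff (dirU w A) D = Const (eval_mpoly w T)" .
  moreover from this wT \<open>dg w A \<le> D\<close> have "dg w A = D"
    by (metis Const_eq_0_iff le_antisym le_degree)
  ultimately have "wmonic w A" unfolding wmonic_def using wT by auto
  with w0 wB show ?thesis using that by blast
qed

subsection \<open>Division along a direction\<close>

text \<open>Pseudo-division of \<open>dirU w h\<close> by \<open>dirU w g\<close>, carried back by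
  \<open>dirV w\<close>. The multiplier \<open>L\<close> is the leading coefficient of
  \<open>g\<close> along \<open>w\<close> and is itself constant along \<open>w\<close>.\<close>

lemma dir_pseudo_div:
  assumes "g \<noteq> 0"
  obtains L where "L \<noteq> 0" "dirU w L = [:lead_coeff (dirU w g):]" 
    "\<And>h. \<exists>i q r. L ^ i * h = q * g + r \<and> (r = 0 \<or> dg w r < dg w g)"
proof -
  define L where "L = dirV w [:lead_coeff (dirU w g):]"
  have UL: "dirU w L = [:lead_coeff (dirU w g):]"
    by (simp add: L_def dirU_dirV drop0_coeff_dirU drop0.map_poly_pCons_hom)
  then have "L \<noteq> 0" using assms by auto
  moreover have "\<exists>i q r. L ^ i * h = q * g + r \<and> (r = 0 \<or> dg w r < dg w g)" for h
  proof -
    obtain q0 r0 where *: "pseudo_divmod (dirU w h) (dirU w g) = (q0, r0)" by force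
    define i where "i = Suc (dg w h) - dg w g"
    have eq: "Polynomial.smult (lead_coeff (dirU w g) ^ i) (dirU w h) = dirU w g * q0 + r0"
      and r0: "r0 = 0 \<or> degree r0 < dg w g"
      using pseudo_divmod[OF _ *] assms by (auto simp: i_def)
    have "dirV w (dirU w (L ^ i * h)) = dirV w (dirU w g * q0 + r0)"
      unfolding eq[symmetric] dirU.hom_mult dirU.hom_power UL by (simp add: poly_const_pow)
    then have "L ^ i * h = dirV w q0 * g + dirV w r0"
      by (simp add: dirV.hom_add dirV.hom_mult mult.commute)
    moreover have "dirV w r0 = 0 \<or> dg w (dirV w r0) < dg w g"
      using r0 dg_dirV_le[of w r0] by auto
    ultimately show ?thesis by blast
  qed
  ultimately show ?thesis using that UL by blast
qed

lemma wmonic_div: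
  assumes "wmonic w g"
  obtains q r where "h = q * g + r" "r = 0 \<or> dg w r < dg w g"
proof -
  obtain c where c: "c \<noteq> 0" "lead_coeff (dirU w g) = Const c" using assms by (auto simp: wmonic_def)
  obtain L where L: "dirU w L = [:lead_coeff (dirU w g):]" 
    "\<And>h. \<exists>i q r. L ^ i * h = q * g + r \<and> (r = 0 \<or> dg w r < dg w g)"
    using dir_pseudo_div[OF wmonic_nonzero[OF assms]] by blast
  have LC: "L = Const c" using dirV_dirU[of w L] unfolding L(1) c(2) by (simp add: dirV_const)
  obtain i q r where qr: "L ^ i * h = q * g + r" "r = 0 \<or> dg w r < dg w g" using L(2) by blast
  define e where "e = Const (1 / c ^ i)"
  have "e * L ^ i = 1" using c(1) by (simp add: e_def LC flip: Const_power Const_mult)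
  then have "h = e * (L ^ i * h)" by (simp flip: mult.assoc)
  also have "\<dots> = (e * q) * g + e * r" unfolding qr(1) by (simp add: algebra_simps)
  finally have "h = (e * q) * g + e * r" .
  moreover have "e * r = 0 \<or> dg w (e * r) < dg w g"
    using qr(2) by (auto simp: e_def dirU.hom_mult intro: le_less_trans[OF degree_smult_le])
  ultimately show ?thesis by (rule that)
qed

lemma dg_power_0: "dg w L = 0 \<Longrightarrow> dg w (L ^ i) = 0"
  by (metis degree_power_le dirU.hom_power le_zero_eq mult_zero_left)

text \<open>Among the nonzero combinations of \<open>G\<close> and \<open>H\<close>, one of least
  degree along \<open>w\<close> divides both up to powers of its leading coefficient
  \<open>L\<close>, as in Euclid's algorithm over the field of fractions. If its degree were
  positive, primality would make this combination or \<open>G\<close> divide a power of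
  \<open>L\<close>, which is constant along \<open>w\<close>.\<close>

lemma coprime_elimination:
  assumes G: "wmonic w G" "prime_elem G" and H: "\<not> G dvd H"
  obtains r \<alpha> \<beta> where "r \<noteq> 0" "dg w r = 0" "r = \<alpha> * G + \<beta> * H"
proof -
  define J where "J = {x. x \<noteq> 0 \<and> (\<exists>\<alpha> \<beta>. x = \<alpha> * G + \<beta> * H)}"
  have G0: "G \<noteq> 0" by (rule wmonic_nonzero[OF G(1)])
  have dG: "dg w G > 0" by (rule wmonic_prime_dg[OF G])
  have "G \<in> J" using G0 by (auto simp: J_def intro: exI[of _ 1] exI[of _ 0])
  then obtain h where h: "h \<in> J" "\<And>x. x \<in> J \<Longrightarrow> dg w h \<le> dg w x"
    using ex_has_least_nat[of "\<lambda>x. x \<in> J" G "dg w"] by blast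
  obtain \<alpha> \<beta> where ab: "h = \<alpha> * G + \<beta> * H" and h0: "h \<noteq> 0" using h(1) by (auto simp: J_def)
  obtain L where L: "L \<noteq> 0" "dirU w L = [:lead_coeff (dirU w h):]" 
    "\<And>x. \<exists>i q r. L ^ i * x = q * h + r \<and> (r = 0 \<or> dg w r < dg w h)"
    using dir_pseudo_div[OF h0] by blast
  have mult: "\<exists>i q. L ^ i * x = q * h" if "x = a * G + b * H" for x a b
  proof -
    obtain i q r where qr: "L ^ i * x = q * h + r" "r = 0 \<or> dg w r < dg w h" using L(3) by blast
    have "r = (L ^ i * a - q * \<alpha>) * G + (L ^ i * b - q * \<beta>) * H"
      using qr(1) unfolding ab that by (simp add: algebra_simps)
    then have "r \<noteq> 0 \<Longrightarrow> r \<in> J" by (auto simp: J_def)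
    then have "r = 0" using qr(2) h(2)[of r] by (metis not_le)
    then show ?thesis using qr(1) by auto
  qed
  obtain i q where iq: "L ^ i * G = q * h" using mult[of G 1 0] by auto
  obtain j q' where jq: "L ^ j * H = q' * h" using mult[of H 0 1] by auto
  have dL: "dg w L = 0" by (simp add: L(2))
  have "dg w h = 0"
  proof (rule ccontr)
    assume dh: "dg w h \<noteq> 0"
    have "G dvd q * h" by (metis iq dvd_triv_right)
    then consider "G dvd q" | "G dvd h" using G(2) prime_elem_dvd_multD by blast
    then show False
    proof cases
      case 1
      then obtain q2 where "q = G * q2" by auto
      then have "L ^ i = q2 * h" using iq G0 by (simp add: mult_ac)
      moreover from this have "q2 \<noteq> 0" using L(1) by auto
      ultimately have "dg w (L ^ i) = dg w q2 + dg w h" using h0 by (simp add: dg_mult)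
      then show False using dg_power_0[OF dL, of i] dh by simp
    next
      case 2
      then have "G dvd L ^ j * H" by (metis jq dvd_mult)
      then have "G dvd L" using G(2) H prime_elem_dvd_multD prime_elem_dvd_power by blast
      then obtain y where "L = G * y" by auto
      then have "dg w L = dg w G + dg w y" using L(1) G0 by (auto simp: dg_mult)
      then show False using dL dG by simp
    qed
  qed
  then show ?thesis using that[OF h0 _ ab] by simp
qed

subsection \<open>Prime ideals with a monic element\<close>

text \<open>By Gauss' lemma the primitive parts of \<open>q\<close> and \<open>g\<close> multiply to
  \<open>f\<close> up to a unit, so that the primitive part of \<open>g\<close> has a unit as
  leading coefficient. Hence \<open>l\<close> and the content of \<open>g\<close> are
  associated.\<close>

lemma gauss_lead_coeff_dvd:
  fixes f q g :: "complex poly poly"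
  assumes eq: "Polynomial.smult (l ^ i) f = q * g" and l: "l = lead_coeff g" "l \<noteq> 0"
    and f: "is_unit (lead_coeff f)"
  shows "l dvd coeff g r"
proof -
  have "content f dvd 1" using content_dvd_coeff[of f "degree f"] f dvd_trans by blast
  then have cf: "content f = 1" by (metis is_unit_normalize normalize_content)
  have "content (Polynomial.smult (l ^ i) f) = content q * content g"
    unfolding eq by (rule content_mult)
  then have c: "normalize (l ^ i) = content q * content g" by (simp add: cf)
  obtain u where u: "is_unit u" "l ^ i = u * normalize (l ^ i)"
    by (metis unit_factor_is_unit l(2) power_not_zero unit_factor_mult_normalize)
  have "Polynomial.smult (content q * content g) (primitive_part q * primitive_part g) = q * g"
    by (metis content_times_primitive_part mult_smult_left mult_smult_right smult_smult)
  also have "\<dots> = Polynomial.smult (content q * content g) (Polynomial.smult u f)"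
    unfolding eq[symmetric] by (subst u(2)) (simp add: c mult.commute)
  finally have "primitive_part q * primitive_part g = Polynomial.smult u f"
    using c l(2) by (metis normalize_eq_0_iff power_eq_0_iff smult_cancel)
  then have "lead_coeff (primitive_part q) * lead_coeff (primitive_part g) = u * lead_coeff f"
    by (metis lead_coeff_mult lead_coeff_smult)
  then have "is_unit (lead_coeff (primitive_part g))"
    using u(1) f by (metis dvd_mult_right is_unit_mult_iff dvd_refl)
  moreover have "l = content g * lead_coeff (primitive_part g)"
    unfolding l(1) by (metis content_times_primitive_part lead_coeff_smult)
  ultimately have "l dvd content g" by (metis dvd_refl mult_unit_dvd_iff)
  then show ?thesis using content_dvd_coeff dvd_trans by blast
qed

text \<open>Reduction to coefficients in one variable. The coefficient is divided by
  \<open>l\<close> along a direction in which \<open>l\<close> is monic. If a remainder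
  \<open>r\<close> were left, evaluation at a point \<open>b\<close> where the leading coefficient
  of \<open>r\<close> is nonzero would contradict \<open>gauss_lead_coeff_dvd\<close>: the image of
  \<open>l\<close> would divide that of \<open>r\<close>, which has smaller degree.\<close>

lemma lead_coeff_dvd_coeff:
  fixes f q g :: "mpoly poly"
  assumes eq: "Polynomial.smult (l ^ i) f = q * g" and l: "l = lead_coeff g" "l \<noteq> 0"
    and f: "lead_coeff f = Const c" "c \<noteq> 0" and l0: "0 \<notin> indets l"
  shows "l dvd coeff g s"
proof -
  obtain w where w: "w 0 = 1" "wmonic w l" using exists_direction[of l 1] l(2) l0
    by (auto simp: indets_def)
  obtain Q r where Qr: "coeff g s = Q * l + r" "r = 0 \<or> dg w r < dg w l" using wmonic_div[OF w(2)] by blast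
  show ?thesis
  proof (cases "r = 0")
    case False
    then obtain b where b: "eval_mpoly b (lead_coeff (dirU w r)) \<noteq> 0"
      using eval_nonzero[of "lead_coeff (dirU w r)"] by auto
    define ch where "ch x = map_poly (eval_mpoly b) (dirU w x)" for x
    have "comm_ring_hom (\<lambda>x. map_poly (eval_mpoly b) (dirU w x))"
      by (rule comm_ring_hom_comp[OF comm_ring_hom_map_poly[OF eval_hom] dirU.comm_ring_hom_axioms])
    then interpret ch: comm_ring_hom ch by (simp add: ch_def[abs_def])
    interpret chP: comm_ring_hom "map_poly ch" by (rule comm_ring_hom_map_poly) unfold_locales
    obtain c' where c': "c' \<noteq> 0" "lead_coeff (dirU w l) = Const c'" using w(2) by (auto simp: wmonic_def)
    have dl: "degree (ch l) = dg w l" unfolding ch_def by (rule degree_map_poly) (use c' in auto)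
    have "coeff (ch l) (dg w l) \<noteq> 0" unfolding ch_def using c' by (simp add: ev.coeff_map_poly_hom)
    then have lch: "ch l \<noteq> 0" by auto
    have rch: "ch r \<noteq> 0" using b unfolding ch_def by (metis coeff_0 ev.coeff_map_poly_hom)
    have "degree (ch r) \<le> dg w r" unfolding ch_def by (rule degree_map_poly_le)
    have lead: "ch l = lead_coeff (map_poly ch g)"
    proof -
      have "degree (map_poly ch g) = degree g" by (rule degree_map_poly) (use l lch in auto)
      then show ?thesis by (simp add: ch.coeff_map_poly_hom l(1))
    qed
    have chc: "ch (Const c) = [:c:]" by (simp add: ch_def ev.map_poly_pCons_hom)
    have "degree (map_poly ch f) = degree f" by (rule degree_map_poly) (use f chc in auto)
    then have "lead_coeff (map_poly ch f) = [:c:]" by (simp add: ch.coeff_map_poly_hom f(1) chc)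
    then have un: "is_unit (lead_coeff (map_poly ch f))" using f(2) by (simp add: is_unit_const_poly_iff)
    have "map_poly ch ([:l ^ i:] * f) = map_poly ch (q * g)" using eq by simp
    then have "Polynomial.smult (ch l ^ i) (map_poly ch f) = map_poly ch q * map_poly ch g"
      unfolding chP.hom_mult by (simp add: ch.map_poly_pCons_hom ch.hom_power)
    from gauss_lead_coeff_dvd[OF this lead lch un, of s]
    have "ch l dvd ch Q * ch l + ch r" unfolding ch.coeff_map_poly_hom Qr(1) by (simp add: ch.hom_add ch.hom_mult)
    then have "ch l dvd ch r" by (simp add: dvd_add_right_iff)
    then have "degree (ch l) \<le> degree (ch r)" using rch dvd_imp_degree_le by blast
    then show ?thesis using dl \<open>degree (ch r) \<le> dg w r\<close> Qr(2) False by simp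
  qed (use Qr in simp)
qed

definition prime_ideal :: "'a::comm_ring_1 set \<Rightarrow> bool" where
  "prime_ideal K \<longleftrightarrow> 1 \<notin> K \<and> (\<forall>x\<in>K. \<forall>y\<in>K. x - y \<in> K) \<and> (\<forall>x. \<forall>y\<in>K. x * y \<in> K) \<and>
     (\<forall>x y. x * y \<in> K \<longrightarrow> x \<in> K \<or> y \<in> K)"

lemma prime_ideal_kernel:
  fixes f :: "'a::comm_ring_1 \<Rightarrow> 'b::idom"
  assumes "comm_ring_hom f" shows "prime_ideal {x. f x = 0}"
proof -
  interpret comm_ring_hom f by fact
  show ?thesis by (auto simp: prime_ideal_def hom_minus hom_mult)
qed

text \<open>An element \<open>g\<close> of least degree along \<open>w\<close> divides
  \<open>F\<close> only up to powers of its leading coefficient \<open>L\<close>. As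
  \<open>F\<close> is monic along \<open>w\<close>, Gauss' lemma lets \<open>L\<close> be cancelled
  from \<open>g\<close>; the quotient \<open>G\<close> stays in \<open>K\<close> because
  \<open>L\<close>, constant along \<open>w\<close>, is not in the prime ideal. Now \<open>G\<close>
  is monic along \<open>w\<close>, and division by it leaves no remainder on
  \<open>K\<close>.\<close>

theorem prime_ideal_generator:
  assumes K: "prime_ideal K" and F: "F \<in> K" "wmonic w F"
    and free: "\<And>L. L \<in> K \<Longrightarrow> dg w L = 0 \<Longrightarrow> L = 0"
  obtains G where "wmonic w G" "prime_elem G" "\<And>h. h \<in> K \<longleftrightarrow> G dvd h"
proof -
  have K1: "1 \<notin> K" and Kd: "\<And>x y. x \<in> K \<Longrightarrow> y \<in> K \<Longrightarrow> x - y \<in> K"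
    and Km: "\<And>x y. y \<in> K \<Longrightarrow> x * y \<in> K" and Kp: "\<And>x y. x * y \<in> K \<Longrightarrow> x \<in> K \<or> y \<in> K"
    using K by (auto simp: prime_ideal_def)
  have F0: "F \<noteq> 0" by (rule wmonic_nonzero[OF F(2)])
  obtain g where g: "g \<in> K" "g \<noteq> 0" "\<And>x. x \<in> K \<Longrightarrow> x \<noteq> 0 \<Longrightarrow> dg w g \<le> dg w x"
    using ex_has_least_nat[of "\<lambda>x. x \<in> K \<and> x \<noteq> 0" F "dg w"] F(1) F0 by blast
  obtain L where L: "L \<noteq> 0" "dirU w L = [:lead_coeff (dirU w g):]" 
    "\<And>x. \<exists>i q r. L ^ i * x = q * g + r \<and> (r = 0 \<or> dg w r < dg w g)"
    using dir_pseudo_div[OF g(2)] by blast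
  have LK: "L \<notin> K" using free[of L] L(1,2) by auto
  obtain i q where iq: "L ^ i * F = q * g"
  proof -
    obtain i q r where qr: "L ^ i * F = q * g + r" "r = 0 \<or> dg w r < dg w g" using L(3) by blast
    have "r = L ^ i * F - q * g" using qr(1) by simp
    then have "r \<in> K" using Kd Km F(1) g(1) by simp
    then have "r = 0" using qr(2) g(3)[of r] by (metis not_le)
    then show ?thesis using qr(1) that by auto
  qed
  define l where "l = lead_coeff (dirU w g)"
  have l0: "l \<noteq> 0" using g(2) by (simp add: l_def)
  obtain c where c: "c \<noteq> 0" "lead_coeff (dirU w F) = Const c" using F(2) by (auto simp: wmonic_def)
  have "dirU w (L ^ i * F) = dirU w (q * g)" by (simp add: iq)
  then have "Polynomial.smult (l ^ i) (dirU w F) = dirU w q * dirU w g"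
    unfolding dirU.hom_mult dirU.hom_power L(2) by (simp add: poly_const_pow l_def)
  from lead_coeff_dvd_coeff[OF this l_def l0 c(2,1)]
  have "l dvd coeff (dirU w g) s" for s by (simp add: l_def indets_coeff_dirU)
  then have "[:l:] dvd dirU w g" by (simp add: const_poly_dvd_iff)
  then obtain g' where g': "dirU w g = dirU w L * g'" by (auto simp: L(2) l_def)
  define G where "G = dirV w g'"
  have gG: "g = L * G" using arg_cong[OF g', of "dirV w"] by (simp add: dirV.hom_mult G_def)
  then have GK: "G \<in> K" using Kp[of L G] g(1) LK by auto
  have G0: "G \<noteq> 0" using gG g(2) by auto
  have "l = l * lead_coeff (dirU w G)"
    using arg_cong[OF gG, of "\<lambda>x. lead_coeff (dirU w x)"]
    unfolding dirU.hom_mult lead_coeff_mult L(2) l_def by simp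
  then have "lead_coeff (dirU w G) = Const 1" using l0 by auto
  then have wG: "wmonic w G" unfolding wmonic_def by (intro exI[of _ 1]) simp
  have dvdK: "h \<in> K \<longleftrightarrow> G dvd h" for h
  proof
    assume h: "h \<in> K"
    obtain Q r where Qr: "h = Q * G + r" "r = 0 \<or> dg w r < dg w G" using wmonic_div[OF wG] by blast
    have "r = h - Q * G" using Qr(1) by simp
    then have "r \<in> K" using Kd Km h GK by simp
    moreover have "dg w G \<le> dg w g" using gG L(1) G0 by (simp add: dg_mult)
    ultimately have "r = 0" using Qr(2) g(3)[of r] by (metis not_le order_less_le_trans)
    then show "G dvd h" using Qr(1) by simp
  next
    assume "G dvd h"
    then show "h \<in> K" using Km GK by (auto simp: mult.commute elim!: dvdE)
  qed
  have "prime_elem G"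
    unfolding prime_elem_def using G0 K1 Kp by (auto simp flip: dvdK)
  with wG dvdK show ?thesis using that by blast
qed

subsection \<open>Zeros near a given zero\<close>

lemma tendsto_eval_mpoly:
  assumes "\<And>i. ((\<lambda>l. q l i) \<longlongrightarrow> p i) X"
  shows "((\<lambda>l. eval_mpoly (q l) A) \<longlongrightarrow> eval_mpoly p A) X"
  unfolding eval_mpoly_def using assms by (intro tendsto_intros)

text \<open>The product of the norms of all roots is
  \<open>norm (poly f 0) / norm (lead_coeff f)\<close>, so that the smallest root satisfies the
  bound.\<close>

lemma small_root:
  fixes f :: "complex poly"
  assumes "degree f > 0"
  shows "\<exists>\<sigma>. poly f \<sigma> = 0 \<and> norm (lead_coeff f) * norm \<sigma> ^ degree f \<le> norm (poly f 0)"
proof -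
  obtain as where as: "Polynomial.smult (lead_coeff f) (\<Prod>a\<leftarrow>as. [:- a, 1:]) = f" "length as = degree f"
    using fundamental_theorem_algebra_factorized[of f] by auto
  have ne: "as \<noteq> []" using as(2) assms by auto
  define \<sigma> where "\<sigma> = arg_min_list norm as"
  have \<sigma>: "\<sigma> \<in> set as" "\<And>a. a \<in> set as \<Longrightarrow> norm \<sigma> \<le> norm a"
    unfolding \<sigma>_def using ne by (simp_all add: arg_min_list_in f_arg_min_list_f)
  have le: "x ^ length bs \<le> norm (\<Prod>a\<leftarrow>bs. poly [:- a, 1:] (0::complex))" if "x \<ge> 0" "\<And>a. a \<in> set bs \<Longrightarrow> x \<le> norm a" for x bs
    using that by (induction bs) (auto simp: norm_mult intro!: mult_mono)
  have "poly f y = lead_coeff f * (\<Prod>a\<leftarrow>as. poly [:- a, 1:] y)" for y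
    by (subst as(1)[symmetric]) (simp add: poly_prod_list o_def)
  moreover have "(\<Prod>a\<leftarrow>as. poly [:- a, 1:] \<sigma>) = 0" using \<sigma>(1) by (auto simp: prod_list_zero_iff)
  ultimately show ?thesis
    using le[of "norm \<sigma>" as] \<sigma>(2) as(2) by (intro exI[of _ \<sigma>]) (auto simp: norm_mult intro!: mult_left_mono)
qed

text \<open>Points near \<open>p\<close> with \<open>r\<close> nonzero exist on a line through
  \<open>p\<close>, and they are corrected to zeros of \<open>A\<close> by moving along
  \<open>w\<close>. The correction tends to 0 by \<open>small_root\<close>, and it leaves the value
  of \<open>r\<close> unchanged because \<open>r\<close> is constant along \<open>w\<close>.\<close>

lemma nearby_zeros:
  assumes w: "w 0 = 1" "wmonic w A" and d: "dg w A > 0" and p: "eval_mpoly p A = 0"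
    and r: "r \<noteq> 0" "dg w r = 0"
  obtains q where "\<And>i. (\<lambda>l. q l i) \<longlonglongrightarrow> p i" "\<And>l. eval_mpoly (q l) A = 0" "\<And>l. eval_mpoly (q l) r \<noteq> 0"
proof -
  obtain b where b: "eval_mpoly b r \<noteq> 0" using eval_nonzero[OF r(1)] by blast
  have "poly (lp p (\<lambda>i. b i - p i) r) 1 \<noteq> 0" using b by (simp add: poly_lp)
  then have "finite {t. poly (lp p (\<lambda>i. b i - p i) r) t = 0}" by (intro poly_roots_finite) auto
  then have "finite ((\<lambda>l. 1 / of_nat (Suc l)) -` {t. poly (lp p (\<lambda>i. b i - p i) r) t = 0})"
    by (rule finite_vimageI) (auto simp: inj_def)
  then obtain N where N: "\<And>l. l \<ge> N \<Longrightarrow> poly (lp p (\<lambda>i. b i - p i) r) (1 / of_nat (Suc l)) \<noteq> 0"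
    unfolding finite_nat_set_iff_bounded by (metis (mono_tags, lifting) mem_Collect_eq not_less vimageI)
  define P where "P l i = p i + 1 / of_nat (Suc (l + N)) * (b i - p i)" for l i
  have t0: "(\<lambda>l. 1 / of_nat (Suc (l + N)) :: complex) \<longlonglongrightarrow> 0"
    using LIMSEQ_ignore_initial_segment[OF LIMSEQ_Suc[OF lim_1_over_n[where 'a = complex]], of N] by simp
  have "(\<lambda>l. P l i) \<longlonglongrightarrow> p i + 0 * (b i - p i)" for i
    unfolding P_def by (intro tendsto_intros t0)
  then have P: "(\<lambda>l. P l i) \<longlonglongrightarrow> p i" for i by simp
  have Pr: "eval_mpoly (P l) r \<noteq> 0" for l
    using N[of "l + N"] unfolding poly_lp P_def by simp
  obtain c where c: "c \<noteq> 0" "\<And>p. degree (lp p w A) = dg w A" "\<And>p. lead_coeff (lp p w A) = c"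
    using degree_lp[OF w] by metis
  have "\<exists>\<sigma>. poly (lp (P l) w A) \<sigma> = 0 \<and> norm c * norm \<sigma> ^ dg w A \<le> norm (eval_mpoly (P l) A)" for l
    using small_root[of "lp (P l) w A"] d c by (simp add: poly_lp[of "P l" w A 0])
  then obtain \<sigma> where \<sigma>: "\<And>l. poly (lp (P l) w A) (\<sigma> l) = 0"
      "\<And>l. norm c * norm (\<sigma> l) ^ dg w A \<le> norm (eval_mpoly (P l) A)" by metis
  have lim0: "(\<lambda>l. norm (eval_mpoly (P l) A) / norm c) \<longlonglongrightarrow> 0"
    using tendsto_divide[OF tendsto_norm[OF tendsto_eval_mpoly[of P p sequentially A, OF P]] tendsto_const[of "norm c"]] c(1) p by simp
  have "(\<lambda>l. norm (\<sigma> l) ^ dg w A) \<longlonglongrightarrow> 0"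
    by (rule tendsto_sandwich[OF _ _ tendsto_const lim0])
       (use \<sigma>(2) c(1) in \<open>auto simp: field_simps intro!: always_eventually\<close>)
  then have "(\<lambda>l. root (dg w A) (norm (\<sigma> l) ^ dg w A)) \<longlonglongrightarrow> root (dg w A) 0"
    by (rule tendsto_real_root)
  then have "(\<lambda>l. norm (\<sigma> l)) \<longlonglongrightarrow> 0" using d by (simp add: real_root_power_cancel)
  then have \<sigma>0: "\<sigma> \<longlonglongrightarrow> 0" by (rule tendsto_norm_zero_cancel)
  define q where "q l i = P l i + \<sigma> l * w i" for l i
  have "(\<lambda>l. q l i) \<longlonglongrightarrow> p i + 0 * w i" for i unfolding q_def by (intro tendsto_intros P \<sigma>0)
  moreover have "eval_mpoly (q l) A = 0" for l using \<sigma>(1)[of l] unfolding poly_lp q_def .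
  moreover have "eval_mpoly (q l) r \<noteq> 0" for l
    using Pr[of l] eval_line_const[OF w(1) r(2), of "P l" "\<sigma> l"] unfolding q_def by simp
  ultimately show ?thesis by (intro that[of q]) auto
qed

subsection \<open>Multiplicity of a prime factor\<close>

lemma drop0_of_nat [simp]: "drop0 (of_nat i) = of_nat i"
  by (induction i) (simp_all add: drop0.hom_add)

lemma eval_of_nat [simp]: "eval_mpoly a (of_nat i) = of_nat i"
  by (induction i) (simp_all add: ev.hom_add)

text \<open>The derivative of \<open>G\<close> in direction \<open>w\<close>. Its smaller degree
  excludes divisibility by \<open>G\<close>, so that for prime \<open>G\<close> a line with
  direction \<open>w\<close> through a generic zero meets the zero set simply.\<close>

lemma dir_derivative:
  assumes "w 0 = 1" "dg w G > 0"
  obtains DG where "DG \<noteq> 0" "dg w DG < dg w G" "\<And>p. eval_mpoly p DG = poly (pderiv (lp p w G)) 0"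
proof -
  define DG where "DG = dirV w (pderiv (dirU w G))"
  have UD: "dirU w DG = pderiv (dirU w G)"
    by (rule poly_eqI) (simp add: DG_def dirU_dirV drop0.coeff_map_poly_hom coeff_pderiv drop0.hom_mult drop0_coeff_dirU 
        flip: of_nat_Suc)
  have "pderiv (dirU w G) \<noteq> 0" using assms(2) by (simp add: pderiv_eq_0_iff)
  then have "DG \<noteq> 0" by (metis UD dirU_eq_0_iff)
  moreover have "dg w DG < dg w G" unfolding UD using assms(2) by (simp add: degree_pderiv)
  moreover have "eval_mpoly p DG = poly (pderiv (lp p w G)) 0" for p
  proof -
    have mp: "map_poly (eval_mpoly b) (pderiv f) = pderiv (map_poly (eval_mpoly b) f)" for b f
      by (rule poly_eqI) (simp add: coeff_pderiv ev.coeff_map_poly_hom ev.hom_mult ev.hom_add flip: of_nat_Suc)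
    have "eval_mpoly p DG = poly (lp p w DG) 0" by (simp add: poly_lp)
    also have "\<dots> = poly (pderiv (lp p w G)) 0"
      unfolding lp_dirU[of w, OF assms(1)] UD mp by (simp add: poly_pcompose pderiv_pcompose pderiv_pCons)
    finally show ?thesis .
  qed
  ultimately show ?thesis using that by blast
qed

lemma order_0_pos: "p \<noteq> 0 \<Longrightarrow> poly p 0 = 0 \<Longrightarrow> order 0 p > 0"
  by (metis gr0I order_root)

lemma order_power: fixes p :: "'a::idom poly"
  shows "p \<noteq> 0 \<Longrightarrow> order x (p ^ i) = i * order x p"
  by (induction i) (simp_all add: order_mult)

lemma multiplicity_le:
  assumes w: "w 0 = 1" "wmonic w (G ^ f * H)" and p: "eval_mpoly p G = 0"
  shows "f \<le> order 0 (lp p w (G ^ f * H))"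
proof -
  obtain c where "c \<noteq> 0" "lead_coeff (lp p w (G ^ f * H)) = c"
    using degree_lp[OF w] by metis
  then have "lp p w G ^ f * lp p w H \<noteq> 0" by (auto simp: lp.hom_mult lp.hom_power)
  moreover have "f = 0 \<or> 0 < order 0 (lp p w G)"
    using calculation by (cases "f = 0") (auto intro!: order_0_pos simp: poly_lp p power_0_left)
  moreover have "f \<le> f * order 0 (lp p w G)"
    using calculation(2) by (cases "order 0 (lp p w G)") auto
  ultimately show ?thesis
    by (cases "f = 0") (auto simp: lp.hom_mult lp.hom_power order_mult order_power intro: trans_le_add1)
qed

text \<open>By \<open>dense\<close>, the set \<open>V\<close> is Zariski dense in the zero set of
  the prime \<open>G\<close>. It therefore has a point where neither \<open>H\<close> nor the
  derivative \<open>DG\<close> vanishes; there \<open>G\<close> has a simple zero along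
  \<open>w\<close>, and the order of \<open>G ^ f * H\<close> is exactly \<open>f\<close>.\<close>

lemma multiplicity_ge:
  assumes w: "w 0 = 1" "wmonic w G" and G: "prime_elem G" and H: "\<not> G dvd H"
    and V: "\<And>p. p \<in> V \<Longrightarrow> eval_mpoly p G = 0" "\<And>p. p \<in> V \<Longrightarrow> e \<le> order 0 (lp p w (G ^ f * H))"
    and dense: "\<And>h. \<not> G dvd h \<Longrightarrow> \<exists>p\<in>V. eval_mpoly p h \<noteq> 0"
  shows "e \<le> f"
proof -
  have G0: "G \<noteq> 0" and dG: "dg w G > 0" using w G wmonic_nonzero wmonic_prime_dg by auto
  obtain DG where DG: "DG \<noteq> 0" "dg w DG < dg w G" "\<And>p. eval_mpoly p DG = poly (pderiv (lp p w G)) 0"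
    using dir_derivative[OF w(1) dG] by blast
  have "\<not> G dvd DG"
  proof
    assume "G dvd DG"
    then obtain x where "DG = G * x" by auto
    then have "dg w DG = dg w G + dg w x" using DG(1) G0 by (auto simp: dg_mult)
    then show False using DG(2) by simp
  qed
  then have "\<not> G dvd DG * H" using H G prime_elem_dvd_multD by blast
  then obtain p where p: "p \<in> V" "eval_mpoly p DG \<noteq> 0" "eval_mpoly p H \<noteq> 0"
    using dense[of "DG * H"] by (auto simp: ev.hom_mult)
  have ord1: "order 0 (lp p w G) = 1"
  proof -
    have 1: "poly (pderiv (lp p w G)) 0 \<noteq> 0" using p(2) DG(3) by simp
    then have "pderiv (lp p w G) \<noteq> 0" by auto
    moreover have "lp p w G \<noteq> 0" using 1 by auto
    moreover have "poly (lp p w G) 0 = 0" using V(1)[OF p(1)] by (simp add: poly_lp)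
    moreover have "order 0 (pderiv (lp p w G)) = 0" using 1 by (metis order_0I)
    ultimately show ?thesis using order_pderiv[of "lp p w G" 0] by (simp add: order_root)
  qed
  have "poly (lp p w H) 0 \<noteq> 0" using p(3) by (simp add: poly_lp)
  then have "order 0 (lp p w H) = 0" "lp p w H \<noteq> 0" by (auto simp: order_0I)
  moreover have "lp p w G \<noteq> 0" using ord1 degree_lp[OF w] by (metis leading_coeff_0_iff)
  ultimately have "order 0 (lp p w (G ^ f * H)) = f"
    using ord1 by (simp add: lp.hom_mult lp.hom_power order_mult order_power)
  then show ?thesis using V(2)[OF p(1)] by simp
qed

subsection \<open>Resultants and roots\<close>

lemma complex_poly_factor:
  fixes p :: "complex poly"
  obtains y where "p = Polynomial.smult (lead_coeff p) (\<Prod>i<degree p. [:- y i, 1:])"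
proof -
  obtain as where as: "Polynomial.smult (lead_coeff p) (\<Prod>a\<leftarrow>as. [:- a, 1:]) = p" "length as = degree p"
    using fundamental_theorem_algebra_factorized[of p] by auto
  have "(\<Prod>a\<leftarrow>as. [:- a, 1:]) = (\<Prod>i<degree p. [:- (as ! i), 1:])"
    unfolding prod.list_conv_set_nth by (auto simp: as(2) atLeast0LessThan intro!: prod.cong)
  then show ?thesis using as(1) that by metis
qed

lemma degree_prod_linear: "degree (\<Prod>i<(m::nat). [:- y i, 1:] :: 'a::idom poly) = m"
  by (subst degree_prod_eq_sum_degree) auto

lemma lead_coeff_prod_linear: "lead_coeff (\<Prod>i<(m::nat). [:- y i, 1:] :: 'a::idom poly) = 1"
  by (simp add: lead_coeff_prod del: degree_prod_linear)

lemmas prod_linear_simps = degree_prod_linear[unfolded pCons_one] lead_coeff_prod_linear[unfolded pCons_one]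

lemma neg_one_power_cancel: "(-1) ^ m * ((-1) ^ m * x) = (x :: complex)"
  by (cases "even m") auto

lemma prod_diff_swap:
  "(\<Prod>i<(m::nat). \<Prod>j<(l::nat). \<alpha> i - \<beta> j :: complex) = (-1) ^ (m * l) * (\<Prod>j<l. \<Prod>i<m. \<beta> j - \<alpha> i)"
proof -
  have "(\<Prod>i<m. \<Prod>j<l. \<alpha> i - \<beta> j) = (\<Prod>i<m. \<Prod>j<l. (-1) * (\<beta> j - \<alpha> i))" by simp
  also have "\<dots> = (-1) ^ (m * l) * (\<Prod>i<m. \<Prod>j<l. \<beta> j - \<alpha> i)"
    by (simp only: prod.distrib prod_constant card_lessThan) (simp add: power_mult[symmetric] mult.commute)
  also have "(\<Prod>i<m. \<Prod>j<l. \<beta> j - \<alpha> i) = (\<Prod>j<l. \<Prod>i<m. \<beta> j - \<alpha> i)" by (rule prod.swap)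
  finally show ?thesis .
qed

lemma root_product_swap:
  assumes f: "f = Polynomial.smult c (\<Prod>i<(m::nat). [:- \<alpha> i, 1:])" and g: "g = Polynomial.smult b (\<Prod>j<(l::nat). [:- \<beta> j, 1:])"
  shows "(c::complex) ^ l * (\<Prod>i<m. poly g (\<alpha> i)) = (-1) ^ (m * l) * (b ^ m * (\<Prod>j<l. poly f (\<beta> j)))"
  unfolding f g by (simp add: poly_prod prod.distrib prod_diff_swap[of \<alpha> \<beta> l m] mult_ac)

text \<open>One step of Euclid's algorithm, from the relation between subresultants of index 0. A
  remainder of degree 0, which includes the remainder 0, is a separate case.\<close>

lemma resultant_euclid:
  fixes f g h :: "complex poly"
  assumes "f = q * g + h" "degree g \<le> degree f" "degree h < degree g" "g \<noteq> 0"
  shows "resultant f g = (-1) ^ (degree f * degree g) * lead_coeff g ^ (degree f - degree h) * resultant g h"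
proof -
  have eq: "f + (- q) * g = h" using assms(1) by simp
  have hg: "degree h < degree g \<or> b" for b using assms(3) by simp
  show ?thesis
  proof (cases "degree h = 0")
    case False
    from BT_lemma_1_12[OF eq assms(2) hg, of 0] False
    show ?thesis by (simp add: subresultant_resultant)
  next
    case True
    then obtain c where c: "h = [:c:]" by (metis degree_0_id)
    from BT_lemma_1_13[OF eq assms(2) hg hg] True assms(3) show ?thesis
      by (auto simp: subresultant_resultant c power_eq_if)
  qed
qed

text \<open>Induction along Euclid's algorithm: at the roots of \<open>g\<close>, the polynomial
  \<open>f\<close> and its remainder \<open>h\<close> have the same values. The summand 1 in the
  measure pays for exchanging \<open>f\<close> and \<open>g\<close> when \<open>g\<close> has the
  larger degree.\<close>

theorem resultant_roots:
  fixes g :: "complex poly"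
  assumes "f = Polynomial.smult c (\<Prod>i<(m::nat). [:- \<alpha> i, 1:])" "c \<noteq> 0" "g \<noteq> 0"
  shows "resultant f g = c ^ degree g * (\<Prod>i<m. poly g (\<alpha> i))"
  using assms
proof (induction "degree f + degree g + (if degree f < degree g then 1 else 0)" arbitrary: f g c m \<alpha> rule: less_induct)
  case less
  have df: "degree f = m" using less.prems(1,2) by (simp add: prod_linear_simps)
  have lf: "lead_coeff f = c" 
    unfolding less.prems(1) lead_coeff_smult lead_coeff_prod_linear by simp
  obtain \<beta> where \<beta>: "g = Polynomial.smult (lead_coeff g) (\<Prod>j<degree g. [:- \<beta> j, 1:])" by (rule complex_poly_factor)
  note swap = root_product_swap[OF less.prems(1) \<beta>]
  have f0: "f \<noteq> 0" using lf less.prems(2) by auto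
  show ?case
  proof (cases "degree g = 0")
    case True
    then obtain b where "g = [:b:]" by (metis degree_0_id)
    then show ?thesis by (simp add: df)
  next
    case dg: False
    show ?thesis
    proof (cases "degree f < degree g")
      case True
      have "resultant g f = lead_coeff g ^ degree f * (\<Prod>i<degree g. poly f (\<beta> i))"
        by (rule less.hyps[OF _ \<beta>]) (use True less.prems f0 in auto)
      then show ?thesis using swap by (simp add: resultant_swap[of f g] df)
    next
      case False
      define h where "h = f mod g"
      have fh: "f = (f div g) * g + h" by (simp add: h_def)
      have dh: "degree h < degree g" unfolding h_def using dg less.prems(3)
        by (metis degree_mod_less' degree_0 gr0I h_def mod_0)
      have hb: "poly h (\<beta> j) = poly f (\<beta> j)" if "j < degree g" for j
      proof -
        have "poly g (\<beta> j) = 0" using that by (subst \<beta>) (auto simp: poly_prod)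
        then show ?thesis using arg_cong[OF fh, of "\<lambda>p. poly p (\<beta> j)"] by simp
      qed
      have E: "resultant f g = (-1) ^ (degree f * degree g) * lead_coeff g ^ (degree f - degree h) * resultant g h"
        by (rule resultant_euclid[OF fh]) (use False dh less.prems in auto)
      show ?thesis
      proof (cases "h = 0")
        case True
        have "(\<Prod>j<degree g. poly f (\<beta> j)) = (\<Prod>j<degree g. poly h (\<beta> j))" using hb by simp
        also have "\<dots> = 0" using dg True by auto
        finally show ?thesis using swap E True dg by (simp add: df)
      next
        case hn: False
        have "resultant g h = lead_coeff g ^ degree h * (\<Prod>j<degree g. poly h (\<beta> j))"
          by (rule less.hyps[OF _ \<beta>]) (use False less.prems hn dh in auto)
        also have "(\<Prod>j<degree g. poly h (\<beta> j)) = (\<Prod>j<degree g. poly f (\<beta> j))" using hb by simp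
        finally have "resultant g h = lead_coeff g ^ degree h * (\<Prod>j<degree g. poly f (\<beta> j))" .
        moreover have "lead_coeff g ^ degree f = lead_coeff g ^ (degree f - degree h) * lead_coeff g ^ degree h"
          using dh False by (simp flip: power_add)
        ultimately show ?thesis using swap E by (simp add: df)
      qed
    qed
  qed
qed

lemma pderiv_root_product:
  fixes f :: "complex poly"
  assumes f: "f = Polynomial.smult c (\<Prod>i<(m::nat). [:- \<alpha> i, 1:])" and i: "i < m"
  shows "poly (pderiv f) (\<alpha> i) = c * (\<Prod>j\<in>{..<m}-{i}. \<alpha> i - \<alpha> j)"
proof -
  define g where "g = Polynomial.smult c (\<Prod>j\<in>{..<m}-{i}. [:- \<alpha> j, 1:])"
  have "f = [:- \<alpha> i, 1:] * g"
    unfolding f g_def using i by (subst prod.remove[of _ i]) auto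
  then have "poly (pderiv f) (\<alpha> i) = poly g (\<alpha> i)" by (simp add: pderiv_mult pderiv_pCons del: mult_pCons_left)
  then show ?thesis by (simp add: g_def poly_prod)
qed

lemma resultant_pderiv:
  fixes f :: "complex poly"
  assumes f: "f = Polynomial.smult c (\<Prod>i<(m::nat). [:- \<alpha> i, 1:])" "c \<noteq> 0" and m: "m > 0"
  shows "resultant f (pderiv f) = c ^ (2 * m - 1) * (\<Prod>i<m. \<Prod>j\<in>{..<m}-{i}. \<alpha> i - \<alpha> j)"
proof -
  have df: "degree f = m" using f by (simp add: prod_linear_simps)
  then have "pderiv f \<noteq> 0" using m by (simp add: pderiv_eq_0_iff)
  then have "resultant f (pderiv f) = c ^ (m - 1) * (\<Prod>i<m. poly (pderiv f) (\<alpha> i))"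
    using resultant_roots[OF f] by (simp add: degree_pderiv df)
  also have "(\<Prod>i<m. poly (pderiv f) (\<alpha> i)) = (\<Prod>i<m. c * (\<Prod>j\<in>{..<m}-{i}. \<alpha> i - \<alpha> j))"
    using pderiv_root_product[OF f(1)] by simp
  also have "\<dots> = c ^ m * (\<Prod>i<m. \<Prod>j\<in>{..<m}-{i}. \<alpha> i - \<alpha> j)" by (simp add: prod.distrib)
  also have "c ^ (m - 1) * \<dots> = c ^ (m - 1 + m) * (\<Prod>i<m. \<Prod>j\<in>{..<m}-{i}. \<alpha> i - \<alpha> j)"
    by (simp add: power_add)
  also have "m - 1 + m = 2 * m - 1" using m by simp
  finally show ?thesis .
qed

subsection \<open>Critical points\<close>

text \<open>The zeros of \<open>crit e p\<close> are the critical points of \<open>p / x ^ e\<close>, with an extra factor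
  \<open>x\<close> in the numerator of the derivative cancelled if \<open>e = 0\<close>; \<open>cv e p y\<close> is the critical value.
  Changing the coefficient of \<open>x ^ e\<close> in \<open>p\<close> shifts all critical values by the same amount.\<close>

definition crit :: "nat \<Rightarrow> complex poly \<Rightarrow> complex poly" where
  "crit e p = (if e = 0 then 1 else [:0, 1:]) * pderiv p - Polynomial.smult (of_nat e) p"

definition cv :: "nat \<Rightarrow> complex poly \<Rightarrow> complex \<Rightarrow> complex" where
  "cv e p y = poly p y / y ^ e"

text \<open>For \<open>e > 0\<close> the factor \<open>of_nat i - of_nat e\<close> removes the
  coefficient of \<open>x ^ e\<close>, for \<open>e = 0\<close> the shift of the index does. This is
  why \<open>crit\<close> does not react to a change of the coordinate \<open>a k\<close>.\<close>

lemma coeff_crit: "coeff (crit e p) i =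
   (if e = 0 then of_nat (Suc i) * coeff p (Suc i) else (of_nat i - of_nat e) * coeff p i)"
  by (cases i) (auto simp: crit_def coeff_pderiv algebra_simps)

lemma Var_nonzero: "Var j \<noteq> 0"
proof
  assume "Var j = 0"
  then have "eval_mpoly (\<lambda>_. 1) (Var j) = 0" by simp
  then show False by (simp del: ev.hom_zero)
qed

lemma coeff_P: "coeff (P n) i = (if i = n then 1 else if i < n then Var (n - i) else 0)"
proof -
  have "coeff (P n) i = (if i = n then 1 else 0) + (\<Sum>j=1..n. if n - j = i then Var j else 0)"
    by (auto simp: P_def coeff_sum)
  also have "(\<Sum>j=1..n. if n - j = i then Var j else 0) = (\<Sum>j=1..n. if j = n - i then if i < n then Var j else 0 else 0)"
    by (intro sum.cong) auto
  also have "\<dots> = (if i < n then Var (n - i) else 0)" by (subst sum.delta) auto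
  finally show ?thesis by auto
qed

lemma degree_P: "degree (P n) = n" "lead_coeff (P n) = 1"
proof -
  show "degree (P n) = n" by (intro antisym degree_le le_degree) (auto simp: coeff_P)
  then show "lead_coeff (P n) = 1" by (simp add: coeff_P)
qed

lemma coeff_P_at: "coeff (P_at n a) i = (if i = n then 1 else if i < n then a (n - i) else 0)"
  by (simp add: P_at_def ev.coeff_map_poly_hom coeff_P)

lemma degree_P_at [simp]: "degree (P_at n a) = n" 
  by (intro antisym degree_le le_degree) (auto simp: coeff_P_at)

lemma lead_coeff_P_at: "lead_coeff (P_at n a) = 1" 
  by (simp add: coeff_P_at)

lemma P_at_nonzero [simp]: "P_at n a \<noteq> 0"
  using lead_coeff_P_at[of n a] by auto

lemma eval_R:
  assumes "n > 0" shows "eval_mpoly a (R n) = resultant (P_at n a) (pderiv (P_at n a))"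
proof -
  have mp: "map_poly (eval_mpoly a) (pderiv f) = pderiv (map_poly (eval_mpoly a) f)" for f
    by (rule poly_eqI) (simp add: coeff_pderiv ev.coeff_map_poly_hom ev.hom_mult ev.hom_add flip: of_nat_Suc)
  have "degree (map_poly (eval_mpoly a) (P n)) = degree (P n)"
    using degree_P_at[of n a] by (simp add: degree_P P_at_def)
  moreover have "degree (map_poly (eval_mpoly a) (pderiv (P n))) = degree (pderiv (P n))"
    unfolding mp using calculation by (simp add: degree_pderiv)
  ultimately show ?thesis
    unfolding R_def P_at_def mp[symmetric] by (rule ev.resultant_map_poly[symmetric])
qed

section \<open>The double discriminant in terms of critical values\<close>

locale discriminant_params =
  fixes n k :: nat
  assumes n2: "2 \<le> n" and k1: "1 \<le> k" and kn: "k \<le> n"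
begin

definition e where "e = n - k"
text \<open>The number of critical points with multiplicity, which is also the degree of
  \<open>R n\<close> in the variable of index \<open>k\<close>.\<close>

definition \<nu> where "\<nu> = (if k = n then n - 1 else n)"
text \<open>For \<open>k < n\<close> and \<open>a n = 0\<close> the point 0 would be a zero of
  \<open>crit\<close> at which \<open>P / x ^ e\<close> is not defined.\<close>

definition ok :: "(nat \<Rightarrow> complex) \<Rightarrow> bool" where "ok a \<longleftrightarrow> k = n \<or> a n \<noteq> 0"

abbreviation "N a \<equiv> crit e (P_at n a)"
abbreviation "cva a \<equiv> cv e (P_at n a)"
abbreviation "roots_of a y \<equiv> N a = Polynomial.smult (of_nat k) (\<Prod>i<\<nu>. [:- y i, 1:])"

lemma e_0_iff: "e = 0 \<longleftrightarrow> k = n" using kn by (auto simp: e_def)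

lemma nu_pos: "\<nu> > 0" using n2 by (auto simp: \<nu>_def)

lemma degree_crit: "degree (N a) = \<nu>" and lead_coeff_crit: "lead_coeff (N a) = of_nat k"
proof -
  have 1: "coeff (N a) \<nu> = of_nat k"
    using kn k1 n2 by (auto simp: coeff_crit e_0_iff coeff_P_at \<nu>_def e_def of_nat_diff)
  have "coeff (N a) i = 0" if "i > \<nu>" for i
    using that by (auto simp: coeff_crit e_0_iff coeff_P_at \<nu>_def)
  then show "degree (N a) = \<nu>" 
    using 1 k1 by (intro antisym degree_le le_degree) auto
  then show "lead_coeff (N a) = of_nat k" using 1 by simp
qed

lemma roots_exist: obtains y where "roots_of a y"
proof -
  obtain y where "N a = Polynomial.smult (lead_coeff (N a)) (\<Prod>i<degree (N a). [:- y i, 1:])"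
    by (rule complex_poly_factor)
  from that[OF this[unfolded lead_coeff_crit, unfolded degree_crit]] show ?thesis .
qed

lemma P_at_upd: "P_at n (a(k := z)) = P_at n a + monom (z - a k) e"
  by (rule poly_eqI) (use kn k1 in \<open>auto simp: coeff_P_at coeff_monom e_def\<close>)

lemma crit_upd: "N (a(k := z)) = N a"
proof (rule poly_eqI)
  fix i
  show "coeff (N (a(k := z))) i = coeff (N a) i"
    unfolding coeff_crit P_at_upd by (auto simp: coeff_monom)
qed

lemma poly_crit_root: "roots_of a y \<Longrightarrow> i < \<nu> \<Longrightarrow> poly (N a) (y i) = 0"
  by (auto simp: poly_prod)

lemma root_nonzero: assumes "poly (N a) x = 0" "ok a" shows "e = 0 \<or> x \<noteq> 0"
proof (rule ccontr)
  assume *: "\<not> (e = 0 \<or> x \<noteq> 0)"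
  then have "poly (N a) x = coeff (N a) 0" by (simp add: poly_0_coeff_0)
  also have "\<dots> = - of_nat e * a n" using * n2 by (simp add: coeff_crit coeff_P_at)
  finally show False using assms * by (simp add: ok_def e_0_iff)
qed

lemma cv_upd: assumes "e = 0 \<or> x \<noteq> 0" shows "cva (a(k := z)) x = cva a x + (z - a k)"
  using assms unfolding cv_def P_at_upd by (auto simp: poly_monom add_divide_distrib)

text \<open>The resultant is the product of the derivative over the roots of P, and for
  \<open>e > 0\<close> multiplication by x turns the derivative into \<open>crit\<close> there.
  Exchanging the two polynomials gives the product of P over the critical points, that is, of the
  critical values times \<open>y ^ e\<close>. Both products of roots are multiples of
  \<open>a n\<close> by Vieta, and the balance is the power \<open>e - 1\<close>.\<close>

lemma eval_R_crit:
  "\<exists>K. K \<noteq> 0 \<and> (\<forall>a y. ok a \<longrightarrow> roots_of a y \<longrightarrow> eval_mpoly a (R n) = K * a n ^ (e - 1) * (\<Prod>j<\<nu>. cva a (y j)))"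
proof -
  have n0: "n > 0" using n2 by simp
  \<comment> \<open>By Vieta the product of the critical points is
    \<open>(-1) ^ n * (- of_nat e / of_nat k) * a n\<close> for \<open>e > 0\<close>; its power
    \<open>e\<close> contributes this constant.\<close>
  define K1 :: complex where "K1 = (if e = 0 then 1 else ((-1) ^ n * (- of_nat e / of_nat k)) ^ e)"
  define K where "K = of_nat k ^ n * K1"
  have "K \<noteq> 0" using k1 by (auto simp: K_def K1_def)
  moreover have "eval_mpoly a (R n) = K * a n ^ (e - 1) * (\<Prod>j<\<nu>. cva a (y j))" if ok: "ok a" and y: "roots_of a y" for a y
  proof -
    let ?p = "P_at n a"
    obtain \<alpha> where "?p = Polynomial.smult (lead_coeff ?p) (\<Prod>i<degree ?p. [:- \<alpha> i, 1:])"
      by (rule complex_poly_factor)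
    note \<alpha> = this[unfolded lead_coeff_P_at, unfolded degree_P_at]
    have pa: "poly ?p (\<alpha> i) = 0" if "i < n" for i using that by (subst \<alpha>) (auto simp: poly_prod)
    have "pderiv ?p \<noteq> 0" using n0 by (simp add: pderiv_eq_0_iff)
    from resultant_roots[OF \<alpha> _ this] 
    have R: "eval_mpoly a (R n) = (\<Prod>i<n. poly (pderiv ?p) (\<alpha> i))" by (simp add: eval_R[OF n0])
    from root_product_swap[OF \<alpha> y]
    have S: "(\<Prod>i<n. poly (N a) (\<alpha> i)) = (-1) ^ (n * \<nu>) * (of_nat k ^ n * (\<Prod>j<\<nu>. poly ?p (y j)))" by simp
    have cvp: "poly ?p (y j) = y j ^ e * cva a (y j)" if "j < \<nu>" for j
      using root_nonzero[OF poly_crit_root[OF y that] ok] by (auto simp: cv_def)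
    then have prod: "(\<Prod>j<\<nu>. poly ?p (y j)) = (\<Prod>j<\<nu>. y j) ^ e * (\<Prod>j<\<nu>. cva a (y j))"
      by (simp add: prod.distrib prod_power_distrib)
    show ?thesis
    proof (cases "e = 0")
      case True
      have "even (n * \<nu>)" using n0 True unfolding \<nu>_def by (simp add: e_0_iff)
      moreover have "poly (N a) (\<alpha> i) = poly (pderiv ?p) (\<alpha> i)" for i by (simp add: crit_def True)
      ultimately show ?thesis using S R prod by (simp add: True K_def K1_def)
    next
      case False
      then have \<nu>n: "\<nu> = n" by (auto simp: \<nu>_def e_0_iff)
      have an: "a n \<noteq> 0" using ok False by (simp add: ok_def e_0_iff)
      have "(\<Prod>i<n. poly (N a) (\<alpha> i)) = (\<Prod>i<n. \<alpha> i) * (\<Prod>i<n. poly (pderiv ?p) (\<alpha> i))"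
        by (simp add: crit_def False pa prod.distrib)
      moreover have "(\<Prod>i<n. \<alpha> i) = (-1) ^ n * a n"
      proof -
        have "a n = poly ?p 0" using n0 by (simp add: poly_0_coeff_0 coeff_P_at)
        also have "\<dots> = (\<Prod>i<n. (-1) * \<alpha> i)" by (subst \<alpha>) (simp add: poly_prod)
        also have "\<dots> = (-1) ^ n * (\<Prod>i<n. \<alpha> i)" by (simp only: prod.distrib) simp
        finally show ?thesis by (simp add: neg_one_power_cancel)
      qed
      moreover
      have Y: "(\<Prod>j<\<nu>. y j) = (-1) ^ n * (- of_nat e / of_nat k) * a n"
      proof -
        have "- of_nat e * a n = poly (N a) 0" using n0 False by (simp add: poly_0_coeff_0 coeff_crit coeff_P_at)
        also have "\<dots> = of_nat k * (\<Prod>i<n. (-1) * y i)" by (subst y) (simp add: poly_prod \<nu>n)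
        also have "\<dots> = of_nat k * ((-1) ^ n * (\<Prod>i<n. y i))" by (simp only: prod.distrib) simp
        finally have "(-1) ^ n * (\<Prod>i<n. y i) = - of_nat e / of_nat k * a n" using k1 by (simp add: field_simps)
        then have "(-1) ^ n * ((-1) ^ n * (\<Prod>i<n. y i)) = (-1) ^ n * (- of_nat e / of_nat k * a n)" by simp
        then show ?thesis by (simp only: neg_one_power_cancel \<nu>n mult.assoc)
      qed
      ultimately have "(-1) ^ n * a n * eval_mpoly a (R n) = (\<Prod>i<n. poly (N a) (\<alpha> i))"
        using R by simp
      also have "\<dots> = (-1) ^ (n * n) * (of_nat k ^ n * (\<Prod>j<\<nu>. poly ?p (y j)))" using S \<nu>n by simp
      also have "(\<Prod>j<\<nu>. poly ?p (y j)) = K1 * a n ^ e * (\<Prod>j<\<nu>. cva a (y j))"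
        unfolding prod Y K1_def if_not_P[OF False]
          power_mult_distrib[of "(-1) ^ n * (- of_nat e / of_nat k)" "a n"] ..
      finally have "(-1) ^ n * a n * eval_mpoly a (R n) =
        (-1) ^ (n * n) * (of_nat k ^ n * (K1 * a n ^ e * (\<Prod>j<\<nu>. cva a (y j))))" .
      moreover have "(-1::complex) ^ (n * n) = (-1) ^ n" by (simp add: minus_one_power_iff)
      moreover have "a n ^ e = a n * a n ^ (e - 1)" using False by (simp add: power_eq_if)
      ultimately show ?thesis using an by (simp add: K_def mult_ac)
    qed
  qed
  ultimately show ?thesis by blast
qed

lemma as_univariate_R:
  "\<exists>K. K \<noteq> 0 \<and> (\<forall>a y. ok a \<longrightarrow> roots_of a y \<longrightarrow> map_poly (eval_mpoly a) (as_univariate k (R n)) =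
     Polynomial.smult (K * a n ^ (e - 1)) (\<Prod>j<\<nu>. [:- (a k - cva a (y j)), 1:]))"
proof -
  obtain K where K: "K \<noteq> 0" "\<And>a y. ok a \<Longrightarrow> roots_of a y \<Longrightarrow> eval_mpoly a (R n) = K * a n ^ (e - 1) * (\<Prod>j<\<nu>. cva a (y j))"
    using eval_R_crit by metis
  have "map_poly (eval_mpoly a) (as_univariate k (R n)) =
     Polynomial.smult (K * a n ^ (e - 1)) (\<Prod>j<\<nu>. [:- (a k - cva a (y j)), 1:])" if ok: "ok a" and y: "roots_of a y" for a y
  proof (rule poly_eq_poly_eq_iff[THEN iffD1], rule ext)
    fix z
    let ?a = "a(k := z)"
    have ok': "ok ?a" using ok by (auto simp: ok_def)
    have y': "roots_of ?a y" using y by (simp only: crit_upd)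
    \<comment> \<open>For \<open>k = n\<close> the update changes \<open>a n\<close> itself, but
      then the exponent is 0.\<close>
    have an: "?a n ^ (e - 1) = a n ^ (e - 1)" 
    proof (cases "k = n")
      case True
      then have "e = 0" using e_0_iff by simp
      then show ?thesis by simp
    qed simp
    have "poly (map_poly (eval_mpoly a) (as_univariate k (R n))) z = K * a n ^ (e - 1) * (\<Prod>j<\<nu>. cva ?a (y j))"
      unfolding poly_as_univariate K(2)[OF ok' y'] an ..
    also have "(\<Prod>j<\<nu>. cva ?a (y j)) = (\<Prod>j<\<nu>. z - (a k - cva a (y j)))"
      using root_nonzero[OF poly_crit_root[OF y] ok] by (intro prod.cong) (auto simp: cv_upd)
    finally show "poly (map_poly (eval_mpoly a) (as_univariate k (R n))) z = 
       poly (Polynomial.smult (K * a n ^ (e - 1)) (\<Prod>j<\<nu>. [:- (a k - cva a (y j)), 1:])) z"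
      by (simp add: poly_prod algebra_simps)
  qed
  then show ?thesis using K(1) by blast
qed

text \<open>The power of \<open>a n\<close> stems from the leading coefficient
  \<open>K * a n ^ (e - 1)\<close> of \<open>R n\<close> in the variable of index \<open>k\<close>,
  which enters the resultant with the derivative to the power \<open>2 * \<nu> - 1\<close>.\<close>

theorem eval_D_tilde:
  "\<exists>C. C \<noteq> 0 \<and> (\<forall>a y. ok a \<longrightarrow> roots_of a y \<longrightarrow> eval_mpoly a (D_tilde n k) = 
     C * a n ^ ((e - 1) * (2 * \<nu> - 1)) * (\<Prod>i<\<nu>. \<Prod>j\<in>{..<\<nu>}-{i}. cva a (y j) - cva a (y i)))"
proof -
  let ?U = "as_univariate k (R n)"
  obtain K where K: "K \<noteq> 0" "\<And>a y. ok a \<Longrightarrow> roots_of a y \<Longrightarrow> map_poly (eval_mpoly a) ?U =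
     Polynomial.smult (K * a n ^ (e - 1)) (\<Prod>j<\<nu>. [:- (a k - cva a (y j)), 1:])"
    using as_univariate_R by metis
  have lc0: "K * a n ^ (e - 1) \<noteq> 0" if "ok a" for a using that K(1) by (auto simp: ok_def e_def)
  have deg: "degree (map_poly (eval_mpoly a) ?U) = \<nu>" if "ok a" for a
    using roots_exist[of a] K(2)[OF that] lc0[OF that] by (metis degree_prod_linear degree_smult_eq)
  \<comment> \<open>Evaluation commutes with the resultant only if the degree is kept. A leading
    coefficient in degree above \<nu> would vanish at all points with \<open>ok\<close> and hence,
    after multiplication by \<open>Var n\<close> if \<open>k < n\<close>, everywhere.\<close>
  have dU: "degree ?U = \<nu>"
  proof (rule antisym)
    show "degree ?U \<le> \<nu>"
    proof (rule ccontr)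
      assume *: "\<not> degree ?U \<le> \<nu>"
      have "eval_mpoly a (lead_coeff ?U * (if k = n then 1 else Var n)) = 0" for a
      proof (cases "ok a")
        case True
        have "coeff (map_poly (eval_mpoly a) ?U) (degree ?U) = 0"
          by (rule coeff_eq_0) (use deg[OF True] * in simp)
        then show ?thesis by (simp add: ev.coeff_map_poly_hom ev.hom_mult)
      qed (auto simp: ok_def ev.hom_mult)
      then have "lead_coeff ?U * (if k = n then 1 else Var n) = 0" by (intro mpoly_eqI) simp
      moreover have "Var n \<noteq> 0" by (rule Var_nonzero)
      ultimately have "lead_coeff ?U = 0" by (auto split: if_splits)
      then show False using * by simp
    qed
    have "ok (\<lambda>_. 1)" by (simp add: ok_def)
    from deg[OF this] show "\<nu> \<le> degree ?U" by (metis degree_map_poly_le)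
  qed
  define C where "C = K ^ (2 * \<nu> - 1)"
  have "C \<noteq> 0" using K(1) by (simp add: C_def)
  moreover have "eval_mpoly a (D_tilde n k) = C * a n ^ ((e - 1) * (2 * \<nu> - 1)) *
      (\<Prod>i<\<nu>. \<Prod>j\<in>{..<\<nu>}-{i}. cva a (y j) - cva a (y i))" if ok: "ok a" and y: "roots_of a y" for a y
  proof -
    have mp: "map_poly (eval_mpoly a) (pderiv f) = pderiv (map_poly (eval_mpoly a) f)" for f
      by (rule poly_eqI) (simp add: coeff_pderiv ev.coeff_map_poly_hom ev.hom_mult ev.hom_add flip: of_nat_Suc)
    have "eval_mpoly a (D_tilde n k) = resultant (map_poly (eval_mpoly a) ?U) (map_poly (eval_mpoly a) (pderiv ?U))"
      unfolding D_tilde_def as_univariate_partial_deriv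
    proof (rule ev.resultant_map_poly[symmetric])
      show "degree (map_poly (eval_mpoly a) ?U) = degree ?U" using deg[OF ok] dU by simp
      then show "degree (map_poly (eval_mpoly a) (pderiv ?U)) = degree (pderiv ?U)"
        unfolding mp by (simp add: degree_pderiv)
    qed
    also have "\<dots> = (K * a n ^ (e - 1)) ^ (2 * \<nu> - 1) *
        (\<Prod>i<\<nu>. \<Prod>j\<in>{..<\<nu>}-{i}. (a k - cva a (y i)) - (a k - cva a (y j)))"
      unfolding mp by (rule resultant_pderiv[OF K(2)[OF ok y] lc0[OF ok] nu_pos])
    finally show ?thesis by (simp add: C_def power_mult_distrib power_mult)
  qed
  ultimately show ?thesis by blast
qed

end

subsection \<open>Convergence of polynomials and of their roots\<close>

text \<open>Convergence of the coefficients; wherever values are compared it is combined with a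
  common bound on the degrees.\<close>

definition pconv :: "(nat \<Rightarrow> complex poly) \<Rightarrow> complex poly \<Rightarrow> bool" where
  "pconv f g \<longleftrightarrow> (\<forall>i. (\<lambda>l. coeff (f l) i) \<longlonglongrightarrow> coeff g i)"

lemma pconv_const: "pconv (\<lambda>_. g) g"
  by (simp add: pconv_def)

lemma pconv_add: "pconv f g \<Longrightarrow> pconv f' g' \<Longrightarrow> pconv (\<lambda>l. f l + f' l) (g + g')"
  by (simp add: pconv_def tendsto_add)

lemma pconv_diff: "pconv f g \<Longrightarrow> pconv f' g' \<Longrightarrow> pconv (\<lambda>l. f l - f' l) (g - g')"
  by (simp add: pconv_def tendsto_diff)

lemma pconv_smult: "c \<longlonglongrightarrow> c' \<Longrightarrow> pconv f g \<Longrightarrow> pconv (\<lambda>l. Polynomial.smult (c l) (f l)) (Polynomial.smult c' g)"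
  by (simp add: pconv_def tendsto_mult)

lemma pconv_mult: "pconv f g \<Longrightarrow> pconv f' g' \<Longrightarrow> pconv (\<lambda>l. f l * f' l) (g * g')"
  unfolding pconv_def coeff_mult by (intro allI tendsto_sum tendsto_mult) auto

lemma pconv_pCons: "c \<longlonglongrightarrow> c' \<Longrightarrow> pconv f g \<Longrightarrow> pconv (\<lambda>l. pCons (c l) (f l)) (pCons c' g)"
  unfolding pconv_def coeff_pCons by (auto split: nat.split)

lemma pconv_linear: "y \<longlonglongrightarrow> x \<Longrightarrow> pconv (\<lambda>l. [:y l, 1:]) [:x, 1:]"
  "y \<longlonglongrightarrow> x \<Longrightarrow> pconv (\<lambda>l. [:- y l, 1:]) [:- x, 1:]"
  by (intro pconv_pCons pconv_const; simp add: tendsto_minus)+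

lemma pconv_power: "pconv f g \<Longrightarrow> pconv (\<lambda>l. f l ^ i) (g ^ i)"
  by (induction i) (simp_all add: pconv_const pconv_mult)

lemma pconv_prod: "(\<And>i. i \<in> A \<Longrightarrow> pconv (f i) (g i)) \<Longrightarrow> pconv (\<lambda>l. \<Prod>i\<in>A. f i l) (\<Prod>i\<in>A. g i)"
  by (induction A rule: infinite_finite_induct) (simp_all add: pconv_const pconv_mult)

lemma pconv_sum: "(\<And>i. i \<in> A \<Longrightarrow> pconv (f i) (g i)) \<Longrightarrow> pconv (\<lambda>l. \<Sum>i\<in>A. f i l) (\<Sum>i\<in>A. g i)"
  by (induction A rule: infinite_finite_induct) (simp_all add: pconv_const pconv_add)

lemma pconv_pderiv: "pconv f g \<Longrightarrow> pconv (\<lambda>l. pderiv (f l)) (pderiv g)"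
  unfolding pconv_def coeff_pderiv by (intro allI tendsto_mult) auto

lemma pconv_crit: "pconv f g \<Longrightarrow> pconv (\<lambda>l. crit e (f l)) (crit e g)"
  unfolding crit_def by (intro pconv_diff pconv_mult pconv_smult pconv_const pconv_pderiv tendsto_const)

lemma pconv_subseq: "pconv f g \<Longrightarrow> strict_mono r \<Longrightarrow> pconv (\<lambda>l. f (r l)) g"
  unfolding pconv_def using LIMSEQ_subseq_LIMSEQ by (auto simp: o_def)

lemma poly_degree_le: fixes p :: "complex poly" 
  assumes "degree p \<le> D" shows "poly p x = (\<Sum>i\<le>D. coeff p i * x ^ i)"
  unfolding poly_altdef by (rule sum.mono_neutral_left) (use assms le_degree in auto)

lemma pconv_degree_le: assumes "pconv f g" "\<And>l. degree (f l) \<le> D" shows "degree g \<le> D"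
proof (rule degree_le, intro allI impI)
  fix i assume "i > D"
  then have "coeff (f l) i = 0" for l using assms(2)[of l] by (simp add: coeff_eq_0)
  moreover have "(\<lambda>l. coeff (f l) i) \<longlonglongrightarrow> coeff g i" using assms(1) by (simp add: pconv_def)
  ultimately show "coeff g i = 0" by (simp add: LIMSEQ_const_iff)
qed

lemma tendsto_poly_pconv:
  assumes "pconv f g" "\<And>l. degree (f l) \<le> D" "y \<longlonglongrightarrow> x"
  shows "(\<lambda>l. poly (f l) (y l)) \<longlonglongrightarrow> poly g x"
  unfolding poly_degree_le[OF assms(2)] poly_degree_le[OF pconv_degree_le[OF assms(1,2)]]
  using assms(1,3) unfolding pconv_def by (intro tendsto_intros) auto

lemma pconv_pcompose:
  assumes "pconv f g" "\<And>l. degree (f l) \<le> D" "y \<longlonglongrightarrow> x"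
  shows "pconv (\<lambda>l. pcompose (f l) [:y l, 1:]) (pcompose g [:x, 1:])"
proof -
  have eq: "pcompose p q = (\<Sum>i\<le>D. Polynomial.smult (coeff p i) (q ^ i))" if "degree p \<le> D" for p q :: "complex poly"
  proof (rule poly_eq_poly_eq_iff[THEN iffD1], rule ext)
    show "poly (pcompose p q) z = poly (\<Sum>i\<le>D. Polynomial.smult (coeff p i) (q ^ i)) z" for z
      by (simp add: poly_pcompose poly_sum poly_degree_le[OF that])
  qed
  show ?thesis
    unfolding eq[OF assms(2)] eq[OF pconv_degree_le[OF assms(1,2)]]
    using assms(1,3) unfolding pconv_def[of f]
    by (intro pconv_sum pconv_smult pconv_power pconv_linear) auto
qed

text \<open>Cauchy's bound. It depends only on the coefficients, so that along a convergent sequence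
  with fixed degree and leading coefficient all roots stay bounded.\<close>

lemma root_bound:
  fixes f :: "complex poly"
  assumes "degree f = m" "lead_coeff f = c" "c \<noteq> 0" "m > 0" "poly f y = 0"
  shows "norm y \<le> 1 + (\<Sum>i<m. norm (coeff f i)) / norm c"
proof (cases "norm y \<le> 1")
  case True
  then show ?thesis by (smt (verit) divide_nonneg_nonneg norm_ge_zero sum_nonneg)
next
  case False
  have "0 = (\<Sum>i\<le>m. coeff f i * y ^ i)" using assms(1,5) poly_degree_le[of f m y] by simp
  also have "\<dots> = (\<Sum>i<m. coeff f i * y ^ i) + c * y ^ m" using assms(1,2) by (simp add: lessThan_Suc_atMost[symmetric])
  finally have "c * y ^ m = - (\<Sum>i<m. coeff f i * y ^ i)"
    by (simp add: eq_neg_iff_add_eq_0 add.commute)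
  then have "norm (c * y ^ m) = norm (\<Sum>i<m. coeff f i * y ^ i)" by simp
  also have "\<dots> \<le> (\<Sum>i<m. norm (coeff f i) * norm y ^ (m - 1))"
  proof (rule order_trans[OF norm_sum sum_mono])
    fix i assume "i \<in> {..<m}"
    then have "norm y ^ i \<le> norm y ^ (m - 1)" using False by (intro power_increasing) auto
    then show "norm (coeff f i * y ^ i) \<le> norm (coeff f i) * norm y ^ (m - 1)"
      by (simp add: norm_mult norm_power mult_left_mono)
  qed
  also have "\<dots> = (\<Sum>i<m. norm (coeff f i)) * norm y ^ (m - 1)" by (simp add: sum_distrib_right)
  finally have *: "norm (c * y ^ m) \<le> (\<Sum>i<m. norm (coeff f i)) * norm y ^ (m - 1)" .
  have "norm c * norm y * norm y ^ (m - 1) \<le> (\<Sum>i<m. norm (coeff f i)) * norm y ^ (m - 1)"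
  proof -
    have "norm y ^ m = norm y * norm y ^ (m - 1)" using assms(4) by (cases m) simp_all
    with * show ?thesis by (simp add: norm_mult norm_power mult.assoc)
  qed
  moreover have "norm y ^ (m - 1) > 0" using False by (intro zero_less_power) linarith
  ultimately have "norm c * norm y \<le> (\<Sum>i<m. norm (coeff f i))" by simp
  then have "norm y \<le> (\<Sum>i<m. norm (coeff f i)) / norm c" using assms(3) by (simp add: field_simps)
  then show ?thesis by simp
qed

lemma common_subsequence:
  fixes ys :: "nat \<Rightarrow> nat \<Rightarrow> complex"
  assumes "\<And>i. i < m \<Longrightarrow> bounded (range (\<lambda>l. ys l i))"
  shows "\<exists>r y. strict_mono (r :: nat \<Rightarrow> nat) \<and> (\<forall>i<m. (\<lambda>l. ys (r l) i) \<longlonglongrightarrow> y i)"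
  using assms
proof (induction m)
  case 0
  show ?case by (intro exI[of _ id]) (auto simp: strict_mono_def)
next
  case (Suc m)
  then obtain r y where r: "strict_mono r" "\<And>i. i < m \<Longrightarrow> (\<lambda>l. ys (r l) i) \<longlonglongrightarrow> y i" by (metis less_SucI)
  have "bounded (range (\<lambda>l. ys (r l) m))"
    by (rule bounded_subset[OF Suc.prems[of m]]) auto
  then obtain z r' where r': "strict_mono r'" "((\<lambda>l. ys (r l) m) \<circ> r') \<longlonglongrightarrow> z"
    using bounded_imp_convergent_subsequence by metis
  have "(\<lambda>l. ys ((r \<circ> r') l) i) \<longlonglongrightarrow> (y(m := z)) i" if "i < Suc m" for i
    using that r' LIMSEQ_subseq_LIMSEQ[OF r(2) r'(1), of i] by (auto simp: o_def less_Suc_eq)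
  then show ?case using strict_mono_o[OF r(1) r'(1)] by blast
qed

theorem root_subsequence:
  assumes f: "pconv f g" "\<And>l. f l = Polynomial.smult c (\<Prod>i<(m::nat). [:- ys l i, 1:])" and c: "c \<noteq> 0"
  obtains r y where "strict_mono (r :: nat \<Rightarrow> nat)" "\<And>i. i < m \<Longrightarrow> (\<lambda>l. ys (r l) i) \<longlonglongrightarrow> y i"
    "g = Polynomial.smult c (\<Prod>i<m. [:- y i, 1:])"
proof -
  have df: "degree (f l) = m" for l by (simp add: f(2) prod_linear_simps c)
  have lf: "lead_coeff (f l) = c" for l unfolding f(2) lead_coeff_smult lead_coeff_prod_linear by simp
  have "bounded (range (\<lambda>l. ys l i))" if "i < m" for i
  proof -
    have "(\<lambda>l. 1 + (\<Sum>i<m. norm (coeff (f l) i)) / norm c) \<longlonglongrightarrow> 1 + (\<Sum>i<m. norm (coeff g i)) / norm c"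
      using f(1) unfolding pconv_def by (intro tendsto_intros) (use c in auto)
    from convergent_imp_Bseq[OF convergentI[OF this]]
    obtain B where B: "\<And>l. norm (1 + (\<Sum>i<m. norm (coeff (f l) i)) / norm c) \<le> B"
      unfolding Bseq_def by blast
    have "norm (ys l i) \<le> B" for l
    proof -
      have "poly (f l) (ys l i) = 0" using that by (auto simp: f(2) poly_prod)
      from root_bound[OF df lf c _ this] that
      have "norm (ys l i) \<le> 1 + (\<Sum>i<m. norm (coeff (f l) i)) / norm c" by auto
      also have "\<dots> \<le> norm \<dots>" by simp
      finally show ?thesis using B[of l] by linarith
    qed
    then show ?thesis by (auto simp: bounded_iff)
  qed
  from common_subsequence[of m ys, OF this] obtain r y where r: "strict_mono r" "\<And>i. i < m \<Longrightarrow> (\<lambda>l. ys (r l) i) \<longlonglongrightarrow> y i" by blast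
  have "pconv (\<lambda>l. f (r l)) (Polynomial.smult c (\<Prod>i<m. [:- y i, 1:]))"
    unfolding f(2) using r(2) by (intro pconv_smult pconv_prod pconv_linear) auto
  with pconv_subseq[OF f(1) r(1)] have "g = Polynomial.smult c (\<Prod>i<m. [:- y i, 1:])"
    unfolding pconv_def by (intro poly_eqI) (metis LIMSEQ_unique)
  with r show ?thesis by (rule that)
qed

lemma roots_permutation:
  assumes "(\<Prod>i<(m::nat). [:- y i, 1:]) = (\<Prod>i<m. [:- z i, 1 :: complex:])"
  obtains q where "q permutes {..<m}" "\<And>i. i < m \<Longrightarrow> y i = z (q i)"
proof -
  have "proots (\<Prod>i<m. [:- y i, 1 :: complex:]) = image_mset y (mset_set {..<m})" for y and m :: nat
  proof (induction m)
    case (Suc m)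
    have "proots ((\<Prod>i<m. [:- y i, 1:]) * [:- y m, 1:]) = proots (\<Prod>i<m. [:- y i, 1:]) + proots [:- y m, 1:]"
      by (rule proots_mult) auto
    also have "\<dots> = image_mset y (mset_set {..<Suc m})"
      unfolding proots_linear_factor Suc by (simp add: lessThan_Suc)
    finally show ?case by (simp only: prod.lessThan_Suc)
  qed simp
  with assms have "image_mset y (mset_set {..<m}) = image_mset z (mset_set {..<m})" by metis
  then obtain q where "q permutes {..<m}" "\<forall>i\<in>{..<m}. y i = z (q i)"
    using image_mset_eq_implies_permutes[of "{..<m}" y z] by auto
  then show ?thesis using that by auto
qed

text \<open>The limits supplied by compactness are the roots of \<open>g\<close> in some order; one
  permutation of the indices, the same for all \<open>l\<close>, turns this order into the
  prescribed one.\<close>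

theorem root_subsequence_to:
  assumes f: "pconv f g" "\<And>l. degree (f l) = m" "\<And>l. lead_coeff (f l) = c" and c: "c \<noteq> 0"
    and g: "g = Polynomial.smult c (\<Prod>i<m. [:- y i, 1:])"
  obtains r ys where "strict_mono (r :: nat \<Rightarrow> nat)" "\<And>l. f (r l) = Polynomial.smult c (\<Prod>i<m. [:- ys l i, 1:])"
    "\<And>i. i < m \<Longrightarrow> (\<lambda>l. ys l i) \<longlonglongrightarrow> y i"
proof -
  have "\<forall>l. \<exists>z. f l = Polynomial.smult c (\<Prod>i<m. [:- z i, 1:])"
  proof
    fix l
    obtain z where "f l = Polynomial.smult (lead_coeff (f l)) (\<Prod>i<degree (f l). [:- z i, 1:])"
      by (rule complex_poly_factor)
    from this[unfolded f(3), unfolded f(2)] show "\<exists>z. f l = Polynomial.smult c (\<Prod>i<m. [:- z i, 1:])" by blast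
  qed
  then obtain zs where zs0: "\<forall>l. f l = Polynomial.smult c (\<Prod>i<m. [:- zs l i, 1:])" by (rule choice[THEN exE])
  note zs = zs0[rule_format]
  from root_subsequence[OF f(1) zs c] obtain r x where r: "strict_mono r" 
     "\<And>i. i < m \<Longrightarrow> (\<lambda>l. zs (r l) i) \<longlonglongrightarrow> x i" and x: "g = Polynomial.smult c (\<Prod>i<m. [:- x i, 1:])" by blast
  have "(\<Prod>i<m. [:- y i, 1:]) = (\<Prod>i<m. [:- x i, 1:])"
    using arg_cong[OF g[unfolded x], of "Polynomial.smult (1 / c)"] c by simp
  then obtain q where q: "q permutes {..<m}" "\<And>i. i < m \<Longrightarrow> y i = x (q i)" by (rule roots_permutation) blast
  define ys where "ys l i = zs (r l) (q i)" for l i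
  have "f (r l) = Polynomial.smult c (\<Prod>i<m. [:- ys l i, 1:])" for l
    unfolding zs[of "r l"] ys_def using prod.permute[OF q(1), of "\<lambda>i. [:- zs (r l) i, 1:]"] by (simp add: o_def)
  moreover have "(\<lambda>l. ys l i) \<longlonglongrightarrow> y i" if "i < m" for i
    unfolding ys_def q(2)[OF that] using r(2)[of "q i"] permutes_in_image[OF q(1), of i] that by auto
  ultimately show ?thesis using r(1) that by blast
qed

text \<open>Near 0 a polynomial behaves like a nonzero multiple of \<open>s\<close> to the power of
  its order, so that one sequence of nonzero parameters tending to 0 determines the
  comparison.\<close>

lemma order_limit:
  fixes q :: "complex poly"
  assumes q: "q \<noteq> 0" and s: "\<And>l. s l \<noteq> 0" "s \<longlonglongrightarrow> 0" and lim: "(\<lambda>l. poly q (s l) / s l ^ m) \<longlonglongrightarrow> L"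
  shows "m \<le> order 0 q" "L \<noteq> 0 \<Longrightarrow> order 0 q = m"
proof -
  define r where "r = order 0 q"
  obtain q' where q': "q = [:- 0, 1:] ^ r * q'" "\<not> [:- 0, 1:] dvd q'" using order_decomp[OF q, of 0] r_def by blast
  have q0: "poly q' 0 \<noteq> 0" using q'(2) by (simp add: poly_eq_0_iff_dvd)
  have ps: "poly q (s l) = s l ^ r * poly q' (s l)" for l using arg_cong[OF q'(1), of "\<lambda>f. poly f (s l)"] by simp
  have lim': "(\<lambda>l. poly q' (s l)) \<longlonglongrightarrow> poly q' 0" by (intro tendsto_poly s(2))
  show "m \<le> order 0 q"
  proof (rule ccontr)
    assume "\<not> m \<le> order 0 q"
    then have lt: "r < m" by (simp add: r_def)
    have "(\<lambda>l. poly q (s l) / s l ^ m * s l ^ (m - r)) \<longlonglongrightarrow> L * 0 ^ (m - r)"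
      by (intro tendsto_mult lim tendsto_power s(2))
    moreover have "poly q (s l) / s l ^ m * s l ^ (m - r) = poly q' (s l)" for l
    proof -
      have "s l ^ m = s l ^ r * s l ^ (m - r)" using lt by (simp flip: power_add)
      then show ?thesis using s(1)[of l] by (simp add: ps)
    qed
    ultimately show False using LIMSEQ_unique[OF lim'] q0 lt by simp
  qed
  then have le: "m \<le> r" by (simp add: r_def)
  assume L: "L \<noteq> 0"
  have "poly q (s l) / s l ^ m = s l ^ (r - m) * poly q' (s l)" for l
  proof -
    have "s l ^ r = s l ^ m * s l ^ (r - m)" using le by (simp flip: power_add)
    then show ?thesis using s(1)[of l] by (simp add: ps)
  qed
  moreover have "(\<lambda>l. s l ^ (r - m) * poly q' (s l)) \<longlonglongrightarrow> 0 ^ (r - m) * poly q' 0"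
    by (intro tendsto_mult lim' tendsto_power s(2))
  ultimately have "L = 0 ^ (r - m) * poly q' 0" using LIMSEQ_unique[OF lim] by simp
  then show "order 0 q = m" using L le by (cases "r = m") (auto simp: r_def)
qed

subsection \<open>Critical values under perturbation\<close>

abbreviation "Xe e \<equiv> (if e = 0 then 1 else [:0, 1:] :: complex poly)"

lemma crit_mult: "crit e (f * g) = Xe e * pderiv f * g + f * crit e g"
  by (simp add: crit_def pderiv_mult algebra_simps)

lemma crit_add: "crit e (f + g) = crit e f + crit e g"
  by (simp add: crit_def pderiv_add smult_add_right algebra_simps)

lemma crit_smult: "crit e (Polynomial.smult c f) = Polynomial.smult c (crit e f)"
  by (simp add: crit_def pderiv_smult smult_diff_right algebra_simps)

lemma poly_crit: "poly (crit e p) y = (if e = 0 then 1 else y) * poly (pderiv p) y - of_nat e * poly p y"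
  by (simp add: crit_def)

lemma degree_crit_le: "degree p \<le> D \<Longrightarrow> degree (crit e p) \<le> D"
  by (intro degree_le) (auto simp: coeff_crit coeff_eq_0)

text \<open>Up to a factor, the left-hand side is the numerator of the difference between
  \<open>p / x ^ e\<close> and its value at \<open>y\<close>, which vanishes to order two at a
  critical point.\<close>

lemma critical_cross_difference:
  assumes "poly (crit e p) y = 0" "e = 0 \<or> y \<noteq> 0"
  obtains \<psi> where "Polynomial.smult (y ^ e) p - monom (poly p y) e = [:- y, 1:] ^ 2 * \<psi>"
proof -
  let ?f = "Polynomial.smult (y ^ e) p - monom (poly p y) e"
  have 0: "poly ?f y = 0" by (simp add: poly_monom)
  have 1: "poly (pderiv ?f) y = 0"
  proof (cases "e = 0")
    case True
    then show ?thesis using assms(1) by (simp add: poly_crit pderiv_diff pderiv_smult pderiv_monom)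
  next
    case False
    then have "y ^ e = y * y ^ (e - 1)" by (cases e) simp_all
    then have "y * poly (pderiv ?f) y = y ^ e * poly (crit e p) y"
      using False by (simp add: poly_crit pderiv_diff pderiv_smult pderiv_monom poly_monom algebra_simps)
    then show ?thesis using assms False by simp
  qed
  show ?thesis
  proof (cases "?f = 0")
    case True
    then show ?thesis by (intro that[of 0]) simp
  next
    case False
    have "2 \<le> order y ?f"
    proof (cases "pderiv ?f = 0")
      case True
      then have "degree ?f = 0" by (simp add: pderiv_eq_0_iff)
      then obtain c where "?f = [:c:]" by (metis degree_0_id)
      then show ?thesis using 0 False by auto
    next
      case pd: False
      have "order y (pderiv ?f) \<noteq> 0" using 1 pd order_root[of "pderiv ?f" y] by blast
      with order_pderiv[OF False 0] show ?thesis by linarith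
    qed
    then have "[:- y, 1:] ^ 2 dvd ?f" using order_divides[of y 2 ?f] by blast
    then show ?thesis using that by (auto elim: dvdE)
  qed
qed

lemma simple_root_quotient:
  fixes f :: "complex poly"
  assumes "poly f y = 0"
  obtains h where "f = [:- y, 1:] * h" "poly h y = poly (pderiv f) y"
proof -
  obtain h where h: "f = [:- y, 1:] * h" using assms by (metis dvdE poly_eq_0_iff_dvd)
  have "poly (pderiv f) y = poly h y" unfolding h pderiv_mult by (simp add: pderiv_pCons)
  with h show ?thesis using that by simp
qed

text \<open>To first order a critical value changes by the value of the perturbation at the fixed
  point \<open>y\<close>: a simple critical point moves by O(s), and by
  \<open>critical_cross_difference\<close> its displacement affects the value only to second
  order.\<close>

theorem critical_value_speed:
  assumes p: "\<And>l. p' l = p + Polynomial.smult (s l) (\<delta> l)" "pconv \<delta> W" "\<And>l. degree (\<delta> l) \<le> D"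
    and s: "\<And>l. s l \<noteq> 0" "s \<longlonglongrightarrow> 0"
    and y: "ys \<longlonglongrightarrow> y" "\<And>l. poly (crit e (p' l)) (ys l) = 0" "poly (crit e p) y = 0" "poly (pderiv (crit e p)) y \<noteq> 0"
    and e: "e = 0 \<or> y \<noteq> 0"
  shows "(\<lambda>l. (cv e (p' l) (ys l) - cv e p y) / s l) \<longlonglongrightarrow> cv e W y"
proof -
  obtain h where h: "crit e p = [:- y, 1:] * h" "poly h y \<noteq> 0" using simple_root_quotient[OF y(3)] y(4) by metis
  obtain \<psi> where \<psi>: "Polynomial.smult (y ^ e) p - monom (poly p y) e = [:- y, 1:] ^ 2 * \<psi>"
    by (rule critical_cross_difference[OF y(3) e])
  have ye: "y ^ e \<noteq> 0" using e by auto
  have h_lim: "(\<lambda>l. poly h (ys l)) \<longlonglongrightarrow> poly h y" and \<psi>_lim: "(\<lambda>l. poly \<psi> (ys l)) \<longlonglongrightarrow> poly \<psi> y"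
    by (intro tendsto_poly y(1))+
  have ye_lim: "(\<lambda>l. ys l ^ e) \<longlonglongrightarrow> y ^ e" by (intro tendsto_power y(1))
  have \<delta>_lim: "(\<lambda>l. poly (\<delta> l) (ys l)) \<longlonglongrightarrow> poly W y" by (rule tendsto_poly_pconv[OF p(2,3) y(1)])
  have c_lim: "(\<lambda>l. poly (crit e (\<delta> l)) (ys l)) \<longlonglongrightarrow> poly (crit e W) y"
    by (rule tendsto_poly_pconv[OF pconv_crit[OF p(2)] degree_crit_le[OF p(3)] y(1)])
  have ev: "eventually (\<lambda>l. poly h (ys l) \<noteq> 0 \<and> ys l ^ e \<noteq> 0) sequentially"
    using tendsto_imp_eventually_ne[OF h_lim h(2)] tendsto_imp_eventually_ne[OF ye_lim ye] by eventually_elim auto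
  have move: "(ys l - y) * poly h (ys l) = - s l * poly (crit e (\<delta> l)) (ys l)" for l
    using y(2)[of l] unfolding p(1) crit_add crit_smult h(1) by (simp add: algebra_simps add_eq_0_iff)
  have main: "(cv e (p' l) (ys l) - cv e p y) / s l = poly (\<delta> l) (ys l) / ys l ^ e +
      - poly (crit e (\<delta> l)) (ys l) / poly h (ys l) * (ys l - y) * poly \<psi> (ys l) / (ys l ^ e * y ^ e)"
    if "poly h (ys l) \<noteq> 0" "ys l ^ e \<noteq> 0" for l
  proof -
    have "y ^ e * poly p (ys l) - poly p y * ys l ^ e = (ys l - y) ^ 2 * poly \<psi> (ys l)"
      using arg_cong[OF \<psi>, of "\<lambda>f. poly f (ys l)"] by (simp add: poly_monom)
    then have 1: "poly p (ys l) / ys l ^ e - poly p y / y ^ e = (ys l - y) ^ 2 * poly \<psi> (ys l) / (ys l ^ e * y ^ e)"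
      unfolding diff_frac_eq[OF that(2) ye] by (simp only: mult.commute)
    have "ys l - y = (ys l - y) * poly h (ys l) / poly h (ys l)" using that(1) by simp
    then have 2: "ys l - y = s l * (- poly (crit e (\<delta> l)) (ys l) / poly h (ys l))"
      unfolding move by simp
    have "cv e (p' l) (ys l) - cv e p y = s l * (poly (\<delta> l) (ys l) / ys l ^ e) + (poly p (ys l) / ys l ^ e - poly p y / y ^ e)"
      by (simp add: cv_def p(1) add_divide_distrib)
    also have "\<dots> = s l * (poly (\<delta> l) (ys l) / ys l ^ e +
       - poly (crit e (\<delta> l)) (ys l) / poly h (ys l) * (ys l - y) * poly \<psi> (ys l) / (ys l ^ e * y ^ e))"
      unfolding 1 power2_eq_square by (subst (1) 2) (simp add: distrib_left right_diff_distrib mult.assoc)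
    finally show ?thesis using s(1)[of l] by simp
  qed
  have "(\<lambda>l. poly (\<delta> l) (ys l) / ys l ^ e +
      - poly (crit e (\<delta> l)) (ys l) / poly h (ys l) * (ys l - y) * poly \<psi> (ys l) / (ys l ^ e * y ^ e))
     \<longlonglongrightarrow> poly W y / y ^ e + - poly (crit e W) y / poly h y * (y - y) * poly \<psi> y / (y ^ e * y ^ e)"
    by (intro tendsto_intros \<delta>_lim c_lim h_lim \<psi>_lim ye_lim y(1)) (use ye h(2) in auto)
  then have "(\<lambda>l. poly (\<delta> l) (ys l) / ys l ^ e +
      - poly (crit e (\<delta> l)) (ys l) / poly h (ys l) * (ys l - y) * poly \<psi> (ys l) / (ys l ^ e * y ^ e))
     \<longlonglongrightarrow> cv e W y" by (simp add: cv_def)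
  then show ?thesis
    by (rule Lim_transform_eventually, intro eventually_mono[OF ev]) (simp add: main)
qed

text \<open>Subtracting \<open>c l * x ^ e\<close> makes the critical value at \<open>ys l\<close>
  zero and preserves the critical points, so the polynomial shifted by \<open>ys l\<close> is
  \<open>x ^ 2 * \<Psi>\<close>. That \<open>zs l\<close> is critical too expresses
  \<open>2 * \<Psi>(h)\<close>, with \<open>h = zs l - ys l\<close>, as \<open>h\<close> times a
  quantity tending to \<open>- Q(u)\<close>, because \<Psi> tends to \<open>x * Q(x + u)\<close>.
  This gives the third power and the constant.\<close>

theorem merging_critical_values:
  assumes p: "pconv p' p" "\<And>l. degree (p' l) \<le> D" and pu: "p = [:- u, 1:] ^ 3 * Q" and e: "e = 0 \<or> u \<noteq> 0"
    and y: "ys \<longlonglongrightarrow> u" "zs \<longlonglongrightarrow> u" "\<And>l. [:- ys l, 1:] * [:- zs l, 1:] dvd crit e (p' l)"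
  obtains H where "H \<longlonglongrightarrow> - poly Q u / (2 * u ^ e)"
    "eventually (\<lambda>l. cv e (p' l) (zs l) - cv e (p' l) (ys l) = (zs l - ys l) ^ 3 * H l) sequentially"
proof -
  define c where "c l = cv e (p' l) (ys l)" for l
  define \<Phi> where "\<Phi> l = p' l - monom (c l) e" for l
  define T where "T l = pcompose (\<Phi> l) [:ys l, 1:]" for l
  define \<Psi> where "\<Psi> l = poly_shift 2 (T l)" for l
  define x where "x y = (if e = 0 then 1 else y)" for y :: complex
  define h where "h l = zs l - ys l" for l
  have xu: "x u \<noteq> 0" and ue: "u ^ e \<noteq> 0" using e by (auto simp: x_def)
  have x_lim: "(\<lambda>l. x (zs l)) \<longlonglongrightarrow> x u" "(\<lambda>l. x (ys l)) \<longlonglongrightarrow> x u" using y by (auto simp: x_def)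
  have pw_lim: "(\<lambda>l. zs l ^ e) \<longlonglongrightarrow> u ^ e" "(\<lambda>l. ys l ^ e) \<longlonglongrightarrow> u ^ e" by (intro tendsto_power y)+
  have ev: "eventually (\<lambda>l. x (zs l) \<noteq> 0 \<and> x (ys l) \<noteq> 0 \<and> zs l ^ e \<noteq> 0 \<and> ys l ^ e \<noteq> 0) sequentially"
    using tendsto_imp_eventually_ne[OF x_lim(1) xu] tendsto_imp_eventually_ne[OF x_lim(2) xu]
      tendsto_imp_eventually_ne[OF pw_lim(1) ue] tendsto_imp_eventually_ne[OF pw_lim(2) ue]
    by eventually_elim auto
  have "c \<longlonglongrightarrow> poly p u / u ^ e"
    unfolding c_def cv_def by (intro tendsto_divide tendsto_poly_pconv[OF p] pw_lim y ue)
  then have c_lim: "c \<longlonglongrightarrow> 0" by (simp add: pu)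
  have "pconv \<Phi> (p - monom 0 e)"
    unfolding \<Phi>_def
  proof (intro pconv_diff p, unfold pconv_def coeff_monom, intro allI)
    fix i
    show "(\<lambda>l. if e = i then c l else 0) \<longlonglongrightarrow> (if e = i then 0 else 0)"
      using c_lim by (cases "e = i") simp_all
  qed
  then have \<Phi>_lim: "pconv \<Phi> p" by simp
  have d\<Phi>: "degree (\<Phi> l) \<le> max D e" for l
    unfolding \<Phi>_def using p(2)[of l] by (intro degree_diff_le) (auto intro: order_trans[OF degree_monom_le])
  have T_lim: "pconv T (pcompose p [:u, 1:])"
    unfolding T_def by (rule pconv_pcompose[OF \<Phi>_lim d\<Phi> y(1)])
  have pc: "pcompose p [:u, 1:] = monom 1 3 * pcompose Q [:u, 1:]"
    by (simp add: pu pcompose_mult pcompose_hom.hom_power pcompose_pCons monom_altdef)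
  have \<Psi>_lim: "pconv \<Psi> (poly_shift 2 (pcompose p [:u, 1:]))"
    using T_lim by (simp add: pconv_def \<Psi>_def coeff_poly_shift)
  have d\<Psi>: "degree (\<Psi> l) \<le> max D e" for l
  proof -
    have "degree (T l) \<le> max D e" using d\<Phi>[of l] by (simp add: T_def degree_pcompose)
    then show ?thesis unfolding \<Psi>_def by (intro degree_le) (auto simp: coeff_poly_shift coeff_eq_0)
  qed
  have h_lim: "h \<longlonglongrightarrow> 0" using tendsto_diff[OF y(2,1)] by (simp add: h_def[abs_def])
  have \<Psi>0: "poly (poly_shift 2 (pcompose p [:u, 1:])) 0 = 0"
    unfolding pc by (simp add: poly_0_coeff_0 coeff_poly_shift coeff_monom_mult)
  have \<Psi>1: "poly (pderiv (poly_shift 2 (pcompose p [:u, 1:]))) 0 = poly Q u"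
    unfolding pc by (simp add: poly_0_coeff_0 coeff_pderiv coeff_poly_shift coeff_monom_mult numeral_3_eq_3)
  have L0: "(\<lambda>l. poly (\<Psi> l) (h l)) \<longlonglongrightarrow> 0"
    using tendsto_poly_pconv[OF \<Psi>_lim d\<Psi> h_lim] \<Psi>0 by simp
  have L1: "(\<lambda>l. poly (pderiv (\<Psi> l)) (h l)) \<longlonglongrightarrow> poly Q u"
  proof -
    have "degree (pderiv (\<Psi> l)) \<le> max D e" for l using d\<Psi>[of l] degree_pderiv_le[of "\<Psi> l"] by linarith
    from tendsto_poly_pconv[OF pconv_pderiv[OF \<Psi>_lim] this h_lim] show ?thesis unfolding \<Psi>1 .
  qed
  define H where "H l = (of_nat e * poly (\<Psi> l) (h l) / x (zs l) - poly (pderiv (\<Psi> l)) (h l)) / (2 * zs l ^ e)" for l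
  have "H \<longlonglongrightarrow> (of_nat e * 0 / x u - poly Q u) / (2 * u ^ e)"
    unfolding H_def by (intro tendsto_intros L0 L1 x_lim pw_lim) (use xu ue in auto)
  then have "H \<longlonglongrightarrow> - poly Q u / (2 * u ^ e)" by simp
  moreover have "cv e (p' l) (zs l) - cv e (p' l) (ys l) = (zs l - ys l) ^ 3 * H l"
    if nz: "x (zs l) \<noteq> 0" "x (ys l) \<noteq> 0" "zs l ^ e \<noteq> 0" "ys l ^ e \<noteq> 0" for l
  proof -
    obtain S where S: "crit e (p' l) = [:- ys l, 1:] * [:- zs l, 1:] * S" using y(3)[of l] by (auto elim: dvdE)
    have crit\<Phi>: "crit e (\<Phi> l) = crit e (p' l)"
      by (rule poly_eqI) (auto simp: \<Phi>_def coeff_crit coeff_monom)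
    have \<Phi>0: "poly (\<Phi> l) (ys l) = 0" using nz(4) by (simp add: \<Phi>_def c_def cv_def poly_monom)
    have "poly (crit e (\<Phi> l)) (ys l) = 0" unfolding crit\<Phi> S poly_mult by simp
    then have \<Phi>1: "poly (pderiv (\<Phi> l)) (ys l) = 0" using nz(2) \<Phi>0 by (auto simp: poly_crit x_def split: if_splits)
    have "coeff (T l) 0 = 0" using \<Phi>0 by (simp add: T_def poly_pcompose flip: poly_0_coeff_0)
    moreover have "coeff (T l) (Suc 0) = 0"
    proof -
      have "coeff (T l) (Suc 0) = poly (pderiv (T l)) 0" by (simp add: poly_0_coeff_0 coeff_pderiv)
      also have "\<dots> = 0" using \<Phi>1 by (simp add: T_def pderiv_pcompose poly_pcompose pderiv_pCons)
      finally show ?thesis .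
    qed
    ultimately have T\<Psi>: "T l = [:0, 1:] ^ 2 * \<Psi> l"
      by (intro poly_eqI) (auto simp: \<Psi>_def coeff_poly_shift power2_eq_square coeff_pCons split: nat.split)
    \<comment> \<open>The critical polynomial shifted by \<open>ys l\<close> and divided by x. The
      factor belonging to \<open>zs l\<close> makes it vanish at \<open>h l\<close>.\<close>
    define B where "B = pcompose (Xe e) [:ys l, 1:] * (\<Psi> l + \<Psi> l + [:0, 1:] * pderiv (\<Psi> l)) - Polynomial.smult (of_nat e) ([:0, 1:] * \<Psi> l)"
    have "pcompose (crit e (\<Phi> l)) [:ys l, 1:] = pcompose (Xe e) [:ys l, 1:] * pderiv (T l) - Polynomial.smult (of_nat e) (T l)"
      by (simp add: crit_def T_def pcompose_diff pcompose_mult pcompose_smult pderiv_pcompose pderiv_pCons)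
    also have "pderiv (T l) = [:0, 1:] * (\<Psi> l + \<Psi> l + [:0, 1:] * pderiv (\<Psi> l))"
      unfolding T\<Psi> power2_eq_square pderiv_mult by (simp add: pderiv_pCons)
    also have "pcompose (Xe e) [:ys l, 1:] * \<dots> - Polynomial.smult (of_nat e) (T l) = [:0, 1:] * B"
      unfolding T\<Psi> power2_eq_square B_def by (simp only: right_diff_distrib mult_smult_right mult_ac)
    finally have "[:0, 1:] * B = pcompose (crit e (p' l)) [:ys l, 1:]" by (simp add: crit\<Phi>)
    also have "\<dots> = [:0, 1:] * ([:- h l, 1:] * pcompose S [:ys l, 1:])"
    proof -
      have "pcompose [:- ys l, 1:] [:ys l, 1:] = [:0, 1:]" "pcompose [:- zs l, 1:] [:ys l, 1:] = [:- h l, 1:]"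
        by (simp_all add: pcompose_pCons h_def)
      then show ?thesis unfolding S pcompose_mult by (simp only: mult.assoc)
    qed
    finally have "B = [:- h l, 1:] * pcompose S [:ys l, 1:]" by (metis mult_cancel_left pCons_eq_0_iff zero_neq_one)
    then have B0: "poly B (h l) = 0" by simp
    have "poly (pcompose (Xe e) [:ys l, 1:]) (h l) = x (zs l)" by (simp add: poly_pcompose x_def h_def)
    then have "x (zs l) * (2 * poly (\<Psi> l) (h l) + h l * poly (pderiv (\<Psi> l)) (h l)) = of_nat e * h l * poly (\<Psi> l) (h l)"
      using B0 by (simp add: B_def algebra_simps)
    then have "2 * poly (\<Psi> l) (h l) + h l * poly (pderiv (\<Psi> l)) (h l) = of_nat e * h l * poly (\<Psi> l) (h l) / x (zs l)"
      using nz(1) by (metis nonzero_mult_div_cancel_left)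
    then have "2 * poly (\<Psi> l) (h l) = of_nat e * h l * poly (\<Psi> l) (h l) / x (zs l) - h l * poly (pderiv (\<Psi> l)) (h l)"
      by (simp only: eq_diff_eq)
    then have two: "2 * poly (\<Psi> l) (h l) = h l * (of_nat e * poly (\<Psi> l) (h l) / x (zs l) - poly (pderiv (\<Psi> l)) (h l))"
      by (simp add: right_diff_distrib)
    have "cv e (p' l) (zs l) - cv e (p' l) (ys l) = poly (\<Phi> l) (zs l) / zs l ^ e"
      using nz(3) by (simp add: \<Phi>_def c_def poly_monom cv_def diff_divide_distrib)
    also have "poly (\<Phi> l) (zs l) = poly (T l) (h l)" by (simp add: T_def poly_pcompose h_def)
    also have "\<dots> = h l ^ 2 * poly (\<Psi> l) (h l)" by (simp add: T\<Psi>)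
    also have "\<dots> / zs l ^ e = h l ^ 2 * (2 * poly (\<Psi> l) (h l)) / (2 * zs l ^ e)" by simp
    also have "\<dots> = h l ^ 3 * H l" unfolding two H_def by (simp add: power3_eq_cube power2_eq_square)
    finally show ?thesis by (simp add: h_def)
  qed
  with ev have "eventually (\<lambda>l. cv e (p' l) (zs l) - cv e (p' l) (ys l) = (zs l - ys l) ^ 3 * H l) sequentially"
    by (auto elim: eventually_mono)
  ultimately show ?thesis by (rule that)
qed

text \<open>The squared distance of the two roots is the square of the sum minus four times the
  product of \<open>u - ys l\<close> and \<open>u - zs l\<close>. Evaluation at \<open>u\<close>
  shows that the product is of order \<open>s\<close>, evaluation of the derivative that the sum is
  O(s), so that its square is negligible.\<close>

lemma splitting_double_root:
  assumes f: "f = [:- u, 1:] ^ 2 * S" "poly S u \<noteq> 0"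
    and eq: "\<And>l. f + Polynomial.smult (s l) g = [:- ys l, 1:] * [:- zs l, 1:] * S' l" "pconv S' S" "\<And>l. degree (S' l) \<le> D"
    and s: "\<And>l. s l \<noteq> 0" "s \<longlonglongrightarrow> 0"
  shows "(\<lambda>l. (zs l - ys l) ^ 2 / s l) \<longlonglongrightarrow> - 4 * poly g u / poly S u"
proof -
  define A where "A l = (u - ys l) * (u - zs l) / s l" for l
  define B where "B l = ((u - ys l) + (u - zs l)) / s l" for l
  have S_lim: "(\<lambda>l. poly (S' l) u) \<longlonglongrightarrow> poly S u" by (rule tendsto_poly_pconv[OF eq(2,3) tendsto_const])
  have dS: "degree (pderiv (S' l)) \<le> D" for l using eq(3)[of l] degree_pderiv_le[of "S' l"] by simp
  have S1_lim: "(\<lambda>l. poly (pderiv (S' l)) u) \<longlonglongrightarrow> poly (pderiv S) u" 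
    by (rule tendsto_poly_pconv[OF pconv_pderiv[OF eq(2)] dS tendsto_const])
  have ev: "eventually (\<lambda>l. poly (S' l) u \<noteq> 0) sequentially" by (rule tendsto_imp_eventually_ne[OF S_lim f(2)])
  have A1: "A l * poly (S' l) u = poly g u" for l
    using arg_cong[OF eq(1)[of l], of "\<lambda>p. poly p u"] s(1)[of l] unfolding f(1) by (simp add: A_def field_simps)
  have f1: "poly (pderiv f) u = 0" unfolding f(1) power2_eq_square pderiv_mult by simp
  have B1: "B l * poly (S' l) u + A l * poly (pderiv (S' l)) u = poly (pderiv g) u" for l
  proof -
    have "poly (pderiv ([:- ys l, 1:] * [:- zs l, 1:] * S' l)) u =
       ((u - ys l) + (u - zs l)) * poly (S' l) u + (u - ys l) * (u - zs l) * poly (pderiv (S' l)) u"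
      unfolding pderiv_mult by (simp add: pderiv_pCons algebra_simps)
    also have "poly (pderiv ([:- ys l, 1:] * [:- zs l, 1:] * S' l)) u = s l * poly (pderiv g) u"
      unfolding eq(1)[symmetric] by (simp add: pderiv_add pderiv_smult f1)
    finally show ?thesis using s(1)[of l] by (simp add: A_def B_def field_simps)
  qed
  have "(\<lambda>l. poly g u / poly (S' l) u) \<longlonglongrightarrow> poly g u / poly S u" by (intro tendsto_intros S_lim f(2))
  then have A_lim: "A \<longlonglongrightarrow> poly g u / poly S u"
    by (rule Lim_transform_eventually, intro eventually_mono[OF ev]) (metis A1 nonzero_mult_div_cancel_right)
  have "(\<lambda>l. (poly (pderiv g) u - A l * poly (pderiv (S' l)) u) / poly (S' l) u)
    \<longlonglongrightarrow> (poly (pderiv g) u - poly g u / poly S u * poly (pderiv S) u) / poly S u"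
    by (intro tendsto_intros S_lim S1_lim A_lim f(2))
  then have "B \<longlonglongrightarrow> (poly (pderiv g) u - poly g u / poly S u * poly (pderiv S) u) / poly S u"
    by (rule Lim_transform_eventually, intro eventually_mono[OF ev]) (metis B1 add_diff_cancel_right' nonzero_mult_div_cancel_right)
  then obtain b where B_lim: "B \<longlonglongrightarrow> b" by blast
  have "(\<lambda>l. B l * B l * s l - 4 * A l) \<longlonglongrightarrow> b * b * 0 - 4 * (poly g u / poly S u)"
    by (intro tendsto_intros A_lim B_lim s(2))
  moreover have "B l * B l * s l - 4 * A l = (zs l - ys l) ^ 2 / s l" for l
    using s(1)[of l] by (simp add: A_def B_def field_simps power2_eq_square)
  ultimately show ?thesis by simp
qed

subsection \<open>Polynomials with a triple root or two double roots\<close>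

definition lin :: "complex \<Rightarrow> complex poly" where "lin u = [:- u, 1:]"

lemma poly_lin [simp]: "poly (lin u) x = x - u" by (simp add: lin_def)
lemma pderiv_lin [simp]: "pderiv (lin u) = 1" by (simp add: lin_def pderiv_pCons)
lemma lin_nonzero [simp]: "lin u \<noteq> 0" by (simp add: lin_def)
lemma degree_lin [simp]: "degree (lin u) = 1" by (simp add: lin_def)
lemma lead_coeff_lin [simp]: "lead_coeff (lin u) = 1" by (simp add: lin_def)
lemma lin_dvd_iff: "lin u dvd p \<longleftrightarrow> poly p u = 0" by (simp add: lin_def poly_eq_0_iff_dvd)
lemma pconv_lin: "y \<longlonglongrightarrow> x \<Longrightarrow> pconv (\<lambda>l. lin (y l)) (lin x)"
  unfolding lin_def by (rule pconv_linear)

lemma smult_numeral: "Polynomial.smult (numeral m) p = numeral m * (p :: complex poly)"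
  by (simp add: numeral_poly)

lemma lin_diff: "lin (u + z) = lin u - [:z:]" by (simp add: lin_def)

lemma lin_lin_dvd:
  assumes "u \<noteq> v" "poly p u = 0" "poly p v = 0" shows "lin u * lin v dvd p"
proof -
  obtain q where q: "p = lin u * q" using assms(2) by (metis dvdE lin_dvd_iff)
  then have "poly q v = 0" using assms(1,3) by simp
  then show ?thesis unfolding q by (intro mult_dvd_mono dvd_refl) (simp add: lin_dvd_iff)
qed

lemma lin_power2_dvd:
  assumes "poly p u = 0" "poly (pderiv p) u = 0" obtains q where "p = lin u ^ 2 * q"
proof -
  obtain h where h: "p = lin u * h" "poly h u = 0"
    using simple_root_quotient[OF assms(1)] assms(2) unfolding lin_def by metis
  then obtain q where "h = lin u * q" by (metis dvdE lin_dvd_iff)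
  then have "p = lin u ^ 2 * q" using h(1) by (simp add: power2_eq_square mult.assoc)
  then show ?thesis by (rule that)
qed

lemma P_at_surj:
  assumes "degree p = n" "lead_coeff p = 1" obtains a where "P_at n a = p"
proof
  show "P_at n (\<lambda>j. coeff p (n - j)) = p"
    by (rule poly_eqI) (use assms in \<open>auto simp: coeff_P_at coeff_eq_0\<close>)
qed

section \<open>Equal critical values and the two strata\<close>

context discriminant_params
begin

text \<open>Allowing an arbitrary change of \<open>a k\<close> makes this set and \<open>VM\<close>
  full preimages under the projection, and divisibility admits higher multiplicities, so that both
  are images of polynomial maps.\<close>

definition VS :: "(nat \<Rightarrow> complex) set" where
  "VS = {a. \<exists>z u. lin u ^ 3 dvd P_at n (a(k := z))}"

definition VM :: "(nat \<Rightarrow> complex) set" where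
  "VM = {a. \<exists>z u v. lin u ^ 2 * lin v ^ 2 dvd P_at n (a(k := z))}"

abbreviation "X x \<equiv> poly (Xe e) x"

lemma X_nonzero_iff: "X x \<noteq> 0 \<longleftrightarrow> e = 0 \<or> x \<noteq> 0" by auto

lemma shifted_double_root:
  assumes ok: "ok a" and y: "poly (N a) y = 0" and z: "z = a k - cva a y"
  obtains q where "P_at n (a(k := z)) = lin y ^ 2 * q"
proof -
  let ?p = "P_at n (a(k := z))"
  have e: "e = 0 \<or> y \<noteq> 0" by (rule root_nonzero[OF y ok])
  have "cva (a(k := z)) y = 0" using cv_upd[OF e, of a z] z by simp
  then have 0: "poly ?p y = 0" using e by (auto simp: cv_def)
  have "poly (N (a(k := z))) y = 0" using y by (simp only: crit_upd)
  then have "poly (pderiv ?p) y = 0" using 0 e by (auto simp: poly_crit split: if_splits)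
  then obtain q where "?p = lin y ^ 2 * q" using lin_power2_dvd[OF 0] by blast
  then show ?thesis by (rule that)
qed

lemma pair_in_V:
  assumes ok: "ok a" and y: "roots_of a y" and ij: "i < \<nu>" "j < \<nu>" "i \<noteq> j" and eq: "cva a (y i) = cva a (y j)"
  shows "y i \<noteq> y j \<Longrightarrow> a \<in> VM" "y i = y j \<Longrightarrow> a \<in> VS"
proof -
  define z where "z = a k - cva a (y i)"
  let ?p = "P_at n (a(k := z))"
  note yi = poly_crit_root[OF y ij(1)] and yj = poly_crit_root[OF y ij(2)]
  obtain q where q: "?p = lin (y i) ^ 2 * q" by (rule shifted_double_root[OF ok yi z_def])
  {
    assume ne: "y i \<noteq> y j"
    have zj: "z = a k - cva a (y j)" by (simp add: z_def eq)
    obtain q' where q': "?p = lin (y j) ^ 2 * q'" by (rule shifted_double_root[OF ok yj zj])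
    have "lin (y j) dvd q"
      using q' q ne by (metis (no_types) lin_dvd_iff dvd_triv_left power2_eq_square mult.assoc poly_lin poly_mult 
           right_minus_eq no_zero_divisors poly_mult_zero_iff)
    then obtain t where t: "q = lin (y j) * t" by (auto elim: dvdE)
    have "lin (y j) * (lin (y i) ^ 2 * t) = lin (y j) * (lin (y j) * q')"
      using q q' unfolding t by (simp add: power2_eq_square mult_ac)
    then have "lin (y i) ^ 2 * t = lin (y j) * q'" by (simp only: mult_cancel_left lin_nonzero simp_thms)
    then have "poly (lin (y i) ^ 2 * t) (y j) = 0" by simp
    then have "poly t (y j) = 0" using ne by auto
    then obtain t' where "t = lin (y j) * t'" by (metis dvdE lin_dvd_iff)
    then have "?p = lin (y i) ^ 2 * lin (y j) ^ 2 * t'" unfolding q t by (simp add: power2_eq_square mult_ac)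
    then show "a \<in> VM" unfolding VM_def by (metis (mono_tags) dvd_triv_left mem_Collect_eq)
  next
    assume eq: "y i = y j"
    have "(\<Prod>l<\<nu>. [:- y l, 1:]) = [:- y i, 1:] * ([:- y j, 1:] * (\<Prod>l\<in>{..<\<nu>}-{i}-{j}. [:- y l, 1:]))"
      using ij by (subst prod.remove[of _ i], simp, simp, subst prod.remove[of _ j]) auto
    then obtain S where S: "N a = lin (y i) * (lin (y i) * S)"
      using y eq unfolding lin_def by (metis mult_smult_right)
    \<comment> \<open>The double zero of \<open>N a\<close> at \<open>y i\<close> is compared with
      this form of the same polynomial: after cancelling one linear factor, the value at
      \<open>y i\<close> is 0 on one side and \<open>2 * X (y i) * poly q (y i)\<close> on the
      other, so \<open>q\<close> vanishes there.\<close>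
    have N': "N a = lin (y i) * (Polynomial.smult 2 (Xe e * q) + lin (y i) * crit e q)"
    proof -
      have "N a = crit e (lin (y i) ^ 2 * q)" using q crit_upd[of a z] by simp
      also have "\<dots> = lin (y i) * (Polynomial.smult 2 (Xe e * q) + lin (y i) * crit e q)"
        unfolding crit_mult by (simp only: power2_eq_square pderiv_mult pderiv_lin mult_1_left mult_1_right)
          (simp add: algebra_simps smult_numeral)
      finally show ?thesis .
    qed
    have "lin (y i) * S = Polynomial.smult 2 (Xe e * q) + lin (y i) * crit e q"
      using S N' by (metis lin_nonzero mult_left_cancel)
    from arg_cong[OF this, of "\<lambda>f. poly f (y i)"]
    have "poly q (y i) = 0" using root_nonzero[OF yi ok] by (auto split: if_splits)
    then obtain t where "q = lin (y i) * t" by (metis dvdE lin_dvd_iff)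
    then have "?p = lin (y i) ^ 3 * t" unfolding q by (simp add: power2_eq_square power3_eq_cube mult_ac)
    then show "a \<in> VS" unfolding VS_def by (metis (mono_tags) dvd_triv_left mem_Collect_eq)
  }
qed

text \<open>All ordered pairs of distinct indices except the two formed by \<nu> - 2 and \<nu> - 1;
  these last two indices are reserved for the critical points located at the multiple roots.\<close>

definition pairs :: "(nat \<times> nat) set" where
  "pairs = {(i, j). i < \<nu> \<and> j < \<nu> \<and> i \<noteq> j \<and> (i < \<nu> - 2 \<or> j < \<nu> - 2)}"

lemma finite_pairs: "finite pairs"
  by (rule finite_subset[of _ "{..<\<nu>} \<times> {..<\<nu>}"]) (auto simp: pairs_def)

definition nice :: "(nat \<Rightarrow> complex) \<Rightarrow> (nat \<Rightarrow> complex) \<Rightarrow> bool" where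
  "nice a y \<longleftrightarrow> (\<forall>(i, j)\<in>pairs. cva a (y i) \<noteq> cva a (y j))"

lemma prod_pairs:
  fixes g :: "nat \<Rightarrow> nat \<Rightarrow> complex"
  assumes "\<nu> \<ge> 2"
  shows "(\<Prod>i<\<nu>. \<Prod>j\<in>{..<\<nu>}-{i}. g i j) = g (\<nu> - 2) (\<nu> - 1) * g (\<nu> - 1) (\<nu> - 2) * (\<Prod>(i, j)\<in>pairs. g i j)"
proof -
  have "(\<Prod>i<\<nu>. \<Prod>j\<in>{..<\<nu>}-{i}. g i j) = (\<Prod>(i, j)\<in>(SIGMA i:{..<\<nu>}. {..<\<nu>}-{i}). g i j)"
    by (rule prod.Sigma) auto
  also have "(SIGMA i:{..<\<nu>}. {..<\<nu>}-{i}) = insert (\<nu> - 2, \<nu> - 1) (insert (\<nu> - 1, \<nu> - 2) pairs)"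
    using assms by (auto simp: pairs_def)
  also have "(\<Prod>(i, j)\<in>\<dots>. g i j) = g (\<nu> - 2) (\<nu> - 1) * g (\<nu> - 1) (\<nu> - 2) * (\<Prod>(i, j)\<in>pairs. g i j)"
    using finite_pairs assms by (subst prod.insert; (subst prod.insert)?) (auto simp: pairs_def mult.assoc)
  finally show ?thesis .
qed

end

section \<open>Points with prescribed multiple roots\<close>

locale theorem4_params = discriminant_params +
  assumes n4: "4 \<le> n"
begin

lemma nu3: "3 \<le> \<nu>" using n4 by (auto simp: \<nu>_def)

text \<open>The flag \<open>b\<close> distinguishes the two strata: a triple root (\<open>True\<close>) or two double roots.\<close>

definition sp :: "bool \<Rightarrow> (nat \<Rightarrow> complex) \<Rightarrow> complex \<Rightarrow> complex \<Rightarrow> complex poly \<Rightarrow> bool" where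
  "sp b a u v Q \<longleftrightarrow> ok a \<and> poly Q u \<noteq> 0 \<and> poly Q v \<noteq> 0 \<and>
     (if b then u = v \<and> P_at n a = lin u ^ 3 * Q else u \<noteq> v \<and> P_at n a = lin u ^ 2 * lin v ^ 2 * Q)"

text \<open>The cofactor of the two special critical points in \<open>N a\<close>, from the product
  rule. It does not vanish at them, so that they are simple critical points, or one double critical
  point if they coincide.\<close>

definition spS :: "bool \<Rightarrow> complex \<Rightarrow> complex \<Rightarrow> complex poly \<Rightarrow> complex poly" where
  "spS b u v Q = (if b then Polynomial.smult 3 (Xe e * Q) + lin u * crit e Q 
     else Polynomial.smult 2 (Xe e * (lin u + lin v) * Q) + lin u * lin v * crit e Q)"

lemma crit_lin3: "crit e (lin u ^ 3 * Q) = lin u * lin u * (Polynomial.smult 3 (Xe e * Q) + lin u * crit e Q)"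
proof -
  have "pderiv (lin u ^ 3) = Polynomial.smult 3 (lin u * lin u)"
    by (simp add: power3_eq_cube pderiv_mult smult_numeral algebra_simps)
  then show ?thesis unfolding crit_mult by (simp add: power3_eq_cube algebra_simps smult_numeral)
qed

lemma crit_lin22: "crit e (lin u ^ 2 * lin v ^ 2 * Q) = 
  lin u * lin v * (Polynomial.smult 2 (Xe e * (lin u + lin v) * Q) + lin u * lin v * crit e Q)"
proof -
  have "pderiv (lin u ^ 2 * lin v ^ 2) = Polynomial.smult 2 (lin u * lin v * (lin u + lin v))"
    unfolding power2_eq_square pderiv_mult pderiv_lin
    by (simp add: smult_numeral algebra_simps)
  then show ?thesis unfolding crit_mult by (simp add: power2_eq_square algebra_simps smult_numeral)
qed

lemma sp_crit: "sp b a u v Q \<Longrightarrow> N a = lin u * lin v * spS b u v Q"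
  by (auto simp: sp_def spS_def crit_lin3 crit_lin22 split: if_splits)

lemma sp_root: assumes "sp b a u v Q" shows "poly (N a) u = 0" "poly (N a) v = 0" "X u \<noteq> 0" "X v \<noteq> 0"
proof -
  show 1: "poly (N a) u = 0" "poly (N a) v = 0" using sp_crit[OF assms] by simp_all
  have "ok a" using assms by (simp add: sp_def)
  then show "X u \<noteq> 0" "X v \<noteq> 0" using root_nonzero[OF 1(1)] root_nonzero[OF 1(2)] by auto
qed

lemma sp_S_nonzero: assumes "sp b a u v Q" shows "poly (spS b u v Q) u \<noteq> 0" "poly (spS b u v Q) v \<noteq> 0"
  using assms sp_root(3,4)[OF assms] unfolding sp_def spS_def by (auto split: if_splits)

lemma sp_cv: assumes "sp b a u v Q" shows "cva a u = 0" "cva a v = 0"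
  using assms by (auto simp: sp_def cv_def split: if_splits)

lemma sp_roots:
  assumes "sp b a u v Q"
  obtains y where "roots_of a y" "y (\<nu> - 2) = u" "y (\<nu> - 1) = v"
proof -
  let ?S = "spS b u v Q"
  have S0: "?S \<noteq> 0" using sp_S_nonzero[OF assms] by auto
  have N: "N a = lin u * lin v * ?S" by (rule sp_crit[OF assms])
  have dS: "degree ?S = \<nu> - 2"
    using degree_crit[of a] S0 unfolding N by (simp add: degree_mult_eq)
  have lS: "lead_coeff ?S = of_nat k"
    using lead_coeff_crit[of a] unfolding N lead_coeff_mult lead_coeff_lin by simp
  obtain z where "?S = Polynomial.smult (lead_coeff ?S) (\<Prod>i<degree ?S. [:- z i, 1:])" by (rule complex_poly_factor)
  note z = this[unfolded lS, unfolded dS]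
  define y where "y i = (if i < \<nu> - 2 then z i else if i = \<nu> - 2 then u else v)" for i
  obtain m where m: "\<nu> = Suc (Suc m)" using nu3 by (metis Suc_diff_Suc le_Suc_ex numeral_3_eq_3 plus_nat.simps(2))
  have "(\<Prod>i<\<nu>. [:- y i, 1:]) = (\<Prod>i<m. [:- z i, 1:]) * lin u * lin v"
    unfolding m prod.lessThan_Suc lin_def by (simp add: y_def m)
  then have "roots_of a y" unfolding N by (subst z) (simp add: m mult_ac)
  moreover have "y (\<nu> - 2) = u" "y (\<nu> - 1) = v" by (simp_all add: y_def m)
  ultimately show ?thesis by (rule that)
qed

lemma special_not_root:
  assumes sp: "sp b a u v Q" and y: "roots_of a y" "y (\<nu> - 2) = u" "y (\<nu> - 1) = v" and i: "i < \<nu> - 2"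
  shows "y i \<noteq> u" "y i \<noteq> v" "poly (spS b u v Q) (y i) = 0"
proof -
  obtain m where m: "\<nu> = Suc (Suc m)" using nu3 by (metis Suc_diff_Suc le_Suc_ex numeral_3_eq_3 plus_nat.simps(2))
  have "N a = Polynomial.smult (of_nat k) ((\<Prod>i<m. [:- y i, 1:]) * lin u * lin v)"
    using y unfolding m prod.lessThan_Suc lin_def by simp
  then have "lin u * lin v * spS b u v Q = lin u * lin v * Polynomial.smult (of_nat k) (\<Prod>i<m. [:- y i, 1:])"
    unfolding sp_crit[OF sp] by (simp add: mult_ac)
  then have "spS b u v Q = Polynomial.smult (of_nat k) (\<Prod>i<m. [:- y i, 1:])"
    by (simp only: mult_cancel_left mult_eq_0_iff lin_nonzero simp_thms)
  then show 0: "poly (spS b u v Q) (y i) = 0" using i m by (auto simp: poly_prod)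
  then show "y i \<noteq> u" "y i \<noteq> v" using sp_S_nonzero[OF sp] by auto
qed

text \<open>The velocity of P along the line with direction \<open>w\<close>; the leading term of P
  does not move.\<close>

definition Wp :: "(nat \<Rightarrow> complex) \<Rightarrow> complex poly" where "Wp w = P_at n w - monom 1 n"

lemma coeff_Wp: "coeff (Wp w) i = (if i < n then w (n - i) else 0)"
  by (simp add: Wp_def coeff_P_at coeff_monom)

lemma degree_Wp: "degree (Wp w) \<le> n"
  by (intro degree_le) (simp add: coeff_Wp)

lemma P_at_line: "P_at n (\<lambda>i. a i + s * w i) = P_at n a + Polynomial.smult s (Wp w)"
  by (rule poly_eqI) (simp add: coeff_P_at coeff_Wp)

lemma pconv_P_at: "(\<And>i. (\<lambda>l. q l i) \<longlonglongrightarrow> a i) \<Longrightarrow> pconv (\<lambda>l. P_at n (q l)) (P_at n a)"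
  by (auto simp: pconv_def coeff_P_at)

lemma tendsto_cva:
  assumes "\<And>i. (\<lambda>l. q l i) \<longlonglongrightarrow> a i" "x \<longlonglongrightarrow> y" "X y \<noteq> 0"
  shows "(\<lambda>l. cva (q l) (x l)) \<longlonglongrightarrow> cva a y"
  unfolding cv_def
  by (intro tendsto_divide tendsto_power assms(2) tendsto_poly_pconv[OF pconv_P_at, of _ _ n] assms(1)) (use assms(3) in \<open>auto split: if_splits\<close>)

lemma eventually_ok:
  assumes "\<And>i. (\<lambda>l. q l i) \<longlonglongrightarrow> a i" "ok a" shows "eventually (\<lambda>l. ok (q l)) sequentially"
proof (cases "k = n")
  case False
  then have "a n \<noteq> 0" using assms(2) by (simp add: ok_def)
  from tendsto_imp_eventually_ne[OF assms(1) this] show ?thesis by (auto simp: ok_def elim: eventually_mono)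
next
  case True
  then show ?thesis unfolding ok_def by simp
qed

text \<open>All factors of the double discriminant outside the special pair converge, and at a nice
  point their limits are nonzero. The rate of vanishing along the sequence is thus that of the
  special pair alone.\<close>

lemma special_pair_limit:
  assumes q: "\<And>i. (\<lambda>l. q l i) \<longlonglongrightarrow> a i" and ys: "\<And>l. roots_of (q l) (ys l)" "\<And>i. i < \<nu> \<Longrightarrow> (\<lambda>l. ys l i) \<longlonglongrightarrow> y i"
    and y: "roots_of a y" and ok: "ok a"
    and lim: "(\<lambda>l. (cva (q l) (ys l (\<nu> - 1)) - cva (q l) (ys l (\<nu> - 2))) ^ 2 / s l ^ m) \<longlonglongrightarrow> \<Gamma>"
  shows "\<exists>L. (\<lambda>l. eval_mpoly (q l) (D_tilde n k) / s l ^ m) \<longlonglongrightarrow> L \<and> (\<Gamma> \<noteq> 0 \<longrightarrow> nice a y \<longrightarrow> L \<noteq> 0)"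
proof -
  obtain C where C: "C \<noteq> 0" "\<And>a y. ok a \<Longrightarrow> roots_of a y \<Longrightarrow> eval_mpoly a (D_tilde n k) = 
     C * a n ^ ((e - 1) * (2 * \<nu> - 1)) * (\<Prod>i<\<nu>. \<Prod>j\<in>{..<\<nu>}-{i}. cva a (y j) - cva a (y i))"
    using eval_D_tilde by blast
  define f where "f l = C * q l n ^ ((e - 1) * (2 * \<nu> - 1)) * 
     (- ((cva (q l) (ys l (\<nu> - 1)) - cva (q l) (ys l (\<nu> - 2))) ^ 2 / s l ^ m)) * 
     (\<Prod>(i, j)\<in>pairs. cva (q l) (ys l j) - cva (q l) (ys l i))" for l
  define L where "L = C * a n ^ ((e - 1) * (2 * \<nu> - 1)) * (- \<Gamma>) * (\<Prod>(i, j)\<in>pairs. cva a (y j) - cva a (y i))"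
  have "(\<lambda>l. case p of (i, j) \<Rightarrow> cva (q l) (ys l j) - cva (q l) (ys l i)) \<longlonglongrightarrow> (case p of (i, j) \<Rightarrow> cva a (y j) - cva a (y i))"
    if pp: "p \<in> pairs" for p
  proof -
    obtain i j where p: "p = (i, j)" "i < \<nu>" "j < \<nu>" using pp unfolding pairs_def by blast
    have "X (y i) \<noteq> 0" "X (y j) \<noteq> 0"
      using root_nonzero[OF poly_crit_root[OF y] ok] p by auto
    then show ?thesis unfolding p(1) prod.case by (intro tendsto_diff tendsto_cva q ys(2) p)
  qed
  then have fL: "f \<longlonglongrightarrow> L" unfolding f_def L_def
    by (intro tendsto_mult tendsto_const tendsto_power q tendsto_minus lim tendsto_prod)
  have sq: "c * (- ((x - z) ^ 2 / t)) * w = c * ((x - z) * (z - x) * w) / t" for c x z t w :: complex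
  proof -
    have "(x - z) * (z - x) = - ((x - z) ^ 2)" by (simp add: power2_eq_square algebra_simps)
    then show ?thesis by simp
  qed
  have nu2: "2 \<le> \<nu>" using nu3 by simp
  have f: "f l = eval_mpoly (q l) (D_tilde n k) / s l ^ m" if "ok (q l)" for l
    unfolding C(2)[OF that ys(1)] f_def prod_pairs[OF nu2, of "\<lambda>i j. cva (q l) (ys l j) - cva (q l) (ys l i)"] sq ..
  have "(\<lambda>l. eval_mpoly (q l) (D_tilde n k) / s l ^ m) \<longlonglongrightarrow> L"
    by (rule Lim_transform_eventually[OF fL]) (rule eventually_mono[OF eventually_ok[OF q ok]], simp add: f)
  moreover have "\<Gamma> \<noteq> 0 \<Longrightarrow> nice a y \<Longrightarrow> L \<noteq> 0"
  proof -
    assume G: "\<Gamma> \<noteq> 0" "nice a y"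
    have "a n ^ ((e - 1) * (2 * \<nu> - 1)) \<noteq> 0" using ok e_0_iff by (auto simp: ok_def)
    moreover have "(\<Prod>(i, j)\<in>pairs. cva a (y j) - cva a (y i)) \<noteq> 0"
      using G(2) finite_pairs by (fastforce simp: nice_def)
    ultimately show "L \<noteq> 0" using G(1) C(1) by (simp add: L_def)
  qed
  ultimately show ?thesis by blast
qed

end

subsection \<open>Order of vanishing on the strata\<close>

text \<open>An exact difference quotient: the coefficient of \<open>S\<close> is the perturbation
  used in \<open>sp_path\<close>, and its limit for \<open>S = 0\<close> is the tangent vector,
  which \<open>tangent_cube\<close> simplifies.\<close>

lemma perturbed_cube:
  fixes U S a q q1 A :: "'a::comm_ring_1"
  assumes A: "A = U - S * a"
  shows "A ^ 3 * (q + S * q1) = U ^ 3 * q + S * (- a * (A ^ 2 + A * U + U ^ 2) * (q + S * q1) + U ^ 3 * q1)"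
proof -
  have "A ^ 3 = U ^ 3 + (A - U) * (A ^ 2 + A * U + U ^ 2)"
    by (simp add: power2_eq_square power3_eq_cube algebra_simps)
  also have "A - U = - (S * a)" using A by simp
  finally have *: "A ^ 3 = U ^ 3 + S * (- a * (A ^ 2 + A * U + U ^ 2))" by (simp add: mult_ac)
  show ?thesis by (subst *) (simp add: algebra_simps)
qed

lemma perturbed_squares:
  fixes U S a V b q q1 A B :: "'a::comm_ring_1"
  assumes A: "A = U - S * a" "B = V - S * b"
  shows "A ^ 2 * B ^ 2 * (q + S * q1) = U ^ 2 * V ^ 2 * q + 
      S * (- (a * (A + U) * B ^ 2 + U ^ 2 * (b * (B + V))) * (q + S * q1) + U ^ 2 * V ^ 2 * q1)"
proof -
  have "A ^ 2 * B ^ 2 = U ^ 2 * V ^ 2 + ((A - U) * (A + U) * B ^ 2 + U ^ 2 * ((B - V) * (B + V)))"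
    by (simp add: power2_eq_square algebra_simps)
  moreover have "A - U = - (S * a)" "B - V = - (S * b)" using A by simp_all
  ultimately have *: "A ^ 2 * B ^ 2 = U ^ 2 * V ^ 2 + S * (- (a * (A + U) * B ^ 2 + U ^ 2 * (b * (B + V))))"
    by (simp add: algebra_simps)
  show ?thesis by (subst *) (simp add: algebra_simps)
qed

lemma tangent_cube:
  fixes U a q q1 r :: "'a::comm_ring_1"
  assumes "U * q1 = r + (a * q + a * q + a * q)"
  shows "- a * (U ^ 2 + U * U + U ^ 2) * q + U ^ 3 * q1 = U * U * r"
proof -
  have "U ^ 3 * q1 = U * U * (U * q1)" by (simp add: power3_eq_cube mult_ac)
  also have "\<dots> = U * U * (r + (a * q + a * q + a * q))" by (simp only: assms)
  finally have "U ^ 3 * q1 = U * U * (r + (a * q + a * q + a * q))" .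
  then show ?thesis by (simp only: power2_eq_square algebra_simps) (simp add: algebra_simps)
qed

lemma tangent_squares:
  fixes U a V b q q1 r :: "'a::comm_ring_1"
  assumes "U * V * q1 = r + (a * V * q + a * V * q) + (b * U * q + b * U * q)"
  shows "- (a * (U + U) * V ^ 2 + U ^ 2 * (b * (V + V))) * q + U ^ 2 * V ^ 2 * q1 = U * V * r"
proof -
  have "U ^ 2 * V ^ 2 * q1 = U * V * (U * V * q1)" by (simp add: power2_eq_square mult_ac)
  also have "\<dots> = U * V * (r + (a * V * q + a * V * q) + (b * U * q + b * U * q))" by (simp only: assms)
  finally have "U ^ 2 * V ^ 2 * q1 = U * V * (r + (a * V * q + a * V * q) + (b * U * q + b * U * q))" .
  then show ?thesis by (simp only: power2_eq_square algebra_simps) (simp add: algebra_simps)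
qed

lemma (in discriminant_params) roots_split_pair:
  assumes nu2: "2 \<le> \<nu>" and roots: "roots_of a y"
  shows "N a = lin (y (\<nu> - 2)) * lin (y (\<nu> - 1)) * Polynomial.smult (of_nat k) (\<Prod>i<\<nu> - 2. [:- y i, 1:])"
proof -
  obtain m where m: "\<nu> = Suc (Suc m)" using nu2 by (metis add_2_eq_Suc le_Suc_ex)
  define Z where "Z = (\<Prod>i<m. [:- y i, 1:])"
  have "(\<Prod>i<\<nu>. [:- y i, 1:]) = Z * lin (y m) * lin (y (Suc m))"
    unfolding m prod.lessThan_Suc lin_def Z_def ..
  with roots have "N a = Polynomial.smult (of_nat k) (Z * lin (y m) * lin (y (Suc m)))" by metis
  also have "\<dots> = lin (y m) * lin (y (Suc m)) * Polynomial.smult (of_nat k) Z" by (simp add: mult_ac)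
  finally show ?thesis by (simp add: m Z_def)
qed

context theorem4_params
begin

lemma sp_simple_root:
  assumes sp: "sp False a u v Q"
  shows "poly (pderiv (N a)) u \<noteq> 0" "poly (pderiv (N a)) v \<noteq> 0"
proof -
  have uv: "u \<noteq> v" using sp by (simp add: sp_def)
  have "poly (pderiv (lin u * lin v * f)) u = (u - v) * poly f u" "poly (pderiv (lin u * lin v * f)) v = (v - u) * poly f v" for f
    unfolding pderiv_mult by simp_all
  then show "poly (pderiv (N a)) u \<noteq> 0" "poly (pderiv (N a)) v \<noteq> 0"
    unfolding sp_crit[OF sp] using sp_S_nonzero[OF sp] uv by auto
qed

definition strat_ord :: "bool \<Rightarrow> nat" where "strat_ord b = (if b then 3 else 2)"

text \<open>The condition that a line with velocity \<open>W\<close> leaves the stratum at first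
  order: at a triple root the double critical point splits at the rate of the square root of
  \<open>s\<close>, at two double roots the two critical values separate linearly.\<close>

definition transversal :: "bool \<Rightarrow> complex \<Rightarrow> complex \<Rightarrow> complex poly \<Rightarrow> bool" where
  "transversal b u v W \<longleftrightarrow> (if b then poly (crit e W) u \<noteq> 0 else cv e W u \<noteq> cv e W v)"

lemma coeff_lin_1 [simp]: "coeff (lin u) (Suc 0) = 1"
  by (simp add: lin_def)

lemma roots_split:
  assumes "roots_of a y"
  shows "N a = lin (y (\<nu> - 2)) * lin (y (\<nu> - 1)) * Polynomial.smult (of_nat k) (\<Prod>i<\<nu> - 2. [:- y i, 1:])"
  by (rule roots_split_pair[OF _ assms]) (use nu3 in simp)

lemma roots_dvd: "roots_of a y \<Longrightarrow> lin (y (\<nu> - 2)) * lin (y (\<nu> - 1)) dvd N a"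
  using roots_split[of a y] by (metis dvd_triv_left)

text \<open>The quotient of the double discriminant by the power of \<open>s\<close> converges in
  any case, which gives the inequality. For the equality the limit has to be nonzero, and this
  involves all other differences of critical values.\<close>

theorem order_special:
  assumes sp: "sp b a u v Q" and y: "roots_of a y" "y (\<nu> - 2) = u" "y (\<nu> - 1) = v"
    and F: "lp a w (D_tilde n k) \<noteq> 0"
    and tr: "b \<Longrightarrow> poly (crit e (Wp w)) u \<noteq> 0"
  shows "strat_ord b \<le> order 0 (lp a w (D_tilde n k))"
    "nice a y \<Longrightarrow> transversal b u v (Wp w) \<Longrightarrow> order 0 (lp a w (D_tilde n k)) = strat_ord b"
proof -
  define s0 where "s0 l = (1 / of_nat (Suc l) :: complex)" for l
  have s00: "s0 \<longlonglongrightarrow> 0" unfolding s0_def using LIMSEQ_Suc[OF lim_1_over_n[where 'a = complex]] by simp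
  define q0 where "q0 l i = a i + s0 l * w i" for l i
  have q0: "(\<lambda>l. q0 l i) \<longlonglongrightarrow> a i" for i
    using tendsto_add[OF tendsto_const tendsto_mult[OF s00 tendsto_const], of "a i" "w i"] by (simp add: q0_def)
  have k0: "(of_nat k :: complex) \<noteq> 0" using k1 by simp
  obtain r ys where r: "strict_mono (r :: nat \<Rightarrow> nat)" and ys: "\<And>l. roots_of (q0 (r l)) (ys l)" 
    and ysl: "\<And>i. i < \<nu> \<Longrightarrow> (\<lambda>l. ys l i) \<longlonglongrightarrow> y i"
    using root_subsequence_to[OF pconv_crit[OF pconv_P_at[OF q0]] degree_crit lead_coeff_crit k0 y(1)] by blast
  define q where "q l = q0 (r l)" for l
  define s where "s l = s0 (r l)" for l
  have q: "(\<lambda>l. q l i) \<longlonglongrightarrow> a i" for i unfolding q_def using LIMSEQ_subseq_LIMSEQ[OF q0 r] by (simp add: o_def)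
  have s: "s l \<noteq> 0" "s \<longlonglongrightarrow> 0" for l
    unfolding s_def using LIMSEQ_subseq_LIMSEQ[OF s00 r] by (simp_all add: o_def s0_def del: of_nat_Suc)
  have ql: "q l = (\<lambda>i. a i + s l * w i)" for l by (rule ext) (simp add: q_def q0_def s_def)
  have Pq: "P_at n (q l) = P_at n a + Polynomial.smult (s l) (Wp w)" for l unfolding ql by (rule P_at_line)
  have roots: "roots_of (q l) (ys l)" for l using ys by (simp add: q_def)
  have ok: "ok a" using sp by (simp add: sp_def)
  have idx: "\<nu> - 2 < \<nu>" "\<nu> - 1 < \<nu>" using nu3 by auto
  have yu: "(\<lambda>l. ys l (\<nu> - 2)) \<longlonglongrightarrow> u" and yv: "(\<lambda>l. ys l (\<nu> - 1)) \<longlonglongrightarrow> v" using ysl[OF idx(1)] ysl[OF idx(2)] y by simp_all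
  have root: "poly (N a) u = 0" "poly (N a) v = 0" by (rule sp_root[OF sp])+
  have ue: "e = 0 \<or> u \<noteq> 0" and ve: "e = 0 \<or> v \<noteq> 0" using root_nonzero[OF root(1) ok] root_nonzero[OF root(2) ok] by auto
  have "\<exists>\<Gamma>. (\<lambda>l. (cva (q l) (ys l (\<nu> - 1)) - cva (q l) (ys l (\<nu> - 2))) ^ 2 / s l ^ strat_ord b) \<longlonglongrightarrow> \<Gamma> \<and>
     (transversal b u v (Wp w) \<longrightarrow> \<Gamma> \<noteq> 0)"
  proof (cases b)
    case False
    have sp': "sp False a u v Q" using sp False by simp
    have A: "(\<lambda>l. (cv e (P_at n (q l)) (x l) - cva a z) / s l) \<longlonglongrightarrow> cv e (Wp w) z"
      if x: "x \<longlonglongrightarrow> z" "\<And>l. poly (N (q l)) (x l) = 0" "poly (N a) z = 0" "poly (pderiv (N a)) z \<noteq> 0" "e = 0 \<or> z \<noteq> 0" for x z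
      by (rule critical_value_speed[OF Pq pconv_const degree_Wp s x])
    have "(\<lambda>l. (cva (q l) (ys l (\<nu> - 2)) - cva a u) / s l) \<longlonglongrightarrow> cv e (Wp w) u"
      by (rule A[OF yu _ root(1) sp_simple_root(1)[OF sp'] ue]) (rule poly_crit_root[OF roots idx(1)])
    moreover have "(\<lambda>l. (cva (q l) (ys l (\<nu> - 1)) - cva a v) / s l) \<longlonglongrightarrow> cv e (Wp w) v"
      by (rule A[OF yv _ root(2) sp_simple_root(2)[OF sp'] ve]) (rule poly_crit_root[OF roots idx(2)])
    ultimately have "(\<lambda>l. ((cva (q l) (ys l (\<nu> - 1)) - cva a v) / s l - (cva (q l) (ys l (\<nu> - 2)) - cva a u) / s l) ^ 2)
       \<longlonglongrightarrow> (cv e (Wp w) v - cv e (Wp w) u) ^ 2" by (intro tendsto_power tendsto_diff)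
    then have "(\<lambda>l. (cva (q l) (ys l (\<nu> - 1)) - cva (q l) (ys l (\<nu> - 2))) ^ 2 / s l ^ 2) \<longlonglongrightarrow> (cv e (Wp w) v - cv e (Wp w) u) ^ 2"
      by (simp add: sp_cv[OF sp] diff_divide_distrib[symmetric] power_divide)
    then show ?thesis using False by (intro exI[of _ "(cv e (Wp w) v - cv e (Wp w) u) ^ 2"]) (auto simp: strat_ord_def transversal_def)
  next
    case True
    have uv: "v = u" and pu: "P_at n a = [:- u, 1:] ^ 3 * Q" and Qu: "poly Q u \<noteq> 0"
      using sp True by (auto simp: sp_def lin_def)
    let ?S = "spS b u v Q"
    define S' where "S' l = Polynomial.smult (of_nat k) (\<Prod>i<\<nu> - 2. [:- ys l i, 1:])" for l
    define S where "S = Polynomial.smult (of_nat k) (\<Prod>i<\<nu> - 2. [:- y i, 1:])"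
    have NS': "N (q l) = [:- ys l (\<nu> - 2), 1:] * [:- ys l (\<nu> - 1), 1:] * S' l" for l
      using roots_split[OF roots[of l]] unfolding S'_def lin_def .
    have NS: "N a = [:- u, 1:] ^ 2 * S"
      using roots_split[OF y(1)] y(2,3) unfolding S_def power2_eq_square uv lin_def by simp
    have "S = ?S"
    proof -
      have "lin u * lin u * ?S = lin u * lin u * S"
        using NS sp_crit[OF sp] unfolding uv by (simp add: lin_def power2_eq_square)
      then show ?thesis by (simp only: mult_cancel_left mult_eq_0_iff lin_nonzero simp_thms)
    qed
    then have Su: "poly S u \<noteq> 0" using sp_S_nonzero(1)[OF sp] by simp
    have "pconv S' S" unfolding S'_def S_def
      by (intro pconv_smult tendsto_const pconv_prod pconv_linear ysl) simp
    have dS': "degree (S' l) \<le> \<nu> - 2" for l unfolding S'_def by (rule order_trans[OF degree_smult_le]) (simp add: prod_linear_simps)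
    have Nl: "N a + Polynomial.smult (s l) (crit e (Wp w)) = [:- ys l (\<nu> - 2), 1:] * [:- ys l (\<nu> - 1), 1:] * S' l" for l
      unfolding NS'[symmetric] Pq crit_add crit_smult ..
    define g where "g = - 4 * poly (crit e (Wp w)) u / poly S u"
    have split: "(\<lambda>l. (ys l (\<nu> - 1) - ys l (\<nu> - 2)) ^ 2 / s l) \<longlonglongrightarrow> g"
      unfolding g_def by (rule splitting_double_root[OF NS Su Nl \<open>pconv S' S\<close> dS' s])
    have dvd: "[:- ys l (\<nu> - 2), 1:] * [:- ys l (\<nu> - 1), 1:] dvd N (q l)" for l
      unfolding NS' by (rule dvd_triv_left)
    have dP: "degree (P_at n (q l)) \<le> n" for l by simp
    obtain H where H: "H \<longlonglongrightarrow> - poly Q u / (2 * u ^ e)"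
      "eventually (\<lambda>l. cva (q l) (ys l (\<nu> - 1)) - cva (q l) (ys l (\<nu> - 2)) = (ys l (\<nu> - 1) - ys l (\<nu> - 2)) ^ 3 * H l) sequentially"
      using merging_critical_values[OF pconv_P_at[OF q] dP pu ue yu yv[unfolded uv] dvd] by blast
    define h where "h = - poly Q u / (2 * u ^ e)"
    have "(\<lambda>l. ((ys l (\<nu> - 1) - ys l (\<nu> - 2)) ^ 2 / s l) ^ 3 * H l ^ 2) \<longlonglongrightarrow> g ^ 3 * h ^ 2"
      unfolding h_def by (intro tendsto_mult tendsto_power split H(1))
    moreover have "((x ^ 2 / t) ^ 3 * z ^ 2) = (x ^ 3 * z) ^ 2 / t ^ 3" for x t z :: complex
      by (simp add: power_divide power_mult_distrib flip: power_mult)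
    ultimately have "(\<lambda>l. ((ys l (\<nu> - 1) - ys l (\<nu> - 2)) ^ 3 * H l) ^ 2 / s l ^ 3) \<longlonglongrightarrow> g ^ 3 * h ^ 2" by simp
    then have "(\<lambda>l. (cva (q l) (ys l (\<nu> - 1)) - cva (q l) (ys l (\<nu> - 2))) ^ 2 / s l ^ 3) \<longlonglongrightarrow> g ^ 3 * h ^ 2"
      by (rule Lim_transform_eventually) (rule eventually_mono[OF H(2)], simp)
    moreover have "g \<noteq> 0" using tr True Su by (simp add: g_def)
    moreover have "h \<noteq> 0" using Qu ue by (auto simp: h_def)
    ultimately show ?thesis using True by (intro exI[of _ "g ^ 3 * h ^ 2"]) (simp add: strat_ord_def)
  qed
  then obtain \<Gamma> where \<Gamma>: "(\<lambda>l. (cva (q l) (ys l (\<nu> - 1)) - cva (q l) (ys l (\<nu> - 2))) ^ 2 / s l ^ strat_ord b) \<longlonglongrightarrow> \<Gamma>"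
     "transversal b u v (Wp w) \<Longrightarrow> \<Gamma> \<noteq> 0" by blast
  obtain L where L: "(\<lambda>l. eval_mpoly (q l) (D_tilde n k) / s l ^ strat_ord b) \<longlonglongrightarrow> L" "\<Gamma> \<noteq> 0 \<Longrightarrow> nice a y \<Longrightarrow> L \<noteq> 0"
    using special_pair_limit[OF q roots ysl y(1) ok \<Gamma>(1)] by blast
  have "(\<lambda>l. poly (lp a w (D_tilde n k)) (s l) / s l ^ strat_ord b) \<longlonglongrightarrow> L" using L(1) by (simp add: poly_lp ql)
  note order_limit[OF F s this]
  then show "strat_ord b \<le> order 0 (lp a w (D_tilde n k))"
    "nice a y \<Longrightarrow> transversal b u v (Wp w) \<Longrightarrow> order 0 (lp a w (D_tilde n k)) = strat_ord b"
    using L(2) \<Gamma>(2) by auto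
qed

text \<open>Near a nice point the other critical values remain distinct, so the special pair must
  have equal values. At two double roots its critical points remain distinct. At a triple root they
  must coincide, since by \<open>merging_critical_values\<close> their values differ by a nonzero
  multiple of the cube of their distance. \<open>pair_in_V\<close> then identifies the
  stratum.\<close>

theorem nearby_special:
  assumes sp: "sp b a u v Q" and y: "roots_of a y" "y (\<nu> - 2) = u" "y (\<nu> - 1) = v" and nice: "nice a y"
    and q0: "\<And>i. (\<lambda>l. q0 l i) \<longlonglongrightarrow> a i" "\<And>l. eval_mpoly (q0 l) (D_tilde n k) = 0"
  shows "\<exists>l. q0 l \<in> (if b then VS else VM)"
proof -
  have k0: "(of_nat k :: complex) \<noteq> 0" using k1 by simp
  obtain r ys where r: "strict_mono (r :: nat \<Rightarrow> nat)" and roots: "\<And>l. roots_of (q0 (r l)) (ys l)" 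
    and ysl: "\<And>i. i < \<nu> \<Longrightarrow> (\<lambda>l. ys l i) \<longlonglongrightarrow> y i"
    using root_subsequence_to[OF pconv_crit[OF pconv_P_at[OF q0(1)]] degree_crit lead_coeff_crit k0 y(1)] by blast
  define q where "q l = q0 (r l)" for l
  have q: "(\<lambda>l. q l i) \<longlonglongrightarrow> a i" for i unfolding q_def using LIMSEQ_subseq_LIMSEQ[OF q0(1) r] by (simp add: o_def)
  have roots: "roots_of (q l) (ys l)" for l using roots by (simp add: q_def)
  have ok: "ok a" using sp by (simp add: sp_def)
  have idx: "\<nu> - 2 < \<nu>" "\<nu> - 1 < \<nu>" "\<nu> - 2 \<noteq> \<nu> - 1" using nu3 by auto
  have yu: "(\<lambda>l. ys l (\<nu> - 2)) \<longlonglongrightarrow> u" and yv: "(\<lambda>l. ys l (\<nu> - 1)) \<longlonglongrightarrow> v" using ysl[OF idx(1)] ysl[OF idx(2)] y by simp_all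
  have root: "poly (N a) u = 0" "poly (N a) v = 0" by (rule sp_root[OF sp])+
  have ue: "e = 0 \<or> u \<noteq> 0" using root_nonzero[OF root(1) ok] by auto
  have cvl: "(\<lambda>l. cva (q l) (ys l i)) \<longlonglongrightarrow> cva a (y i)" if "i < \<nu>" for i
    using root_nonzero[OF poly_crit_root[OF y(1) that] ok] by (intro tendsto_cva q ysl that) auto
  have "eventually (\<lambda>l. \<forall>p\<in>pairs. cva (q l) (ys l (fst p)) \<noteq> cva (q l) (ys l (snd p))) sequentially"
  proof (intro eventually_ball_finite finite_pairs ballI)
    fix p assume p: "p \<in> pairs"
    then have lt: "fst p < \<nu>" "snd p < \<nu>" by (auto simp: pairs_def)
    have "cva a (y (fst p)) - cva a (y (snd p)) \<noteq> 0" using nice p by (auto simp: nice_def)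
    from tendsto_imp_eventually_ne[OF tendsto_diff[OF cvl[OF lt(1)] cvl[OF lt(2)]] this]
    show "eventually (\<lambda>l. cva (q l) (ys l (fst p)) \<noteq> cva (q l) (ys l (snd p))) sequentially"
      by (auto elim: eventually_mono)
  qed
  moreover have "eventually (\<lambda>l. ok (q l)) sequentially" by (rule eventually_ok[OF q ok])
  moreover have "eventually (\<lambda>l. cva (q l) (ys l (\<nu> - 2)) = cva (q l) (ys l (\<nu> - 1)) \<longrightarrow>
      (if b then ys l (\<nu> - 2) = ys l (\<nu> - 1) else ys l (\<nu> - 2) \<noteq> ys l (\<nu> - 1))) sequentially"
  proof (cases b)
    case False
    then have "u - v \<noteq> 0" using sp by (simp add: sp_def)
    from tendsto_imp_eventually_ne[OF tendsto_diff[OF yu yv] this] False show ?thesis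
      by (auto elim: eventually_mono)
  next
    case True
    have uv: "v = u" and pu: "P_at n a = [:- u, 1:] ^ 3 * Q" and Qu: "poly Q u \<noteq> 0"
      using sp True by (auto simp: sp_def lin_def)
    have dvd: "[:- ys l (\<nu> - 2), 1:] * [:- ys l (\<nu> - 1), 1:] dvd N (q l)" for l
      using roots_dvd[OF roots] by (simp add: lin_def)
    have dP: "degree (P_at n (q l)) \<le> n" for l by simp
    obtain H where H: "H \<longlonglongrightarrow> - poly Q u / (2 * u ^ e)"
      "eventually (\<lambda>l. cva (q l) (ys l (\<nu> - 1)) - cva (q l) (ys l (\<nu> - 2)) = (ys l (\<nu> - 1) - ys l (\<nu> - 2)) ^ 3 * H l) sequentially"
      using merging_critical_values[OF pconv_P_at[OF q] dP pu ue yu yv[unfolded uv] dvd] by blast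
    have "- poly Q u / (2 * u ^ e) \<noteq> 0" using Qu ue by auto
    from H(2) tendsto_imp_eventually_ne[OF H(1) this] show ?thesis
      by eventually_elim (auto simp: True)
  qed
  ultimately have "eventually (\<lambda>l. (\<forall>p\<in>pairs. cva (q l) (ys l (fst p)) \<noteq> cva (q l) (ys l (snd p))) \<and> ok (q l) \<and> 
     (cva (q l) (ys l (\<nu> - 2)) = cva (q l) (ys l (\<nu> - 1)) \<longrightarrow>
      (if b then ys l (\<nu> - 2) = ys l (\<nu> - 1) else ys l (\<nu> - 2) \<noteq> ys l (\<nu> - 1)))) sequentially"
    by (intro eventually_conj)
  then obtain l where l: "\<And>p. p\<in>pairs \<Longrightarrow> cva (q l) (ys l (fst p)) \<noteq> cva (q l) (ys l (snd p))" "ok (q l)"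
     "cva (q l) (ys l (\<nu> - 2)) = cva (q l) (ys l (\<nu> - 1)) \<Longrightarrow>
      (if b then ys l (\<nu> - 2) = ys l (\<nu> - 1) else ys l (\<nu> - 2) \<noteq> ys l (\<nu> - 1))"
    unfolding eventually_sequentially by blast
  have "cva (q l) (ys l (\<nu> - 2)) = cva (q l) (ys l (\<nu> - 1))"
  proof (rule ccontr)
    assume ne: "cva (q l) (ys l (\<nu> - 2)) \<noteq> cva (q l) (ys l (\<nu> - 1))"
    obtain C where C: "C \<noteq> 0" "\<And>a y. ok a \<Longrightarrow> roots_of a y \<Longrightarrow> eval_mpoly a (D_tilde n k) = 
       C * a n ^ ((e - 1) * (2 * \<nu> - 1)) * (\<Prod>i<\<nu>. \<Prod>j\<in>{..<\<nu>}-{i}. cva a (y j) - cva a (y i))"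
      using eval_D_tilde by blast
    have nu2: "2 \<le> \<nu>" using nu3 by simp
    have "(\<Prod>i<\<nu>. \<Prod>j\<in>{..<\<nu>}-{i}. cva (q l) (ys l j) - cva (q l) (ys l i)) \<noteq> 0"
      unfolding prod_pairs[OF nu2, of "\<lambda>i j. cva (q l) (ys l j) - cva (q l) (ys l i)"]
      using ne l(1) finite_pairs by fastforce
    moreover have "q l n ^ ((e - 1) * (2 * \<nu> - 1)) \<noteq> 0" using l(2) e_0_iff by (auto simp: ok_def)
    ultimately have "eval_mpoly (q l) (D_tilde n k) \<noteq> 0" unfolding C(2)[OF l(2) roots] using C(1) by simp
    then show False using q0(2) by (simp add: q_def)
  qed
  from pair_in_V[OF l(2) roots idx(1,2,3) this] l(3)[OF this] have "q l \<in> (if b then VS else VM)"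
    by (auto split: if_splits)
  then show ?thesis by (auto simp: q_def)
qed

subsection \<open>Existence of generic points on the strata\<close>

text \<open>Deforming the roots of \<open>p\<close> inside a stratum realises every tangent vector
  \<open>(x - u) (x - v) (x - r)\<close>.\<close>

lemma sp_path:
  assumes sp: "sp b a u v Q" and s: "\<And>l. s l \<noteq> 0" "s \<longlonglongrightarrow> 0"
  shows "\<exists>q u' v' Q' \<delta>. eventually (\<lambda>l. sp b (q l) (u' l) (v' l) (Q' l)) sequentially \<and>
    u' \<longlonglongrightarrow> u \<and> v' \<longlonglongrightarrow> v \<and> (\<forall>l. P_at n (q l) = P_at n a + Polynomial.smult (s l) (\<delta> l)) \<and>
    pconv \<delta> (lin u * lin v * lin r) \<and> (\<forall>l. degree (\<delta> l) \<le> n)"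
proof -
  define A where "A = (if b then lin u ^ 3 else lin u ^ 2 * lin v ^ 2)"
  have pA: "P_at n a = A * Q" using sp by (auto simp: sp_def A_def)
  have "degree A + degree Q = n" "Q \<noteq> 0"
  proof -
    show "Q \<noteq> 0" using sp by (auto simp: sp_def)
    moreover have "A \<noteq> 0" by (simp add: A_def)
    ultimately show "degree A + degree Q = n" using degree_P_at[of n a] unfolding pA by (simp add: degree_mult_eq)
  qed
  have dA: "degree A = (if b then 3 else 4)" by (simp add: A_def degree_mult_eq degree_power_eq)
  have lA: "lead_coeff A = 1" unfolding A_def by (auto simp: lead_coeff_mult lead_coeff_power)
  have lQ: "lead_coeff Q = 1" using lead_coeff_P_at[of n a] unfolding pA lead_coeff_mult lA by simp
  have Qn: "poly Q u \<noteq> 0" "poly Q v \<noteq> 0" and uv: "b \<Longrightarrow> u = v" "\<not> b \<Longrightarrow> u \<noteq> v" using sp by (auto simp: sp_def)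
  \<comment> \<open>The velocities \<alpha>, \<beta> of the multiple roots are chosen such that the
    right-hand side vanishes at \<open>u\<close> and \<open>v\<close>; it is then divisible as
    required, and the quotient is the velocity \<open>Q1\<close> of the cofactor. The degree bound
    keeps the moved cofactor monic of the same degree.\<close>
  obtain \<alpha> \<beta> Q1 where Q1: "Q1 = 0 \<or> degree Q1 < degree Q"
    "if b then \<beta> = \<alpha> \<and> lin u * Q1 = lin r + ([:\<alpha>:] * Q + [:\<alpha>:] * Q + [:\<alpha>:] * Q)
     else lin u * lin v * Q1 = lin r + ([:\<alpha>:] * lin v * Q + [:\<alpha>:] * lin v * Q) + ([:\<beta>:] * lin u * Q + [:\<beta>:] * lin u * Q)"
  proof (cases b)
    case True
    define \<alpha> where "\<alpha> = - (u - r) / (3 * poly Q u)"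
    let ?Z = "lin r + ([:\<alpha>:] * Q + [:\<alpha>:] * Q + [:\<alpha>:] * Q)"
    have "3 * (\<alpha> * poly Q u) = - (u - r)" using Qn by (simp add: \<alpha>_def)
    then have "poly ?Z u = 0" by simp
    then obtain Q1 where Q1: "?Z = lin u * Q1" by (metis dvdE lin_dvd_iff)
    have dQ: "1 \<le> degree Q" using \<open>degree A + degree Q = n\<close> dA True n4 by simp
    have "degree ([:\<alpha>:] * Q) \<le> degree Q" by (simp add: degree_smult_le)
    then have "degree ?Z \<le> degree Q" using dQ by (intro degree_add_le) auto
    then have "Q1 = 0 \<or> degree Q1 < degree Q" unfolding Q1 by (cases "Q1 = 0") (auto simp: degree_mult_eq)
    then show ?thesis by (rule that[of Q1 \<alpha> \<alpha>]) (simp only: True if_True Q1 simp_thms)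
  next
    case False
    define \<alpha> where "\<alpha> = - (u - r) / (2 * ((u - v) * poly Q u))"
    define \<beta> where "\<beta> = - (v - r) / (2 * ((v - u) * poly Q v))"
    let ?Z = "lin r + ([:\<alpha>:] * lin v * Q + [:\<alpha>:] * lin v * Q) + ([:\<beta>:] * lin u * Q + [:\<beta>:] * lin u * Q)"
    have "2 * (\<alpha> * (u - v) * poly Q u) = - (u - r)" "2 * (\<beta> * (v - u) * poly Q v) = - (v - r)"
      using Qn uv False by (simp_all add: \<alpha>_def \<beta>_def)
    moreover have "poly ?Z u = (u - r) + 2 * (\<alpha> * (u - v) * poly Q u)" "poly ?Z v = (v - r) + 2 * (\<beta> * (v - u) * poly Q v)"
      unfolding poly_add poly_mult poly_lin by (simp_all add: algebra_simps)
    ultimately have "poly ?Z u = 0" "poly ?Z v = 0" by simp_all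
    then have "lin u * lin v dvd ?Z" by (rule lin_lin_dvd[OF uv(2)[OF False]])
    then obtain Q1 where Q1: "?Z = lin u * lin v * Q1" by (auto elim: dvdE)
    have "degree ([:c:] * lin x * Q) \<le> degree Q + 1" for c x
      by (rule order_trans[OF degree_mult_le]) (use degree_mult_le[of "[:c:]" "lin x"] in auto)
    then have "degree ?Z \<le> degree Q + 1" by (intro degree_add_le) auto
    then have "Q1 = 0 \<or> degree Q1 < degree Q" unfolding Q1 by (cases "Q1 = 0") (auto simp: degree_mult_eq)
    then show ?thesis by (rule that[of Q1 \<beta> \<alpha>]) (simp only: False if_False Q1)
  qed
  define u' where "u' l = u + s l * \<alpha>" for l
  define v' where "v' l = v + s l * \<beta>" for l
  define Q' where "Q' l = Q + Polynomial.smult (s l) Q1" for l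
  define p where "p l = (if b then lin (u' l) ^ 3 else lin (u' l) ^ 2 * lin (v' l) ^ 2) * Q' l" for l
  define \<delta> where "\<delta> l = (if b then 
       - [:\<alpha>:] * (lin (u' l) ^ 2 + lin (u' l) * lin u + lin u ^ 2) * Q' l + lin u ^ 3 * Q1
     else - ([:\<alpha>:] * (lin (u' l) + lin u) * lin (v' l) ^ 2 + lin u ^ 2 * ([:\<beta>:] * (lin (v' l) + lin v))) * Q' l + lin u ^ 2 * lin v ^ 2 * Q1)" for l
  have u'_lim: "u' \<longlonglongrightarrow> u" and v'_lim: "v' \<longlonglongrightarrow> v"
    using tendsto_add[OF tendsto_const tendsto_mult[OF s(2) tendsto_const], of u \<alpha>]
      tendsto_add[OF tendsto_const tendsto_mult[OF s(2) tendsto_const], of v \<beta>]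
    by (simp_all add: u'_def[abs_def] v'_def[abs_def])
  have Q'_lim: "pconv Q' Q"
    using pconv_add[OF pconv_const pconv_smult[OF s(2) pconv_const], of Q Q1] by (simp add: Q'_def[abs_def])
  have dQ': "degree (Q' l) = degree Q" "lead_coeff (Q' l) = 1" for l
  proof -
    have "degree (Polynomial.smult (s l) Q1) < degree Q \<or> Q1 = 0" using Q1(1) by (auto intro: le_less_trans[OF degree_smult_le])
    then show *: "degree (Q' l) = degree Q" unfolding Q'_def by (auto simp: degree_add_eq_left)
    have "coeff Q1 (degree Q) = 0" using Q1(1) by (auto intro: coeff_eq_0)
    then have "coeff (Q' l) (degree Q) = 1" using lQ by (simp add: Q'_def)
    then show "lead_coeff (Q' l) = 1" unfolding * .
  qed
  have "\<exists>q. P_at n q = p l" for l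
  proof -
    have "Q' l \<noteq> 0" using dQ'(2)[of l] by auto
    then have "degree (p l) = n"
      using \<open>degree A + degree Q = n\<close> dA dQ'(1)[of l] dQ'(2)[of l] unfolding p_def
      by (auto simp: degree_mult_eq degree_power_eq)
    moreover have "lead_coeff (p l) = 1"
      unfolding p_def lead_coeff_mult dQ'(2) by (auto simp: lead_coeff_mult lead_coeff_power)
    ultimately show ?thesis using P_at_surj by metis
  qed
  then obtain q where q: "\<And>l. P_at n (q l) = p l" by metis
  have lins: "lin (u' l) = lin u - [:s l:] * [:\<alpha>:]" "lin (v' l) = lin v - [:s l:] * [:\<beta>:]" and Q'': "Q' l = Q + [:s l:] * Q1" for l
    by (simp_all add: u'_def v'_def Q'_def lin_diff)
  have sm: "Polynomial.smult (s l) x = [:s l:] * x" for l x by simp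
  have Pq: "P_at n (q l) = P_at n a + Polynomial.smult (s l) (\<delta> l)" for l
    unfolding q p_def pA A_def \<delta>_def sm Q''
    using perturbed_cube[OF lins(1)] perturbed_squares[OF lins] by (cases b) (simp_all only: if_True if_False)
  have \<delta>_lim: "pconv \<delta> (lin u * lin v * lin r)"
  proof (cases b)
    case True
    have "pconv (\<lambda>l. - [:\<alpha>:] * (lin (u' l) ^ 2 + lin (u' l) * lin u + lin u ^ 2) * Q' l + lin u ^ 3 * Q1)
      (- [:\<alpha>:] * (lin u ^ 2 + lin u * lin u + lin u ^ 2) * Q + lin u ^ 3 * Q1)"
      by (intro pconv_add pconv_mult pconv_const pconv_power Q'_lim pconv_lin u'_lim)
    also have "- [:\<alpha>:] * (lin u ^ 2 + lin u * lin u + lin u ^ 2) * Q + lin u ^ 3 * Q1 = lin u * lin u * lin r"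
      by (rule tangent_cube) (use Q1(2) True in \<open>simp only: if_True\<close>)
    finally show ?thesis using True uv by (simp add: \<delta>_def[abs_def])
  next
    case False
    have "pconv (\<lambda>l. 0 - ([:\<alpha>:] * (lin (u' l) + lin u) * lin (v' l) ^ 2 + lin u ^ 2 * ([:\<beta>:] * (lin (v' l) + lin v))) * Q' l + lin u ^ 2 * lin v ^ 2 * Q1)
      (0 - ([:\<alpha>:] * (lin u + lin u) * lin v ^ 2 + lin u ^ 2 * ([:\<beta>:] * (lin v + lin v))) * Q + lin u ^ 2 * lin v ^ 2 * Q1)"
      by (intro pconv_add pconv_diff pconv_mult pconv_const pconv_power Q'_lim pconv_lin u'_lim v'_lim)
    also have "0 - ([:\<alpha>:] * (lin u + lin u) * lin v ^ 2 + lin u ^ 2 * ([:\<beta>:] * (lin v + lin v))) * Q + lin u ^ 2 * lin v ^ 2 * Q1 = 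
       - ([:\<alpha>:] * (lin u + lin u) * lin v ^ 2 + lin u ^ 2 * ([:\<beta>:] * (lin v + lin v))) * Q + lin u ^ 2 * lin v ^ 2 * Q1" by (simp only: diff_0 mult_minus_left)
    also have "\<dots> = lin u * lin v * lin r"
      by (rule tangent_squares) (use Q1(2) False in \<open>simp only: if_False\<close>)
    finally show ?thesis unfolding \<delta>_def[abs_def] if_not_P[OF False] by (simp only: diff_0 mult_minus_left)
  qed
  have "degree (\<delta> l) \<le> n" for l
  proof -
    have "\<delta> l = Polynomial.smult (1 / s l) (P_at n (q l) - P_at n a)" using s(1)[of l] unfolding Pq by simp
    moreover have "degree (P_at n (q l) - P_at n a) \<le> n" by (intro degree_diff_le) simp_all
    ultimately show ?thesis using degree_smult_le order_trans by metis
  qed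
  moreover have "eventually (\<lambda>l. sp b (q l) (u' l) (v' l) (Q' l)) sequentially"
  proof -
    have q_lim: "(\<lambda>l. q l n) \<longlonglongrightarrow> a n"
    proof -
      have "(\<lambda>l. coeff (P_at n a) 0 + s l * coeff (\<delta> l) 0) \<longlonglongrightarrow> coeff (P_at n a) 0 + 0 * coeff (lin u * lin v * lin r) 0"
        using \<delta>_lim unfolding pconv_def by (intro tendsto_intros s(2)) auto
      then have "(\<lambda>l. coeff (P_at n (q l)) 0) \<longlonglongrightarrow> coeff (P_at n a) 0" unfolding Pq by simp
      then show ?thesis using n4 by (simp add: coeff_P_at)
    qed
    have "ok a" using sp by (simp add: sp_def)
    then have "eventually (\<lambda>l. ok (q l)) sequentially"
      using tendsto_imp_eventually_ne[OF q_lim] unfolding ok_def by (cases "k = n") (auto elim: eventually_mono)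
    moreover have "degree (Q' l) \<le> degree Q" for l using dQ' by simp
    note tendsto_imp_eventually_ne[OF tendsto_poly_pconv[OF Q'_lim this u'_lim] Qn(1)]
      tendsto_imp_eventually_ne[OF tendsto_poly_pconv[OF Q'_lim this v'_lim] Qn(2)]
    moreover have "eventually (\<lambda>l. if b then u' l = v' l else u' l \<noteq> v' l) sequentially"
    proof (cases b)
      case True
      then show ?thesis using uv Q1(2) by (simp add: u'_def v'_def)
    next
      case False
      then have "u - v \<noteq> 0" using uv by simp
      from tendsto_imp_eventually_ne[OF tendsto_diff[OF u'_lim v'_lim] this] False show ?thesis
        by (auto elim: eventually_mono)
    qed
    ultimately show ?thesis
      by eventually_elim (auto simp: sp_def q p_def)
  qed
  ultimately show ?thesis using u'_lim v'_lim Pq \<delta>_lim by blast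
qed

text \<open>Adds to the deformation a numbering of the critical points that converges and keeps the
  special ones at the last two indices throughout.\<close>

lemma sp_path_roots:
  assumes sp: "sp b a u v Q"
  shows "\<exists>q u' v' Q' ys s \<delta> y. (\<forall>l. sp b (q l) (u' l) (v' l) (Q' l)) \<and> (\<forall>l. roots_of (q l) (ys l)) \<and>
    (\<forall>l. ys l (\<nu> - 2) = u' l) \<and> (\<forall>l. ys l (\<nu> - 1) = v' l) \<and> (\<forall>l. s l \<noteq> 0) \<and> s \<longlonglongrightarrow> 0 \<and>
    (\<forall>l. P_at n (q l) = P_at n a + Polynomial.smult (s l) (\<delta> l)) \<and>
    pconv \<delta> (lin u * lin v * lin r) \<and> (\<forall>l. degree (\<delta> l) \<le> n) \<and>
    (\<forall>i<\<nu>. (\<lambda>l. ys l i) \<longlonglongrightarrow> y i) \<and> roots_of a y \<and> y (\<nu> - 2) = u \<and> y (\<nu> - 1) = v"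
proof -
  define s0 where "s0 l = (1 / of_nat (Suc l) :: complex)" for l
  have s00: "s0 \<longlonglongrightarrow> 0" unfolding s0_def using LIMSEQ_Suc[OF lim_1_over_n[where 'a = complex]] by simp
  have s0n: "s0 l \<noteq> 0" for l by (simp add: s0_def del: of_nat_Suc)
  obtain q0 u0 v0 Q0 \<delta>0 where "eventually (\<lambda>l. sp b (q0 l) (u0 l) (v0 l) (Q0 l)) sequentially"
    "u0 \<longlonglongrightarrow> u" "v0 \<longlonglongrightarrow> v" "\<forall>l. P_at n (q0 l) = P_at n a + Polynomial.smult (s0 l) (\<delta>0 l)"
    "pconv \<delta>0 (lin u * lin v * lin r)" "\<forall>l. degree (\<delta>0 l) \<le> n"
    using sp_path[OF sp s0n s00, where r = r] by (elim exE conjE) (rule that; assumption)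
  note p = this[rule_format]
  obtain M where M: "\<And>l. l \<ge> M \<Longrightarrow> sp b (q0 l) (u0 l) (v0 l) (Q0 l)" using p(1) unfolding eventually_sequentially by blast
  have "\<forall>l. \<exists>y. roots_of (q0 (l + M)) y \<and> y (\<nu> - 2) = u0 (l + M) \<and> y (\<nu> - 1) = v0 (l + M)"
  proof
    fix l
    have "sp b (q0 (l + M)) (u0 (l + M)) (v0 (l + M)) (Q0 (l + M))" by (rule M) simp
    then show "\<exists>y. roots_of (q0 (l + M)) y \<and> y (\<nu> - 2) = u0 (l + M) \<and> y (\<nu> - 1) = v0 (l + M)"
      by (rule sp_roots) blast
  qed
  then obtain zs where zs: "\<forall>l. roots_of (q0 (l + M)) (zs l) \<and> zs l (\<nu> - 2) = u0 (l + M) \<and> zs l (\<nu> - 1) = v0 (l + M)"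
    by (rule choice[THEN exE])
  have k0: "(of_nat k :: complex) \<noteq> 0" using k1 by simp
  have "pconv (\<lambda>l. P_at n (q0 l)) (P_at n a + Polynomial.smult 0 (lin u * lin v * lin r))"
    unfolding p(4) by (intro pconv_add pconv_const pconv_smult s00 p(5))
  then have "pconv (\<lambda>l. N (q0 l)) (N a)" by (intro pconv_crit) simp
  then have "pconv (\<lambda>l. N (q0 (l + M))) (N a)" by (rule pconv_subseq) (simp add: strict_mono_def)
  then obtain t y where t: "strict_mono (t :: nat \<Rightarrow> nat)" "\<And>i. i < \<nu> \<Longrightarrow> (\<lambda>l. zs (t l) i) \<longlonglongrightarrow> y i" "roots_of a y"
    using root_subsequence[of "\<lambda>l. N (q0 (l + M))" "N a" "of_nat k" zs \<nu>] zs k0 by blast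
  define h where "h l = t l + M" for l
  have h: "strict_mono h" using t(1) by (simp add: h_def strict_mono_def)
  have idx: "\<nu> - 2 < \<nu>" "\<nu> - 1 < \<nu>" using nu3 by auto
  have zu: "zs (t l) (\<nu> - 2) = u0 (h l)" and zv: "zs (t l) (\<nu> - 1) = v0 (h l)" for l using zs by (auto simp: h_def)
  have "y (\<nu> - 2) = u" "y (\<nu> - 1) = v"
    using LIMSEQ_unique[OF t(2)[OF idx(1), unfolded zu] LIMSEQ_subseq_LIMSEQ[OF p(2) h, unfolded o_def]]
      LIMSEQ_unique[OF t(2)[OF idx(2), unfolded zv] LIMSEQ_subseq_LIMSEQ[OF p(3) h, unfolded o_def]] .
  moreover have "sp b (q0 (h l)) (u0 (h l)) (v0 (h l)) (Q0 (h l))" for l by (rule M) (simp add: h_def)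
  moreover have "roots_of (q0 (h l)) (zs (t l))" for l using zs by (auto simp: h_def)
  moreover have "(\<lambda>l. s0 (h l)) \<longlonglongrightarrow> 0" using LIMSEQ_subseq_LIMSEQ[OF s00 h] by (simp add: o_def)
  moreover have "pconv (\<lambda>l. \<delta>0 (h l)) (lin u * lin v * lin r)" by (rule pconv_subseq[OF p(5) h])
  ultimately show ?thesis
    by (intro exI[of _ "\<lambda>l. q0 (h l)"] exI[of _ "\<lambda>l. u0 (h l)"] exI[of _ "\<lambda>l. v0 (h l)"] exI[of _ "\<lambda>l. Q0 (h l)"]
      exI[of _ "\<lambda>l. zs (t l)"] exI[of _ "\<lambda>l. s0 (h l)"] exI[of _ "\<lambda>l. \<delta>0 (h l)"] exI[of _ y] conjI allI impI zu zv s0n p(4,6) t(2,3))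
qed

lemma finite_affine_zeros:
  fixes A B :: complex assumes "A \<noteq> 0 \<or> B \<noteq> 0" shows "finite {r. A + r * B = 0}"
proof (cases "B = 0")
  case False
  have "{r. A + r * B = 0} \<subseteq> {- A / B}"
  proof
    fix r assume "r \<in> {r. A + r * B = 0}"
    then have "r * B = - A" by (simp add: eq_neg_iff_add_eq_0 add.commute)
    then show "r \<in> {- A / B}" using False by (metis nonzero_mult_div_cancel_right singletonI)
  qed
  then show ?thesis by (rule finite_subset) simp
qed (use assms in simp)

lemma roots_double:
  assumes y: "roots_of a y" and ij: "i < \<nu>" "j < \<nu>" "i \<noteq> j" "y i = y j"
  shows "poly (pderiv (N a)) (y i) = 0"
  unfolding pderiv_root_product[OF y ij(1)] using ij by (auto intro!: prod_zero)

lemma finite_crit_roots: "finite {x. poly (N a) x = 0}"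
  using lead_coeff_crit[of a] k1 by (intro poly_roots_finite) auto

lemma pairs_special:
  assumes sp: "sp b a u v Q" and y: "roots_of a y" "y (\<nu> - 2) = u" "y (\<nu> - 1) = v" and p: "(i, j) \<in> pairs"
  shows "i < \<nu>" "j < \<nu>" "i \<noteq> j" "\<not> (y i \<in> {u, v} \<and> y j \<in> {u, v})"
  using p special_not_root[OF sp y] by (auto simp: pairs_def)

text \<open>For all but finitely many \<open>r\<close>, the tangent vector
  \<open>(x - u) (x - v) (x - r)\<close> changes \<open>crit\<close> to first order at every other
  critical point, and a multiple root disturbed in this way splits into simple ones.\<close>

lemma exists_simple:
  assumes sp: "sp b a u v Q"
  obtains a' u' v' Q' where "sp b a' u' v' Q'"
    "\<And>\<eta>. poly (N a') \<eta> = 0 \<Longrightarrow> \<eta> \<noteq> u' \<Longrightarrow> \<eta> \<noteq> v' \<Longrightarrow> poly (pderiv (N a')) \<eta> \<noteq> 0"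
proof -
  have ok: "ok a" using sp by (simp add: sp_def)
  define Z where "Z = {x. poly (N a) x = 0} - {u, v}"
  have fin: "finite {r. poly (crit e (lin u * lin v * lin r)) \<eta> = 0}" if "\<eta> \<in> Z" for \<eta>
  proof -
    let ?\<kappa> = "poly (crit e (lin u * lin v)) \<eta>" and ?A = "X \<eta> * ((\<eta> - u) * (\<eta> - v))"
    \<comment> \<open>Affine in \<open>r\<close> and not identically zero: if the slope vanishes,
      the constant term is the nonzero \<open>?A\<close>.\<close>
    have eq: "poly (crit e (lin u * lin v * lin r)) \<eta> = (?A + \<eta> * ?\<kappa>) + r * (- ?\<kappa>)" for r
      unfolding mult.commute[of _ "lin r"] crit_mult[of e "lin r"] by (simp add: algebra_simps)
    have "?A \<noteq> 0" using that root_nonzero[OF _ ok, of \<eta>] by (auto simp: Z_def)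
    then show ?thesis unfolding eq by (intro finite_affine_zeros) auto
  qed
  have "finite (\<Union>\<eta>\<in>Z. {r. poly (crit e (lin u * lin v * lin r)) \<eta> = 0})"
    using fin finite_crit_roots[of a] by (intro finite_UN_I) (auto simp: Z_def)
  then obtain r where r: "\<And>\<eta>. \<eta> \<in> Z \<Longrightarrow> poly (crit e (lin u * lin v * lin r)) \<eta> \<noteq> 0"
    using ex_new_if_finite[OF infinite_UNIV_char_0] by blast
  obtain q u' v' Q' ys s \<delta> y where "\<forall>l. sp b (q l) (u' l) (v' l) (Q' l)" "\<forall>l. roots_of (q l) (ys l)"
    "\<forall>l. ys l (\<nu> - 2) = u' l" "\<forall>l. ys l (\<nu> - 1) = v' l" "\<forall>l. s l \<noteq> 0" "s \<longlonglongrightarrow> 0"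
    "\<forall>l. P_at n (q l) = P_at n a + Polynomial.smult (s l) (\<delta> l)"
    "pconv \<delta> (lin u * lin v * lin r)" "\<forall>l. degree (\<delta> l) \<le> n"
    "\<forall>i<\<nu>. (\<lambda>l. ys l i) \<longlonglongrightarrow> y i" "roots_of a y" "y (\<nu> - 2) = u" "y (\<nu> - 1) = v"
    using sp_path_roots[OF sp, of r] by (elim exE conjE) (rule that; assumption)
  note q = this[rule_format]
  have "eventually (\<lambda>l. ys l i \<noteq> ys l j) sequentially" if p: "(i, j) \<in> pairs" for i j
  proof -
    note ps = pairs_special[OF sp q(11-13) p]
    show ?thesis
    proof (cases "y i = y j")
      case False
      then have "y i - y j \<noteq> 0" by simp
      from tendsto_imp_eventually_ne[OF tendsto_diff[OF q(10)[OF ps(1)] q(10)[OF ps(2)]] this]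
      show ?thesis by (auto elim: eventually_mono)
    next
      case True
      define \<eta> where "\<eta> = y i"
      have \<eta>: "\<eta> \<in> Z" using ps True poly_crit_root[OF q(11) ps(1)] by (auto simp: Z_def \<eta>_def)
      have N0: "N a \<noteq> 0" using lead_coeff_crit[of a] k1 by auto
      obtain g where g: "N a = [:- \<eta>, 1:] ^ order \<eta> (N a) * g" "\<not> [:- \<eta>, 1:] dvd g" using order_decomp[OF N0, of \<eta>] by blast
      define m where "m = order \<eta> (N a)"
      have Ng: "N a = lin \<eta> ^ m * g" using g(1) by (simp add: lin_def m_def)
      have g0: "poly g \<eta> \<noteq> 0" using g(2) lin_dvd_iff[of \<eta> g] by (simp add: lin_def)
      have m0: "m \<noteq> 0" using \<eta> N0 order_root[of "N a" \<eta>] by (auto simp: Z_def m_def)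
      define A where "A = Polynomial.smult (of_nat m) g + lin \<eta> * pderiv g"
      \<comment> \<open>The logarithmic derivative of \<open>lin \<eta> ^ m * g\<close>, cleared of
        denominators. At a double zero of the perturbed polynomial, \<open>N a\<close> and its
        derivative are \<open>- s l\<close> times values of the perturbation and its derivative;
        inserted here, \<open>s l\<close> cancels, and the result contradicts a nonzero
        limit.\<close>
      have id: "N a * A = lin \<eta> * g * pderiv (N a)"
      proof -
        obtain m' where m': "m = Suc m'" using m0 by (cases m) auto
        have "pderiv (N a) = lin \<eta> ^ m' * A"
          unfolding Ng m' pderiv_mult pderiv_power_Suc pderiv_lin A_def by (simp add: algebra_simps)
        then show ?thesis unfolding Ng m' by (simp add: mult_ac)
      qed
      define D where "D l = crit e (\<delta> l)" for l
      have Nl: "N (q l) = N a + Polynomial.smult (s l) (D l)" for l unfolding q(7) crit_add crit_smult D_def ..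
      have Dlim: "pconv D (crit e (lin u * lin v * lin r))" unfolding D_def by (rule pconv_crit[OF q(8)])
      have dD: "degree (D l) \<le> n" for l unfolding D_def by (rule degree_crit_le[OF q(9)])
      have dD': "degree (pderiv (D l)) \<le> n" for l using dD[of l] degree_pderiv_le[of "D l"] by linarith
      have yl: "(\<lambda>l. ys l i) \<longlonglongrightarrow> \<eta>" unfolding \<eta>_def by (rule q(10)[OF ps(1)])
      have "(\<lambda>l. poly (D l) (ys l i) * poly A (ys l i) - (ys l i - \<eta>) * poly g (ys l i) * poly (pderiv (D l)) (ys l i)) \<longlonglongrightarrow>
         poly (crit e (lin u * lin v * lin r)) \<eta> * poly A \<eta> - (\<eta> - \<eta>) * poly g \<eta> * poly (pderiv (crit e (lin u * lin v * lin r))) \<eta>"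
        by (intro tendsto_diff tendsto_mult tendsto_const tendsto_poly yl tendsto_poly_pconv[OF Dlim dD] tendsto_poly_pconv[OF pconv_pderiv[OF Dlim] dD'])
      moreover have "poly (crit e (lin u * lin v * lin r)) \<eta> * poly A \<eta> - (\<eta> - \<eta>) * poly g \<eta> * poly (pderiv (crit e (lin u * lin v * lin r))) \<eta> \<noteq> 0"
        using r[OF \<eta>] g0 m0 by (simp add: A_def)
      ultimately have "eventually (\<lambda>l. poly (D l) (ys l i) * poly A (ys l i) - (ys l i - \<eta>) * poly g (ys l i) * poly (pderiv (D l)) (ys l i) \<noteq> 0) sequentially"
        by (rule tendsto_imp_eventually_ne)
      then show ?thesis
      proof (rule eventually_mono, intro notI)
        fix l assume ne: "poly (D l) (ys l i) * poly A (ys l i) - (ys l i - \<eta>) * poly g (ys l i) * poly (pderiv (D l)) (ys l i) \<noteq> 0"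
          and eq: "ys l i = ys l j"
        let ?z = "ys l i"
        have "poly (N (q l)) ?z = 0" by (rule poly_crit_root[OF q(2) ps(1)])
        then have 0: "poly (N a) ?z = - s l * poly (D l) ?z" unfolding Nl by (simp add: eq_neg_iff_add_eq_0)
        have "poly (pderiv (N (q l))) ?z = 0" by (rule roots_double[OF q(2) ps(1-3) eq])
        then have 1: "poly (pderiv (N a)) ?z = - s l * poly (pderiv (D l)) ?z"
          unfolding Nl by (simp add: pderiv_add pderiv_smult eq_neg_iff_add_eq_0)
        have "- s l * poly (D l) ?z * poly A ?z = (?z - \<eta>) * poly g ?z * (- s l * poly (pderiv (D l)) ?z)"
          using arg_cong[OF id, of "\<lambda>f. poly f ?z"] unfolding poly_mult 0 1 by simp
        then have "s l * (poly (D l) ?z * poly A ?z - (?z - \<eta>) * poly g ?z * poly (pderiv (D l)) ?z) = 0"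
          by (simp add: algebra_simps)
        then show False using ne q(5)[of l] by simp
      qed
    qed
  qed
  then have "eventually (\<lambda>l. \<forall>p\<in>pairs. ys l (fst p) \<noteq> ys l (snd p)) sequentially"
    by (intro eventually_ball_finite finite_pairs) auto
  then obtain l where l: "\<forall>p\<in>pairs. ys l (fst p) \<noteq> ys l (snd p)" unfolding eventually_sequentially by blast
  have "poly (pderiv (N (q l))) \<eta> \<noteq> 0" if \<eta>: "poly (N (q l)) \<eta> = 0" "\<eta> \<noteq> u' l" "\<eta> \<noteq> v' l" for \<eta>
  proof -
    have "(\<Prod>i<\<nu>. \<eta> - ys l i) = 0" using \<eta>(1) k1 unfolding q(2) by (simp add: poly_prod)
    then obtain i where i: "i < \<nu>" "\<eta> = ys l i" by (auto simp: prod_zero_iff)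
    have "i \<noteq> \<nu> - 2" "i \<noteq> \<nu> - 1" using \<eta> i q(3)[of l] q(4)[of l] by auto
    then have "(i, j) \<in> pairs" if "j < \<nu>" "j \<noteq> i" for j using that i(1) by (auto simp: pairs_def)
    then have "\<forall>j\<in>{..<\<nu>}-{i}. ys l i - ys l j \<noteq> 0" using l by force
    then show ?thesis unfolding i(2) pderiv_root_product[OF q(2) i(1)] using k1 by (simp add: prod_zero_iff)
  qed
  with q(1)[of l] show ?thesis by (rule that)
qed

lemma exists_base: "\<exists>a u v Q. sp b a u v Q"
proof -
  define p where "p = (if b then lin 1 ^ 3 * lin 3 ^ (n - 3) else lin 1 ^ 2 * lin 2 ^ 2 * lin 3 ^ (n - 4))"
  have "degree p = n" using n4 by (auto simp: p_def degree_mult_eq degree_power_eq)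
  moreover have "lead_coeff p = 1" unfolding p_def by (auto simp: lead_coeff_mult lead_coeff_power)
  ultimately obtain a where a: "P_at n a = p" by (rule P_at_surj)
  have "a n = poly p 0" using arg_cong[OF a, of "\<lambda>f. coeff f 0"] n4 by (simp add: coeff_P_at poly_0_coeff_0)
  also have "\<dots> \<noteq> 0" by (auto simp: p_def)
  finally have "ok a" by (simp add: ok_def)
  then have "sp b a 1 (if b then 1 else 2) (lin 3 ^ (if b then n - 3 else n - 4))"
    unfolding sp_def a p_def by auto
  then show ?thesis by blast
qed

text \<open>A second deformation, from a point where all other critical points are simple. The
  values at distinct critical points \<open>x\<close> and \<open>z\<close>, not both special, move
  with speeds \<open>g x * (x - r)\<close> and \<open>g z * (z - r)\<close>, which differ for all
  but finitely many \<open>r\<close>. The special values stay 0, in accordance with the zeros of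
  \<open>g\<close> at \<open>u\<close> and \<open>v\<close>.\<close>

theorem exists_nice:
  obtains a u v Q y where "sp b a u v Q" "roots_of a y" "y (\<nu> - 2) = u" "y (\<nu> - 1) = v" "nice a y"
proof -
  obtain a u v Q where sp: "sp b a u v Q"
    and simple: "\<And>\<eta>. poly (N a) \<eta> = 0 \<Longrightarrow> \<eta> \<noteq> u \<Longrightarrow> \<eta> \<noteq> v \<Longrightarrow> poly (pderiv (N a)) \<eta> \<noteq> 0"
    using exists_base[of b] exists_simple by metis
  have ok: "ok a" using sp by (simp add: sp_def)
  define Z where "Z = {x. poly (N a) x = 0}"
  define Y where "Y = {(x, z). x \<in> Z \<and> z \<in> Z \<and> x \<noteq> z \<and> \<not> (x \<in> {u, v} \<and> z \<in> {u, v})}"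
  have fin: "finite {r. cv e (lin u * lin v * lin r) x = cv e (lin u * lin v * lin r) z}" if "(x, z) \<in> Y" for x z
  proof -
    define g where "g x = (x - u) * (x - v) / x ^ e" for x
    have cvg: "cv e (lin u * lin v * lin r) x = g x * (x - r)" for r x by (simp add: cv_def g_def)
    have gn: "g x \<noteq> 0 \<longleftrightarrow> x \<notin> {u, v}" if "x \<in> Z" for x
      using that root_nonzero[OF _ ok, of x] by (auto simp: g_def Z_def)
    have "g x \<noteq> 0 \<or> g z \<noteq> 0" "x \<noteq> z" using \<open>(x, z) \<in> Y\<close> gn by (auto simp: Y_def)
    then have "g x * x - g z * z \<noteq> 0 \<or> g z - g x \<noteq> 0" by auto
    moreover have "cv e (lin u * lin v * lin r) x = cv e (lin u * lin v * lin r) z \<longleftrightarrow> (g x * x - g z * z) + r * (g z - g x) = 0" for r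
      unfolding cvg by (simp add: algebra_simps)
    ultimately show ?thesis using finite_affine_zeros by presburger
  qed
  have "finite Y" by (rule finite_subset[of _ "Z \<times> Z"]) (use finite_crit_roots[of a] in \<open>auto simp: Y_def Z_def\<close>)
  then have "finite (\<Union>p\<in>Y. {r. cv e (lin u * lin v * lin r) (fst p) = cv e (lin u * lin v * lin r) (snd p)})"
  proof (rule finite_UN_I)
    fix p assume "p \<in> Y"
    then show "finite {r. cv e (lin u * lin v * lin r) (fst p) = cv e (lin u * lin v * lin r) (snd p)}"
      using fin[of "fst p" "snd p"] by (simp only: prod.collapse)
  qed
  from ex_new_if_finite[OF infinite_UNIV_char_0 this]
  obtain r where r0: "r \<notin> (\<Union>p\<in>Y. {r. cv e (lin u * lin v * lin r) (fst p) = cv e (lin u * lin v * lin r) (snd p)})" ..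
  have r: "cv e (lin u * lin v * lin r) x \<noteq> cv e (lin u * lin v * lin r) z" if "(x, z) \<in> Y" for x z
  proof
    assume "cv e (lin u * lin v * lin r) x = cv e (lin u * lin v * lin r) z"
    then have "r \<in> (\<Union>p\<in>Y. {r. cv e (lin u * lin v * lin r) (fst p) = cv e (lin u * lin v * lin r) (snd p)})"
      by (intro UN_I[OF that]) (simp only: fst_conv snd_conv mem_Collect_eq)
    then show False using r0 by (rule notE[rotated])
  qed
  obtain q u' v' Q' ys s \<delta> y where "\<forall>l. sp b (q l) (u' l) (v' l) (Q' l)" "\<forall>l. roots_of (q l) (ys l)"
    "\<forall>l. ys l (\<nu> - 2) = u' l" "\<forall>l. ys l (\<nu> - 1) = v' l" "\<forall>l. s l \<noteq> 0" "s \<longlonglongrightarrow> 0"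
    "\<forall>l. P_at n (q l) = P_at n a + Polynomial.smult (s l) (\<delta> l)"
    "pconv \<delta> (lin u * lin v * lin r)" "\<forall>l. degree (\<delta> l) \<le> n"
    "\<forall>i<\<nu>. (\<lambda>l. ys l i) \<longlonglongrightarrow> y i" "roots_of a y" "y (\<nu> - 2) = u" "y (\<nu> - 1) = v"
    using sp_path_roots[OF sp, of r] by (elim exE conjE) (rule that; assumption)
  note q = this[rule_format]
  let ?W = "lin u * lin v * lin r"
  have yZ: "y i \<in> Z" if "i < \<nu>" for i using poly_crit_root[OF q(11) that] by (simp add: Z_def)
  have Plim: "pconv (\<lambda>l. P_at n (q l)) (P_at n a)"
    using pconv_add[OF pconv_const pconv_smult[OF q(6,8)], of "P_at n a"] unfolding q(7) by simp
  have dP: "degree (P_at n (q l)) \<le> n" for l by simp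
  have cvl: "(\<lambda>l. cva (q l) (ys l i)) \<longlonglongrightarrow> cva a (y i)" if i: "i < \<nu>" for i
    unfolding cv_def using root_nonzero[OF poly_crit_root[OF q(11) i] ok]
    by (intro tendsto_divide tendsto_power q(10)[OF i] tendsto_poly_pconv[OF Plim dP]) auto
  have speed: "(\<lambda>l. (cva (q l) (ys l i) - cva a (y i)) / s l) \<longlonglongrightarrow> cv e ?W (y i)" if i: "i < \<nu>" for i
  proof (cases "y i \<in> {u, v}")
    case True
    then have "\<not> i < \<nu> - 2" using special_not_root[OF sp q(11-13), of i] by auto
    then have "i = \<nu> - 2 \<or> i = \<nu> - 1" using i by auto
    then have "cva (q l) (ys l i) = 0" for l using sp_cv[OF q(1)[of l]] q(3)[of l] q(4)[of l] by auto
    moreover have "cva a (y i) = 0" "cv e ?W (y i) = 0" using sp_cv[OF sp] True by (auto simp: cv_def)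
    ultimately show ?thesis by simp
  next
    case False
    show ?thesis
      by (rule critical_value_speed[OF q(7,8,9,5,6) q(10)[OF i] poly_crit_root[OF q(2) i] poly_crit_root[OF q(11) i] simple[OF poly_crit_root[OF q(11) i]]
          root_nonzero[OF poly_crit_root[OF q(11) i] ok]]) (use False in auto)
  qed
  have "eventually (\<lambda>l. cva (q l) (ys l i) \<noteq> cva (q l) (ys l j)) sequentially" if p: "(i, j) \<in> pairs" for i j
  proof -
    note ps = pairs_special[OF sp q(11-13) p]
    show ?thesis
    proof (cases "cva a (y i) = cva a (y j)")
      case False
      then have "cva a (y i) - cva a (y j) \<noteq> 0" by simp
      from tendsto_imp_eventually_ne[OF tendsto_diff[OF cvl[OF ps(1)] cvl[OF ps(2)]] this]
      show ?thesis by (auto elim: eventually_mono)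
    next
      case True
      have "y i \<noteq> y j"
      proof
        assume eq: "y i = y j"
        have "poly (pderiv (N a)) (y i) = 0" by (rule roots_double[OF q(11) ps(1-3) eq])
        then show False using simple[OF poly_crit_root[OF q(11) ps(1)]] ps(4) eq by auto
      qed
      then have "(y i, y j) \<in> Y" using ps yZ by (auto simp: Y_def)
      then have "cv e ?W (y i) - cv e ?W (y j) \<noteq> 0" using r by simp
      from tendsto_imp_eventually_ne[OF tendsto_diff[OF speed[OF ps(1)] speed[OF ps(2)]] this] show ?thesis
        by (rule eventually_mono) (auto simp: True)
    qed
  qed
  then have "eventually (\<lambda>l. \<forall>p\<in>pairs. cva (q l) (ys l (fst p)) \<noteq> cva (q l) (ys l (snd p))) sequentially"
    by (intro eventually_ball_finite finite_pairs) auto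
  then obtain l where l: "\<forall>p\<in>pairs. cva (q l) (ys l (fst p)) \<noteq> cva (q l) (ys l (snd p))" unfolding eventually_sequentially by blast
  then have "nice (q l) (ys l)" by (auto simp: nice_def)
  with q(1-4)[of l] show ?thesis by (rule that)
qed

end

subsection \<open>The exponent of the last coefficient\<close>

lemma poly_lp_axis: "poly (lp (a(n := 0)) (\<lambda>i. if i = n then 1 else 0) F) s = eval_mpoly (a(n := s)) F"
  unfolding poly_lp by (rule arg_cong[where f = "\<lambda>a. eval_mpoly a F"]) auto

lemma max_power_factor:
  assumes "F \<noteq> (0::mpoly)" obtains f H where "F = Var n ^ f * H" "\<not> Var n dvd H"
proof -
  have "\<exists>f H. F = Var n ^ f * H \<and> \<not> Var n dvd H" using assms
  proof (induction "degree (as_univariate n F)" arbitrary: F rule: less_induct)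
    case less
    show ?case
    proof (cases "Var n dvd F")
      case False
      then show ?thesis by (intro exI[of _ 0] exI[of _ F]) simp
    next
      case True
      then obtain G where G: "F = Var n * G" by (auto elim: dvdE)
      then have "G \<noteq> 0" using less.prems by auto
      moreover from this have "degree (as_univariate n F) = Suc (degree (as_univariate n G))"
        unfolding G by (subst degree_as_univariate_mult) (auto simp: Var_nonzero as_univariate_Var)
      ultimately obtain f H where "G = Var n ^ f * H" "\<not> Var n dvd H" using less.hyps[of G] by auto
      then show ?thesis unfolding G by (intro exI[of _ "Suc f"] exI[of _ H]) (simp add: mult_ac)
    qed
  qed
  then show ?thesis using that by blast
qed

lemma not_Var_dvdD:
  assumes "\<not> Var n dvd H" shows "coeff (as_univariate n H) 0 \<noteq> 0"
proof
  assume 0: "coeff (as_univariate n H) 0 = 0"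
  have "[:0, 1:] dvd as_univariate n H" using 0 by (simp add: poly_0_coeff_0 flip: poly_eq_0_iff_dvd[of _ 0, simplified])
  then obtain q where q: "as_univariate n H = [:0, 1:] * q" by (auto elim: dvdE)
  have h: "comm_ring_hom (\<lambda>p. poly p (Var n))" by (rule comm_ring_hom_poly)
  have "poly (as_univariate n H) (Var n) = H"
    by (rule mpoly_hom_eqI[OF comm_ring_hom_comp[OF h as_univariate_hom] comm_ring_hom_ident]) (auto simp: as_univariate_Var)
  then have "H = Var n * poly q (Var n)" unfolding q by simp
  then show False using assms by (metis dvd_triv_left)
qed

lemma eval_coeff_0: "eval_mpoly a (coeff (as_univariate n H) 0) = eval_mpoly (a(n := 0)) H"
  using poly_as_univariate[of a n H 0] by (simp add: poly_0_coeff_0)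

text \<open>The exponent is squeezed. A nonzero limit on one line bounds it by \<open>m\<close> from
  above. The existence of limits over the points of the hyperplane with \<open>B\<close> nonzero
  bounds it from below, because the cofactor \<open>H\<close> is nonzero at some of these
  points.\<close>

theorem exact_power:
  assumes B: "B \<noteq> 0" "n \<notin> indets B"
    and conv: "\<And>a. a n = 0 \<Longrightarrow> eval_mpoly a B \<noteq> 0 \<Longrightarrow> 
       \<exists>s L. (\<forall>l. s l \<noteq> 0) \<and> s \<longlonglongrightarrow> 0 \<and> (\<lambda>l. eval_mpoly (a(n := s l)) F / s l ^ m) \<longlonglongrightarrow> L"
    and a0: "\<And>l. s0 l \<noteq> 0" "s0 \<longlonglongrightarrow> 0" "(\<lambda>l. eval_mpoly (a0(n := s0 l)) F / s0 l ^ m) \<longlonglongrightarrow> L0" "L0 \<noteq> 0"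
  shows "\<exists>H. F = Var n ^ m * H \<and> \<not> Var n dvd H"
proof -
  let ?w = "\<lambda>i. if i = n then 1 else 0 :: complex"
  have F0: "F \<noteq> 0"
  proof
    assume "F = 0"
    then have "(\<lambda>l. 0) \<longlonglongrightarrow> L0" using a0(3) by simp
    then show False using a0(4) LIMSEQ_unique[OF tendsto_const] by blast
  qed
  then obtain f H where FH: "F = Var n ^ f * H" and H: "\<not> Var n dvd H" by (rule max_power_factor)
  have lpF: "lp (a(n := 0)) ?w F = [:0, 1:] ^ f * lp (a(n := 0)) ?w H" for a
    unfolding FH by (simp add: lp.hom_mult lp.hom_power)
  have ord: "order 0 (lp (a(n := 0)) ?w F) = f + order 0 (lp (a(n := 0)) ?w H)" if "lp (a(n := 0)) ?w F \<noteq> 0" for a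
  proof -
    have "lp (a(n := 0)) ?w F = [:- 0, 1:] ^ f * lp (a(n := 0)) ?w H" unfolding lpF by simp
    then show ?thesis using that by (simp only: order_mult order_power_n_n not_False_eq_True)
  qed
  have "f \<le> m"
  proof -
    have nz: "lp (a0(n := 0)) ?w F \<noteq> 0"
    proof
      assume "lp (a0(n := 0)) ?w F = 0"
      then have "eval_mpoly (a0(n := s0 l)) F = 0" for l by (simp flip: poly_lp_axis)
      then have "(\<lambda>l. 0) \<longlonglongrightarrow> L0" using a0(3) by simp
      then show False using a0(4) LIMSEQ_unique[OF tendsto_const] by blast
    qed
    have "order 0 (lp (a0(n := 0)) ?w F) = m"
      by (rule order_limit(2)[OF nz a0(1,2) _ a0(4)]) (simp add: poly_lp_axis a0(3))
    then show ?thesis using ord[OF nz] by simp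
  qed
  moreover have "m \<le> f"
  proof -
    have "coeff (as_univariate n H) 0 * B \<noteq> 0" using not_Var_dvdD[OF H] B(1) by simp
    then obtain a where a: "eval_mpoly a (coeff (as_univariate n H) 0 * B) \<noteq> 0" by (rule eval_nonzero)
    have Ha: "eval_mpoly (a(n := 0)) H \<noteq> 0" and Ba: "eval_mpoly a B \<noteq> 0"
      using a unfolding ev.hom_mult eval_coeff_0 by auto
    have "eval_mpoly (a(n := 0)) B = eval_mpoly a B" by (rule eval_cong) (use B(2) in auto)
    then obtain s L where s: "\<forall>l. s l \<noteq> 0" "s \<longlonglongrightarrow> 0" "(\<lambda>l. eval_mpoly (a(n := s l)) F / s l ^ m) \<longlonglongrightarrow> L"
      using conv[of "a(n := 0)"] Ba by auto
    have H0: "poly (lp (a(n := 0)) ?w H) 0 \<noteq> 0" using Ha by (simp add: poly_lp_axis)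
    then have nz: "lp (a(n := 0)) ?w F \<noteq> 0" unfolding lpF by auto
    have "m \<le> order 0 (lp (a(n := 0)) ?w F)"
      by (rule order_limit(1)[OF nz s(1)[rule_format] s(2), where L = L]) (simp add: poly_lp_axis s(3))
    also have "\<dots> = f" unfolding ord[OF nz] using H0 by (simp add: order_0I)
    finally show ?thesis .
  qed
  ultimately show ?thesis using FH H by auto
qed

section \<open>Critical values as the last coefficient tends to zero\<close>

lemma P_at_Suc: "P_at (Suc m) a = pCons (a (Suc m)) (P_at m a)"
  by (rule poly_eqI) (auto simp: coeff_P_at coeff_pCons split: nat.split)

lemma P_at_upd_above: "m < j \<Longrightarrow> P_at m (a(j := z)) = P_at m a"
  by (rule poly_eqI) (auto simp: coeff_P_at)

lemma poly_difference_quotient: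
  fixes \<phi> :: "complex poly"
  assumes "y \<longlonglongrightarrow> x" "z \<longlonglongrightarrow> x"
  shows "\<exists>H. H \<longlonglongrightarrow> poly (pderiv \<phi>) x \<and> (\<forall>l. poly \<phi> (y l) - poly \<phi> (z l) = (y l - z l) * H l)"
proof (induction \<phi>)
  case 0
  then show ?case by (intro exI[of _ "\<lambda>_. 0"]) simp
next
  case (pCons c q)
  then obtain H where H: "H \<longlonglongrightarrow> poly (pderiv q) x" "\<forall>l. poly q (y l) - poly q (z l) = (y l - z l) * H l" by blast
  have "(\<lambda>l. poly q (y l) + z l * H l) \<longlonglongrightarrow> poly q x + x * poly (pderiv q) x"
    by (intro tendsto_intros tendsto_poly assms H(1))
  moreover have "poly (pCons c q) (y l) - poly (pCons c q) (z l) = (y l - z l) * (poly q (y l) + z l * H l)" for l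
  proof -
    have "poly (pCons c q) (y l) - poly (pCons c q) (z l) = (y l - z l) * poly q (y l) + z l * (poly q (y l) - poly q (z l))"
      by (simp add: algebra_simps)
    then show ?thesis unfolding H(2)[rule_format] by (simp add: algebra_simps)
  qed
  ultimately show ?case by (intro exI[of _ "\<lambda>l. poly q (y l) + z l * H l"]) (simp add: pderiv_pCons)
qed

text \<open>An explicit polynomial with distinct critical values:
  \<open>m * x ^ (m - 1) = - c\<close> at a critical point x, so the value there is a constant
  nonzero multiple of x itself. The critical points are nonzero and distinct because the second
  derivative vanishes at most at 0.\<close>

lemma power_plus_linear_critical:
  fixes c :: complex
  assumes g: "g = monom 1 m + monom c 1" "2 \<le> m" "c \<noteq> 0"
    and z: "pderiv g = Polynomial.smult (of_nat m) (\<Prod>i<m - 1. [:- z i, 1:])" and i: "i < m - 1"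
  shows "poly g (z i) \<noteq> 0" "j < m - 1 \<Longrightarrow> j \<noteq> i \<Longrightarrow> poly g (z i) \<noteq> poly g (z j)"
proof -
  have dg: "pderiv g = monom (of_nat m) (m - 1) + [:c:]" unfolding g(1) by (simp add: pderiv_add pderiv_monom monom_0)
  have 0: "of_nat m * z i ^ (m - 1) = - c" if "i < m - 1" for i
  proof -
    have "poly (pderiv g) (z i) = 0" unfolding z using that by (auto simp: poly_prod intro!: prod_zero)
    then show ?thesis unfolding dg by (simp add: poly_monom eq_neg_iff_add_eq_0)
  qed
  have nz: "z i \<noteq> 0" if "i < m - 1" for i
  proof
    assume "z i = 0"
    then show False using 0[OF that] g(2,3) by (simp add: power_0_left)
  qed
  define \<rho> where "\<rho> = c * (1 - 1 / of_nat m)"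
  have m0: "of_nat m \<noteq> (0::complex)" "of_nat m \<noteq> (1::complex)" using g(2) by simp_all
  have rho: "\<rho> \<noteq> 0" using m0 g(3) by (simp add: \<rho>_def)
  have val: "poly g (z i) = \<rho> * z i" if "i < m - 1" for i
  proof -
    have "z i ^ m = z i * z i ^ (m - 1)" using g(2) by (cases m) auto
    moreover have "z i ^ (m - 1) = - c / of_nat m" using 0[OF that] m0(1) by (metis nonzero_mult_div_cancel_left)
    ultimately show ?thesis unfolding g(1) \<rho>_def by (simp add: poly_monom algebra_simps)
  qed
  show "poly g (z i) \<noteq> 0" using val[OF i] rho nz[OF i] by simp
  assume j: "j < m - 1" "j \<noteq> i"
  have "z i \<noteq> z j"
  proof
    assume "z i = z j"
    have "poly (pderiv (pderiv g)) (z i) = 0"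
      unfolding pderiv_root_product[OF z i] using i j \<open>z i = z j\<close> by (auto intro!: prod_zero)
    moreover have "pderiv (pderiv g) = monom (of_nat (m - 1) * of_nat m) (m - 2)"
      unfolding dg by (simp add: pderiv_add pderiv_monom numeral_2_eq_2 pderiv_pCons)
    moreover have "(of_nat (m - 1) :: complex) \<noteq> 0" using i by simp
    ultimately show False using nz[OF i] m0(1) by (simp add: poly_monom)
  qed
  then show "poly g (z i) \<noteq> poly g (z j)" using val[OF i] val[OF j(1)] rho by simp
qed

lemma offdiagonal_prod_Suc:
  fixes g :: "nat \<Rightarrow> nat \<Rightarrow> 'a::comm_monoid_mult"
  shows "(\<Prod>i<Suc m. \<Prod>j\<in>{..<Suc m}-{i}. g i j) = (\<Prod>i<m. \<Prod>j\<in>{..<m}-{i}. g i j) * (\<Prod>i<m. g i m * g m i)"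
proof -
  have "{..<Suc m} - {i} = insert m ({..<m} - {i})" if "i < m" for i using that by auto
  then have "(\<Prod>i<m. \<Prod>j\<in>{..<Suc m}-{i}. g i j) = (\<Prod>i<m. g i m * (\<Prod>j\<in>{..<m}-{i}. g i j))"
    by (intro prod.cong) auto
  moreover have "{..<Suc m} - {m} = {..<m}" by auto
  ultimately show ?thesis by (simp add: prod.distrib mult_ac)
qed

context discriminant_params
begin

text \<open>The witness is \<open>x ^ n + x\<close>, whose critical values are distinct.\<close>

lemma D_tilde_nonzero_last: assumes "k = n" shows "D_tilde n k \<noteq> 0"
proof -
  define a :: "nat \<Rightarrow> complex" where "a i = (if i = n - 1 then 1 else 0)" for i
  have p: "P_at n a = monom 1 n + monom 1 1"
    by (rule poly_eqI) (use n2 in \<open>auto simp: coeff_P_at a_def coeff_monom\<close>)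
  have e: "e = 0" and nu: "\<nu> = n - 1" using e_0_iff assms unfolding \<nu>_def by (blast, metis)
  have N: "N a = pderiv (P_at n a)" by (simp add: e crit_def)
  obtain y where y: "roots_of a y" by (rule roots_exist)
  have y': "pderiv (P_at n a) = Polynomial.smult (of_nat n) (\<Prod>i<n - 1. [:- y i, 1:])"
    using y unfolding N nu using assms by simp
  note * = power_plus_linear_critical(2)[OF p n2 _ y']
  obtain C where C: "C \<noteq> 0" "\<And>a y. ok a \<Longrightarrow> roots_of a y \<Longrightarrow> eval_mpoly a (D_tilde n k) = 
     C * a n ^ ((e - 1) * (2 * \<nu> - 1)) * (\<Prod>i<\<nu>. \<Prod>j\<in>{..<\<nu>}-{i}. cva a (y j) - cva a (y i))"
    using eval_D_tilde by blast
  have "ok a" using assms unfolding ok_def by (rule disjI1)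
  moreover have "(\<Prod>i<\<nu>. \<Prod>j\<in>{..<\<nu>}-{i}. cva a (y j) - cva a (y i)) \<noteq> 0"
    using * by (auto simp: prod_zero_iff nu cv_def e)
  ultimately have "eval_mpoly a (D_tilde n k) \<noteq> 0" using C(1) unfolding C(2)[OF \<open>ok a\<close> y] by (simp add: e)
  then show ?thesis by auto
qed

text \<open>As the last coefficient \<open>s\<close> tends to 0, two critical points tend to 0 like the square roots of
  \<open>s / a (n - 2)\<close>, with critical values tending to 0.\<close>

lemma last_coeff_limit_1:
  assumes k: "Suc k = n" "3 \<le> n" and a: "a n = 0" "a k = 0" "a (n - 2) \<noteq> 0"
    and z: "pderiv (P_at k a) = Polynomial.smult (of_nat k) (\<Prod>i<k - 1. [:- z i, 1:])"
  shows "\<exists>s L. (\<forall>l. s l \<noteq> 0) \<and> s \<longlonglongrightarrow> 0 \<and> (\<lambda>l. eval_mpoly (a(n := s l)) (D_tilde n k) / s l ^ 1) \<longlonglongrightarrow> L \<and>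
    ((\<forall>i<k - 1. poly (P_at k a) (z i) \<noteq> 0 \<and> (\<forall>j<k - 1. j \<noteq> i \<longrightarrow> poly (P_at k a) (z i) \<noteq> poly (P_at k a) (z j))) \<longrightarrow> L \<noteq> 0)"
proof -
  define g where "g = P_at k a"
  have e: "e = 1" and nu: "\<nu> = n"
  proof -
    have "k \<noteq> n" using k by auto
    then show "\<nu> = n" unfolding \<nu>_def by (rule if_not_P)
    show "e = 1" unfolding e_def using k by linarith
  qed
  have nk: "k - 1 = n - 2" using k by simp
  have g0: "poly g 0 = 0" using k a(2) by (simp add: g_def poly_0_coeff_0 coeff_P_at)
  have g1: "poly (pderiv g) 0 = a (n - 2)" using k nk by (simp add: g_def poly_0_coeff_0 coeff_pderiv coeff_P_at)
  define s0 where "s0 l = (1 / of_nat (Suc l) :: complex)" for l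
  have s00: "s0 \<longlonglongrightarrow> 0" unfolding s0_def using LIMSEQ_Suc[OF lim_1_over_n[where 'a = complex]] by simp
  have s0n: "s0 l \<noteq> 0" for l by (simp add: s0_def del: of_nat_Suc)
  have pa: "P_at n a = [:0, 1:] * g" unfolding g_def using P_at_Suc[of k a] k(1) a(1) by simp
  have pq: "P_at n (a(n := t)) = [:0, 1:] * g + [:t:]" for t
    unfolding g_def using P_at_Suc[of k "a(n := t)"] P_at_upd_above[of k n a t] k(1) by simp
  have Na: "N a = [:- 0, 1:] ^ 2 * pderiv g"
    unfolding pa crit_def e by (simp add: pderiv_mult pderiv_pCons power2_eq_square algebra_simps)
  have Nq: "N (a(n := t)) = N a + Polynomial.smult t [:- 1:]" for t
    unfolding pq pa crit_add by (simp add: crit_def e pderiv_pCons)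
  define m where "m = n - 2"
  have m: "n = Suc (Suc m)" and km: "k - 1 = m" using k by (simp_all add: m_def)
  have num: "\<nu> = Suc (Suc m)" using nu m by (rule trans)
  define y where "y i = (if i < m then z i else 0)" for i
  have zg: "pderiv g = Polynomial.smult (of_nat k) (\<Prod>i<m. [:- z i, 1:])" using z unfolding g_def km .
  have ya: "roots_of a y"
  proof -
    have "(\<Prod>i<\<nu>. [:- y i, 1:]) = (\<Prod>i<m. [:- z i, 1:]) * [:0, 1:] * [:0, 1:]"
      unfolding num prod.lessThan_Suc by (simp add: y_def)
    then show ?thesis unfolding Na zg by (simp add: power2_eq_square mult_ac)
  qed
  have k0: "(of_nat k :: complex) \<noteq> 0" using k1 by simp
  have pcv: "pconv (\<lambda>l. N (a(n := s0 l))) (N a)"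
    using pconv_add[OF pconv_const pconv_smult[OF s00 pconv_const], of "N a" "[:- 1:]"] unfolding Nq by simp
  obtain r ys where r: "strict_mono (r :: nat \<Rightarrow> nat)" and ys: "\<And>l. roots_of (a(n := s0 (r l))) (ys l)" 
    and ysl: "\<And>i. i < \<nu> \<Longrightarrow> (\<lambda>l. ys l i) \<longlonglongrightarrow> y i"
    using root_subsequence_to[OF pcv degree_crit lead_coeff_crit k0 ya] by blast
  define s where "s l = s0 (r l)" for l
  have s: "s l \<noteq> 0" "s \<longlonglongrightarrow> 0" for l unfolding s_def using s0n LIMSEQ_subseq_LIMSEQ[OF s00 r] by (auto simp: o_def)
  define q where "q l = a(n := s l)" for l
  have roots: "roots_of (q l) (ys l)" for l using ys by (simp add: q_def s_def)
  have ok: "ok (q l)" for l using s(1)[of l] by (simp add: ok_def q_def)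
  have ynz: "ys l i \<noteq> 0" if "i < n" for l i
    using root_nonzero[OF poly_crit_root[OF roots] ok, of i] that e nu by auto
  \<comment> \<open>At a critical point \<open>s l\<close> is \<open>y ^ 2\<close> times the
    derivative of \<open>g\<close>. Eliminating \<open>s l\<close> turns the critical value
    \<open>g(y) + s l / y\<close> into a fixed polynomial in y, so that the values at the two
    merging points are compared by a difference quotient.\<close>
  define \<phi> where "\<phi> = g + [:0, 1:] * pderiv g"
  have cvl: "cva (q l) (ys l i) = poly \<phi> (ys l i)" if "i < n" for l i
  proof -
    let ?y = "ys l i"
    have "poly (N (q l)) ?y = 0" using poly_crit_root[OF roots, of i] that by (simp add: nu)
    then have "s l = ?y ^ 2 * poly (pderiv g) ?y" unfolding q_def Nq Na by (simp add: power2_eq_square mult.assoc)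
    then have "poly (P_at n (q l)) ?y = ?y * poly \<phi> ?y"
      unfolding q_def pq \<phi>_def by (simp add: power2_eq_square algebra_simps)
    then show ?thesis using ynz[OF that] by (simp add: cv_def e)
  qed
  have idx: "\<nu> - 2 < \<nu>" "\<nu> - 1 < \<nu>" "2 \<le> \<nu>" "\<nu> - 1 < n" "\<nu> - 2 < n" using k nu by auto
  have y0: "y (\<nu> - 2) = 0" "y (\<nu> - 1) = 0" by (auto simp: y_def num)
  have yu: "(\<lambda>l. ys l (\<nu> - 2)) \<longlonglongrightarrow> 0" and yv: "(\<lambda>l. ys l (\<nu> - 1)) \<longlonglongrightarrow> 0"
    using ysl[OF idx(1)] ysl[OF idx(2)] y0 by simp_all
  define S' where "S' l = Polynomial.smult (of_nat k) (\<Prod>i<\<nu> - 2. [:- ys l i, 1:])" for l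
  have S'eq: "N a + Polynomial.smult (s l) [:- 1:] = [:- ys l (\<nu> - 2), 1:] * [:- ys l (\<nu> - 1), 1:] * S' l" for l
    using roots_split_pair[OF idx(3) roots[of l]] unfolding q_def Nq S'_def lin_def .
  have S'lim: "pconv S' (pderiv g)"
  proof -
    have "pconv S' (Polynomial.smult (of_nat k) (\<Prod>i<\<nu> - 2. [:- y i, 1:]))"
      unfolding S'_def by (intro pconv_smult tendsto_const pconv_prod pconv_linear ysl) simp
    also have "Polynomial.smult (of_nat k) (\<Prod>i<\<nu> - 2. [:- y i, 1:]) = pderiv g"
      unfolding zg num by (intro arg_cong2[where f = Polynomial.smult] prod.cong refl) (auto simp: y_def)
    finally show ?thesis .
  qed
  have dS': "degree (S' l) \<le> \<nu> - 2" for l unfolding S'_def by (rule order_trans[OF degree_smult_le]) (simp add: prod_linear_simps)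
  have g1': "poly (pderiv g) 0 \<noteq> 0" using g1 a(3) by simp
  have "(\<lambda>l. (ys l (\<nu> - 1) - ys l (\<nu> - 2)) ^ 2 / s l) \<longlonglongrightarrow> - 4 * poly [:- 1:] 0 / poly (pderiv g) 0"
    by (rule splitting_double_root[OF Na g1' S'eq S'lim dS' s])
  then have split: "(\<lambda>l. (ys l (\<nu> - 1) - ys l (\<nu> - 2)) ^ 2 / s l) \<longlonglongrightarrow> 4 / a (n - 2)" by (simp add: g1)
  obtain H where H: "H \<longlonglongrightarrow> poly (pderiv \<phi>) 0"
    "\<forall>l. poly \<phi> (ys l (\<nu> - 1)) - poly \<phi> (ys l (\<nu> - 2)) = (ys l (\<nu> - 1) - ys l (\<nu> - 2)) * H l"
    using poly_difference_quotient[OF yv yu] by blast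
  have "poly (pderiv \<phi>) 0 = 2 * a (n - 2)" by (simp add: \<phi>_def pderiv_add pderiv_mult pderiv_pCons g1)
  then have "(\<lambda>l. ((ys l (\<nu> - 1) - ys l (\<nu> - 2)) ^ 2 / s l) * H l ^ 2) \<longlonglongrightarrow> 4 / a (n - 2) * (2 * a (n - 2)) ^ 2"
    using H(1) by (intro tendsto_mult split tendsto_power) simp
  moreover have "4 / a (n - 2) * (2 * a (n - 2)) ^ 2 = 16 * a (n - 2)" using a(3) by (simp add: power2_eq_square)
  ultimately have lim: "(\<lambda>l. (cva (q l) (ys l (\<nu> - 1)) - cva (q l) (ys l (\<nu> - 2))) ^ 2 / s l) \<longlonglongrightarrow> 16 * a (n - 2)"
    unfolding cvl[OF idx(4)] cvl[OF idx(5)] H(2)[rule_format] power_mult_distrib by simp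
  define c where "c i = poly \<phi> (y i)" for i
  have cl: "(\<lambda>l. cva (q l) (ys l i)) \<longlonglongrightarrow> c i" if "i < n" for i
    unfolding cvl[OF that] c_def using ysl[of i] that nu by (intro tendsto_poly) simp
  have zr: "poly (pderiv g) (z i) = 0" if "i < m" for i
    unfolding zg using that by (auto simp: poly_prod intro!: prod_zero)
  \<comment> \<open>At the remaining critical points the derivative of \<open>g\<close> vanishes and
    \<phi> equals \<open>g\<close>; at the merging points the normalisation \<open>a k = 0\<close>
    makes the limit 0.\<close>
  have cz: "c i = (if i < m then poly g (z i) else 0)" for i
    using g0 zr by (auto simp: c_def y_def \<phi>_def)
  obtain C where C: "C \<noteq> 0" "\<And>a y. ok a \<Longrightarrow> roots_of a y \<Longrightarrow> eval_mpoly a (D_tilde n k) = 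
     C * a n ^ ((e - 1) * (2 * \<nu> - 1)) * (\<Prod>i<\<nu>. \<Prod>j\<in>{..<\<nu>}-{i}. cva a (y j) - cva a (y i))"
    using eval_D_tilde by blast
  have F: "eval_mpoly (q l) (D_tilde n k) / s l ^ 1 = C * (- ((cva (q l) (ys l (\<nu> - 1)) - cva (q l) (ys l (\<nu> - 2))) ^ 2 / s l)) * 
     (\<Prod>(i, j)\<in>pairs. cva (q l) (ys l j) - cva (q l) (ys l i))" for l
  proof -
    have sq: "(x - w) * (w - x) = - ((x - w) ^ 2)" for x w :: complex by (simp add: power2_eq_square algebra_simps)
    have ex: "q l n ^ ((e - 1) * (2 * \<nu> - 1)) = 1" using e by simp
    have c: "C * 1 * (- x * B) / t ^ 1 = C * (- (x / t)) * B" for x t B :: complex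
      unfolding power_one_right mult_1_right divide_inverse minus_mult_left[symmetric] minus_mult_right[symmetric] by (simp only: ac_simps)
    have 1: "(\<Prod>i<\<nu>. \<Prod>j\<in>{..<\<nu>}-{i}. cva (q l) (ys l j) - cva (q l) (ys l i)) =
      - ((cva (q l) (ys l (\<nu> - 1)) - cva (q l) (ys l (\<nu> - 2))) ^ 2) * (\<Prod>(i, j)\<in>pairs. cva (q l) (ys l j) - cva (q l) (ys l i))"
      unfolding prod_pairs[OF idx(3)] sq ..
    show ?thesis
      unfolding C(2)[OF ok[of l] roots[of l]] ex 1 by (rule c)
  qed
  define L where "L = C * (- (16 * a (n - 2))) * (\<Prod>(i, j)\<in>pairs. c j - c i)"
  have "(\<lambda>l. case p of (i, j) \<Rightarrow> cva (q l) (ys l j) - cva (q l) (ys l i)) \<longlonglongrightarrow> (case p of (i, j) \<Rightarrow> c j - c i)"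
    if pp: "p \<in> pairs" for p
  proof -
    obtain i j where p: "p = (i, j)" "i < \<nu>" "j < \<nu>" using pp unfolding pairs_def by blast
    note p = p(1) p(2,3)[unfolded nu]
    show ?thesis unfolding p(1) prod.case by (intro tendsto_diff cl p)
  qed
  then have "(\<lambda>l. eval_mpoly (q l) (D_tilde n k) / s l ^ 1) \<longlonglongrightarrow> L"
    unfolding F L_def by (intro tendsto_mult tendsto_const tendsto_minus lim tendsto_prod)
  moreover have "L \<noteq> 0" if h: "\<forall>i<k - 1. poly (P_at k a) (z i) \<noteq> 0 \<and> (\<forall>j<k - 1. j \<noteq> i \<longrightarrow> poly (P_at k a) (z i) \<noteq> poly (P_at k a) (z j))"
  proof -
    have ne: "c i \<noteq> c j" if "(i, j) \<in> pairs" for i j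
      using that h unfolding pairs_def cz num km g_def by auto
    have "(\<Prod>p\<in>pairs. case p of (i, j) \<Rightarrow> c j - c i) \<noteq> 0"
    proof
      assume "(\<Prod>p\<in>pairs. case p of (i, j) \<Rightarrow> c j - c i) = 0"
      then obtain p where "p \<in> pairs" "(case p of (i, j) \<Rightarrow> c j - c i) = 0" using finite_pairs prod_zero_iff by blast
      then show False using ne[of "fst p" "snd p"] by (auto simp: case_prod_beta)
    qed
    then show "L \<noteq> 0" using C(1) a(3) by (simp add: L_def)
  qed
  ultimately show ?thesis using s unfolding q_def by (intro exI[of _ s] exI[of _ L]) blast
qed

text \<open>Here only one critical point tends to 0, and its critical value grows like \<open>s ^ (k + 1 - n)\<close>. The
  other critical values tend to those of \<open>P / x\<close>, which is what makes an induction on \<open>n\<close> possible.\<close>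

lemma last_coeff_limit_2:
  assumes k: "Suc (Suc k) \<le> n" and a: "a n = 0" "a (n - 1) \<noteq> 0"
  shows "\<exists>s L. (\<forall>l. s l \<noteq> 0) \<and> s \<longlonglongrightarrow> 0 \<and> (\<lambda>l. eval_mpoly (a(n := s l)) (D_tilde n k) / s l ^ (n - k - 1)) \<longlonglongrightarrow> L \<and>
    (eval_mpoly a (D_tilde (n - 1) k) \<noteq> 0 \<longrightarrow> L \<noteq> 0)"
proof -
  obtain m where m: "n = Suc m" using k by (metis Suc_le_D)
  interpret d': discriminant_params m k by unfold_locales (use k k1 m in auto)
  have e: "e = Suc d'.e" and e': "d'.e > 0" and nu: "\<nu> = Suc m" "d'.\<nu> = m" and em: "n - k - 1 = d'.e" "n - 1 = m"
  proof -
    have "k \<noteq> n" "k \<noteq> m" "m - k > 0" using k m by auto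
    then show "\<nu> = Suc m" "d'.\<nu> = m" "d'.e > 0" unfolding \<nu>_def d'.\<nu>_def d'.e_def using m by simp_all
    show "e = Suc d'.e" "n - k - 1 = d'.e" "n - 1 = m" unfolding e_def d'.e_def using k m by linarith+
  qed
  define g where "g = P_at m a"
  have g0: "poly g 0 = a m" using d'.n2 by (simp add: g_def poly_0_coeff_0 coeff_P_at)
  have am: "a m \<noteq> 0" using a(2) m by simp
  have ok': "d'.ok a" using am by (simp add: d'.ok_def)
  define s0 where "s0 l = (1 / of_nat (Suc l) :: complex)" for l
  have s00: "s0 \<longlonglongrightarrow> 0" unfolding s0_def using LIMSEQ_Suc[OF lim_1_over_n[where 'a = complex]] by simp
  have s0n: "s0 l \<noteq> 0" for l by (simp add: s0_def del: of_nat_Suc)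
  have pa: "P_at n a = [:0, 1:] * g" unfolding g_def m using P_at_Suc[of m a] m a(1) by simp
  have pq: "P_at n (a(n := t)) = [:0, 1:] * g + [:t:]" for t
    unfolding g_def using P_at_Suc[of m "a(n := t)"] P_at_upd_above[of m n a t] m by simp
  have Na: "N a = [:0, 1:] * crit d'.e g"
    unfolding pa crit_def e using e' by (simp add: pderiv_mult pderiv_pCons algebra_simps smult_diff_right smult_add_left)
  have Nq: "N (a(n := t)) = N a + Polynomial.smult t [:- of_nat e:]" for t
    unfolding pq pa crit_add by (simp add: crit_def e pderiv_pCons algebra_simps)
  obtain z where z: "d'.roots_of a z" by (rule d'.roots_exist)
  have z': "crit d'.e g = Polynomial.smult (of_nat k) (\<Prod>i<m. [:- z i, 1:])" using z by (simp add: g_def nu)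
  define y where "y i = (if i < m then z i else 0)" for i
  have ya: "roots_of a y"
  proof -
    have "(\<Prod>i<\<nu>. [:- y i, 1:]) = (\<Prod>i<m. [:- z i, 1:]) * [:0, 1:]"
      unfolding nu prod.lessThan_Suc by (simp add: y_def)
    then show ?thesis unfolding Na z' by (simp add: mult_ac)
  qed
  have k0: "(of_nat k :: complex) \<noteq> 0" using k1 by simp
  have pcv: "pconv (\<lambda>l. N (a(n := s0 l))) (N a)"
    using pconv_add[OF pconv_const pconv_smult[OF s00 pconv_const], of "N a" "[:- of_nat e:]"] unfolding Nq by simp
  obtain r ys where r: "strict_mono (r :: nat \<Rightarrow> nat)" and ys: "\<And>l. roots_of (a(n := s0 (r l))) (ys l)" 
    and ysl: "\<And>i. i < \<nu> \<Longrightarrow> (\<lambda>l. ys l i) \<longlonglongrightarrow> y i"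
    using root_subsequence_to[OF pcv degree_crit lead_coeff_crit k0 ya] by blast
  define s where "s l = s0 (r l)" for l
  have s: "s l \<noteq> 0" "s \<longlonglongrightarrow> 0" for l unfolding s_def using s0n LIMSEQ_subseq_LIMSEQ[OF s00 r] by (auto simp: o_def)
  define q where "q l = a(n := s l)" for l
  have qn: "q l n = s l" for l by (simp add: q_def)
  have roots: "roots_of (q l) (ys l)" for l using ys by (simp add: q_def s_def)
  have ok: "ok (q l)" for l using s(1)[of l] by (simp add: ok_def q_def)
  have ynz: "ys l i \<noteq> 0" if "i < n" for l i
    using root_nonzero[OF poly_crit_root[OF roots] ok, of i] that e nu m by auto
  have znz: "z i \<noteq> 0" if "i < m" for i
    using d'.root_nonzero[OF d'.poly_crit_root[OF z] ok', of i] that e' nu by auto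
  define c where "c i = cv d'.e g (z i)" for i
  have cl: "(\<lambda>l. cva (q l) (ys l i)) \<longlonglongrightarrow> c i" if i: "i < m" for i
  proof -
    have yi: "(\<lambda>l. ys l i) \<longlonglongrightarrow> z i" using ysl[of i] i by (simp add: nu y_def)
    have "(\<lambda>l. (ys l i * poly g (ys l i) + s l) / ys l i ^ e) \<longlonglongrightarrow> (z i * poly g (z i) + 0) / z i ^ e"
      using znz[OF i] by (intro tendsto_intros tendsto_poly yi s(2)) auto
    then show ?thesis using znz[OF i] unfolding cv_def q_def pq c_def by (simp add: e add.commute)
  qed
  define x where "x l = ys l m" for l
  have xl: "x \<longlonglongrightarrow> 0" using ysl[of m] by (simp add: x_def[abs_def] nu y_def)
  have xnz: "x l \<noteq> 0" for l using ynz[of m l] m by (simp add: x_def)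
  define D where "D l = poly (crit d'.e g) (x l)" for l
  define D0 where "D0 = - of_nat d'.e * a m"
  have D0: "D0 \<noteq> 0" using e' am by (simp add: D0_def)
  have Dl: "D \<longlonglongrightarrow> D0"
  proof -
    have "D \<longlonglongrightarrow> poly (crit d'.e g) 0" unfolding D_def by (intro tendsto_poly xl)
    then show ?thesis using e' by (simp add: poly_crit D0_def g0)
  qed
  \<comment> \<open>The critical equation for the point that tends to 0. Its factor
    \<open>D l\<close> has a nonzero limit, so \<open>x l\<close> is comparable to
    \<open>s l\<close>.\<close>
  have xD: "x l * D l = of_nat e * s l" for l
  proof -
    have "poly (N (q l)) (x l) = 0" unfolding x_def by (rule poly_crit_root[OF roots]) (simp add: nu)
    then show ?thesis unfolding q_def Nq Na by (simp add: D_def)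
  qed
  have e0: "(of_nat e :: complex) \<noteq> 0" unfolding e by (rule of_nat_neq_0)
  have Dnz: "D l \<noteq> 0" for l using xD[of l] s(1)[of l] e0 by auto
  have xs: "x l / s l = of_nat e / D l" for l using xD[of l] Dnz[of l] s(1)[of l] by (simp add: frac_eq_eq mult_ac)
  define \<kappa> where "\<kappa> = of_nat e / D0"
  have xsl: "(\<lambda>l. x l / s l) \<longlonglongrightarrow> \<kappa>" unfolding xs \<kappa>_def by (intro tendsto_intros Dl D0)
  have k0': "\<kappa> \<noteq> 0" using e0 D0 by (simp add: \<kappa>_def)
  define \<Gamma> where "\<Gamma> = (\<kappa> * a m + 1) / \<kappa> ^ e"
  have "\<kappa> * a m = - of_nat e / of_nat d'.e" using am by (simp add: \<kappa>_def D0_def)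
  also have "\<dots> = - 1 - 1 / of_nat d'.e" using e' by (simp add: e add_divide_distrib diff_divide_distrib)
  finally have "\<kappa> * a m + 1 \<noteq> 0" using e' by simp
  then have G: "\<Gamma> \<noteq> 0" using k0' by (simp add: \<Gamma>_def)
  have sc: "s l ^ d'.e * cva (q l) (ys l m) = ((x l / s l) * poly g (x l) + 1) / (x l / s l) ^ e" for l
  proof -
    have "((x l / s l) * poly g (x l) + 1) / (x l / s l) ^ e = (x l * poly g (x l) + s l) / s l * s l ^ e / x l ^ e"
      using s(1)[of l] by (simp add: power_divide add_divide_distrib)
    also have "\<dots> = s l ^ d'.e * ((x l * poly g (x l) + s l) / x l ^ e)"
      using s(1)[of l] by (simp add: e)
    finally show ?thesis unfolding cv_def q_def pq by (simp add: x_def)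
  qed
  have scl: "(\<lambda>l. s l ^ d'.e * cva (q l) (ys l m)) \<longlonglongrightarrow> \<Gamma>"
  proof -
    have "(\<lambda>l. ((x l / s l) * poly g (x l) + 1) / (x l / s l) ^ e) \<longlonglongrightarrow> (\<kappa> * poly g 0 + 1) / \<kappa> ^ e"
      by (intro tendsto_divide tendsto_add tendsto_mult tendsto_power tendsto_const xsl tendsto_poly xl) (use k0' in simp)
    then show ?thesis unfolding sc \<Gamma>_def g0 .
  qed
  have se: "(\<lambda>l. s l ^ d'.e) \<longlonglongrightarrow> 0" using tendsto_power[OF s(2), of d'.e] e' by (simp add: power_0_left)
  have dl: "(\<lambda>l. s l ^ d'.e * (cva (q l) (ys l m) - cva (q l) (ys l i))) \<longlonglongrightarrow> \<Gamma>" if "i < m" for i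
    using tendsto_diff[OF scl tendsto_mult[OF se cl[OF that]]] by (simp add: algebra_simps)
  have dl': "(\<lambda>l. s l ^ d'.e * (cva (q l) (ys l i) - cva (q l) (ys l m))) \<longlonglongrightarrow> - \<Gamma>" if "i < m" for i
    using tendsto_minus[OF dl[OF that]] by (simp add: algebra_simps)
  obtain C where C: "C \<noteq> 0" "\<And>a y. ok a \<Longrightarrow> roots_of a y \<Longrightarrow> eval_mpoly a (D_tilde n k) = 
     C * a n ^ ((e - 1) * (2 * \<nu> - 1)) * (\<Prod>i<\<nu>. \<Prod>j\<in>{..<\<nu>}-{i}. cva a (y j) - cva a (y i))"
    using eval_D_tilde by blast
  obtain C' where C': "C' \<noteq> 0" "\<And>a y. d'.ok a \<Longrightarrow> d'.roots_of a y \<Longrightarrow> eval_mpoly a (D_tilde m k) = 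
     C' * a m ^ ((d'.e - 1) * (2 * d'.\<nu> - 1)) * (\<Prod>i<d'.\<nu>. \<Prod>j\<in>{..<d'.\<nu>}-{i}. d'.cva a (y j) - d'.cva a (y i))"
    using d'.eval_D_tilde by blast
  have F: "eval_mpoly (q l) (D_tilde n k) / s l ^ d'.e = C * (\<Prod>i<m. \<Prod>j\<in>{..<m}-{i}. cva (q l) (ys l j) - cva (q l) (ys l i)) *
     (\<Prod>i<m. (s l ^ d'.e * (cva (q l) (ys l m) - cva (q l) (ys l i))) * (s l ^ d'.e * (cva (q l) (ys l i) - cva (q l) (ys l m))))" for l
  proof -
    \<comment> \<open>Each of the \<open>m\<close> pairs that contain the growing critical value
      occurs in both orders and absorbs \<open>s l ^ (2 * d'.e)\<close>. Of the exponent in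
      \<open>eval_D_tilde\<close> this leaves \<open>d'.e\<close>, which is
      \<open>n - k - 1\<close>.\<close>
    have ex: "(e - 1) * (2 * \<nu> - 1) = d'.e + (d'.e * m + d'.e * m)" by (simp add: e nu algebra_simps)
    have pr: "(\<Prod>i<m. (t * A i) * (t * B i)) = t ^ m * t ^ m * (\<Prod>i<m. A i * B i)" for t :: complex and A B :: "nat \<Rightarrow> complex"
      by (simp add: prod.distrib mult_ac)
    have c: "C * (t * (u * u)) * (A * B) / t = C * A * (u * u * B)" if "t \<noteq> 0" for t u A B :: complex using that by simp
    have "s l ^ d'.e \<noteq> 0" using s(1)[of l] by simp
    from c[OF this] show ?thesis
      unfolding C(2)[OF ok roots] qn ex unfolding nu(1) offdiagonal_prod_Suc pr unfolding power_add power_mult .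
  qed
  define L where "L = C * (\<Prod>i<m. \<Prod>j\<in>{..<m}-{i}. c j - c i) * (\<Prod>i<m. \<Gamma> * (- \<Gamma>))"
  have "(\<lambda>l. eval_mpoly (q l) (D_tilde n k) / s l ^ d'.e) \<longlonglongrightarrow> L"
    unfolding F L_def by (intro tendsto_mult tendsto_const tendsto_prod tendsto_diff cl dl dl') auto
  moreover have "L \<noteq> 0" if h: "eval_mpoly a (D_tilde m k) \<noteq> 0"
  proof -
    have "(\<Prod>i<m. \<Prod>j\<in>{..<m}-{i}. c j - c i) \<noteq> 0"
      using h unfolding C'(2)[OF ok' z] nu(2) c_def g_def by auto
    then show ?thesis using C(1) G by (simp add: L_def)
  qed
  ultimately show ?thesis using s unfolding q_def em by (intro exI[of _ s] exI[of _ L]) blast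
qed


section \<open>Nonvanishing of the double discriminant and its exponent in the last
  coefficient\<close>

lemma R_in_mpolys: "R n \<in> mpolys {1..n} \<inter> {p. int_coeffs p}"
proof -
  let ?S = "mpolys {1..n} \<inter> {p. int_coeffs p}"
  have S: "subring ?S" by (intro subring_Int subring_mpolys subring_int_coeffs)
  have P: "coeff (P n) i \<in> ?S" for i
    using subringD(1,2)[OF S] by (auto simp: coeff_P Var_in_mpolys int_coeffs_Var)
  have "coeff (pderiv (P n)) i \<in> ?S" for i
    unfolding coeff_pderiv by (intro subringD(4)[OF S] P subring_of_nat[OF S])
  then show ?thesis unfolding R_def using P by (intro subring_resultant[OF S]) auto
qed

lemma D_tilde_in_mpolys: "D_tilde n k \<in> mpolys ({1..n} - {k})" "int_coeffs (D_tilde n k)"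
proof -
  let ?S = "mpolys ({1..n} - {k}) \<inter> {p. int_coeffs p}"
  have S: "subring ?S" by (intro subring_Int subring_mpolys subring_int_coeffs)
  have R: "coeff (as_univariate k (R n)) i \<in> ?S" for i
    using R_in_mpolys coeff_as_univariate_mpolys coeff_as_univariate_int by auto
  have "coeff (as_univariate k (partial_deriv k (R n))) i \<in> ?S" for i
    unfolding as_univariate_partial_deriv coeff_pderiv by (intro subringD(4)[OF S] R subring_of_nat[OF S])
  then have "D_tilde n k \<in> ?S" unfolding D_tilde_def using R by (intro subring_resultant[OF S]) auto
  then show "D_tilde n k \<in> mpolys ({1..n} - {k})" "int_coeffs (D_tilde n k)" by auto
qed

lemma eval_D_tilde_upd: "eval_mpoly (a(k := z)) (D_tilde n k) = eval_mpoly a (D_tilde n k)"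
  using D_tilde_in_mpolys(1) by (intro eval_cong) (auto simp: mpolys_def)

lemma limit_nonzero:
  assumes "(\<lambda>l. eval_mpoly (q l) F / c l) \<longlonglongrightarrow> L" "L \<noteq> 0" shows "F \<noteq> 0"
proof
  assume "F = 0"
  then show False using assms LIMSEQ_unique[OF tendsto_const, of 0 L] by simp
qed

lemma last_coeff_example_1:
  assumes k: "Suc k = n" "3 \<le> n"
  shows "\<exists>a s L. (\<forall>l. s l \<noteq> 0) \<and> s \<longlonglongrightarrow> 0 \<and> (\<lambda>l. eval_mpoly (a(n := s l)) (D_tilde n k) / s l ^ 1) \<longlonglongrightarrow> L \<and> L \<noteq> 0"
proof -
  define a :: "nat \<Rightarrow> complex" where "a i = (if i = n - 2 then 1 else 0)" for i
  have k2: "2 \<le> k" using k by simp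
  have "n - 2 = k - 1" using k by simp
  then have p: "P_at k a = monom 1 k + monom 1 1"
    by (intro poly_eqI) (use k2 in \<open>auto simp: coeff_P_at a_def coeff_monom\<close>)
  have "degree (pderiv (P_at k a)) = k - 1" by (simp add: degree_pderiv)
  moreover have "lead_coeff (pderiv (P_at k a)) = of_nat k"
    using k2 by (simp add: degree_pderiv coeff_pderiv coeff_P_at flip: of_nat_Suc del: of_nat_Suc)
  ultimately obtain z where z: "pderiv (P_at k a) = Polynomial.smult (of_nat k) (\<Prod>i<k - 1. [:- z i, 1:])"
    using complex_poly_factor by metis
  note pc = power_plus_linear_critical[OF p k2 one_neq_zero z]
  have h: "\<forall>i<k - 1. poly (P_at k a) (z i) \<noteq> 0 \<and> (\<forall>j<k - 1. j \<noteq> i \<longrightarrow> poly (P_at k a) (z i) \<noteq> poly (P_at k a) (z j))"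
    by (intro allI impI conjI) (rule pc(1), assumption, rule pc(2))
  have "a n = 0" "a k = 0" "a (n - 2) \<noteq> 0" using k by (auto simp: a_def)
  from last_coeff_limit_1[OF k this z]
  obtain s L where "\<forall>l. s l \<noteq> 0" "s \<longlonglongrightarrow> 0" "(\<lambda>l. eval_mpoly (a(n := s l)) (D_tilde n k) / s l ^ 1) \<longlonglongrightarrow> L" "L \<noteq> 0"
    using h by (elim exE conjE) (rule that; (assumption | erule mp, assumption))
  then show ?thesis by (intro exI conjI)
qed

end

text \<open>The smallest case, which the limit formulas do not reach. The witness is
  \<open>x ^ 2 + 1\<close>: the critical points of \<open>x + 1 / x\<close> are 1 and -1, with
  values 2 and -2.\<close>

lemma D_tilde_nonzero_21: "D_tilde 2 (Suc 0) \<noteq> 0"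
proof -
  interpret discriminant_params 2 "Suc 0" by unfold_locales auto
  define a :: "nat \<Rightarrow> complex" where "a i = (if i = 2 then 1 else 0)" for i
  define y :: "nat \<Rightarrow> complex" where "y i = (if i = 0 then 1 else - 1)" for i
  have e: "e = 1" and nu: "\<nu> = 2" unfolding e_def \<nu>_def by simp_all
  have nu2: "\<nu> = Suc (Suc 0)" using nu numeral_2_eq_2 by (rule trans)
  have p: "P_at 2 a = [:1, 0, 1:]"
    by (rule poly_eqI) (auto simp: coeff_P_at a_def coeff_pCons split: nat.split)
  have "N a = [:-1, 0, 1:]" unfolding p e by (simp add: crit_def pderiv_pCons)
  moreover have "(\<Prod>i<\<nu>. [:- y i, 1:]) = [:-1, 0, 1:]"
    unfolding nu2 prod.lessThan_Suc by (simp add: y_def del: pCons_one)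
  ultimately have roots: "roots_of a y" by simp
  have ok: "ok a" by (simp add: ok_def a_def)
  obtain C where C: "C \<noteq> 0" "\<And>a y. ok a \<Longrightarrow> roots_of a y \<Longrightarrow> eval_mpoly a (D_tilde 2 (Suc 0)) = 
     C * a 2 ^ ((e - 1) * (2 * \<nu> - 1)) * (\<Prod>i<\<nu>. \<Prod>j\<in>{..<\<nu>}-{i}. cva a (y j) - cva a (y i))"
    using eval_D_tilde by blast
  have "cva a (y 0) = 2" "cva a (y (Suc 0)) = - 2" by (simp_all add: cv_def p e y_def)
  then have "cva a (y j) \<noteq> cva a (y i)" if "i < 2" "j < 2" "i \<noteq> j" for i j
    using that by (auto simp: less_2_cases_iff)
  then have "(\<Prod>i<\<nu>. \<Prod>j\<in>{..<\<nu>}-{i}. cva a (y j) - cva a (y i)) \<noteq> 0"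
    unfolding nu by (auto simp: prod_zero_iff)
  then have "eval_mpoly a (D_tilde 2 (Suc 0)) \<noteq> 0" unfolding C(2)[OF ok roots] using C(1) by (simp add: e)
  then show ?thesis by auto
qed

lemma last_coeff_example_2:
  assumes "discriminant_params n k" "Suc (Suc k) \<le> n" "D_tilde (n - 1) k \<noteq> 0"
  shows "\<exists>a s L. (\<forall>l. s l \<noteq> 0) \<and> s \<longlonglongrightarrow> 0 \<and> (\<lambda>l. eval_mpoly (a(n := s l)) (D_tilde n k) / s l ^ (n - k - 1)) \<longlonglongrightarrow> L \<and> L \<noteq> 0"
proof -
  interpret discriminant_params n k by fact
  interpret d': discriminant_params "n - 1" k by unfold_locales (use k1 assms(2) in auto)
  have "D_tilde (n - 1) k * Var (n - 1) \<noteq> 0" using assms(3) by (simp add: Var_nonzero)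
  then obtain a where a: "eval_mpoly a (D_tilde (n - 1) k * Var (n - 1)) \<noteq> 0" by (rule eval_nonzero)
  have 0: "eval_mpoly (a(n := 0)) (D_tilde (n - 1) k) = eval_mpoly a (D_tilde (n - 1) k)"
    using d'.D_tilde_in_mpolys(1) assms(2) by (intro eval_cong) (auto simp: mpolys_def)
  have "(a(n := 0)) n = 0" "(a(n := 0)) (n - 1) \<noteq> 0" using a assms(2) by (auto simp: ev.hom_mult)
  from last_coeff_limit_2[OF assms(2) this]
  obtain s L where "\<forall>l. s l \<noteq> 0" "s \<longlonglongrightarrow> 0" "(\<lambda>l. eval_mpoly (a(n := 0, n := s l)) (D_tilde n k) / s l ^ (n - k - 1)) \<longlonglongrightarrow> L"
     "eval_mpoly (a(n := 0)) (D_tilde (n - 1) k) \<noteq> 0 \<longrightarrow> L \<noteq> 0"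
    by (elim exE conjE) (rule that; assumption)
  moreover have "eval_mpoly (a(n := 0)) (D_tilde (n - 1) k) \<noteq> 0" using a unfolding 0 by (auto simp: ev.hom_mult)
  ultimately show ?thesis by (intro exI[of _ "a(n := 0)"] exI[of _ s] exI[of _ L] conjI) (assumption+, erule mp)
qed

text \<open>Induction on \<open>n\<close> for fixed \<open>k\<close>. Explicit polynomials settle
  \<open>n = k\<close> and \<open>n = k + 1\<close>; for \<open>n \<ge> k + 2\<close> the second
  limit formula reduces the question to \<open>n - 1\<close>.\<close>

theorem D_tilde_nonzero: "discriminant_params n k \<Longrightarrow> D_tilde n k \<noteq> 0"
proof (induction n)
  case 0
  then show ?case by (simp add: discriminant_params_def)
next
  case (Suc m)
  interpret discriminant_params "Suc m" k by fact
  consider "k = Suc m" | "k = m" "m = 1" | "Suc k = Suc m" "3 \<le> Suc m" | "Suc (Suc k) \<le> Suc m" using n2 kn k1 by linarith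
  then show ?case
  proof cases
    case 1
    then show ?thesis by (rule D_tilde_nonzero_last)
  next
    case 2
    then show ?thesis using D_tilde_nonzero_21 by (simp add: numeral_2_eq_2)
  next
    case 3
    show ?thesis using last_coeff_example_1[OF 3] by (elim exE conjE) (rule limit_nonzero)
  next
    case 4
    then have "discriminant_params m k" using k1 by unfold_locales auto
    then have "D_tilde (Suc m - 1) k \<noteq> 0" using Suc.IH by simp
    from last_coeff_example_2[OF Suc.prems 4 this] show ?thesis by (elim exE conjE) (rule limit_nonzero)
  qed
qed

text \<open>For \<open>k < n\<close> the exponent \<open>d n k\<close> is 1 if
  \<open>k = n - 1\<close> and \<open>n - k - 1\<close> otherwise, which are the powers of
  \<open>s\<close> in the two limit formulas.\<close>

theorem last_coeff_power:
  assumes "discriminant_params n k" "3 \<le> n" "k < n"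
  shows "\<exists>H. D_tilde n k = Var n ^ d n k * H \<and> \<not> Var n dvd H"
proof -
  interpret discriminant_params n k by fact
  have ind: "n \<notin> indets (Var j)" if "j < n" for j using Var_in_mpolys[of j "{j}"] that by (auto simp: mpolys_def)
  show ?thesis
  proof (cases "Suc k = n")
    case True
    then have dn: "d n k = 1" by (auto simp: d_def)
    obtain a0 s0 L0 where *: "\<And>l. s0 l \<noteq> 0" "s0 \<longlonglongrightarrow> 0" "(\<lambda>l. eval_mpoly (a0(n := s0 l)) (D_tilde n k) / s0 l ^ 1) \<longlonglongrightarrow> L0" "L0 \<noteq> 0"
      using last_coeff_example_1[OF True assms(2)] by blast
    show ?thesis unfolding dn
    proof (rule exact_power[OF Var_nonzero ind _ *])
      show "n - 2 < n" using assms(2) by simp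
      fix a assume a: "a n = 0" "eval_mpoly a (Var (n - 2)) \<noteq> 0"
      \<comment> \<open>\<open>last_coeff_limit_1\<close> is stated for points with
        \<open>a k = 0\<close>; the double discriminant is independent of this coordinate.\<close>
      let ?a = "a(k := 0)"
      have "degree (pderiv (P_at k ?a)) = k - 1" by (simp add: degree_pderiv)
      moreover have "lead_coeff (pderiv (P_at k ?a)) = of_nat k"
        using k1 by (simp add: degree_pderiv coeff_pderiv coeff_P_at flip: of_nat_Suc del: of_nat_Suc)
      ultimately obtain z where z: "pderiv (P_at k ?a) = Polynomial.smult (of_nat k) (\<Prod>i<k - 1. [:- z i, 1:])"
        using complex_poly_factor by metis
      have "?a n = 0" "?a k = 0" "?a (n - 2) \<noteq> 0" using a True assms(2) by auto
      note lim = last_coeff_limit_1[OF True assms(2) this z]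
      have "?a(n := t) = (a(n := t))(k := 0)" for t using assms(3) by (intro fun_upd_twist) simp
      then have upd: "eval_mpoly (?a(n := t)) (D_tilde n k) = eval_mpoly (a(n := t)) (D_tilde n k)" for t
        by (simp only: eval_D_tilde_upd)
      from lim show "\<exists>s L. (\<forall>l. s l \<noteq> 0) \<and> s \<longlonglongrightarrow> 0 \<and> (\<lambda>l. eval_mpoly (a(n := s l)) (D_tilde n k) / s l ^ 1) \<longlonglongrightarrow> L"
        unfolding upd by (elim exE conjE) (intro exI conjI; assumption)
    qed
  next
    case False
    then have k2: "Suc (Suc k) \<le> n" using assms(3) by simp
    then have dn: "d n k = n - k - 1" by (simp add: d_def)
    have "discriminant_params (n - 1) k" by unfold_locales (use k1 k2 in auto)
    then have "D_tilde (n - 1) k \<noteq> 0" by (rule D_tilde_nonzero)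
    then obtain a0 s0 L0 where *: "\<And>l. s0 l \<noteq> 0" "s0 \<longlonglongrightarrow> 0" "(\<lambda>l. eval_mpoly (a0(n := s0 l)) (D_tilde n k) / s0 l ^ (n - k - 1)) \<longlonglongrightarrow> L0" "L0 \<noteq> 0"
      using last_coeff_example_2[OF assms(1) k2] by blast
    show ?thesis unfolding dn
    proof (rule exact_power[OF Var_nonzero ind _ *])
      show "n - 1 < n" using assms(2) by simp
      fix a assume a: "a n = 0" "eval_mpoly a (Var (n - 1)) \<noteq> 0"
      then have "a (n - 1) \<noteq> 0" by simp
      from last_coeff_limit_2[OF k2 a(1) this]
      show "\<exists>s L. (\<forall>l. s l \<noteq> 0) \<and> s \<longlonglongrightarrow> 0 \<and> (\<lambda>l. eval_mpoly (a(n := s l)) (D_tilde n k) / s l ^ (n - k - 1)) \<longlonglongrightarrow> L"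
        by (elim exE conjE) (intro exI conjI; assumption)
    qed
  qed
qed

subsection \<open>Parametrisation of the strata\<close>

lemma P_at_eqI:
  assumes "degree p = n" "lead_coeff p = 1" "\<And>j. 1 \<le> j \<Longrightarrow> j \<le> n \<Longrightarrow> a j = coeff p (n - j)"
  shows "P_at n a = p"
proof (rule poly_eqI)
  fix i
  consider "i = n" | "i < n" | "i > n" by linarith
  then show "coeff (P_at n a) i = coeff p i"
    using assms(1,2) assms(3)[of "n - i"] by cases (auto simp: coeff_P_at coeff_eq_0)
qed

lemma P_at_cong: "(\<And>j. 1 \<le> j \<Longrightarrow> j \<le> n \<Longrightarrow> a j = a' j) \<Longrightarrow> P_at n a = P_at n a'"
  by (rule poly_eqI) (auto simp: coeff_P_at)

lemma eval_poly: "eval_mpoly \<theta> (poly p x) = poly (map_poly (eval_mpoly \<theta>) p) (eval_mpoly \<theta> x)"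
  by simp

lemma eval_poly_Const: "eval_mpoly \<theta> (poly (map_poly Const W) x) = poly W (eval_mpoly \<theta> x)"
proof -
  interpret C: comm_ring_hom Const by (rule comm_ring_hom_Const)
  have "map_poly (eval_mpoly \<theta>) (map_poly Const W) = W" by (rule poly_eqI) (simp add: coeff_map_poly)
  then show ?thesis unfolding eval_poly by simp
qed

lemma monic_cofactor:
  assumes "P_at n a = A * q" "lead_coeff A = 1"
  shows "degree q = n - degree A" "lead_coeff q = 1"
proof -
  have 0: "A \<noteq> 0" "q \<noteq> 0" using assms P_at_nonzero[of n a] by auto
  show "lead_coeff q = 1" using lead_coeff_P_at[of n a] unfolding assms(1) lead_coeff_mult assms(2) by simp
  have "degree A + degree q = n" using degree_P_at[of n a] 0 unfolding assms(1) by (simp add: degree_mult_eq)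
  then show "degree q = n - degree A" by simp
qed

context theorem4_params
begin

definition stratum :: "bool \<Rightarrow> (nat \<Rightarrow> complex) set" where "stratum b = (if b then VS else VM)"

text \<open>Over any commutative ring, so that the multiple roots may be variables as well as
  numbers.\<close>

definition multiple :: "bool \<Rightarrow> 'a \<Rightarrow> 'a \<Rightarrow> 'a::comm_ring_1 poly" where
  "multiple b u v = (if b then [:- u, 1:] ^ 3 else [:- u, 1:] ^ 2 * [:- v, 1:] ^ 2)"

definition codeg :: "bool \<Rightarrow> nat" where "codeg b = (if b then n - 3 else n - 4)"

lemma multiple_lin: "multiple b u v = (if b then lin u ^ 3 else lin u ^ 2 * lin v ^ 2)"
  by (simp add: multiple_def lin_def)

lemma multiple_degree: "degree (multiple b u v :: complex poly) = n - codeg b" "lead_coeff (multiple b u v :: complex poly) = 1"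
proof -
  show "degree (multiple b u v :: complex poly) = n - codeg b"
    using n4 by (auto simp: multiple_lin codeg_def degree_mult_eq degree_power_eq)
  show "lead_coeff (multiple b u v :: complex poly) = 1"
    by (cases b) (simp_all only: multiple_lin if_True if_False lead_coeff_mult lead_coeff_power lead_coeff_lin power_one mult_1_left)
qed

lemma codeg: "codeg b \<le> n - 3" "codeg b \<le> n" "\<not> b \<Longrightarrow> codeg b < n - 3" using n4 by (auto simp: codeg_def)

lemma stratum_iff: "a \<in> stratum b \<longleftrightarrow> (\<exists>z u v. multiple b u v dvd P_at n (a(k := z)))"
  by (auto simp: stratum_def VS_def VM_def multiple_lin)

text \<open>The parameters are the multiple roots, \<open>Var 0\<close> and \<open>Var (n - 3)\<close>, the coefficients
  of the cofactor, and, shifted by \<open>n\<close>, the coordinates which are not constrained.\<close>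

definition PG :: "bool \<Rightarrow> mpoly poly" where "PG b = multiple b (Var 0) (Var (n - 3)) * P (codeg b)"

definition gp :: "bool \<Rightarrow> (nat \<Rightarrow> complex) \<Rightarrow> complex poly" where
  "gp b \<theta> = multiple b (\<theta> 0) (\<theta> (n - 3)) * P_at (codeg b) \<theta>"

definition subst_at :: "bool \<Rightarrow> nat \<Rightarrow> mpoly" where
  "subst_at b j = (if j \<in> {1..n} - {k} then coeff (PG b) (n - j) else Var (j + n))"

definition subst :: "bool \<Rightarrow> mpoly \<Rightarrow> mpoly" where "subst b = heval Const (subst_at b)"

definition param :: "bool \<Rightarrow> (nat \<Rightarrow> complex) \<Rightarrow> nat \<Rightarrow> complex" where
  "param b \<theta> j = eval_mpoly \<theta> (subst_at b j)"

lemma subst_hom: "comm_ring_hom (subst b)" unfolding subst_def by (rule heval_hom[OF comm_ring_hom_Const])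

lemma eval_subst: "eval_mpoly \<theta> (subst b h) = eval_mpoly (param b \<theta>) h"
  by (rule mpoly_hom_eqI[OF comm_ring_hom_comp[OF eval_hom subst_hom] eval_hom])
    (simp_all add: subst_def comm_ring_hom_Const param_def)

lemma map_PG: "map_poly (eval_mpoly \<theta>) (PG b) = gp b \<theta>"
proof -
  interpret m: comm_ring_hom "map_poly (eval_mpoly \<theta>)" by (rule comm_ring_hom_map_poly[OF eval_hom])
  have "map_poly (eval_mpoly \<theta>) [:- Var j, 1:] = [:- \<theta> j, 1:]" for j
    by (rule poly_eqI) (auto simp: coeff_map_poly coeff_pCons ev.hom_uminus split: nat.split)
  then show ?thesis by (simp add: PG_def gp_def multiple_def m.hom_mult m.hom_power P_at_def)
qed

lemma eval_coeff_PG: "eval_mpoly \<theta> (coeff (PG b) i) = coeff (gp b \<theta>) i"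
  unfolding map_PG[symmetric] by (simp add: coeff_map_poly)

lemma gp_degree: "degree (gp b \<theta>) = n" "lead_coeff (gp b \<theta>) = 1"
proof -
  show 1: "lead_coeff (gp b \<theta>) = 1" unfolding gp_def lead_coeff_mult multiple_degree(2) lead_coeff_P_at by simp
  have "multiple b (\<theta> 0) (\<theta> (n - 3)) \<noteq> 0" using multiple_degree(2)[of b "\<theta> 0" "\<theta> (n - 3)"] by auto
  then show "degree (gp b \<theta>) = n" using codeg(2)[of b] by (simp add: gp_def degree_mult_eq multiple_degree)
qed

lemma param_simps: "j \<in> {1..n} - {k} \<Longrightarrow> param b \<theta> j = coeff (gp b \<theta>) (n - j)" "j \<notin> {1..n} - {k} \<Longrightarrow> param b \<theta> j = \<theta> (j + n)"
  by (simp_all only: param_def subst_at_def eval_coeff_PG eval_Var if_True if_False simp_thms)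

lemma P_at_param: "P_at n ((param b \<theta>)(k := coeff (gp b \<theta>) (n - k))) = gp b \<theta>"
  by (rule P_at_eqI[OF gp_degree]) (auto simp: param_simps)

lemma stratum_param: "a \<in> stratum b \<longleftrightarrow> (\<exists>\<theta>. a = param b \<theta>)"
proof
  assume "\<exists>\<theta>. a = param b \<theta>"
  then obtain \<theta> where a: "a = param b \<theta>" by blast
  have "multiple b (\<theta> 0) (\<theta> (n - 3)) dvd P_at n (a(k := coeff (gp b \<theta>) (n - k)))"
    unfolding a P_at_param unfolding gp_def by (rule dvd_triv_left)
  then show "a \<in> stratum b" unfolding stratum_iff by blast
next
  assume "a \<in> stratum b"
  then obtain z u v q where q: "P_at n (a(k := z)) = multiple b u v * q" unfolding stratum_iff dvd_def by blast
  have "degree q = codeg b" "lead_coeff q = 1"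
    using monic_cofactor[OF q multiple_degree(2)] codeg(2)[of b] by (auto simp: multiple_degree)
  then obtain c where c: "P_at (codeg b) c = q" by (rule P_at_surj)
  \<comment> \<open>For two double roots the cofactor has degree \<open>n - 4\<close>, so that the
    index \<open>n - 3\<close> is available for the second root; for a triple root this index holds
    the last coefficient of the cofactor.\<close>
  define \<theta> where "\<theta> i = (if i = 0 then u else if \<not> b \<and> i = n - 3 then v else if i \<le> n - 3 then c i else a (i - n))" for i
  have "P_at (codeg b) \<theta> = q" unfolding c[symmetric]
    by (rule P_at_cong) (use codeg[of b] in \<open>auto simp: \<theta>_def\<close>)
  moreover have "multiple b (\<theta> 0) (\<theta> (n - 3)) = multiple b u v"
    using n4 by (auto simp: multiple_def \<theta>_def)
  ultimately have gp: "gp b \<theta> = P_at n (a(k := z))" by (simp add: gp_def q)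
  have "a j = param b \<theta> j" for j
  proof (cases "j \<in> {1..n} - {k}")
    case True
    then show ?thesis by (auto simp: param_simps gp coeff_P_at)
  next
    case False
    moreover have "j + n \<noteq> 0" "j + n \<noteq> n - 3" "\<not> j + n \<le> n - 3" using n4 by linarith+
    ultimately show ?thesis by (simp only: param_simps(2) \<theta>_def if_False simp_thms) simp
  qed
  then show "\<exists>\<theta>. a = param b \<theta>" by blast
qed

definition K :: "bool \<Rightarrow> mpoly set" where "K b = {h. \<forall>a\<in>stratum b. eval_mpoly a h = 0}"

text \<open>The stratum is the image of a polynomial map, so vanishing on it means that substitution
  of this map gives 0. As the kernel of a homomorphism into an integral domain, the ideal is prime;
  the integer coefficients of the map are the source of those of \<open>M\<close> and
  \<open>T\<close>.\<close>

lemma K_subst: "K b = {h. subst b h = 0}"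
proof -
  have "subst b h = 0 \<longleftrightarrow> (\<forall>a\<in>stratum b. eval_mpoly a h = 0)" for h
  proof
    assume 0: "subst b h = 0"
    show "\<forall>a\<in>stratum b. eval_mpoly a h = 0"
      using eval_subst[of _ b h] unfolding stratum_param 0 by (auto simp: stratum_param)
  next
    assume "\<forall>a\<in>stratum b. eval_mpoly a h = 0"
    then have "eval_mpoly \<theta> (subst b h) = 0" for \<theta> unfolding eval_subst using stratum_param by blast
    then show "subst b h = 0" by (intro mpoly_eqI) simp
  qed
  then show ?thesis by (auto simp: K_def)
qed

lemma prime_ideal_K: "prime_ideal (K b)"
  unfolding K_subst by (rule prime_ideal_kernel[OF subst_hom])

text \<open>\<gamma> collects the conditions on a parameter: the constant coefficient is nonzero,
  the multiple roots differ from the roots of the cofactor and, if there are two, from each other,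
  and \<open>W\<close> is nonzero at the first one. Explicit values show that each factor is a
  nonzero polynomial.\<close>

lemma generic_factor:
  assumes "W \<noteq> 0"
  shows "\<exists>\<gamma>. \<gamma> \<noteq> 0 \<and> (\<forall>\<theta>. eval_mpoly \<theta> \<gamma> \<noteq> 0 \<longrightarrow> (\<exists>z u v Q. sp b ((param b \<theta>)(k := z)) u v Q \<and> poly W u \<noteq> 0))"
proof -
  define c where "c = codeg b"
  define \<gamma> where "\<gamma> = coeff (PG b) 0 * poly (P c) (Var 0) * poly (map_poly Const W) (Var 0) *
     (if b then 1 else poly (P c) (Var (n - 3)) * (Var 0 - Var (n - 3)))"
  have P: "eval_mpoly \<theta> (poly (P c) (Var j)) = poly (P_at c \<theta>) (\<theta> j)" for j \<theta>
    unfolding eval_poly P_at_def by simp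
  have nz: "p \<noteq> 0" if "eval_mpoly \<theta> p \<noteq> 0" for \<theta> p using that by auto
  have 1: "coeff (PG b) 0 \<noteq> 0"
  proof (rule nz)
    let ?\<theta> = "\<lambda>_. 1 :: complex"
    have "coeff (gp b ?\<theta>) 0 = poly (gp b ?\<theta>) 0" by (simp add: poly_0_coeff_0)
    also have "\<dots> \<noteq> 0"
      by (auto simp: gp_def multiple_lin poly_0_coeff_0[of "P_at _ _"] coeff_P_at)
    finally show "eval_mpoly ?\<theta> (coeff (PG b) 0) \<noteq> 0" unfolding eval_coeff_PG .
  qed
  have x: "P_at c (\<lambda>i. if i = j then 1 else 0) = monom 1 c" if "j = 0 \<or> c < j" for j
    by (rule poly_eqI) (use that in \<open>auto simp: coeff_P_at coeff_monom\<close>)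
  have 2: "poly (P c) (Var 0) \<noteq> 0"
    by (rule nz[of "\<lambda>i. if i = 0 then 1 else 0"]) (use x[of 0] in \<open>simp add: P poly_monom\<close>)
  have 3: "poly (map_poly Const W) (Var 0) \<noteq> 0"
  proof -
    obtain u where "poly W u \<noteq> 0" using assms poly_all_0_iff_0 by blast
    then show ?thesis by (intro nz[of "\<lambda>_. u"]) (simp only: eval_poly_Const eval_Var not_False_eq_True)
  qed
  have 4: "poly (P c) (Var (n - 3)) \<noteq> 0" "Var 0 - Var (n - 3) \<noteq> 0" if "\<not> b"
  proof -
    show "poly (P c) (Var (n - 3)) \<noteq> 0"
      by (rule nz[of "\<lambda>i. if i = n - 3 then 1 else 0"]) (use x[of "n - 3"] codeg(3)[OF that, folded c_def] in \<open>simp add: P poly_monom\<close>)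
    show "Var 0 - Var (n - 3) \<noteq> 0"
      by (rule nz[of "\<lambda>i. if i = 0 then 1 else 0"]) (use n4 in \<open>simp add: ev.hom_minus\<close>)
  qed
  have "\<gamma> \<noteq> 0" using 1 2 3 4 unfolding \<gamma>_def by (auto split: if_splits)
  moreover have "\<exists>z u v Q. sp b ((param b \<theta>)(k := z)) u v Q \<and> poly W u \<noteq> 0" if g: "eval_mpoly \<theta> \<gamma> \<noteq> 0" for \<theta>
  proof -
    have g: "coeff (gp b \<theta>) 0 \<noteq> 0" "poly (P_at c \<theta>) (\<theta> 0) \<noteq> 0" "poly W (\<theta> 0) \<noteq> 0"
      "\<not> b \<Longrightarrow> poly (P_at c \<theta>) (\<theta> (n - 3)) \<noteq> 0" "\<not> b \<Longrightarrow> \<theta> 0 \<noteq> \<theta> (n - 3)"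
      using g unfolding \<gamma>_def ev.hom_mult P eval_coeff_PG eval_poly_Const eval_Var by (auto simp: P ev.hom_mult ev.hom_minus)
    let ?a = "(param b \<theta>)(k := coeff (gp b \<theta>) (n - k))"
    let ?v = "if b then \<theta> 0 else \<theta> (n - 3)"
    have "ok ?a" unfolding ok_def using g(1) n4 by (auto simp: param_simps)
    moreover have "P_at n ?a = (if b then lin (\<theta> 0) ^ 3 else lin (\<theta> 0) ^ 2 * lin (\<theta> (n - 3)) ^ 2) * P_at c \<theta>"
      unfolding P_at_param unfolding gp_def multiple_lin c_def ..
    ultimately have "sp b ?a (\<theta> 0) ?v (P_at c \<theta>)" unfolding sp_def using g by auto
    then show ?thesis using g(3) by blast
  qed
  ultimately show ?thesis by blast
qed

text \<open>The parameter space is irreducible: a product of nonzero polynomials is nonzero, so the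
  conditions in \<gamma> and the nonvanishing of \<open>h\<close> can be met at once.\<close>

lemma generic_points:
  assumes "W \<noteq> 0" "h \<notin> K b"
  shows "\<exists>a z u v Q. eval_mpoly a h \<noteq> 0 \<and> sp b (a(k := z)) u v Q \<and> poly W u \<noteq> 0"
proof -
  obtain \<gamma> where \<gamma>: "\<gamma> \<noteq> 0" "\<And>\<theta>. eval_mpoly \<theta> \<gamma> \<noteq> 0 \<Longrightarrow> \<exists>z u v Q. sp b ((param b \<theta>)(k := z)) u v Q \<and> poly W u \<noteq> 0"
    using generic_factor[OF assms(1)] by blast
  have "subst b h * \<gamma> \<noteq> 0" using assms(2) \<gamma>(1) by (simp add: K_subst)
  then obtain \<theta> where "eval_mpoly \<theta> (subst b h * \<gamma>) \<noteq> 0" by (rule eval_nonzero)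
  then have "eval_mpoly (param b \<theta>) h \<noteq> 0" "eval_mpoly \<theta> \<gamma> \<noteq> 0" by (auto simp: ev.hom_mult eval_subst)
  with \<gamma>(2) show ?thesis by blast
qed

lemma eventually_poly_nonzero:
  fixes q :: "complex poly"
  assumes "q \<noteq> 0" "\<And>l. s l \<noteq> 0" "s \<longlonglongrightarrow> 0" shows "eventually (\<lambda>l. poly q (s l) \<noteq> 0) sequentially"
proof -
  have "filterlim s (at 0) sequentially" using assms(2,3) by (auto simp: filterlim_at)
  moreover have "eventually (\<lambda>x. poly q x \<noteq> 0) (at 0)"
    using islimpt_finite[OF poly_roots_finite[OF assms(1)], of 0] unfolding islimpt_iff_eventually by simp
  ultimately show ?thesis by (rule eventually_compose_filterlim[rotated])
qed

text \<open>On the line from the given parameter to one where \<gamma> is nonzero, only finitely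
  many points are excluded.\<close>

lemma stratum_limit:
  assumes "a \<in> stratum b"
  shows "\<exists>q. (\<forall>i. (\<lambda>l. q l i) \<longlonglongrightarrow> a i) \<and> (\<forall>l. \<exists>z u v Q. sp b ((q l)(k := z)) u v Q)"
proof -
  obtain \<theta> where a: "a = param b \<theta>" using assms stratum_param by blast
  have "(1 :: complex poly) \<noteq> 0" by simp
  then obtain \<gamma> where \<gamma>: "\<gamma> \<noteq> 0" "\<And>\<theta>. eval_mpoly \<theta> \<gamma> \<noteq> 0 \<Longrightarrow> \<exists>z u v Q. sp b ((param b \<theta>)(k := z)) u v Q"
    using generic_factor[of 1 b] by blast
  obtain \<theta>1 where \<theta>1: "eval_mpoly \<theta>1 \<gamma> \<noteq> 0" using \<gamma>(1) by (rule eval_nonzero)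
  define w where "w i = \<theta>1 i - \<theta> i" for i
  have "poly (lp \<theta> w \<gamma>) 1 \<noteq> 0" using \<theta>1 by (simp add: poly_lp w_def)
  then have nz: "lp \<theta> w \<gamma> \<noteq> 0" by auto
  define s where "s l = (1 / of_nat (Suc l) :: complex)" for l
  have s0: "s \<longlonglongrightarrow> 0" unfolding s_def using LIMSEQ_Suc[OF lim_1_over_n[where 'a = complex]] by simp
  have sn: "s l \<noteq> 0" for l by (simp add: s_def del: of_nat_Suc)
  obtain M where M: "\<And>l. l \<ge> M \<Longrightarrow> poly (lp \<theta> w \<gamma>) (s l) \<noteq> 0"
    using eventually_poly_nonzero[OF nz sn s0] unfolding eventually_sequentially by blast
  define q where "q l = param b (\<lambda>i. \<theta> i + s (l + M) * w i)" for l
  have "\<exists>z u v Q. sp b ((q l)(k := z)) u v Q" for l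
    unfolding q_def by (rule \<gamma>(2)) (use M[of "l + M"] in \<open>simp add: poly_lp\<close>)
  moreover have "(\<lambda>l. q l i) \<longlonglongrightarrow> a i" for i
  proof -
    have "(\<lambda>l. \<theta> j + s (l + M) * w j) \<longlonglongrightarrow> \<theta> j + 0 * w j" for j
      by (intro tendsto_intros LIMSEQ_ignore_initial_segment[OF s0])
    then show ?thesis unfolding q_def a param_def by (intro tendsto_eval_mpoly) simp
  qed
  ultimately show ?thesis by blast
qed

subsection \<open>Admissible directions\<close>

text \<open>A nonzero linear functional of the velocity is a nonzero linear form in the direction,
  so that a generic direction avoids its kernel.\<close>

lemma Wp_form:
  assumes L: "\<And>p q. L (p + q) = L p + L q" "\<And>c p. L (Polynomial.smult c p) = c * L p"
    and i: "i < n" "L (monom 1 i) \<noteq> (0 :: complex)"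
  shows "\<exists>B. B \<noteq> 0 \<and> 0 \<notin> indets B \<and> (\<forall>w. eval_mpoly w B = L (Wp w))"
proof -
  define B where "B = (\<Sum>i<n. Const (L (monom 1 i)) * Var (n - i))"
  have L0: "L 0 = 0" using L(2)[of 0 0] by simp
  have Ls: "L (sum f A) = (\<Sum>x\<in>A. L (f x))" if "finite A" for f :: "nat \<Rightarrow> complex poly" and A
    using that by induction (simp_all add: L0 L(1))
  have W: "Wp w = (\<Sum>i<n. Polynomial.smult (w (n - i)) (monom 1 i))" for w
    by (rule poly_eqI) (auto simp: coeff_Wp coeff_sum coeff_monom if_distrib[of "(*) _"] cong: if_cong)
  have ev: "eval_mpoly w B = L (Wp w)" for w
    unfolding W Ls[OF finite_lessThan] L(2) B_def by (simp add: ev.hom_sum ev.hom_mult mult.commute)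
  have "Wp (\<lambda>j. if j = n - i then 1 else 0) = monom 1 i"
    by (rule poly_eqI) (use i(1) in \<open>auto simp: coeff_Wp coeff_monom\<close>)
  then have "B \<noteq> 0" using ev[of "\<lambda>j. if j = n - i then 1 else 0"] i(2) by auto
  moreover have "B \<in> mpolys {1..n}" unfolding B_def
    by (intro subring_sum subring_mpolys subringD(4)[OF subring_mpolys] Const_in_mpolys) (auto simp: Var_in_mpolys)
  then have "0 \<notin> indets B" by (auto simp: mpolys_def)
  ultimately show ?thesis using ev by blast
qed

lemma transversal_form:
  assumes "sp b a u v Q"
  shows "\<exists>B. B \<noteq> 0 \<and> 0 \<notin> indets B \<and> (\<forall>w. eval_mpoly w B \<noteq> 0 \<longrightarrow> transversal b u v (Wp w))"
proof -
  \<comment> \<open>The quotient of \<open>x ^ (e + 1)\<close> by \<open>x ^ e\<close> is x, which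
    separates \<open>u\<close> from \<open>v\<close> and has no critical point at \<open>u\<close>.
    For \<open>k = 1\<close> this monomial is the fixed leading term of P, and
    \<open>x ^ (e - 1)\<close> with the quotient \<open>1 / x\<close> takes its place.\<close>
  define i where "i = (if k = 1 then n - 2 else Suc e)"
  have ein: "k = 1 \<Longrightarrow> Suc i = e \<and> e > 0" "k \<noteq> 1 \<Longrightarrow> i = Suc e" "i < n"
    unfolding i_def e_def using n4 k1 kn by auto
  have nz: "e = 0 \<or> u \<noteq> 0" "e = 0 \<or> v \<noteq> 0" using sp_root(3,4)[OF assms] X_nonzero_iff by auto
  show ?thesis
  proof (cases b)
    case True
    have "poly (crit e (monom 1 i)) u \<noteq> 0"
    proof (cases "k = 1")
      case k: True
      from ein(1)[OF this] have "e = Suc i" "u \<noteq> 0" using nz by auto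
      then show ?thesis by (cases i) (simp_all add: poly_crit pderiv_monom poly_monom algebra_simps)
    next
      case False
      then have i: "i = Suc e" using ein(2) by simp
      show ?thesis unfolding poly_crit i using nz(1) by (cases "e = 0") (simp_all add: pderiv_monom poly_monom algebra_simps)
    qed
    from Wp_form[of "\<lambda>p. poly (crit e p) u", OF _ _ ein(3) this] True show ?thesis
      by (auto simp: crit_add crit_smult transversal_def)
  next
    case False
    have uv: "u \<noteq> v" using assms False by (simp add: sp_def)
    have "cv e (monom 1 i) u - cv e (monom 1 i) v \<noteq> 0"
    proof (cases "k = 1")
      case k: True
      from ein(1)[OF this] have "e = Suc i" "u \<noteq> 0" "v \<noteq> 0" using nz by auto
      then show ?thesis using uv by (simp add: cv_def poly_monom)
    next
      case False
      then have i: "i = Suc e" using ein(2) by simp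
      have "x ^ Suc e / x ^ e = x" if "e = 0 \<or> x \<noteq> 0" for x :: complex using that by auto
      then show ?thesis using uv nz unfolding cv_def poly_monom i by simp
    qed
    from Wp_form[of "\<lambda>p. cv e p u - cv e p v", OF _ _ ein(3) this]
    obtain B where "B \<noteq> 0" "0 \<notin> indets B" "\<And>w. eval_mpoly w B = cv e (Wp w) u - cv e (Wp w) v"
      by (auto simp: cv_def add_divide_distrib algebra_simps)
    with False show ?thesis by (intro exI[of _ B]) (simp add: transversal_def)
  qed
qed

end

subsection \<open>Factorisation\<close>

lemma Var_dvd_iff: "Var n dvd H \<longleftrightarrow> coeff (as_univariate n H) 0 = 0"
proof
  assume "Var n dvd H"
  then obtain q where "H = Var n * q" by (auto elim: dvdE)
  then show "coeff (as_univariate n H) 0 = 0" by (simp add: au.hom_mult as_univariate_Var)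
qed (use not_Var_dvdD in blast)

lemma prime_elem_Var: "prime_elem (Var n)"
proof (rule prime_elemI)
  show "Var n \<noteq> 0" by (rule Var_nonzero)
  show "\<not> Var n dvd 1" by (simp add: Var_dvd_iff)
qed (auto simp: Var_dvd_iff au.hom_mult coeff_mult_0)

lemma prime_power_dvd:
  fixes p :: "'a::idom"
  assumes p: "prime_elem p" and A: "\<not> p dvd A"
  shows "p ^ m dvd A * B \<Longrightarrow> p ^ m dvd B"
proof (induction m arbitrary: B)
  case (Suc m)
  have "p dvd A * B" using Suc.prems unfolding power_Suc by (rule dvd_mult_left)
  then have "p dvd B" using p A by (simp add: prime_elem_dvd_mult_iff)
  then obtain B' where B: "B = p * B'" by (auto elim: dvdE)
  have p0: "p \<noteq> 0" using p by auto
  have "p * p ^ m dvd p * (A * B')" using Suc.prems unfolding B by (simp add: mult_ac)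
  then have "p ^ m dvd A * B'" using p0 by (simp only: dvd_mult_cancel_left simp_thms)
  then have "p ^ m dvd B'" by (rule Suc.IH)
  then show ?case unfolding B power_Suc by (rule mult_dvd_mono[OF dvd_refl])
qed simp

lemma prime_factor_power:
  assumes "prime_elem G" "wmonic w F"
  shows "\<exists>f H. F = G ^ f * H \<and> \<not> G dvd H"
  using assms(2)
proof (induction "dg w F" arbitrary: F rule: less_induct)
  case less
  show ?case
  proof (cases "G dvd F")
    case False
    then show ?thesis by (intro exI[of _ 0] exI[of _ F]) simp
  next
    case True
    then obtain F' where F: "F = G * F'" by (auto elim: dvdE)
    have G: "wmonic w G" using less.prems unfolding F by (rule wmonic_factor)
    have F': "wmonic w F'" using less.prems unfolding F by (subst (asm) mult.commute) (rule wmonic_factor)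
    have "dg w F = dg w G + dg w F'" unfolding F using wmonic_nonzero[OF G] wmonic_nonzero[OF F'] by (rule dg_mult)
    then have "dg w F' < dg w F" using wmonic_prime_dg[OF G assms(1)] by simp
    from less.hyps[OF this F'] obtain f H where "F' = G ^ f * H" "\<not> G dvd H" by blast
    then show ?thesis unfolding F by (intro exI[of _ "Suc f"] exI[of _ H]) (simp add: mult_ac)
  qed
qed

text \<open>The combination from \<open>coprime_elimination\<close> vanishes at the common zeros of
  \<open>G\<close> and \<open>A\<close>. Being constant along \<open>w\<close>, it can be avoided by
  \<open>nearby_zeros\<close> without leaving the zero set of \<open>A\<close>.\<close>

lemma elimination_zero:
  assumes "wmonic w G" "prime_elem G" "\<not> G dvd A"
  shows "\<exists>r. r \<noteq> 0 \<and> dg w r = 0 \<and> (\<forall>q. eval_mpoly q A = 0 \<longrightarrow> eval_mpoly q r \<noteq> 0 \<longrightarrow> eval_mpoly q G \<noteq> 0)"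
proof -
  obtain r \<alpha> \<beta> where r: "r \<noteq> 0" "dg w r = 0" "r = \<alpha> * G + \<beta> * A" using coprime_elimination[OF assms] by blast
  have "eval_mpoly q G \<noteq> 0" if q: "eval_mpoly q A = 0" "eval_mpoly q r \<noteq> 0" for q
  proof
    assume "eval_mpoly q G = 0"
    then have "eval_mpoly q (\<alpha> * G + \<beta> * A) = 0" using q(1) by (simp add: ev.hom_add ev.hom_mult)
    then show False using q(2) unfolding r(3)[symmetric] by simp
  qed
  then show ?thesis using r(1,2) by (intro exI[of _ r] conjI allI impI)
qed

lemma wmonic_has_zero:
  assumes "w 0 = 1" "wmonic w A" "dg w A > 0" shows "\<exists>p. eval_mpoly p A = 0"
proof -
  have "degree (lp (\<lambda>_. 0) w A) = dg w A" by (rule degree_lp[OF assms(1,2)])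
  then have "degree (lp (\<lambda>_. 0) w A) > 0" using assms(3) by simp
  from small_root[OF this] obtain s where "poly (lp (\<lambda>_. 0) w A) s = 0" by blast
  then show ?thesis unfolding poly_lp by (rule exI[where x = "\<lambda>i. 0 + s * w i"])
qed

lemma lp_nonzero: assumes "w 0 = 1" "wmonic w A" shows "lp p w A \<noteq> 0"
proof -
  have "lead_coeff (lp p w A) \<noteq> 0" by (rule degree_lp[OF assms]) simp
  then show ?thesis by auto
qed

section \<open>Generators of the two ideals and the factorisation\<close>

context theorem4_params
begin

abbreviation "F \<equiv> D_tilde n k"

lemma F_nonzero: "F \<noteq> 0" by (rule D_tilde_nonzero) unfold_locales

lemma lp_F_upd: "lp (a(k := z)) w F = lp a w F"
proof -
  have "poly (lp (a(k := z)) w F) s = poly (lp a w F) s" for s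
  proof -
    have "(\<lambda>i. (a(k := z)) i + s * w i) = (\<lambda>i. a i + s * w i)(k := z + s * w k)" by auto
    then show ?thesis unfolding poly_lp by (simp only: eval_D_tilde_upd)
  qed
  then show ?thesis by (simp add: poly_eq_poly_eq_iff[symmetric] fun_eq_iff)
qed

lemma sp_in_stratum: assumes "sp b (a(k := z)) u v Q" shows "a \<in> stratum b"
proof -
  have "multiple b u v dvd P_at n (a(k := z))"
    using assms by (auto simp: sp_def multiple_lin split: if_splits)
  then show ?thesis unfolding stratum_iff by blast
qed

lemma zero_in_stratum:
  assumes "eval_mpoly q F = 0" "ok q" shows "\<exists>b. q \<in> stratum b"
proof -
  obtain C where C: "C \<noteq> 0" "\<And>a y. ok a \<Longrightarrow> roots_of a y \<Longrightarrow> eval_mpoly a (D_tilde n k) = 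
     C * a n ^ ((e - 1) * (2 * \<nu> - 1)) * (\<Prod>i<\<nu>. \<Prod>j\<in>{..<\<nu>}-{i}. cva a (y j) - cva a (y i))"
    using eval_D_tilde by blast
  obtain y where y: "roots_of q y" by (rule roots_exist)
  have nz: "q n ^ ((e - 1) * (2 * \<nu> - 1)) \<noteq> 0" using assms(2) e_0_iff by (auto simp: ok_def)
  have "(\<Prod>i<\<nu>. \<Prod>j\<in>{..<\<nu>}-{i}. cva q (y j) - cva q (y i)) = 0"
    using assms(1) unfolding C(2)[OF assms(2) y] mult_eq_0_iff[of "_ * _"] mult_eq_0_iff[of C] by (simp only: C(1) nz simp_thms)
  then obtain i j where ij: "i < \<nu>" "j < \<nu>" "j \<noteq> i" "cva q (y j) - cva q (y i) = 0"
    by (auto simp: prod_zero_iff)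
  then have eq: "cva q (y i) = cva q (y j)" by simp
  show ?thesis
  proof (cases "y i = y j")
    case True
    then have "q \<in> VS" using pair_in_V(2)[OF assms(2) y ij(1,2) ij(3)[symmetric] eq] by simp
    then show ?thesis by (intro exI[of _ True]) (simp add: stratum_def)
  next
    case False
    then have "q \<in> VM" using pair_in_V(1)[OF assms(2) y ij(1,2) ij(3)[symmetric] eq] by simp
    then show ?thesis by (intro exI[of _ False]) (simp add: stratum_def)
  qed
qed

text \<open>\<open>F\<close> lies in the ideal because it vanishes at generic points of the stratum.
  A nonzero element constant along \<open>w\<close> would be avoided by zeros of \<open>F\<close>
  near \<open>a\<close>, but these reach the stratum by \<open>nearby_special\<close>; so
  \<open>prime_ideal_generator\<close> applies. The exponent is bounded from above at the nice point
  \<open>a\<close> and from below at generic points.\<close>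

theorem stratum_generator:
  assumes w: "w 0 = 1" "wmonic w F"
    and a: "sp b a u v Q" "roots_of a y" "y (\<nu> - 2) = u" "y (\<nu> - 1) = v" "nice a y" "transversal b u v (Wp w)"
  shows "\<exists>G H. wmonic w G \<and> prime_elem G \<and> (\<forall>h. h \<in> K b \<longleftrightarrow> G dvd h) \<and> F = G ^ strat_ord b * H \<and> \<not> G dvd H"
proof -
  \<comment> \<open>At a triple root the order estimate asks for \<open>crit\<close> of the velocity
    to be nonzero at \<open>u\<close>; at two double roots the condition is void.\<close>
  define W where "W = (if b then crit e (Wp w) else 1)"
  have W: "W \<noteq> 0" using a(6) by (auto simp: W_def transversal_def)
  note lpF = lp_nonzero[OF w]
  have ge: "strat_ord b \<le> order 0 (lp a w F)" if s: "sp b (a(k := z)) u v Q" "poly W u \<noteq> 0" for a z u v Q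
  proof -
    obtain y where y: "roots_of (a(k := z)) y" "y (\<nu> - 2) = u" "y (\<nu> - 1) = v" using sp_roots[OF s(1)] by blast
    have "b \<Longrightarrow> poly (crit e (Wp w)) u \<noteq> 0" using s(2) by (simp add: W_def)
    from order_special(1)[OF s(1) y lpF this] show ?thesis by (simp only: lp_F_upd)
  qed
  have FK: "F \<in> K b"
  proof (rule ccontr)
    assume "F \<notin> K b"
    from generic_points[OF W this] obtain a z u v Q where
      *: "eval_mpoly a F \<noteq> 0" "sp b (a(k := z)) u v Q" "poly W u \<noteq> 0" by blast
    have "order 0 (lp a w F) > 0" using ge[OF *(2,3)] by (auto simp: strat_ord_def split: if_splits)
    then have "poly (lp a w F) 0 = 0" using lpF by (simp add: order_gt_0_iff)
    then show False using *(1) by (simp add: poly_lp)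
  qed
  have "sp b (a(k := a k)) u v Q" using a(1) by simp
  then have aV: "a \<in> stratum b" by (rule sp_in_stratum)
  then have Fa: "eval_mpoly a F = 0" using FK by (simp add: K_def)
  have dgF: "dg w F > 0"
  proof (rule ccontr)
    assume "\<not> dg w F > 0"
    then obtain c where "c \<noteq> 0" "F = Const c" using dg_0_const[OF w(2)] by blast
    then show False using Fa by simp
  qed
  have free: "L = 0" if L: "L \<in> K b" "dg w L = 0" for L
  proof (rule ccontr)
    assume "L \<noteq> 0"
    then obtain q where q: "\<And>i. (\<lambda>l. q l i) \<longlonglongrightarrow> a i" "\<And>l. eval_mpoly (q l) F = 0" "\<And>l. eval_mpoly (q l) L \<noteq> 0"
      using nearby_zeros[OF w dgF Fa _ L(2)] by metis
    obtain l where "q l \<in> (if b then VS else VM)" using nearby_special[OF a(1-5) q(1,2)] by blast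
    then have "eval_mpoly (q l) L = 0" using L(1) by (simp add: K_def stratum_def)
    then show False using q(3) by simp
  qed
  obtain G where G: "wmonic w G" "prime_elem G" "\<And>h. h \<in> K b \<longleftrightarrow> G dvd h"
    using prime_ideal_generator[OF prime_ideal_K FK w(2) free] by blast
  obtain f H where FH: "F = G ^ f * H" "\<not> G dvd H" using prime_factor_power[OF G(2) w(2)] by blast
  have GV: "eval_mpoly p G = 0" if "p \<in> stratum b" for p using that G(3)[of G] by (simp add: K_def)
  have tr: "b \<Longrightarrow> poly (crit e (Wp w)) u \<noteq> 0" using a(6) by (simp add: transversal_def)
  have w': "wmonic w (G ^ f * H)" using w(2) unfolding FH(1) .
  have "f \<le> strat_ord b"
    using multiplicity_le[OF w(1) w' GV[OF aV]] order_special(2)[OF a(1-4) lpF tr a(5,6)] unfolding FH(1) by simp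
  moreover have "strat_ord b \<le> f"
  proof (rule multiplicity_ge[OF w(1) G(1,2) FH(2), where V = "{a. \<exists>z u v Q. sp b (a(k := z)) u v Q \<and> poly W u \<noteq> 0}"])
    fix p assume "p \<in> {a. \<exists>z u v Q. sp b (a(k := z)) u v Q \<and> poly W u \<noteq> 0}"
    then obtain z u v Q where p: "sp b (p(k := z)) u v Q" "poly W u \<noteq> 0" by blast
    show "eval_mpoly p G = 0" by (rule GV[OF sp_in_stratum[OF p(1)]])
    show "strat_ord b \<le> order 0 (lp p w (G ^ f * H))" using ge[OF p] unfolding FH(1) .
  next
    fix h assume "\<not> G dvd h"
    then have "h \<notin> K b" using G(3) by blast
    from generic_points[OF W this] show "\<exists>p\<in>{a. \<exists>z u v Q. sp b (a(k := z)) u v Q \<and> poly W u \<noteq> 0}. eval_mpoly p h \<noteq> 0" by blast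
  qed
  ultimately have "f = strat_ord b" by simp
  then show ?thesis using G FH by blast
qed

lemma not_indets_mult: "0 \<notin> indets p \<Longrightarrow> 0 \<notin> indets q \<Longrightarrow> 0 \<notin> indets (p * q)"
  using subringD(4)[OF subring_mpolys[of "- {0}"], of p q] by (auto simp: mpolys_def)

text \<open>One direction serves \<open>F\<close>, \<open>Var n\<close> and both generators, so that
  several eliminants constant along it can be avoided simultaneously by avoiding their
  product.\<close>

definition generators :: "(nat \<Rightarrow> complex) \<Rightarrow> (bool \<Rightarrow> mpoly) \<Rightarrow> bool" where
  "generators w G \<longleftrightarrow> w 0 = 1 \<and> wmonic w F \<and> wmonic w (Var n) \<and>
     (\<forall>b. wmonic w (G b) \<and> prime_elem (G b) \<and> (\<forall>h. h \<in> K b \<longleftrightarrow> G b dvd h) \<and>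
        (\<exists>H. F = G b ^ strat_ord b * H \<and> \<not> G b dvd H))"

lemma exists_generators: "\<exists>w G. generators w G"
proof -
  have "\<forall>b. \<exists>a u v Q y B. sp b a u v Q \<and> roots_of a y \<and> y (\<nu> - 2) = u \<and> y (\<nu> - 1) = v \<and> nice a y \<and>
    B \<noteq> 0 \<and> 0 \<notin> indets B \<and> (\<forall>w. eval_mpoly w B \<noteq> 0 \<longrightarrow> transversal b u v (Wp w))"
  proof
    fix b
    obtain a u v Q y where a: "sp b a u v Q" "roots_of a y" "y (\<nu> - 2) = u" "y (\<nu> - 1) = v" "nice a y"
      by (rule exists_nice)
    show "\<exists>a u v Q y B. sp b a u v Q \<and> roots_of a y \<and> y (\<nu> - 2) = u \<and> y (\<nu> - 1) = v \<and> nice a y \<and>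
      B \<noteq> 0 \<and> 0 \<notin> indets B \<and> (\<forall>w. eval_mpoly w B \<noteq> 0 \<longrightarrow> transversal b u v (Wp w))"
      using a transversal_form[OF a(1)] by blast
  qed
  then obtain B where B: "\<forall>b. \<exists>a u v Q y. sp b a u v Q \<and> roots_of a y \<and> y (\<nu> - 2) = u \<and> y (\<nu> - 1) = v \<and> nice a y \<and>
    B b \<noteq> 0 \<and> 0 \<notin> indets (B b) \<and> (\<forall>w. eval_mpoly w (B b) \<noteq> 0 \<longrightarrow> transversal b u v (Wp w))"
    by metis
  have B0: "B b \<noteq> 0" "0 \<notin> indets (B b)" for b using B by blast+
  have "Var n \<in> mpolys {n}" by (simp add: Var_in_mpolys)
  then have n0: "0 \<notin> indets (Var n)" using n4 by (auto simp: mpolys_def)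
  have "0 \<notin> indets F" using D_tilde_in_mpolys(1) by (auto simp: mpolys_def)
  moreover have "Var n * (B True * B False) \<noteq> 0" using B0 Var_nonzero by simp
  moreover have "0 \<notin> indets (Var n * (B True * B False))" using B0 n0 by (intro not_indets_mult)
  ultimately obtain w where w: "w 0 = 1" "wmonic w F" "eval_mpoly w (Var n * (B True * B False)) \<noteq> 0"
    using exists_direction[OF F_nonzero] by metis
  have wB: "eval_mpoly w (B b) \<noteq> 0" for b using w(3) by (cases b) (auto simp: ev.hom_mult)
  have wn: "w n \<noteq> 0" using w(3) by (auto simp: ev.hom_mult)
  have "wmonic w (Var n)" unfolding wmonic_def by (intro exI[of _ "w n"]) (use wn n4 in simp)
  moreover have "\<forall>b. \<exists>G. wmonic w G \<and> prime_elem G \<and> (\<forall>h. h \<in> K b \<longleftrightarrow> G dvd h) \<and> (\<exists>H. F = G ^ strat_ord b * H \<and> \<not> G dvd H)"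
  proof
    fix b
    obtain a u v Q y where a: "sp b a u v Q" "roots_of a y" "y (\<nu> - 2) = u" "y (\<nu> - 1) = v" "nice a y"
      "transversal b u v (Wp w)" using B wB by blast
    show "\<exists>G. wmonic w G \<and> prime_elem G \<and> (\<forall>h. h \<in> K b \<longleftrightarrow> G dvd h) \<and> (\<exists>H. F = G ^ strat_ord b * H \<and> \<not> G dvd H)"
      using stratum_generator[OF w(1,2) a] by blast
  qed
  ultimately show ?thesis unfolding generators_def using w(1,2) by metis
qed

lemma generatorsD:
  assumes "generators w G"
  shows "w 0 = 1" "wmonic w F" "wmonic w (Var n)" "wmonic w (G b)" "prime_elem (G b)" "h \<in> K b \<longleftrightarrow> G b dvd h"
    "\<exists>H. F = G b ^ strat_ord b * H \<and> \<not> G b dvd H"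
  using assms unfolding generators_def by blast+

lemma eval_generator: assumes "generators w G" "q \<in> stratum b" shows "eval_mpoly q (G b) = 0"
  using generatorsD(6)[OF assms(1), of "G b" b] assms(2) by (simp add: K_def)

text \<open>The multiplicities 2 and 3 tell the generators apart: if \<open>G False\<close> divided
  \<open>G True\<close>, its cube would divide \<open>F\<close>. Divisibility the other way would
  make the two primes associated.\<close>

lemma generators_not_dvd:
  assumes "generators w G" shows "\<not> G b dvd G (\<not> b)"
proof -
  have 1: "\<not> G False dvd G True"
  proof
    assume "G False dvd G True"
    then have "G False ^ 3 dvd G True ^ 3" by (rule dvd_power_same)
    also obtain H' where "F = G True ^ 3 * H'" using generatorsD(7)[OF assms, of True] by (auto simp: strat_ord_def)
    then have "G True ^ 3 dvd F" by simp
    finally obtain E where E: "F = G False ^ 3 * E" by (auto elim: dvdE)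
    obtain H where H: "F = G False ^ 2 * H" "\<not> G False dvd H" using generatorsD(7)[OF assms, of False] by (auto simp: strat_ord_def)
    have "G False ^ 2 * H = G False ^ 2 * (G False * E)" using E H(1) by (simp add: power3_eq_cube power2_eq_square mult.assoc)
    moreover have "G False ^ 2 \<noteq> 0" using wmonic_nonzero[OF generatorsD(4)[OF assms, of False]] by simp
    ultimately have "H = G False * E" by (simp only: mult_cancel_left simp_thms)
    then show False using H(2) by simp
  qed
  have 2: "\<not> G True dvd G False"
  proof
    assume "G True dvd G False"
    then obtain q where q: "G False = G True * q" by (auto elim: dvdE)
    then have "G False dvd G True \<or> G False dvd q"
      using generatorsD(5)[OF assms, of False] by (metis dvd_refl prime_elem_dvd_multD)
    then have "G False dvd q" using 1 by simp
    then obtain t where "q = G False * t" by (auto elim: dvdE)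
    then have "G True * q = G False * (G True * t)" by (simp only: mult_ac)
    then have "G False * 1 = G False * (G True * t)" using q by simp
    moreover have "G False \<noteq> 0" using wmonic_nonzero[OF generatorsD(4)[OF assms, of False]] .
    ultimately have "1 = G True * t" by (simp only: mult_cancel_left simp_thms)
    then have "G True dvd 1" by (metis dvd_triv_left)
    then show False using generatorsD(5)[OF assms, of True] by (auto simp: prime_elem_def)
  qed
  show ?thesis using 1 2 by (cases b) simp_all
qed

text \<open>The stratum has a point with nonzero coordinate at \<open>n\<close>; for
  \<open>k = n\<close> this coordinate may be set to 1 without leaving the stratum.\<close>

lemma generator_not_dvd_Var:
  assumes "generators w G" shows "\<not> G b dvd Var n"
proof
  assume "G b dvd Var n"
  then have VK: "Var n \<in> K b" using generatorsD(6)[OF assms] by blast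
  obtain a u v Q y where a: "sp b a u v Q" "roots_of a y" "y (\<nu> - 2) = u" "y (\<nu> - 1) = v" "nice a y"
    by (rule exists_nice)
  define a' where "a' = (if k = n then a(k := 1) else a)"
  have "a'(k := a k) = a" by (auto simp: a'_def)
  then have "a' \<in> stratum b" using sp_in_stratum[of b a' "a k"] a(1) by simp
  moreover have "a' n \<noteq> 0" using a(1) by (auto simp: a'_def sp_def ok_def)
  ultimately show False using VK by (auto simp: K_def)
qed

text \<open>At a zero of \<open>G b\<close> where neither the other generator nor
  \<open>Var n\<close> vanishes, \<open>zero_in_stratum\<close> leaves only the stratum of
  \<open>b\<close>. Such zeros approximate every zero of \<open>G b\<close>, because the exceptions
  lie in the zero sets of eliminants constant along \<open>w\<close>.\<close>

lemma generator_closure: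
  assumes G: "generators w G" and p: "eval_mpoly p (G b) = 0"
  shows "\<exists>q. (\<forall>i. (\<lambda>l. q l i) \<longlonglongrightarrow> p i) \<and> (\<forall>l. q l \<in> stratum b)"
proof -
  note g = generatorsD[OF G]
  have vn: "\<not> Var n dvd G b"
  proof
    assume "Var n dvd G b"
    then obtain q where q: "G b = Var n * q" by (auto elim: dvdE)
    then have "G b dvd q" using generator_not_dvd_Var[OF G] g(5)[of b] by (metis dvd_refl prime_elem_dvd_multD)
    then obtain t where "q = G b * t" by (auto elim: dvdE)
    then have "Var n * q = G b * (Var n * t)" by (simp only: mult_ac)
    then have "G b * 1 = G b * (Var n * t)" using q by simp
    then have "1 = Var n * t" using wmonic_nonzero[OF g(4)[of b]] by (simp only: mult_cancel_left simp_thms)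
    then have "Var n dvd 1" by (metis dvd_triv_left)
    then show False by (simp add: Var_dvd_iff)
  qed
  have nd: "\<not> G (\<not> b) dvd G b" using generators_not_dvd[OF G, of "\<not> b"] by simp
  obtain r1 where r1: "r1 \<noteq> 0" "dg w r1 = 0" "\<And>q. eval_mpoly q (G b) = 0 \<Longrightarrow> eval_mpoly q r1 \<noteq> 0 \<Longrightarrow> eval_mpoly q (G (\<not> b)) \<noteq> 0"
    using elimination_zero[OF g(4) g(5) nd] by blast
  obtain r2 where r2: "r2 \<noteq> 0" "dg w r2 = 0" "\<And>q. eval_mpoly q (G b) = 0 \<Longrightarrow> eval_mpoly q r2 \<noteq> 0 \<Longrightarrow> eval_mpoly q (Var n) \<noteq> 0"
    using elimination_zero[OF g(3) prime_elem_Var vn] by blast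
  have r: "r1 * r2 \<noteq> 0" "dg w (r1 * r2) = 0" using r1(1,2) r2(1,2) by (simp_all add: dg_mult)
  obtain q where q: "\<And>i. (\<lambda>l. q l i) \<longlonglongrightarrow> p i" "\<And>l. eval_mpoly (q l) (G b) = 0" "\<And>l. eval_mpoly (q l) (r1 * r2) \<noteq> 0"
    using nearby_zeros[OF g(1) g(4) wmonic_prime_dg[OF g(4) g(5)] p r] by blast
  have "q l \<in> stratum b" for l
  proof -
    have nz: "eval_mpoly (q l) r1 \<noteq> 0" "eval_mpoly (q l) r2 \<noteq> 0" using q(3)[of l] by (auto simp: ev.hom_mult)
    obtain H where "F = G b ^ strat_ord b * H" using g(7)[of b] by blast
    then have "eval_mpoly (q l) F = 0" using q(2)[of l] by (simp add: ev.hom_mult ev.hom_power strat_ord_def)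
    moreover have "ok (q l)" using r2(3)[OF q(2) nz(2)] by (simp add: ok_def)
    ultimately obtain b' where b': "q l \<in> stratum b'" using zero_in_stratum by blast
    have "b' = b" using r1(3)[OF q(2) nz(1)] eval_generator[OF G b'] by (cases "b' = b") auto
    then show ?thesis using b' by simp
  qed
  then show ?thesis using q(1) by blast
qed

text \<open>Once the powers of \<open>Var n\<close> and of both generators are split off, a cofactor
  \<open>H\<close> of positive degree along \<open>w\<close> would have a zero that satisfies
  \<open>ok\<close> and at which both generators are nonzero, contrary to
  \<open>zero_in_stratum\<close>. Degree 0 and monicity along \<open>w\<close> make \<open>H\<close>
  constant.\<close>

theorem factorisation:
  assumes G: "generators w G"
  shows "\<exists>c. c \<noteq> 0 \<and> F = Const c * Var n ^ d n k * G False ^ 2 * G True ^ 3"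
proof -
  note g = generatorsD[OF G]
  have "\<exists>H. F = Var n ^ d n k * H \<and> (k < n \<longrightarrow> \<not> Var n dvd H)"
  proof (cases "k < n")
    case True
    have "discriminant_params n k" by unfold_locales
    then show ?thesis using last_coeff_power[of n k] True n4 by auto
  next
    case False
    then have "d n k = 0" using kn by (simp add: d_def)
    then show ?thesis using False by simp
  qed
  then obtain H0 where H0: "F = Var n ^ d n k * H0" "k < n \<Longrightarrow> \<not> Var n dvd H0" by blast
  have nd: "\<not> G b dvd Var n ^ i" for b i
    using generator_not_dvd_Var[OF G] g(5)[of b] prime_elem_dvd_power by blast
  obtain HM where HM: "F = G False ^ 2 * HM" "\<not> G False dvd HM" using g(7)[of False] by (auto simp: strat_ord_def)
  obtain HT where HT: "F = G True ^ 3 * HT" "\<not> G True dvd HT" using g(7)[of True] by (auto simp: strat_ord_def)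
  have "G False ^ 2 dvd Var n ^ d n k * H0" using HM(1) H0(1) by (metis dvd_triv_left)
  then have "G False ^ 2 dvd H0" by (rule prime_power_dvd[OF g(5) nd])
  then obtain H1 where H1: "H0 = G False ^ 2 * H1" by (auto elim: dvdE)
  have "\<not> G True dvd Var n ^ d n k * G False ^ 2"
  proof
    assume "G True dvd Var n ^ d n k * G False ^ 2"
    then have "G True dvd G False ^ 2" using nd g(5) prime_elem_dvd_multD by blast
    then have "G True dvd G False" using g(5) prime_elem_dvd_power by blast
    then show False using generators_not_dvd[OF G, of True] by simp
  qed
  moreover have "F = (Var n ^ d n k * G False ^ 2) * H1" unfolding H0(1) H1 by (simp only: mult.assoc)
  then have "G True ^ 3 dvd (Var n ^ d n k * G False ^ 2) * H1" using HT(1) by (metis dvd_triv_left)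
  ultimately have "G True ^ 3 dvd H1" by (rule prime_power_dvd[OF g(5)])
  then obtain H where H: "H1 = G True ^ 3 * H" by (auto elim: dvdE)
  have FH: "F = Var n ^ d n k * G False ^ 2 * G True ^ 3 * H" unfolding H0(1) H1 H by (simp add: mult_ac)
  have G0: "G b \<noteq> 0" for b by (rule wmonic_nonzero[OF g(4)])
  have ndM: "\<not> G False dvd H"
  proof
    assume "G False dvd H"
    moreover have "G False ^ 2 * HM = G False ^ 2 * (Var n ^ d n k * G True ^ 3 * H)" using FH HM(1) by (simp add: mult_ac)
    then have "HM = Var n ^ d n k * G True ^ 3 * H" using G0[of False] by (simp only: mult_cancel_left power_not_zero simp_thms)
    ultimately show False using HM(2) by (simp add: dvd_mult)
  qed
  have ndT: "\<not> G True dvd H"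
  proof
    assume "G True dvd H"
    moreover have "G True ^ 3 * HT = G True ^ 3 * (Var n ^ d n k * G False ^ 2 * H)" using FH HT(1) by (simp add: mult_ac)
    then have "HT = Var n ^ d n k * G False ^ 2 * H" using G0[of True] by (simp only: mult_cancel_left power_not_zero simp_thms)
    ultimately show False using HT(2) by (simp add: dvd_mult)
  qed
  have ndV: "\<not> Var n dvd H" if "k < n" using H0(2)[OF that] unfolding H1 H by (auto simp: dvd_mult)
  have Hm: "wmonic w H" using g(2) unfolding FH by (subst (asm) mult.commute) (rule wmonic_factor)
  have "dg w H = 0"
  proof (rule ccontr)
    assume "dg w H \<noteq> 0"
    then have dg: "dg w H > 0" by simp
    obtain p where p: "eval_mpoly p H = 0" using wmonic_has_zero[OF g(1) Hm dg] by blast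
    have nd': "\<not> G b dvd H" for b using ndM ndT by (cases b) simp_all
    have "\<exists>r. \<forall>b. r b \<noteq> 0 \<and> dg w (r b) = 0 \<and> (\<forall>q. eval_mpoly q H = 0 \<longrightarrow> eval_mpoly q (r b) \<noteq> 0 \<longrightarrow> eval_mpoly q (G b) \<noteq> 0)"
      by (rule choice) (use elimination_zero[OF g(4) g(5) nd'] in blast)
    then obtain r where r: "\<And>b. r b \<noteq> 0" "\<And>b. dg w (r b) = 0"
      "\<And>b q. eval_mpoly q H = 0 \<Longrightarrow> eval_mpoly q (r b) \<noteq> 0 \<Longrightarrow> eval_mpoly q (G b) \<noteq> 0" by blast
    have "\<exists>r. r \<noteq> 0 \<and> dg w r = 0 \<and> (\<forall>q. eval_mpoly q H = 0 \<longrightarrow> eval_mpoly q r \<noteq> 0 \<longrightarrow> ok q)"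
    proof (cases "k < n")
      case True
      from elimination_zero[OF g(3) prime_elem_Var ndV[OF True]] show ?thesis by (auto simp: ok_def)
    next
      case False
      then have "ok q" for q using kn unfolding ok_def by linarith
      then show ?thesis by (intro exI[of _ 1]) simp
    qed
    then obtain r' where r': "r' \<noteq> 0" "dg w r' = 0" "\<And>q. eval_mpoly q H = 0 \<Longrightarrow> eval_mpoly q r' \<noteq> 0 \<Longrightarrow> ok q" by blast
    have rr: "r True * r False * r' \<noteq> 0" "dg w (r True * r False * r') = 0"
      using r(1,2) r'(1,2) by (simp_all add: dg_mult)
    have "\<exists>q. (\<forall>l::nat. eval_mpoly (q l) H = 0) \<and> (\<forall>l. eval_mpoly (q l) (r True * r False * r') \<noteq> 0)"
      by (rule nearby_zeros[OF g(1) Hm dg p rr]) (intro exI conjI allI)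
    then obtain q :: "nat \<Rightarrow> nat \<Rightarrow> complex" where "\<forall>l. eval_mpoly (q l) H = 0" "\<forall>l. eval_mpoly (q l) (r True * r False * r') \<noteq> 0"
      by (elim exE conjE)
    note q = this[rule_format]
    let ?q = "q 0"
    have nz': "eval_mpoly ?q (r True) \<noteq> 0" "eval_mpoly ?q (r False) \<noteq> 0" "eval_mpoly ?q r' \<noteq> 0"
      using q(2)[of 0] unfolding ev.hom_mult mult_eq_0_iff by simp_all
    then have nz: "eval_mpoly ?q (r b) \<noteq> 0" for b by (cases b) simp_all
    have "eval_mpoly ?q F = 0" unfolding FH ev.hom_mult q(1) by (rule mult_zero_right)
    from zero_in_stratum[OF this r'(3)[OF q(1) nz'(3)]] obtain b where b: "?q \<in> stratum b" ..
    from r(3)[OF q(1) nz] eval_generator[OF G b] show False by (rule notE)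
  qed
  from dg_0_const[OF Hm this] obtain c where c: "c \<noteq> 0" "H = Const c" by metis
  have "F = Const c * Var n ^ d n k * G False ^ 2 * G True ^ 3" unfolding FH c(2) by (simp only: mult_ac)
  with c(1) show ?thesis by (intro exI[of _ c] conjI)
qed

end

subsection \<open>Integer coefficients\<close>

text \<open>A Q-linear projection of the complex numbers onto the rationals, extended from the
  independent set \<open>{1}\<close>.\<close>

lemma exists_rational_functional:
  "\<exists>\<psi> :: complex \<Rightarrow> rat. \<psi> 1 = 1 \<and> (\<forall>x y. \<psi> (x + y) = \<psi> x + \<psi> y) \<and> (\<forall>r x. \<psi> (of_rat r * x) = r * \<psi> x)"
proof -
  interpret V1: vector_space "\<lambda>(r::rat) (z::complex). of_rat r * z"
    by unfold_locales (auto simp: of_rat_add of_rat_mult algebra_simps)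
  interpret V2: vector_space "(*) :: rat \<Rightarrow> rat \<Rightarrow> rat"
    by unfold_locales (auto simp: algebra_simps)
  interpret V: vector_space_pair "\<lambda>(r::rat) (z::complex). of_rat r * z" "(*) :: rat \<Rightarrow> rat \<Rightarrow> rat" ..
  have "V1.independent {1}" by (simp add: V1.independent_insert)
  from V.linear_independent_extend[OF this, of "\<lambda>_. 1"]
  obtain g where g: "Vector_Spaces.linear (\<lambda>(r::rat) (z::complex). of_rat r * z) (*) g" "g 1 = 1" by auto
  interpret g: Vector_Spaces.linear "\<lambda>(r::rat) (z::complex). of_rat r * z" "(*)" g by (rule g(1))
  show ?thesis using g(2) g.add g.scale by blast
qed

lemma subring_coeffs:
  assumes "subring S" shows "subring {p :: 'a::comm_ring_1 poly. \<forall>i. coeff p i \<in> S}"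
proof -
  note S = subringD[OF assms]
  have "coeff 1 i \<in> S" for i :: nat using S(1,2) by (simp add: coeff_1)
  moreover have "coeff (p * q) i \<in> S" if "\<forall>i. coeff p i \<in> S" "\<forall>i. coeff q i \<in> S" for p q i
    unfolding coeff_mult using that by (intro subring_sum[OF assms] S(4)) auto
  ultimately show ?thesis unfolding subring_def using S(3) by auto
qed

lemma rational_multiple:
  assumes "\<And>m. m \<in> A \<Longrightarrow> f m \<in> range (of_rat :: rat \<Rightarrow> complex)" "finite A"
  shows "\<exists>D::int. D \<noteq> 0 \<and> (\<forall>m\<in>A. of_int D * f m \<in> \<int>)"
  using assms(2,1)
proof (induction A rule: finite_induct)
  case empty
  then show ?case by (intro exI[of _ 1]) simp
next
  case (insert x A)
  then obtain D where D: "D \<noteq> 0" "\<And>m. m \<in> A \<Longrightarrow> of_int D * f m \<in> \<int>" by auto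
  obtain r where r: "f x = of_rat r" using insert.prems by blast
  obtain a b where ab: "quotient_of r = (a, b)" by (cases "quotient_of r")
  have b: "b > 0" using quotient_of_denom_pos[OF ab] .
  have "r = of_int a / of_int b" by (rule quotient_of_div[OF ab])
  then have fx: "f x = of_int a / of_int b" unfolding r by (simp add: of_rat_divide)
  have "of_int (b * D) * f m \<in> \<int>" if "m \<in> insert x A" for m
  proof (cases "m = x")
    case True
    then have "of_int (b * D) * f m = of_int (D * a)" using b by (simp add: fx)
    then show ?thesis by (simp only: Ints_of_int)
  next
    case False
    then have "m \<in> A" using that by simp
    then have "of_int b * (of_int D * f m) \<in> \<int>" by (intro Ints_mult Ints_of_int D(2))
    then show ?thesis by (simp only: mult.assoc of_int_mult)
  qed
  then show ?case using D(1) b by (intro exI[of _ "b * D"]) simp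
qed

definition cmap :: "(complex \<Rightarrow> rat) \<Rightarrow> mpoly \<Rightarrow> mpoly" where
  "cmap \<psi> h = Poly_Mapping.map (\<lambda>c. of_rat (\<psi> c)) h"

lemma lookup_cmap: "\<psi> 0 = 0 \<Longrightarrow> lookup (cmap \<psi> h) m = of_rat (\<psi> (lookup h m))"
  by (simp add: cmap_def Poly_Mapping.map.rep_eq when_def)

lemma lookup_Const_mult: "lookup (Const c * p) m = c * lookup p m"
proof (induction p rule: mpoly_add_single_induct)
  case (single m' b)
  then show ?case by (simp add: Const_def mult_single lookup_single when_def)
next
  case (add p q)
  then show ?case by (simp add: distrib_left lookup_add)
qed

text \<open>Each monomial is sent to a polynomial with integer coefficients, and these can be pulled
  out of the Q-linear map \<psi>.\<close>

lemma heval_cmap: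
  assumes \<psi>: "\<And>x y. \<psi> (x + y) = \<psi> x + \<psi> y" "\<And>r x. \<psi> (of_rat r * x) = r * \<psi> x"
    and x: "\<And>j. int_coeffs (x j)"
  shows "heval Const x (cmap \<psi> h) = cmap \<psi> (heval Const x h)"
proof -
  note C = comm_ring_hom_Const
  interpret H: comm_ring_hom "heval Const x" by (rule heval_hom[OF C])
  have l0: "\<psi> 0 = 0" using \<psi>(2)[of 0 0] by simp
  note lk = lookup_cmap[of \<psi>, OF l0]
  have add: "cmap \<psi> (p + q) = cmap \<psi> p + cmap \<psi> q" for p q
    by (rule poly_mapping_eqI) (simp add: lk lookup_add \<psi>(1) of_rat_add)
  show ?thesis
  proof (induction h rule: mpoly_add_single_induct)
    case (add p q)
    then show ?case by (simp add: \<open>\<And>p q. cmap \<psi> (p + q) = cmap \<psi> p + cmap \<psi> q\<close> H.hom_add)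
  next
    case (single m c)
    have s: "cmap \<psi> (single m c) = single m (of_rat (\<psi> c))"
      by (rule poly_mapping_eqI) (simp add: lk lookup_single when_def l0)
    define N where "N = monomial_value x m"
    have "int_coeffs N"
      unfolding N_def monomial_value_def
      using subring_prod[OF subring_int_coeffs, of "keys m" "\<lambda>j. x j ^ lookup m j"] subring_power[OF subring_int_coeffs] x by auto
    have "lookup (Const (of_rat (\<psi> c)) * N) m' = lookup (cmap \<psi> (Const c * N)) m'" for m'
    proof -
      obtain i where i: "lookup N m' = of_int i" using \<open>int_coeffs N\<close> unfolding int_coeffs_def by (metis Ints_cases)
      have "\<psi> (c * of_int i) = of_int i * \<psi> c" using \<psi>(2)[of "of_int i" c] by (simp add: mult.commute)
      then show ?thesis unfolding lk lookup_Const_mult i by (simp add: of_rat_mult mult.commute)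
    qed
    then have "Const (of_rat (\<psi> c)) * N = cmap \<psi> (Const c * N)" by (intro poly_mapping_eqI) 
    then show ?case unfolding s heval_single[OF C] N_def .
  qed
qed

text \<open>A rational-linear functional that fixes 1, applied to the coefficients, maps the kernel of an
  integral substitution to itself. Hence a generator with a coefficient 1 is fixed, so that it has
  rational coefficients.\<close>

lemma int_multiple:
  assumes G: "G \<noteq> 0" and x: "\<And>j. int_coeffs (x j)"
    and gen: "\<And>h. heval Const x h = 0 \<longleftrightarrow> G dvd h"
  shows "\<exists>c. c \<noteq> 0 \<and> int_coeffs (Const c * G)"
proof -
  obtain \<psi> :: "complex \<Rightarrow> rat" where \<psi>: "\<psi> 1 = 1" "\<And>x y. \<psi> (x + y) = \<psi> x + \<psi> y" "\<And>r x. \<psi> (of_rat r * x) = r * \<psi> x"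
    using exists_rational_functional by blast
  have l0: "\<psi> 0 = 0" using \<psi>(3)[of 0 0] by simp
  note lk = lookup_cmap[of \<psi>, OF l0]
  obtain m0 where m0: "lookup G m0 \<noteq> 0" using G by (metis poly_mapping_eqI lookup_zero)
  define c0 where "c0 = 1 / lookup G m0"
  have c0: "c0 \<noteq> 0" "c0 * lookup G m0 = 1" using m0 by (simp_all add: c0_def)
  define G1 where "G1 = Const c0 * G"
  have G1m: "lookup G1 m0 = 1" unfolding G1_def lookup_Const_mult by (rule c0(2))
  have G10: "G1 \<noteq> 0" using G1m by auto
  have "heval Const x G1 = 0" unfolding gen G1_def by simp
  then have "heval Const x (cmap \<psi> G1) = cmap \<psi> 0" using heval_cmap[OF \<psi>(2,3) x] by simp
  also have "cmap \<psi> 0 = 0" by (rule poly_mapping_eqI) (simp add: lk l0)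
  finally have "G dvd cmap \<psi> G1" unfolding gen .
  then obtain q0 where q0: "cmap \<psi> G1 = G * q0" by (auto elim: dvdE)
  define q where "q = Const (1 / c0) * q0"
  have "Const c0 * Const (1 / c0) = 1" using c0(1) by (simp flip: Const_mult)
  moreover have "G1 * q = (Const c0 * Const (1 / c0)) * (G * q0)" unfolding G1_def q_def by (simp only: mult_ac)
  ultimately have q: "cmap \<psi> G1 = G1 * q" unfolding q0 by simp
  have nz: "cmap \<psi> G1 \<noteq> 0"
  proof
    assume "cmap \<psi> G1 = 0"
    then have "lookup (cmap \<psi> G1) m0 = 0" by simp
    then show False unfolding lk G1m \<psi>(1) by simp
  qed
  then have qn: "q \<noteq> 0" unfolding q by auto
  \<comment> \<open>Applying \<psi> to the coefficients creates no new monomials and so raises no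
    degree; the quotient \<open>q\<close> therefore has degree 0 in every variable. The coefficient
    1 at \<open>m0\<close>, which \<psi> fixes, makes it equal to 1.\<close>
  have "j \<notin> indets q" for j
  proof -
    have "degree (as_univariate j (cmap \<psi> G1)) \<le> degree (as_univariate j G1)"
    proof (rule degree_le, intro allI impI)
      fix i assume "degree (as_univariate j G1) < i"
      then have 0: "coeff (as_univariate j G1) i = 0" by (rule coeff_eq_0)
      show "coeff (as_univariate j (cmap \<psi> G1)) i = 0"
      proof (rule poly_mapping_eqI)
        fix m
        have "lookup (coeff (as_univariate j G1) i) m = 0" unfolding 0 by simp
        then show "lookup (coeff (as_univariate j (cmap \<psi> G1)) i) m = lookup 0 m"
          unfolding lookup_coeff_as_univariate lk by (auto simp: l0 split: if_splits)
      qed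
    qed
    then have "degree (as_univariate j q) = 0" unfolding q degree_as_univariate_mult[OF G10 qn] by simp
    then show ?thesis by (simp add: in_indets_iff)
  qed
  then have "indets q = {}" by blast
  then obtain t where t: "q = Const t" by (rule indets_empty)
  have "lookup (cmap \<psi> G1) m0 = lookup (Const t * G1) m0" unfolding q t by (simp add: mult.commute)
  then have "t = 1" unfolding lookup_Const_mult lk G1m \<psi>(1) by simp
  then have cG: "cmap \<psi> G1 = G1" unfolding q t by simp
  have rg: "lookup G1 m \<in> range of_rat" for m using lk[of G1 m] unfolding cG by (rule range_eqI)
  have "\<exists>D::int. D \<noteq> 0 \<and> (\<forall>m\<in>keys G1. of_int D * lookup G1 m \<in> \<int>)"
    by (rule rational_multiple[OF rg finite_keys])
  then obtain D0 :: int where D0: "D0 \<noteq> 0" "\<forall>m\<in>keys G1. of_int D0 * lookup G1 m \<in> \<int>" by (elim exE conjE)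
  define D where "D = (of_int D0 :: complex)"
  have D: "D \<noteq> 0" "\<And>m. m \<in> keys G1 \<Longrightarrow> D * lookup G1 m \<in> \<int>" using D0 by (simp_all add: D_def)
  have "D * lookup G1 m \<in> \<int>" for m using D(2)[of m] by (cases "m \<in> keys G1") (auto simp: in_keys_iff)
  then have "int_coeffs (Const D * G1)" unfolding int_coeffs_def lookup_Const_mult by blast
  then have "int_coeffs (Const (D * c0) * G)" unfolding G1_def Const_mult by (simp only: mult.assoc)
  then show ?thesis using D(1) c0(1) by (intro exI[of _ "D * c0"]) simp
qed

text \<open>The constant is a quotient of two corresponding integer coefficients.\<close>

lemma rational_factor:
  assumes "F = Const c * N" "int_coeffs F" "int_coeffs N" "F \<noteq> 0"
  shows "\<exists>r. r \<noteq> 0 \<and> c = of_rat r"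
proof -
  have "N \<noteq> 0" "c \<noteq> 0" using assms(1,4) by auto
  then obtain m where m: "lookup N m \<noteq> 0" by (metis poly_mapping_eqI lookup_zero)
  obtain i j where ij: "lookup F m = of_int i" "lookup N m = of_int j" 
    using assms(2,3) unfolding int_coeffs_def by (metis Ints_cases)
  have "of_int i = c * of_int j" using assms(1) lookup_Const_mult[of c N m] ij by simp
  then have "c = of_rat (of_int i / of_int j)" using m ij by (simp add: of_rat_divide)
  then show ?thesis using \<open>c \<noteq> 0\<close> by (metis of_rat_0)
qed

subsection \<open>Closures of projections\<close>

lemma topspace_coord_space: "topspace (coord_space I) = extensional I"
  by (auto simp: coord_space_def PiE_def)

lemma continuous_map_eval: "continuous_map (coord_space I) euclidean (\<lambda>b. eval_mpoly b p)"
proof -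
  have c: "continuous_map (coord_space I) euclidean (\<lambda>b. b j)" for j
  proof (cases "j \<in> I")
    case True
    then show ?thesis unfolding coord_space_def by (rule continuous_map_product_projection)
  next
    case False
    \<comment> \<open>Outside \<open>I\<close> all points of the space have the value
      \<open>undefined\<close>, so that the coordinate is constant.\<close>
    have "continuous_map (coord_space I) euclidean (\<lambda>b. undefined :: complex)" by simp
    then show ?thesis
    proof (rule continuous_map_eq)
      fix b assume "b \<in> topspace (coord_space I)"
      then show "undefined = b j" using False unfolding topspace_coord_space extensional_def by simp
    qed
  qed
  have "continuous_map (coord_space I) (product_topology (\<lambda>_. euclidean) UNIV) (\<lambda>b. b)"
    using c by (simp add: continuous_map_componentwise_UNIV)
  then have 1: "continuous_map (coord_space I) euclidean (\<lambda>b. b)" by (simp add: euclidean_product_topology)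
  have "continuous_map euclidean euclidean (\<lambda>b :: nat \<Rightarrow> complex. eval_mpoly b p)"
    unfolding continuous_map_iff_continuous2 eval_mpoly_def
    by (intro continuous_on_sum continuous_on_mult continuous_on_prod continuous_on_power continuous_on_const continuous_on_product_coordinates)
  from continuous_map_compose[OF 1 this] show ?thesis by (simp add: o_def)
qed

lemma closedin_zero_set: "closedin (coord_space I) (zero_set I p)"
proof -
  have "closedin (coord_space I) {b \<in> topspace (coord_space I). eval_mpoly b p \<in> {0}}"
    by (rule closedin_continuous_map_preimage[OF continuous_map_eval]) simp
  then show ?thesis by (simp add: zero_set_def)
qed

lemma limit_in_closed:
  assumes S: "closedin (coord_space I) S" and q: "\<And>i. i \<in> I \<Longrightarrow> (\<lambda>l. q l i) \<longlonglongrightarrow> p i"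
    and qS: "\<And>l::nat. restrict (q l) I \<in> S"
  shows "restrict p I \<in> S"
proof (rule limitin_closedin[OF _ S])
  show "limitin (coord_space I) (\<lambda>l. restrict (q l) I) (restrict p I) sequentially"
    unfolding coord_space_def limitin_componentwise using q by (auto simp: PiE_def)
qed (use qS in auto)

section \<open>Zero sets of the generators and integral generators\<close>

context theorem4_params
begin

abbreviation "J \<equiv> {1..n} - {k}"

definition locus :: "bool \<Rightarrow> (nat \<Rightarrow> complex) set" where
  "locus b = (if b then Sigma_set n else Maxwell_set n)"

lemma order_lin:
  assumes "p = lin u ^ m * q" "poly q u \<noteq> 0" shows "order u p = m"
proof -
  have "p \<noteq> 0" using assms by auto
  then have "order u p = order u (lin u ^ m) + order u q" unfolding assms(1) by (rule order_mult)
  also have "order u (lin u ^ m) = m" unfolding lin_def by (rule order_power_n_n)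
  also have "order u q = 0" using assms(2) by (simp add: order_0I)
  finally show ?thesis by simp
qed

lemma sp_in_locus:
  assumes "sp b a u v Q" shows "restrict a {1..n} \<in> locus b"
proof -
  have P: "P_at n (restrict a {1..n}) = P_at n a" by (rule P_at_cong) simp
  have "restrict a {1..n} \<in> topspace (coord_space {1..n})" by (simp add: topspace_coord_space)
  moreover have "order u (P_at n a) = 3" if b
    using assms that by (intro order_lin[where q = Q]) (auto simp: sp_def)
  moreover have "u \<noteq> v \<and> order u (P_at n a) = 2 \<and> order v (P_at n a) = 2" if "\<not> b"
  proof -
    have p: "P_at n a = lin u ^ 2 * (lin v ^ 2 * Q)" "P_at n a = lin v ^ 2 * (lin u ^ 2 * Q)" "u \<noteq> v"
      using assms that by (auto simp: sp_def mult_ac)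
    have "poly Q u \<noteq> 0" "poly Q v \<noteq> 0" using assms by (auto simp: sp_def)
    then show ?thesis using order_lin[OF p(1)] order_lin[OF p(2)] p(3) by simp
  qed
  ultimately show ?thesis by (auto simp: locus_def Sigma_set_def Maxwell_set_def P P[unfolded One_nat_def])
qed

lemma locus_in_stratum:
  assumes "a \<in> locus b" shows "a \<in> stratum b"
proof -
  have "\<exists>u v. multiple b u v dvd P_at n a"
  proof (cases b)
    case True
    then obtain x where "order x (P_at n a) = 3" using assms by (auto simp: locus_def Sigma_set_def)
    then have "lin x ^ 3 dvd P_at n a" using order_1[of x "P_at n a"] by (simp add: lin_def)
    then show ?thesis using True by (auto simp: multiple_lin)
  next
    case False
    then obtain x y where xy: "x \<noteq> y" "order x (P_at n a) = 2" "order y (P_at n a) = 2"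
      using assms by (auto simp: locus_def Maxwell_set_def)
    obtain q where q: "P_at n a = lin x ^ 2 * q" using order_1[of x "P_at n a"] xy(2) by (auto simp: lin_def elim: dvdE)
    have "q \<noteq> 0" using q P_at_nonzero[of n a] by auto
    have "order y (lin x ^ 2) = 0" using xy(1) by (intro order_0I) auto
    then have "order y q = 2" using xy(3) P_at_nonzero[of n a] unfolding q by (simp add: order_mult)
    then have "lin y ^ 2 dvd q" using order_1[of y q] by (simp add: lin_def)
    then have "lin x ^ 2 * lin y ^ 2 dvd P_at n a" unfolding q by (rule mult_dvd_mono[OF dvd_refl])
    then show ?thesis using False by (auto simp: multiple_lin)
  qed
  then show ?thesis unfolding stratum_iff by (metis fun_upd_triv)
qed

text \<open>A zero of \<open>G b\<close> is a limit of points of the stratum, and each of these is a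
  limit of points where, after a change of \<open>a k\<close>, the multiplicities are exact; such
  points have their projection in that of \<open>locus b\<close>. The other inclusion holds because
  the zero set is closed.\<close>

lemma zero_set_closure:
  assumes G: "generators w G" and ind: "indets (G b) \<subseteq> J"
  shows "zero_set J (G b) = coord_space J closure_of (coord_proj n k ` locus b)"
proof
  let ?C = "coord_space J closure_of (coord_proj n k ` locus b)"
  show "?C \<subseteq> zero_set J (G b)"
  proof (rule closure_of_minimal[OF _ closedin_zero_set], clarify)
    fix a assume "a \<in> locus b"
    then have "eval_mpoly a (G b) = 0" using eval_generator[OF G] locus_in_stratum by blast
    moreover have "eval_mpoly (restrict a J) (G b) = eval_mpoly a (G b)" by (rule eval_cong) (use ind in auto)
    ultimately show "coord_proj n k a \<in> zero_set J (G b)"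
      by (simp add: zero_set_def coord_proj_def topspace_coord_space)
  qed
  have sub: "coord_proj n k ` locus b \<subseteq> topspace (coord_space J)"
    by (auto simp: coord_proj_def topspace_coord_space)
  have sp_C: "restrict q J \<in> ?C" if "sp b (q(k := z)) u v Q" for q z u v Q
  proof -
    have "restrict q J = coord_proj n k (restrict (q(k := z)) {1..n})"
      by (auto simp: coord_proj_def)
    then have "restrict q J \<in> coord_proj n k ` locus b" using sp_in_locus[OF that] by blast
    then show ?thesis using closure_of_subset[OF sub] by blast
  qed
  have stratum_C: "restrict a J \<in> ?C" if a: "a \<in> stratum b" for a
  proof -
    obtain q where q: "\<And>i. (\<lambda>l. q l i) \<longlonglongrightarrow> a i" "\<And>l. \<exists>z u v Q. sp b ((q l)(k := z)) u v Q"
      using stratum_limit[OF a] by blast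
    show ?thesis by (rule limit_in_closed[OF closedin_closure_of q(1)]) (use q(2) sp_C in blast)
  qed
  show "zero_set J (G b) \<subseteq> ?C"
  proof
    fix p assume p: "p \<in> zero_set J (G b)"
    then have "eval_mpoly p (G b) = 0" and r: "restrict p J = p" by (auto simp: zero_set_def topspace_coord_space extensional_restrict)
    then obtain q where q: "\<And>i. (\<lambda>l. q l i) \<longlonglongrightarrow> p i" "\<And>l. q l \<in> stratum b"
      using generator_closure[OF G] by blast
    have "restrict p J \<in> ?C" by (rule limit_in_closed[OF closedin_closure_of q(1)]) (rule stratum_C[OF q(2)])
    then show "p \<in> ?C" unfolding r .
  qed
qed

lemma int_subst_at: "int_coeffs (subst_at b j)"
proof -
  let ?S = "{p. \<forall>i. coeff p i \<in> {p. int_coeffs p}}"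
  have S: "subring ?S" by (rule subring_coeffs[OF subring_int_coeffs])
  note I = subringD[OF subring_int_coeffs]
  have "[:- Var i, 1:] \<in> ?S" for i
    using I(1) I(2) I(5)[of "Var i"] int_coeffs_Var[of i] by (auto simp: coeff_pCons split: nat.split)
  then have "multiple b (Var 0) (Var (n - 3)) \<in> ?S"
    unfolding multiple_def by (cases b) (simp_all only: if_True if_False subring_power[OF S] subringD(4)[OF S])
  moreover have "P m \<in> ?S" for m
    using I(1) I(2) int_coeffs_Var by (auto simp: coeff_P)
  ultimately have "PG b \<in> ?S" unfolding PG_def by (rule subringD(4)[OF S])
  then show ?thesis by (auto simp: subst_at_def int_coeffs_Var)
qed

lemma Const_unit: "c \<noteq> 0 \<Longrightarrow> Const c * Const (1 / c) = 1"
  by (simp flip: Const_mult)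

lemma generators_scale:
  assumes G: "generators w G" and c: "\<And>b. c b \<noteq> 0"
  shows "generators w (\<lambda>b. Const (c b) * G b)"
proof -
  note g = generatorsD[OF G]
  have dv: "Const (c b) * G b dvd h \<longleftrightarrow> G b dvd h" for b h
  proof
    assume "G b dvd h"
    then obtain t where "h = G b * t" by (auto elim: dvdE)
    then have "h = (Const (c b) * Const (1 / c b)) * (G b * t)" unfolding Const_unit[OF c] by simp
    also have "\<dots> = Const (c b) * G b * (Const (1 / c b) * t)" by (simp only: mult_ac)
    finally show "Const (c b) * G b dvd h" by (metis dvd_triv_left)
  qed (rule dvd_mult_right)
  have "wmonic w (Const (c b) * G b)" for b
  proof -
    obtain t where "t \<noteq> 0" "lead_coeff (dirU w (G b)) = Const t" using g(4)[of b] unfolding wmonic_def by blast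
    then show ?thesis unfolding wmonic_def using c[of b]
      by (intro exI[of _ "c b * t"]) (simp add: dirU.hom_mult lead_coeff_smult Const_mult)
  qed
  moreover have "prime_elem (Const (c b) * G b)" for b
  proof (rule prime_elemI)
    show "Const (c b) * G b \<noteq> 0" using c[of b] wmonic_nonzero[OF g(4)[of b]] by simp
    show "\<not> Const (c b) * G b dvd 1" unfolding dv using g(5)[of b] by (simp add: prime_elem_def)
  qed (use g(5)[of b] in \<open>auto simp: dv prime_elem_dvd_mult_iff\<close>)
  moreover have "\<exists>H. F = (Const (c b) * G b) ^ strat_ord b * H \<and> \<not> Const (c b) * G b dvd H" for b
  proof -
    obtain H where H: "F = G b ^ strat_ord b * H" "\<not> G b dvd H" using g(7)[of b] by blast
    let ?u = "Const (c b) ^ strat_ord b" and ?v = "Const (1 / c b) ^ strat_ord b"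
    have uv: "?u * ?v = 1" unfolding power_mult_distrib[symmetric] Const_unit[OF c] by simp
    have "F = (?u * ?v) * (G b ^ strat_ord b * H)" unfolding uv H(1) by simp
    then have "F = (Const (c b) * G b) ^ strat_ord b * (?v * H)" by (simp only: power_mult_distrib mult_ac)
    moreover have "\<not> G b dvd ?v * H"
    proof
      assume "G b dvd ?v * H"
      then have "G b dvd ?u * (?v * H)" by simp
      then have "G b dvd (?u * ?v) * H" by (simp only: mult.assoc)
      then show False using H(2) unfolding uv by simp
    qed
    ultimately show ?thesis unfolding dv by blast
  qed
  ultimately show ?thesis unfolding generators_def using g dv by blast
qed

text \<open>Scaling by nonzero constants preserves all properties of the generators, so that the
  multiples supplied by \<open>int_multiple\<close> can replace them.\<close>

lemma exists_int_generators: "\<exists>w G. generators w G \<and> (\<forall>b. int_coeffs (G b))"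
proof -
  obtain w G where G: "generators w G" using exists_generators by blast
  note g = generatorsD[OF G]
  have "\<exists>c. c \<noteq> 0 \<and> int_coeffs (Const c * G b)" for b
  proof (rule int_multiple[OF wmonic_nonzero[OF g(4)] int_subst_at])
    show "heval Const (subst_at b) h = 0 \<longleftrightarrow> G b dvd h" for h
      using g(6)[of h b] by (simp add: K_subst subst_def)
  qed
  then have "\<exists>c. \<forall>b. c b \<noteq> 0 \<and> int_coeffs (Const (c b) * G b)" by (intro choice allI)
  then obtain c where c: "\<And>b. c b \<noteq> 0" "\<And>b. int_coeffs (Const (c b) * G b)" by blast
  show ?thesis using generators_scale[OF G c(1)] c(2) by (intro exI conjI allI)
qed

lemma double_discriminant_factorisation:
  "\<exists>(c :: rat) (M :: mpoly) (T :: mpoly).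
           c \<noteq> 0 \<and>
           indets M \<subseteq> {1..n} - {k} \<and> irreducible M \<and> int_coeffs M \<and>
           indets T \<subseteq> {1..n} - {k} \<and> irreducible T \<and> int_coeffs T \<and>
           D_tilde n k = Const (of_rat c) * Var n ^ d n k * M ^ 2 * T ^ 3 \<and>
           zero_set ({1..n} - {k}) M =
             coord_space ({1..n} - {k}) closure_of (coord_proj n k ` Maxwell_set n) \<and>
           zero_set ({1..n} - {k}) T =
             coord_space ({1..n} - {k}) closure_of (coord_proj n k ` Sigma_set n)"
proof -
  obtain w G where G: "generators w G" and int: "\<And>b. int_coeffs (G b)" using exists_int_generators by blast
  note g = generatorsD[OF G]
  obtain c where c: "c \<noteq> 0" "F = Const c * Var n ^ d n k * G False ^ 2 * G True ^ 3" using factorisation[OF G] by blast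
  have ind: "indets (G b) \<subseteq> J" for b
  proof -
    obtain H0 where H0: "F = G b ^ strat_ord b * H0" using g(7)[of b] by blast
    obtain m where m: "strat_ord b = Suc m" by (cases "strat_ord b") (auto simp: strat_ord_def split: if_splits)
    define H where "H = G b ^ m * H0"
    have H: "F = G b * H" unfolding H0 m H_def power_Suc by (rule mult.assoc)
    have "indets (G b) \<subseteq> indets F" using F_nonzero indets_factor[of "G b" H] unfolding H by simp
    also have "\<dots> \<subseteq> J" using D_tilde_in_mpolys(1) by (simp add: mpolys_def)
    finally show ?thesis .
  qed
  define N where "N = Var n ^ d n k * G False ^ 2 * G True ^ 3"
  have "N \<in> {p. int_coeffs p}" unfolding N_def using int int_coeffs_Var
    by (intro subringD(4)[OF subring_int_coeffs] subring_power[OF subring_int_coeffs]) auto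
  moreover have "F = Const c * N" unfolding c(2) N_def by (simp only: mult.assoc)
  ultimately obtain r where r: "r \<noteq> 0" "c = of_rat r"
    using rational_factor[OF _ D_tilde_in_mpolys(2) _ F_nonzero, of c N] by auto
  have irr: "irreducible (G b)" for b using g(5) by (rule prime_elem_imp_irreducible)
  have "zero_set J (G b) = coord_space J closure_of (coord_proj n k ` locus b)" for b
    by (rule zero_set_closure[OF G ind])
  from this[of True] this[of False] have zs:
    "zero_set J (G True) = coord_space J closure_of (coord_proj n k ` Sigma_set n)"
    "zero_set J (G False) = coord_space J closure_of (coord_proj n k ` Maxwell_set n)"
    unfolding locus_def if_True if_False by this
  have F: "F = Const (of_rat r) * Var n ^ d n k * G False ^ 2 * G True ^ 3" using c(2) unfolding r(2) .
  show ?thesis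
    by (rule exI[of _ r], rule exI[of _ "G False"], rule exI[of _ "G True"]) (intro conjI r(1) ind int irr F zs)
qed

end

theorem theorem4:
  fixes n k :: nat
  assumes "n \<ge> 4" and "1 \<le> k" and "k \<le> n"
  shows "\<exists>(c :: rat) (M :: mpoly) (T :: mpoly).
           c \<noteq> 0 \<and>
           indets M \<subseteq> {1..n} - {k} \<and> irreducible M \<and> int_coeffs M \<and>
           indets T \<subseteq> {1..n} - {k} \<and> irreducible T \<and> int_coeffs T \<and>
           D_tilde n k = Const (of_rat c) * Var n ^ d n k * M ^ 2 * T ^ 3 \<and>
           zero_set ({1..n} - {k}) M =
             coord_space ({1..n} - {k}) closure_of (coord_proj n k ` Maxwell_set n) \<and>
           zero_set ({1..n} - {k}) T =
             coord_space ({1..n} - {k}) closure_of (coord_proj n k ` Sigma_set n)"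
proof -
  interpret theorem4_params n k by unfold_locales (use assms in auto)
  show ?thesis by (rule double_discriminant_factorisation)
qed

end
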